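(* Suppose that the $\mathbb Z$-valued random variable $\kappa$ satisfies $\mathbb E[e^{\lambda|\kappa|}]<\infty$ for some $\lambda>0$, and that $\mathbb E[\kappa]<2/3$. Let $(\tilde Z_k)_{k\in\mathbb Z_+}$ be the embedded process of the noisy simple harmonic urn with noise $\kappa$. Let $(D_t)_{t\in[0,1]}$ be a diffusion process taking values in $[0,\infty)$ with $D_0=0$ and infinitesimal mean $\mu(x)$ and infinitesimal variance $\sigma^2(x)$ given for $x\in[0,\infty)$ by $$\mu(x)=\tfrac23-\mathbb E[\kappa],\qquad \sigma^2(x)=\tfrac23x.$$ Then as $k\to\infty$, $$\bigl(k^{-1}\tilde Z_{\lfloor kt\rfloor}\bigr)_{t\in[0,1]}\to(D_t)_{t\in[0,1]},$$ where the convergence is in the sense of finite-dimensional distributions. Up to multiplication by a scalar, $D_t$ is the square of a Bessel process with parameter $4-6\mathbb E[\kappa]>0$.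
   Context: $\mathbb Z_+=\{0,1,2,\dots\}$, $\mathbb N=\{1,2,\dots\}$, and $\operatorname{sgn}(x)=-1,0,1$ according as $x<0$, $x=0$, $x>0$. Let $\kappa,\kappa_1,\kappa_2,\dots$ be i.i.d. $\mathbb Z$-valued random variables. The noisy simple harmonic urn is the Markov chain $(\tilde X_n,\tilde Y_n)_{n\in\mathbb Z_+}$ on $\mathbb Z^2\setminus\{(0,0)\}$ with $(\tilde X_0,\tilde Y_0)=(z_0,1)$, $z_0\in\mathbb N$, and the following transition law, where $\kappa_n$ is independent of all other randomness up to time $n$. Given $(\tilde X_n,\tilde Y_n)=(x,y)$ with $xy\neq0$, $$(\tilde X_{n+1},\tilde Y_{n+1})=\begin{cases}(x,y+\operatorname{sgn}(x)) & \text{with probability } \frac{|x|}{|x|+|y|},\\ (x-\operatorname{sgn}(y),y) & \text{with probability } \frac{|y|}{|x|+|y|};\end{cases}$$ if $x=0$, then $(\tilde X_{n+1},\tilde Y_{n+1})=(-\operatorname{sgn}(y),\ \operatorname{sgn}(y)\max(1,|y|-\kappa_n))$; if $y=0$, then $(\tilde X_{n+1},\tilde Y_{n+1})=(\operatorname{sgn}(x)\max(1,|x|-\kappa_n),\ \operatorname{sgn}(x))$. Set $\tilde\nu_0=-1$ and $\tilde\nu_k=\min\{n>\tilde\nu_{k-1}:\tilde X_n\tilde Y_n=0\}$ for $k\in\mathbb N$. Set $\tilde Z_0=z_0$ and, for $k\in\mathbb N$, $\tilde Z_k=\max\{|\tilde X_{1+\tilde\nu_k}|,|\tilde Y_{1+\tilde\nu_k}|\}=|\tilde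 X_{1+\tilde\nu_k}|+|\tilde Y_{1+\tilde\nu_k}|-1$; $(\tilde Z_k)$ is a Markov chain on $\mathbb N$. A diffusion with infinitesimal mean $\mu(x)$ and variance $\sigma^2(x)$ has transition functions satisfying $\partial_t p=\mu(x)\partial_xp+\frac12\sigma^2(x)\partial_x^2p$; here $(D_t)$ is the nonnegative solution of $dD_t=(\frac23-\mathbb E[\kappa])\,dt+\sqrt{\tfrac23D_t}\,dB_t$ with $D_0=0$. A Bessel process with parameter $\gamma$ is the diffusion on $[0,\infty)$ with infinitesimal mean $(\gamma-1)/(2x)$ and infinitesimal variance $1$ (for $\gamma\in\mathbb N$ it has the law of the norm of $\gamma$-dimensional Brownian motion). *)

theory Defs
  imports "HOL-Probability.Probability"
begin

section \<open>The noisy simple harmonic urn\<close>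

text \<open>
  Transition law of the noisy urn; \<open>K\<close> is the law of the noise variable \<open>\<kappa>\<close>. Since the noise used in
  step \<open>n\<close> is independent of everything up to time \<open>n\<close>, the urn is the Markov chain with this kernel.
  The value at \<open>(0, 0)\<close> is irrelevant: that state is never reached from another one.
\<close>

definition nshu_step :: "int pmf \<Rightarrow> int \<times> int \<Rightarrow> (int \<times> int) pmf" where
  "nshu_step K = (\<lambda>(x, y).
     if x \<noteq> 0 \<and> y \<noteq> 0 then
       map_pmf (\<lambda>b. if b then (x, y + sgn x) else (x - sgn y, y))
         (bernoulli_pmf (real_of_int \<bar>x\<bar> / real_of_int (\<bar>x\<bar> + \<bar>y\<bar>)))
     else if x = 0 then
       map_pmf (\<lambda>j. (- sgn y, sgn y * max 1 (\<bar>y\<bar> - j))) K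
     else
       map_pmf (\<lambda>j. (sgn x * max 1 (\<bar>x\<bar> - j), sgn x)) K)"

definition markov_chain ::
  "'a measure \<Rightarrow> ('s \<Rightarrow> 's pmf) \<Rightarrow> 's \<Rightarrow> (nat \<Rightarrow> 'a \<Rightarrow> 's) \<Rightarrow> bool" where
  "markov_chain M Q s0 S \<longleftrightarrow>
     prob_space M \<and>
     (\<forall>n. S n \<in> M \<rightarrow>\<^sub>M count_space UNIV) \<and>
     (AE \<omega> in M. S 0 \<omega> = s0) \<and>
     (\<forall>n h s. measure M {\<omega> \<in> space M. (\<forall>i\<le>n. S i \<omega> = h i) \<and> S (Suc n) \<omega> = s} =
              measure M {\<omega> \<in> space M. \<forall>i\<le>n. S i \<omega> = h i} * pmf (Q (h n)) s)"

definition noisy_simple_harmonic_urn ::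
  "'a measure \<Rightarrow> int pmf \<Rightarrow> int \<Rightarrow> (nat \<Rightarrow> 'a \<Rightarrow> int \<times> int) \<Rightarrow> bool" where
  "noisy_simple_harmonic_urn M K z0 S \<longleftrightarrow> markov_chain M (nshu_step K) (z0, 1) S"

text \<open>
  The times at which a trajectory is on a coordinate axis, starting from the convention \<open>-1\<close>.
  Almost every trajectory of the urn visits the axes infinitely often, so the value of \<open>LEAST\<close>
  in the absence of a further visit matters on a null set only.
\<close>

fun axis_time :: "(nat \<Rightarrow> int \<times> int) \<Rightarrow> nat \<Rightarrow> int" where
  "axis_time s 0 = - 1"
| "axis_time s (Suc k) =
     int (LEAST n. int n > axis_time s k \<and> fst (s n) * snd (s n) = 0)"

fun embedded_process :: "int \<Rightarrow> (nat \<Rightarrow> int \<times> int) \<Rightarrow> nat \<Rightarrow> int" where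
  "embedded_process z0 s 0 = z0"
| "embedded_process z0 s (Suc k) =
     (let n = nat (1 + axis_time s (Suc k)) in max \<bar>fst (s n)\<bar> \<bar>snd (s n)\<bar>)"


section \<open>Convergence of finite-dimensional distributions\<close>

text \<open>
  For each finite set \<open>J\<close> of times, the random vectors indexed by \<open>J\<close> converge in distribution
  in \<open>\<real>\<^sup>J\<close>, tested against bounded continuous functions on \<open>\<real>\<^sup>J\<close>.
\<close>

definition fdd_converges ::
  "real set \<Rightarrow> 'a measure \<Rightarrow> (nat \<Rightarrow> real \<Rightarrow> 'a \<Rightarrow> real) \<Rightarrow>
   'b measure \<Rightarrow> (real \<Rightarrow> 'b \<Rightarrow> real) \<Rightarrow> bool" where
  "fdd_converges T M X N D \<longleftrightarrow>
     (\<forall>J f. finite J \<and> J \<subseteq> T \<and>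
            continuous_map (powertop_real J) euclideanreal f \<and>
            bounded (f ` (J \<rightarrow>\<^sub>E UNIV)) \<longrightarrow>
        (\<lambda>k. \<integral>\<omega>. f (\<lambda>t\<in>J. X k t \<omega>) \<partial>M) \<longlonglongrightarrow> (\<integral>\<omega>. f (\<lambda>t\<in>J. D t \<omega>) \<partial>N))"


section \<open>Diffusions on the half-line\<close>

abbreviation halfline :: "real measure" where
  "halfline \<equiv> restrict_space borel {0..}"

text \<open>Standard (stochastically continuous), time-homogeneous transition function on \<open>[0,\<infinity>)\<close>.\<close>

definition transition_function :: "(real \<Rightarrow> real \<Rightarrow> real measure) \<Rightarrow> bool" where
  "transition_function p \<longleftrightarrow>
     (\<forall>t\<ge>0. p t \<in> halfline \<rightarrow>\<^sub>M prob_algebra halfline) \<and>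
     (\<forall>x\<ge>0. p 0 x = return halfline x) \<and>
     (\<forall>s\<ge>0. \<forall>t\<ge>0. \<forall>x\<ge>0. p (s + t) x = p s x \<bind> p t) \<and>
     (\<forall>x\<ge>0. \<forall>e>0. ((\<lambda>t. measure (p t x) {y \<in> {0..}. dist y x < e}) \<longlongrightarrow> 1) (at_right 0))"

definition natural_filtration ::
  "'b measure \<Rightarrow> real set \<Rightarrow> (real \<Rightarrow> 'b \<Rightarrow> real) \<Rightarrow> real \<Rightarrow> 'b measure" where
  "natural_filtration N T X s =
     sigma (space N) {X r -` A \<inter> space N | r A. r \<in> T \<and> r \<le> s \<and> A \<in> sets borel}"

text \<open>
  \<open>X\<close> is a Markov process with values in \<open>[0,\<infinity>)\<close>, time set \<open>T\<close>, continuous paths and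
  transition function \<open>p\<close>.
\<close>

definition continuous_markov_process ::
  "'b measure \<Rightarrow> real set \<Rightarrow> (real \<Rightarrow> 'b \<Rightarrow> real) \<Rightarrow> (real \<Rightarrow> real \<Rightarrow> real measure) \<Rightarrow> bool" where
  "continuous_markov_process N T X p \<longleftrightarrow>
     prob_space N \<and>
     transition_function p \<and>
     (\<forall>t\<in>T. X t \<in> N \<rightarrow>\<^sub>M halfline) \<and>
     (AE \<omega> in N. continuous_on T (\<lambda>t. X t \<omega>)) \<and>
     (\<forall>s\<in>T. \<forall>t\<in>T. \<forall>A\<in>sets halfline. s \<le> t \<longrightarrow>
        (AE \<omega> in N.
           real_cond_exp N (natural_filtration N T X s) (\<lambda>\<omega>. indicator A (X t \<omega>)) \<omega> =
           measure (p (t - s) (X s \<omega>)) A))"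

text \<open>
  The backward equation \<open>\<partial>\<^sub>t p = \<mu>(x) \<partial>\<^sub>x p + (\<sigma>\<^sup>2(x) / 2) \<partial>\<^sub>x\<^sup>2 p\<close> for the functions
  \<open>(t, x) \<mapsto> p t x A\<close>, at all \<open>t > 0\<close> and all \<open>x \<in> S\<close>. The argument \<open>sigma2\<close> is the infinitesimal
  variance \<open>\<sigma>\<^sup>2\<close> itself. If \<open>0 \<in> S\<close>, the space derivatives at \<open>0\<close> are one-sided and the equation
  at \<open>0\<close> determines the behaviour at the boundary.
\<close>

definition backward_equation ::
  "real set \<Rightarrow> (real \<Rightarrow> real) \<Rightarrow> (real \<Rightarrow> real) \<Rightarrow> (real \<Rightarrow> real \<Rightarrow> real measure) \<Rightarrow> bool" where
  "backward_equation S mu sigma2 p \<longleftrightarrow>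
     (\<forall>A\<in>sets halfline.
        continuous_on ({0<..} \<times> {0..}) (\<lambda>(t, x). measure (p t x) A) \<and>
        (\<exists>ut ux uxx. \<forall>t>0. \<forall>x\<in>S.
           ((\<lambda>r. measure (p r x) A) has_real_derivative ut t x) (at t) \<and>
           ((\<lambda>y. measure (p t y) A) has_real_derivative ux t x) (at x within S) \<and>
           ((\<lambda>y. ux t y) has_real_derivative uxx t x) (at x within S) \<and>
           ut t x = mu x * ux t x + 1 / 2 * sigma2 x * uxx t x))"

text \<open>
  A diffusion on \<open>[0,\<infinity>)\<close> whose infinitesimal mean and variance are prescribed on all of \<open>[0,\<infinity>)\<close>.
  For \<open>mu x = m > 0\<close> and \<open>sigma2 x = 2/3 * x\<close> the equation at \<open>x = 0\<close> reads
  \<open>\<partial>\<^sub>t p = m \<partial>\<^sub>x p\<close>; it rules out absorption or stickiness at \<open>0\<close>, and the diffusion is the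
  nonnegative solution of \<open>dX = m dt + sqrt (2/3 * X) dB\<close>.
\<close>

definition diffusion ::
  "'b measure \<Rightarrow> real set \<Rightarrow> (real \<Rightarrow> real) \<Rightarrow> (real \<Rightarrow> real) \<Rightarrow> (real \<Rightarrow> 'b \<Rightarrow> real) \<Rightarrow> bool" where
  "diffusion N T mu sigma2 X \<longleftrightarrow>
     (\<exists>p. continuous_markov_process N T X p \<and> backward_equation {0..} mu sigma2 p)"

text \<open>
  The infinitesimal mean \<open>(\<gamma> - 1) / (2 * x)\<close> of a Bessel process is singular at \<open>0\<close>, so its backward
  equation is imposed on \<open>(0,\<infinity>)\<close>. For \<open>0 < \<gamma> < 2\<close> the origin is hit and a boundary condition is
  needed: the origin is instantaneously reflecting, i.e. the derivative with respect to the scale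
  function (whose density is \<open>x powr (1 - \<gamma>)\<close>) vanishes there. For \<open>\<gamma> \<ge> 2\<close> the condition holds
  automatically.
\<close>

definition bessel_process ::
  "'b measure \<Rightarrow> real set \<Rightarrow> real \<Rightarrow> (real \<Rightarrow> 'b \<Rightarrow> real) \<Rightarrow> bool" where
  "bessel_process N T \<gamma> X \<longleftrightarrow>
     (\<exists>p. continuous_markov_process N T X p \<and>
          backward_equation {0<..} (\<lambda>x. (\<gamma> - 1) / (2 * x)) (\<lambda>_. 1) p \<and>
          (\<forall>A\<in>sets halfline. \<forall>t>0.
             ((\<lambda>x. x powr (\<gamma> - 1) * deriv (\<lambda>y. measure (p t y) A) x) \<longlongrightarrow> 0) (at_right 0)))"

end

theory Submission
  imports Defs
begin

text \<open>
  Between two visits to the axes the urn crosses a quadrant. Started from distances \<open>(z, 1)\<close>, it meets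
  the next axis at a distance \<open>W\<close> whose moments follow from polynomial harmonic and superharmonic
  functions of the state, the leading ones built from \<open>D = a (a + 1) + b (b - 1) - z (z + 1)\<close>; this
  gives \<open>E W = z + 2/3 + O(z\<^sup>-\<^sup>1\<^sup>/\<^sup>2)\<close>, \<open>E (W - z)\<^sup>2 = 2z/3 + O(z\<^sup>1\<^sup>/\<^sup>2)\<close> and \<open>E (W - z)\<^sup>4 = O(z\<^sup>2)\<close>.
  Hence the embedded chain has drift close to \<open>m = 2/3 - E \<kappa>\<close> and variance close to \<open>2z/3\<close>. Because
  \<open>m > 0\<close>, a power \<open>z\<^sup>g\<close> is a submartingale away from \<open>0\<close>, and this makes the occupation times of
  bounded sets negligible.

  The functions \<open>u t x = (1 + l t/3)\<^sup>-\<^sup>3\<^sup>m exp (- l x / (1 + l t/3))\<close> solve \<open>\<partial>\<^sub>t u = m \<partial>\<^sub>x u + (x/3) \<partial>\<^sub>x\<^sup>2 u\<close>,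
  so telescoping shows that they are the limits of the Laplace transforms of the rescaled chain.
  They are also the Laplace transforms of the diffusion: by the maximum principle a bounded solution of
  the backward equation is determined by its initial values, and exponential polynomials are dense
  among those. The Markov property propagates this to joint Laplace transforms. By Stone and
  Weierstrass, applied in the variables \<open>exp (- x)\<close>, joint Laplace transforms determine convergence in
  distribution. Finally, \<open>sqrt (6 D)\<close> is a Bessel process by a change of variables.
\<close>

section \<open>Crossing a quadrant\<close>

text \<open>Two obstacles shape the proof. In one crossing the drift is of order 1 while the
  fluctuations are of order \<open>sqrt z\<close>, so the constant 2/3 cannot come from a crude
  estimate. The two polynomial identities, of degree two and four, are exact; the fourth-moment
  bound only shows that the third and fourth moments occurring in the second identity are of lower
  order. What remains is a drift error of order \<open>1 / sqrt z\<close>, which is not small near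
  0, and a chain started at a fixed state begins there; hence the interest in occupation times. On
  the other side, the diffusion is given only through some transition function obeying a backward
  equation at positive times, so its law must be identified. An explicit candidate is compared with
  it on the initial functions \<open>measure (p e y) A\<close>, which are continuous in
  \<open>y\<close>, and then \<open>e\<close> tends to 0. Laplace transforms fit both sides because
  the limiting semigroup maps an exponential to a multiple of an exponential. Conditioning on the
  past therefore turns a joint transform into one with fewer times.\<close>

text \<open>
  Inside a quadrant the distances \<open>(a, b)\<close> to the axis ahead and to the axis behind move to
  \<open>(a, b + 1)\<close> with probability \<open>a / (a + b)\<close> and to \<open>(a - 1, b)\<close> otherwise; the number of moves of the first
  kind before the first drop of \<open>a\<close> has law \<open>drop_prob a b\<close>.
\<close>

definition drop_tail :: "nat \<Rightarrow> nat \<Rightarrow> nat \<Rightarrow> real" where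
  "drop_tail a b i = (\<Prod>j<i. real a / real (a + b + j))"

definition drop_prob :: "nat \<Rightarrow> nat \<Rightarrow> nat \<Rightarrow> real" where
  "drop_prob a b i = drop_tail a b i * (real (b + i) / real (a + b + i))"

lemma drop_tail_0 [simp]: "drop_tail a b 0 = 1"
  by (simp add: drop_tail_def)

lemma drop_tail_Suc: "drop_tail a b (Suc i) = drop_tail a b i * (real a / real (a + b + i))"
  by (simp add: drop_tail_def)

lemma drop_tail_nonneg: "drop_tail a b i \<ge> 0"
  by (auto simp: drop_tail_def intro!: prod_nonneg)

lemma drop_prob_nonneg: "drop_prob a b i \<ge> 0"
  unfolding drop_prob_def by (intro mult_nonneg_nonneg drop_tail_nonneg divide_nonneg_nonneg) auto

lemma drop_tail_shift:
  assumes "b \<ge> 1"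
  shows "drop_tail a b (Suc i) = real a / real (a + b) * drop_tail a (Suc b) i"
  unfolding drop_tail_def by (subst prod.lessThan_Suc_shift) (simp add: add_ac)

text \<open>Consecutive tails have a ratio tending to 0, so the tail beats every power. This kills
  the boundary term when a function of polynomial growth is stopped at the first drop.\<close>

lemma drop_tail_power_tendsto_0: "(\<lambda>i. drop_tail a b i * real (Suc i) ^ n) \<longlonglongrightarrow> 0"
proof (rule summable_LIMSEQ_zero, rule summable_ratio_test[where c = "1/2"])
  \<comment> \<open>From this index on the ratio is at most 1/2: the power contributes at most
    \<open>2 ^ n\<close>, and \<open>a * 2 ^ n / (a + b + i) \<le> 1/2\<close>.\<close>
  fix i :: nat assume i: "i \<ge> a * 2 ^ (n + 1) + 1"
  have "norm (drop_tail a b (Suc i) * real (Suc (Suc i)) ^ n) =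
      drop_tail a b i * (real a / real (a + b + i) * real (Suc (Suc i)) ^ n)"
    by (simp add: drop_tail_Suc abs_mult drop_tail_nonneg)
  also have "\<dots> \<le> drop_tail a b i * (1/2 * real (Suc i) ^ n)"
  proof (rule mult_left_mono)
    have "real (Suc (Suc i)) ^ n \<le> (2 * real (Suc i)) ^ n" by (intro power_mono) auto
    then have "real a / real (a + b + i) * real (Suc (Suc i)) ^ n
        \<le> real a / real (a + b + i) * (2 * real (Suc i)) ^ n"
      by (intro mult_left_mono) auto
    also have "\<dots> = (real a * 2 ^ n / real (a + b + i)) * real (Suc i) ^ n"
      by (simp add: power_mult_distrib del: of_nat_Suc)
    also have "\<dots> \<le> 1/2 * real (Suc i) ^ n"
    proof (rule mult_right_mono)
      have "real (a * 2 ^ (n + 1) + 1) \<le> real i" using i by linarith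
      define p where "p = real a * 2 ^ n"
      have "0 \<le> p" "2 * p + 1 \<le> real i" using \<open>real (a * 2 ^ (n + 1) + 1) \<le> real i\<close> by (simp_all add: p_def)
      then have "p \<le> 1/2 * real (a + b + i)" "real (a + b + i) > 0" by simp_all
      then show "real a * 2 ^ n / real (a + b + i) \<le> 1/2"
        unfolding p_def[symmetric] by (simp only: pos_divide_le_eq)
    qed auto
    finally show "real a / real (a + b + i) * real (Suc (Suc i)) ^ n \<le> 1/2 * real (Suc i) ^ n" .
  qed (rule drop_tail_nonneg)
  finally show "norm (drop_tail a b (Suc i) * real (Suc (Suc i)) ^ n) \<le> 1/2 * norm (drop_tail a b i * real (Suc i) ^ n)"
    by (simp add: abs_mult drop_tail_nonneg)
qed simp

text \<open>Optional stopping at the first drop or after \<open>n\<close> moves, whichever is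
  earlier: \<open>h c\<close> is the value while the second distance is \<open>c\<close>,
  \<open>g c\<close> the value just after a drop. The hypothesis is the one-step inequality
  multiplied by \<open>a + c\<close>, and the sum telescopes.\<close>

lemma drop_prob_super_partial_sum:
  assumes ab: "b \<ge> 1"
    and super: "\<And>c. c \<ge> b \<Longrightarrow> real a * h (Suc c) + real c * g c \<le> real (a + c) * h c"
  shows "(\<Sum>i<n. drop_prob a b i * g (b + i)) \<le> h b - drop_tail a b n * h (b + n)"
proof (induction n)
  case (Suc n)
  have "real (b + n) * g (b + n) / real (a + b + n)
      \<le> (real (a + b + n) * h (b + n) - real a * h (Suc (b + n))) / real (a + b + n)"
    using super[of "b + n"] by (intro divide_right_mono) (auto simp: add_ac)
  then have "real (b + n) / real (a + b + n) * g (b + n)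
      \<le> h (b + n) - real a / real (a + b + n) * h (Suc (b + n))"
    using ab by (simp add: diff_divide_distrib)
  then have "drop_tail a b n * (real (b + n) / real (a + b + n) * g (b + n))
      \<le> drop_tail a b n * (h (b + n) - real a / real (a + b + n) * h (Suc (b + n)))"
    by (intro mult_left_mono drop_tail_nonneg)
  with Suc show ?case by (simp add: drop_prob_def drop_tail_Suc algebra_simps)
qed simp

lemma drop_prob_harm_partial_sum:
  assumes ab: "b \<ge> 1"
    and harm: "\<And>c. c \<ge> b \<Longrightarrow> real a * h (Suc c) + real c * g c = real (a + c) * h c"
  shows "(\<Sum>i<n. drop_prob a b i * g (b + i)) = h b - drop_tail a b n * h (b + n)"
proof (rule antisym)
  show "(\<Sum>i<n. drop_prob a b i * g (b + i)) \<le> h b - drop_tail a b n * h (b + n)"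
    using drop_prob_super_partial_sum[OF ab, of a h g n] harm by simp
  have "(\<Sum>i<n. drop_prob a b i * (- g (b + i))) \<le> - h b - drop_tail a b n * (- h (b + n))"
    using harm by (intro drop_prob_super_partial_sum[OF ab]) (fastforce simp: algebra_simps)
  then show "(\<Sum>i<n. drop_prob a b i * g (b + i)) \<ge> h b - drop_tail a b n * h (b + n)"
    by (simp add: sum_negf)
qed

text \<open>Polynomial growth makes the boundary term \<open>drop_tail a b n * h (b + n)\<close>
  vanish in the limit.\<close>

lemma drop_prob_harm_sums:
  assumes ab: "b \<ge> 1"
    and harm: "\<And>c. c \<ge> b \<Longrightarrow> real a * h (Suc c) + real c * g c = real (a + c) * h c"
    and growth: "\<And>c. c \<ge> b \<Longrightarrow> \<bar>h c\<bar> \<le> C * real c ^ n"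
  shows "(\<lambda>i. drop_prob a b i * g (b + i)) sums h b"
proof -
  have "(\<lambda>i. drop_tail a b i * h (b + i)) \<longlonglongrightarrow> 0"
  proof (rule tendsto_rabs_zero_cancel, rule tendsto_sandwich[where f = "\<lambda>_. 0"])
    have "0 \<le> C * real b ^ n" using growth[of b] abs_ge_zero[of "h b"] by linarith
    moreover have "real b ^ n > 0" using ab by simp
    ultimately have C: "C \<ge> 0" by (simp add: zero_le_mult_iff)
    show "\<forall>\<^sub>F i in sequentially. \<bar>drop_tail a b i * h (b + i)\<bar>
        \<le> C * real b ^ n * (drop_tail a b i * real (Suc i) ^ n)"
    proof (rule always_eventually, rule allI)
      fix i
      have "real (b + i) \<le> real b * real (Suc i)"
        using ab mult_right_mono[of 1 "real b" "real i"] by (simp add: algebra_simps)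
      then have "real (b + i) ^ n \<le> (real b * real (Suc i)) ^ n" by (intro power_mono) auto
      then have "C * real (b + i) ^ n \<le> C * (real b ^ n * real (Suc i) ^ n)"
        using C by (intro mult_left_mono) (auto simp: power_mult_distrib)
      then have "\<bar>h (b + i)\<bar> \<le> C * (real b ^ n * real (Suc i) ^ n)"
        using growth[of "b + i"] by simp
      then have "drop_tail a b i * \<bar>h (b + i)\<bar> \<le> drop_tail a b i * (C * (real b ^ n * real (Suc i) ^ n))"
        by (intro mult_left_mono drop_tail_nonneg)
      then show "\<bar>drop_tail a b i * h (b + i)\<bar>
        \<le> C * real b ^ n * (drop_tail a b i * real (Suc i) ^ n)"
        by (simp add: abs_mult drop_tail_nonneg mult_ac)
    qed
    show "(\<lambda>i. C * real b ^ n * (drop_tail a b i * real (Suc i) ^ n)) \<longlonglongrightarrow> 0"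
      using tendsto_mult_left[OF drop_tail_power_tendsto_0, of "C * real b ^ n"] by simp
  qed (auto simp: always_eventually)
  then have "(\<lambda>n. h b - drop_tail a b n * h (b + n)) \<longlonglongrightarrow> h b - 0" by (intro tendsto_intros)
  then show ?thesis unfolding sums_def by (simp add: drop_prob_harm_partial_sum[OF ab harm])
qed

lemma drop_prob_sums: "b \<ge> 1 \<Longrightarrow> drop_prob a b sums 1"
  using drop_prob_harm_sums[of b a "\<lambda>_. 1" "\<lambda>_. 1" 1 0] by simp

definition drop_pmf :: "nat \<Rightarrow> nat \<Rightarrow> nat pmf" where
  "drop_pmf a b = map_pmf (\<lambda>i. b + i) (embed_pmf (drop_prob a b))"

lemma pmf_embed_drop_prob:
  assumes "b \<ge> 1" shows "pmf (embed_pmf (drop_prob a b)) i = drop_prob a b i"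
proof (rule pmf_embed_pmf)
  show "(\<integral>\<^sup>+ x. ennreal (drop_prob a b x) \<partial>count_space UNIV) = 1"
    unfolding nn_integral_count_space_nat using drop_prob_sums[OF assms, of a]
    by (subst suminf_ennreal2) (auto simp: drop_prob_nonneg sums_iff)
qed (rule drop_prob_nonneg)

lemma set_drop_pmf: "set_pmf (drop_pmf a b) \<subseteq> {b..}"
  unfolding drop_pmf_def by auto

lemma nn_integral_drop_pmf:
  assumes "b \<ge> 1"
  shows "(\<integral>\<^sup>+c. f c \<partial>drop_pmf a b) = (\<Sum>i. ennreal (drop_prob a b i) * f (b + i))"
proof -
  have "(\<integral>\<^sup>+c. f c \<partial>drop_pmf a b) = (\<integral>\<^sup>+i. f (b + i) \<partial>embed_pmf (drop_prob a b))"
    unfolding drop_pmf_def by (rule nn_integral_map_pmf)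
  then show ?thesis
    unfolding nn_integral_measure_pmf nn_integral_count_space_nat
    by (simp add: pmf_embed_drop_prob[OF assms])
qed

text \<open>For nonnegative \<open>h\<close> the boundary term has the favourable sign and is simply
  dropped.\<close>

lemma nn_integral_drop_pmf_super:
  assumes ab: "b \<ge> 1"
    and super: "\<And>c. c \<ge> b \<Longrightarrow> real a * h (Suc c) + real c * g c \<le> real (a + c) * h c"
    and nn: "\<And>c. c \<ge> b \<Longrightarrow> g c \<ge> 0" "\<And>c. c \<ge> b \<Longrightarrow> h c \<ge> 0"
  shows "(\<integral>\<^sup>+c. ennreal (g c) \<partial>drop_pmf a b) \<le> ennreal (h b)"
proof -
  have "(\<Sum>i. ennreal (drop_prob a b i) * ennreal (g (b + i))) =
      (\<Sum>i. ennreal (drop_prob a b i * g (b + i)))"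
    by (simp add: ennreal_mult drop_prob_nonneg nn)
  also have "\<dots> \<le> ennreal (h b)"
  proof (rule suminf_le_const)
    fix n
    have "(\<Sum>i<n. drop_prob a b i * g (b + i)) \<le> h b"
      using drop_prob_super_partial_sum[OF ab super, of n] mult_nonneg_nonneg[OF drop_tail_nonneg[of a b n] nn(2)[of "b + n"]]
      by simp
    then show "(\<Sum>i<n. ennreal (drop_prob a b i * g (b + i))) \<le> ennreal (h b)"
      by (subst sum_ennreal) (auto intro!: mult_nonneg_nonneg drop_prob_nonneg nn ennreal_leI)
  qed simp
  finally show ?thesis by (simp add: nn_integral_drop_pmf[OF ab])
qed

lemma nn_integral_drop_pmf_harm:
  assumes ab: "b \<ge> 1"
    and harm: "\<And>c. c \<ge> b \<Longrightarrow> real a * h (Suc c) + real c * g c = real (a + c) * h c"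
    and growth: "\<And>c. c \<ge> b \<Longrightarrow> \<bar>h c\<bar> \<le> C * real c ^ n"
    and nn: "\<And>c. c \<ge> b \<Longrightarrow> g c \<ge> 0"
  shows "(\<integral>\<^sup>+c. ennreal (g c) \<partial>drop_pmf a b) = ennreal (h b)"
proof -
  have "(\<integral>\<^sup>+c. ennreal (g c) \<partial>drop_pmf a b) = (\<Sum>i. ennreal (drop_prob a b i * g (b + i)))"
    by (simp add: nn_integral_drop_pmf[OF ab] ennreal_mult drop_prob_nonneg nn)
  also have "\<dots> = ennreal (h b)"
    using drop_prob_harm_sums[OF ab harm growth]
    by (subst suminf_ennreal2) (auto simp: sums_iff nn drop_prob_nonneg)
  finally show ?thesis .
qed

text \<open>The law of the second distance when the first one reaches \<open>0\<close>.\<close>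

primrec exc_pmf :: "nat \<Rightarrow> nat \<Rightarrow> nat pmf" where
  "exc_pmf 0 b = return_pmf b"
| "exc_pmf (Suc a) b = bind_pmf (drop_pmf (Suc a) b) (exc_pmf a)"

lemma set_exc_pmf: "set_pmf (exc_pmf a b) \<subseteq> {b..}"
proof (induction a arbitrary: b)
  case (Suc a)
  show ?case
  proof
    fix w assume "w \<in> set_pmf (exc_pmf (Suc a) b)"
    then obtain c where "c \<in> set_pmf (drop_pmf (Suc a) b)" "w \<in> set_pmf (exc_pmf a c)"
      by auto
    moreover from calculation have "b \<le> c" "c \<le> w"
      using set_drop_pmf[of "Suc a" b] Suc[of c] by blast+
    ultimately show "w \<in> {b..}" by simp
  qed
qed simp

lemma pmf_exc_pmf_less: "w < b \<Longrightarrow> pmf (exc_pmf a b) w = 0"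
  using set_exc_pmf[of a b] by (force simp: set_pmf_iff)

lemma ennreal_pmf_exc_pmf_Suc:
  "b \<ge> 1 \<Longrightarrow> ennreal (pmf (exc_pmf (Suc a) b) w) =
    (\<Sum>i. ennreal (drop_prob (Suc a) b i) * ennreal (pmf (exc_pmf a (b + i)) w))"
  by (simp add: ennreal_pmf_bind nn_integral_drop_pmf)

lemma drop_prob_shift:
  "b \<ge> 1 \<Longrightarrow> drop_prob a b (Suc i) = real a / real (a + b) * drop_prob a (Suc b) i"
  unfolding drop_prob_def by (simp add: drop_tail_shift)

text \<open>\<open>exc_pmf\<close> is built drop by drop. Separating an immediate drop from the rest
  recovers the equation for a single move of the urn, the form in which the law is later compared
  with \<open>nshu_step\<close>; the remaining terms are the same series started from
  \<open>Suc b\<close>.\<close>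

lemma pmf_exc_pmf_step:
  assumes b: "b \<ge> 1"
  shows "pmf (exc_pmf (Suc a) b) w =
    real (Suc a) / real (Suc a + b) * pmf (exc_pmf (Suc a) (Suc b)) w +
    real b / real (Suc a + b) * pmf (exc_pmf a b) w"
proof -
  have "ennreal (pmf (exc_pmf (Suc a) b) w) =
      (\<Sum>i. ennreal (drop_prob (Suc a) b (Suc i)) * ennreal (pmf (exc_pmf a (b + Suc i)) w))
      + ennreal (drop_prob (Suc a) b 0) * ennreal (pmf (exc_pmf a b) w)"
    unfolding ennreal_pmf_exc_pmf_Suc[OF b]
    by (subst suminf_offset[where i = 1]) (auto simp: add_ac)
  also have "(\<Sum>i. ennreal (drop_prob (Suc a) b (Suc i)) * ennreal (pmf (exc_pmf a (b + Suc i)) w))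
     = (\<Sum>i. ennreal (real (Suc a) / real (Suc a + b)) * (ennreal (drop_prob (Suc a) (Suc b) i)
           * ennreal (pmf (exc_pmf a (Suc b + i)) w)))"
    unfolding drop_prob_shift[OF b] by (subst ennreal_mult) (auto simp: drop_prob_nonneg mult_ac)
  also have "\<dots> = ennreal (real (Suc a) / real (Suc a + b)) * ennreal (pmf (exc_pmf (Suc a) (Suc b)) w)"
    by (subst ennreal_pmf_exc_pmf_Suc) auto
  also have "drop_prob (Suc a) b 0 = real b / real (Suc a + b)"
    by (simp add: drop_prob_def)
  also have "ennreal (real (Suc a) / real (Suc a + b)) * ennreal (pmf (exc_pmf (Suc a) (Suc b)) w)
     + ennreal (real b / real (Suc a + b)) * ennreal (pmf (exc_pmf a b) w)
     = ennreal (real (Suc a) / real (Suc a + b) * pmf (exc_pmf (Suc a) (Suc b)) w +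
    real b / real (Suc a + b) * pmf (exc_pmf a b) w)"
    by (simp add: ennreal_mult[symmetric] ennreal_plus[symmetric] del: ennreal_plus)
  finally show ?thesis
    by (subst (asm) ennreal_inj) auto
qed

text \<open>The path that first makes all \<open>w - b\<close> increases and then only drops has
  positive probability. This is what will drive the embedded chain out of bounded sets.\<close>

lemma pmf_exc_pmf_pos: "b \<ge> 1 \<Longrightarrow> a \<ge> 1 \<Longrightarrow> w \<ge> b \<Longrightarrow> pmf (exc_pmf a b) w > 0"
proof (induction "w - b" arbitrary: b)
  case 0
  then have w: "w = b" by simp
  obtain a' where a: "a = Suc a'" using 0 by (cases a) auto
  have "pmf (exc_pmf n b) b > 0" for n
  proof (induction n)
    case (Suc n)
    have "real b / real (Suc n + b) * pmf (exc_pmf n b) b > 0" using Suc 0 by auto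
    moreover have "real (Suc n) / real (Suc n + b) * pmf (exc_pmf (Suc n) (Suc b)) b \<ge> 0" by auto
    ultimately show ?case unfolding pmf_exc_pmf_step[OF \<open>b \<ge> 1\<close>] by linarith
  qed simp
  then show ?case using w by simp
next
  case (Suc k)
  obtain a' where a: "a = Suc a'" using Suc by (cases a) auto
  have "pmf (exc_pmf a (Suc b)) w > 0" by (rule Suc) (use Suc in auto)
  moreover have "real b / real (Suc a' + b) * pmf (exc_pmf a' b) w \<ge> 0" by auto
  ultimately show ?case unfolding a pmf_exc_pmf_step[OF \<open>b \<ge> 1\<close>]
    by (simp add: a add_pos_nonneg del: of_nat_Suc)
qed

text \<open>Optional stopping across the whole quadrant, one drop at a time: after the first drop
  the induction hypothesis bounds the rest by \<open>H a c\<close>, and the one-drop result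
  integrates that over \<open>c\<close>.\<close>

lemma nn_integral_exc_pmf_super:
  fixes H :: "nat \<Rightarrow> nat \<Rightarrow> real"
  assumes "b \<ge> 1"
    and "\<And>x y. x < a \<Longrightarrow> y \<ge> b \<Longrightarrow>
      real (Suc x) * H (Suc x) (Suc y) + real y * H x y \<le> real (Suc x + y) * H (Suc x) y"
    and nn: "\<And>x y. x \<le> a \<Longrightarrow> y \<ge> b \<Longrightarrow> H x y \<ge> 0"
  shows "(\<integral>\<^sup>+w. ennreal (H 0 w) \<partial>exc_pmf a b) \<le> ennreal (H a b)"
  using assms
proof (induction a arbitrary: b)
  case (Suc a)
  have "(\<integral>\<^sup>+w. ennreal (H 0 w) \<partial>exc_pmf (Suc a) b) = (\<integral>\<^sup>+c. (\<integral>\<^sup>+w. ennreal (H 0 w) \<partial>exc_pmf a c) \<partial>drop_pmf (Suc a) b)"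
    by simp
  also have "\<dots> \<le> (\<integral>\<^sup>+c. ennreal (H a c) \<partial>drop_pmf (Suc a) b)"
  proof (rule nn_integral_mono_AE)
    show "AE c in drop_pmf (Suc a) b. (\<integral>\<^sup>+w. ennreal (H 0 w) \<partial>exc_pmf a c) \<le> ennreal (H a c)"
      unfolding AE_measure_pmf_iff
    proof
      fix c assume "c \<in> set_pmf (drop_pmf (Suc a) b)"
      then have c: "c \<ge> b" using set_drop_pmf[of "Suc a" b] by auto
      show "(\<integral>\<^sup>+w. ennreal (H 0 w) \<partial>exc_pmf a c) \<le> ennreal (H a c)"
      proof (rule Suc.IH)
        show "1 \<le> c" using c Suc.prems(1) by simp
        show "real (Suc x) * H (Suc x) (Suc y) + real y * H x y \<le> real (Suc x + y) * H (Suc x) y"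
          if "x < a" "c \<le> y" for x y using c that by (intro Suc.prems(2)) auto
        show "H x y \<ge> 0" if "x \<le> a" "c \<le> y" for x y using c that by (intro Suc.prems(3)) auto
      qed
    qed
  qed
  also have "\<dots> \<le> ennreal (H (Suc a) b)"
  proof (rule nn_integral_drop_pmf_super)
    show "real (Suc a) * H (Suc a) (Suc c) + real c * H a c \<le> real (Suc a + c) * H (Suc a) c"
      if "b \<le> c" for c using that by (intro Suc.prems(2)) auto
  qed (use Suc.prems(1,3) in auto)
  finally show ?case .
qed simp

text \<open>The growth constant may depend on the first distance, since it is used for a single drop
  at a time.\<close>

lemma nn_integral_exc_pmf_harm:
  fixes H :: "nat \<Rightarrow> nat \<Rightarrow> real"
  assumes "b \<ge> 1"
    and "\<And>x y. x < a \<Longrightarrow> y \<ge> b \<Longrightarrow>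
      real (Suc x) * H (Suc x) (Suc y) + real y * H x y = real (Suc x + y) * H (Suc x) y"
    and nn: "\<And>x y. x \<le> a \<Longrightarrow> y \<ge> b \<Longrightarrow> H x y \<ge> 0"
    and growth: "\<And>x y. x \<le> a \<Longrightarrow> y \<ge> b \<Longrightarrow> H x y \<le> C x * real y ^ n"
  shows "(\<integral>\<^sup>+w. ennreal (H 0 w) \<partial>exc_pmf a b) = ennreal (H a b)"
  using assms
proof (induction a arbitrary: b)
  case (Suc a)
  have "(\<integral>\<^sup>+w. ennreal (H 0 w) \<partial>exc_pmf (Suc a) b) = (\<integral>\<^sup>+c. (\<integral>\<^sup>+w. ennreal (H 0 w) \<partial>exc_pmf a c) \<partial>drop_pmf (Suc a) b)"
    by simp
  also have "\<dots> = (\<integral>\<^sup>+c. ennreal (H a c) \<partial>drop_pmf (Suc a) b)"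
  proof (rule nn_integral_cong_AE)
    show "AE c in drop_pmf (Suc a) b. (\<integral>\<^sup>+w. ennreal (H 0 w) \<partial>exc_pmf a c) = ennreal (H a c)"
      unfolding AE_measure_pmf_iff
    proof
      fix c assume "c \<in> set_pmf (drop_pmf (Suc a) b)"
      then have c: "c \<ge> b" using set_drop_pmf[of "Suc a" b] by auto
      show "(\<integral>\<^sup>+w. ennreal (H 0 w) \<partial>exc_pmf a c) = ennreal (H a c)"
      proof (rule Suc.IH)
        show "1 \<le> c" using c Suc.prems(1) by simp
        show "real (Suc x) * H (Suc x) (Suc y) + real y * H x y = real (Suc x + y) * H (Suc x) y"
          if "x < a" "c \<le> y" for x y using c that by (intro Suc.prems(2)) auto
        show "H x y \<ge> 0" if "x \<le> a" "c \<le> y" for x y using c that by (intro Suc.prems(3)) auto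
        show "H x y \<le> C x * real y ^ n" if "x \<le> a" "c \<le> y" for x y
          using c that by (intro Suc.prems(4)) auto
      qed
    qed
  qed
  also have "\<dots> = ennreal (H (Suc a) b)"
  proof (rule nn_integral_drop_pmf_harm)
    show "real (Suc a) * H (Suc a) (Suc c) + real c * H a c = real (Suc a + c) * H (Suc a) c"
      if "b \<le> c" for c using that by (intro Suc.prems(2)) auto
    show "\<bar>H (Suc a) c\<bar> \<le> C (Suc a) * real c ^ n" if "b \<le> c" for c
      using that Suc.prems(3)[of "Suc a" c] Suc.prems(4)[of "Suc a" c] by simp
  qed (use Suc.prems(1,3) in auto)
  finally show ?case .
qed simp

section \<open>Moments of the exit distance\<close>

text \<open>The function \<open>x * (x + 1) + y * (y - 1)\<close> gains \<open>2 * y\<close> with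
  probability \<open>x / (x + y)\<close> and loses \<open>2 * x\<close> with probability
  \<open>y / (x + y)\<close>, so it is harmonic.\<close>

lemma exc_first_moment:
  assumes "z \<ge> 1"
  shows "(\<integral>\<^sup>+w. ennreal (real w * (real w - 1)) \<partial>exc_pmf z 1) = ennreal (real z * (real z + 1))"
proof -
  define H :: "nat \<Rightarrow> nat \<Rightarrow> real" where "H = (\<lambda>x y. real x * (real x + 1) + real y * (real y - 1))"
  have "(\<integral>\<^sup>+w. ennreal (H 0 w) \<partial>exc_pmf z 1) = ennreal (H z 1)"
  proof (rule nn_integral_exc_pmf_harm[where C = "\<lambda>x. real x * (real x + 1) + 1" and n = 2])
    show "real (Suc x) * H (Suc x) (Suc y) + real y * H x y = real (Suc x + y) * H (Suc x) y" for x y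
      unfolding H_def by (simp add: algebra_simps)
    show "0 \<le> H x y" if "1 \<le> y" for x y unfolding H_def using that by simp
    show "H x y \<le> (real x * (real x + 1) + 1) * (real y)\<^sup>2" if "1 \<le> y" for x y
    proof -
      have "real x * (real x + 1) * 1 \<le> real x * (real x + 1) * (real y)\<^sup>2"
        using that by (intro mult_left_mono) auto
      then show ?thesis unfolding H_def by (simp add: algebra_simps power2_eq_square)
    qed
  qed simp
  then show ?thesis by (simp add: H_def)
qed

text \<open>The square of \<open>s + t\<close> has drift \<open>4 * x * y\<close>, and
  \<open>x * t - y * s\<close> has drift \<open>- 3 * x * y\<close>; three times the first plus four
  times the second is harmonic. Adding \<open>2 * (s + t)\<close> turns the exit value into
  \<open>s * (3 * w - 1) * (w - 2)\<close>, which is nonnegative at every integer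
  \<open>w \<ge> 1\<close>, as the extended nonnegative integral demands.\<close>

lemma exc_second_moment:
  assumes "z \<ge> 1"
  shows "(\<integral>\<^sup>+w. ennreal (let s = real w * (real w - 1) in 3 * s\<^sup>2 - 4 * real w * s + 2 * s) \<partial>exc_pmf z 1)
     = ennreal (let t = real z * (real z + 1) in 3 * t\<^sup>2 + 4 * real z * t + 2 * t)"
proof -
  define s t where "s = (\<lambda>y. real y * (real y - 1))" and "t = (\<lambda>x. real x * (real x + 1))"
  define H :: "nat \<Rightarrow> nat \<Rightarrow> real"
    where "H = (\<lambda>x y. 3 * (s y + t x)\<^sup>2 + 4 * (real x * t x - real y * s y) + 2 * (s y + t x))"
  have s0: "s y \<ge> 0" if "y \<ge> 1" for y using that by (simp add: s_def)
  have t0: "t x \<ge> 0" for x by (simp add: t_def)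
  have "(\<integral>\<^sup>+w. ennreal (H 0 w) \<partial>exc_pmf z 1) = ennreal (H z 1)"
  proof (rule nn_integral_exc_pmf_harm[where C = "\<lambda>x. 3 * (1 + t x)\<^sup>2 + 4 * real x * t x + 2 * (1 + t x)" and n = 4])
    show "real (Suc x) * H (Suc x) (Suc y) + real y * H x y = real (Suc x + y) * H (Suc x) y" for x y
      unfolding H_def s_def t_def of_nat_Suc of_nat_add by algebra
    show "0 \<le> H x y" if y: "1 \<le> y" for x y
    proof -
      have "s y * ((3 * real y - 1) * (real y - 2)) \<ge> 0"
      proof (cases "y = 1")
        case False
        then show ?thesis using y s0[OF y] by (intro mult_nonneg_nonneg) auto
      qed (simp add: s_def)
      moreover have "s y * ((3 * real y - 1) * (real y - 2)) = 3 * (s y)\<^sup>2 - 4 * real y * s y + 2 * s y"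
        unfolding s_def by algebra
      moreover have "H x y = (3 * (s y)\<^sup>2 - 4 * real y * s y + 2 * s y) + 3 * (t x)\<^sup>2 + 6 * t x * s y + 4 * real x * t x + 2 * t x"
        unfolding H_def by algebra
      ultimately show ?thesis using s0[OF y] t0[of x] by simp
    qed
    show "H x y \<le> (3 * (1 + t x)\<^sup>2 + 4 * real x * t x + 2 * (1 + t x)) * real y ^ 4" if y: "1 \<le> y" for x y
    proof -
      have y2: "(real y)\<^sup>2 \<ge> 1" "real y ^ 4 \<ge> 1" "(real y)\<^sup>2 \<le> real y ^ 4"
        using y by (auto intro: power_increasing)
      have s1: "s y + t x \<le> (1 + t x) * (real y)\<^sup>2"
        using y mult_left_mono[OF y2(1) t0[of x]] by (simp add: s_def power2_eq_square algebra_simps)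
      have "(s y + t x)\<^sup>2 \<le> ((1 + t x) * (real y)\<^sup>2)\<^sup>2"
        using s1 s0[OF y] t0[of x] by (intro power_mono) auto
      then have 1: "(s y + t x)\<^sup>2 \<le> (1 + t x)\<^sup>2 * real y ^ 4" by (simp add: power_mult_distrib)
      have 2: "s y + t x \<le> (1 + t x) * real y ^ 4"
        using s1 mult_left_mono[OF y2(3), of "1 + t x"] t0[of x] by linarith
      have 3: "real x * t x \<le> (real x * t x) * real y ^ 4"
        using mult_left_mono[OF y2(2), of "real x * t x"] t0[of x] by simp
      have "real y * s y \<ge> 0" using s0[OF y] by simp
      then show ?thesis unfolding H_def using 1 2 3 by (simp add: algebra_simps)
    qed
  qed simp
  then show ?thesis by (simp add: H_def s_def t_def Let_def algebra_simps)
qed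

text \<open>
  The expected increment of the fourth power of \<open>D\<close> is absorbed by the factor that a drop of \<open>a\<close>
  costs in the superharmonic function of \<open>exc_fourth_moment\<close>.
\<close>

lemma exc_fourth_moment_aux:
  fixes a y z D :: real
  assumes a: "1 \<le> a" "a \<le> z" and y: "1 \<le> y" and D: "D = a * (a + 1) + y * (y - 1) - z * (z + 1)"
  shows "z\<^sup>2 * (24 * D\<^sup>2 * (y + a) + 32 * D * (y\<^sup>2 - a\<^sup>2) + 16 * (y ^ 3 + a ^ 3))
    \<le> 1/2 * ((D - 2 * a) ^ 4 + 4000000000 * z ^ 6)"
proof -
  \<comment> \<open>Both \<open>y\<^sup>2\<close> and \<open>z * y\<close> are bounded by multiples
    of \<open>P + z\<^sup>2\<close>, which reduces the claim to monomials in \<open>P\<close> and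
    \<open>z\<close>.\<close>
  define P where "P = \<bar>D\<bar>"
  have P: "P \<ge> 0" "D \<le> P" "- D \<le> P" "D\<^sup>2 = P\<^sup>2" "D ^ 4 = P ^ 4" by (auto simp: P_def)
  have z: "z \<ge> 1" using a by simp
  have zk: "z ^ i \<le> z ^ j" if "i \<le> j" for i j using z that by (rule power_increasing[rotated])
  have "z * 1 \<le> z * z" using z by (intro mult_left_mono) auto
  have "a * (a + 1) \<ge> 0" using a by simp
  then have "y * (y - 1) \<le> P + z * (z + 1)" using P D by linarith
  moreover have "z * (z + 1) \<le> 2 * z\<^sup>2" using \<open>z * 1 \<le> z * z\<close> by (simp add: power2_eq_square algebra_simps)
  moreover have "y\<^sup>2 \<le> 2 * (y * (y - 1)) + 1 + 0 * y"
    using zero_le_power2[of "y - 1"] by (simp add: power2_eq_square algebra_simps)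
  moreover have "1 \<le> z\<^sup>2" using z by simp
  ultimately have y2: "y\<^sup>2 \<le> 2 * P + 6 * z\<^sup>2" by linarith
  have "2 * (z * y) \<le> y\<^sup>2 + z\<^sup>2" using zero_le_power2[of "y - z"] by (simp add: power2_eq_square algebra_simps)
  then have y1: "z * y \<le> P + 7/2 * z\<^sup>2" using y2 by simp
  have a2: "a\<^sup>2 \<le> z\<^sup>2" "a ^ 3 \<le> z ^ 3" using a by (auto intro: power_mono)
  have yz: "z * (y + a) \<le> P + 9/2 * z\<^sup>2"
  proof -
    have "z * a \<le> z * z" using a z by (intro mult_left_mono) auto
    then show ?thesis using y1 by (simp add: power2_eq_square distrib_left)
  qed
  have "z * (z * (y + a)) \<le> z * (P + 9/2 * z\<^sup>2)" using yz z by (intro mult_left_mono) auto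
  then have "(24 * P\<^sup>2) * (z * (z * (y + a))) \<le> (24 * P\<^sup>2) * (z * (P + 9/2 * z\<^sup>2))"
    by (rule mult_left_mono) simp
  moreover have "(24 * P\<^sup>2) * (z * (z * (y + a))) = z\<^sup>2 * (24 * D\<^sup>2 * (y + a))"
    unfolding P by (simp add: power2_eq_square mult_ac)
  moreover have "(24 * P\<^sup>2) * (z * (P + 9/2 * z\<^sup>2)) = 24 * (P ^ 3 * z) + 108 * (P\<^sup>2 * z ^ 3)"
    by (simp add: power2_eq_square power3_eq_cube algebra_simps)
  ultimately have 1: "z\<^sup>2 * (24 * D\<^sup>2 * (y + a)) \<le> 24 * (P ^ 3 * z) + 108 * (P\<^sup>2 * z ^ 3)" by simp
  have "D * (y\<^sup>2 - a\<^sup>2) \<le> P * (y\<^sup>2 + a\<^sup>2)"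
  proof -
    have "D * (y\<^sup>2 - a\<^sup>2) \<le> \<bar>D\<bar> * \<bar>y\<^sup>2 - a\<^sup>2\<bar>" by (metis abs_ge_self abs_mult)
    also have "\<bar>y\<^sup>2 - a\<^sup>2\<bar> \<le> y\<^sup>2 + a\<^sup>2"
      using zero_le_power2[of y] zero_le_power2[of a] by linarith
    then have "\<bar>D\<bar> * \<bar>y\<^sup>2 - a\<^sup>2\<bar> \<le> P * (y\<^sup>2 + a\<^sup>2)" unfolding P_def by (intro mult_left_mono) auto
    finally show ?thesis .
  qed
  also have "\<dots> \<le> P * (2 * P + 7 * z\<^sup>2)" using y2 a2 P by (intro mult_left_mono) auto
  finally have "(32 * z\<^sup>2) * (D * (y\<^sup>2 - a\<^sup>2)) \<le> (32 * z\<^sup>2) * (P * (2 * P + 7 * z\<^sup>2))"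
    by (intro mult_left_mono) auto
  then have 2: "z\<^sup>2 * (32 * D * (y\<^sup>2 - a\<^sup>2)) \<le> 64 * (P\<^sup>2 * z\<^sup>2) + 224 * (P * z ^ 4)"
    by (simp add: power2_eq_square power4_eq_xxxx algebra_simps)
  have "y\<^sup>2 * (z * y) \<le> (2 * P + 6 * z\<^sup>2) * (P + 7/2 * z\<^sup>2)"
    using y2 y1 P z y by (intro mult_mono) auto
  then have "z * (y\<^sup>2 * (z * y)) \<le> z * ((2 * P + 6 * z\<^sup>2) * (P + 7/2 * z\<^sup>2))"
    using z by (intro mult_left_mono) auto
  then have 3: "z\<^sup>2 * (16 * (y ^ 3 + a ^ 3)) \<le> 32 * (P\<^sup>2 * z) + 208 * (P * z ^ 3) + 352 * z ^ 5"
    using mult_left_mono[OF a2(2), of "z\<^sup>2"]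
    by (simp add: power2_eq_square power3_eq_cube algebra_simps eval_nat_numeral)
  have 4: "P\<^sup>2 * z\<^sup>2 \<le> P\<^sup>2 * z ^ 3" "P\<^sup>2 * z \<le> P\<^sup>2 * z ^ 3" "P * z ^ 3 \<le> P * z ^ 4" "z ^ 5 \<le> z ^ 6"
    using P zk[of 2 3] zk[of 1 3] zk[of 3 4] zk[of 5 6] by (auto intro: mult_left_mono)
  \<comment> \<open>Young's inequality turns the mixed monomials into a small multiple of
    \<open>P ^ 4\<close> and a large one of \<open>z ^ 6\<close>. The weights leave
    \<open>P ^ 4\<close> with coefficient 1/32, because passing from \<open>D\<close> to
    \<open>D - 2 * a\<close> costs a factor 8 and only 1/2 is available.\<close>
  have 5: "2 * (P * z ^ 4) \<le> P\<^sup>2 * z\<^sup>2 + z ^ 6"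
    using zero_le_power2[of "P * z - z ^ 3"] by (simp add: power2_eq_square algebra_simps eval_nat_numeral)
  have 6: "24 * (P ^ 3 * z) \<le> 1/64 * P ^ 4 + 9216 * (P\<^sup>2 * z\<^sup>2)"
    using zero_le_power2[of "1/8 * P\<^sup>2 - 96 * (P * z)"] by (simp add: power2_eq_square algebra_simps eval_nat_numeral)
  have 7: "10000 * (P\<^sup>2 * z ^ 3) \<le> 1/64 * P ^ 4 + 1600000000 * z ^ 6"
    using zero_le_power2[of "1/8 * P\<^sup>2 - 40000 * z ^ 3"] by (simp add: power2_eq_square algebra_simps eval_nat_numeral)
  have 8: "D ^ 4 \<le> 8 * (D - 2 * a) ^ 4 + 128 * a ^ 4"
  proof -
    have pm: "(u + v) ^ 4 \<le> 8 * u ^ 4 + 8 * v ^ 4" for u v :: real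
    proof -
      have "(u + v)\<^sup>2 \<le> 2 * u\<^sup>2 + 2 * v\<^sup>2"
        using zero_le_power2[of "u - v"] by (simp add: power2_eq_square algebra_simps)
      then have "((u + v)\<^sup>2)\<^sup>2 \<le> (2 * u\<^sup>2 + 2 * v\<^sup>2)\<^sup>2" by (intro power_mono) auto
      also have "\<dots> \<le> 8 * u ^ 4 + 8 * v ^ 4"
        using zero_le_power2[of "u\<^sup>2 - v\<^sup>2"] by (simp add: power2_eq_square algebra_simps eval_nat_numeral)
      finally show ?thesis by simp
    qed
    show ?thesis using pm[of "D - 2 * a" "2 * a"] by simp
  qed
  have 9: "a ^ 4 \<le> z ^ 6"
  proof -
    have "a ^ 4 \<le> z ^ 4" using a by (intro power_mono) auto
    then show ?thesis using zk[of 4 6] by simp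
  qed
  have 10: "z ^ 6 \<ge> 0" "P ^ 4 \<ge> 0" "P\<^sup>2 * z ^ 3 \<ge> 0" using z by auto
  have "z\<^sup>2 * (24 * D\<^sup>2 * (y + a) + 32 * D * (y\<^sup>2 - a\<^sup>2) + 16 * (y ^ 3 + a ^ 3)) =
    z\<^sup>2 * (24 * D\<^sup>2 * (y + a)) + z\<^sup>2 * (32 * D * (y\<^sup>2 - a\<^sup>2)) + z\<^sup>2 * (16 * (y ^ 3 + a ^ 3))"
    by (simp only: distrib_left)
  also have "\<dots> \<le> 1/32 * P ^ 4 + 1600000568 * z ^ 6"
    using 1 2 3 4 5 6 7 10 by linarith
  also have "\<dots> \<le> (D - 2 * a) ^ 4 / 2 + 2000000000 * z ^ 6"
    using 8 9 10 P(5) by linarith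
  finally show ?thesis by simp
qed

text \<open>The weight \<open>q\<close> equals 1 at the exit and stays below \<open>exp 1\<close>
  for \<open>x \<le> z\<close>, so it costs only the constant \<open>exp 1\<close>. When the first
  distance leaves \<open>a\<close> it shrinks by \<open>exp (- a / z\<^sup>2)\<close>, which
  supplies the missing negative drift. The summand \<open>z ^ 6\<close> in \<open>F\<close>, of the
  order of the bound to be proved, takes over where \<open>D\<close> is small.\<close>

lemma exc_fourth_moment:
  assumes z: "z \<ge> 1"
  shows "(\<integral>\<^sup>+w. ennreal ((real w * (real w - 1) - real z * (real z + 1)) ^ 4) \<partial>exc_pmf z 1)
    \<le> ennreal (exp 1 * 4000000000 * real z ^ 6)"
proof -
  define D where "D = (\<lambda>x y. real x * (real x + 1) + real y * (real y - 1) - real z * (real z + 1))"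
  define q where "q = (\<lambda>x. exp (real x * (real x + 1) / (2 * (real z)\<^sup>2)))"
  define F where "F = (\<lambda>x y. D x y ^ 4 + 4000000000 * real z ^ 6)"
  define H where "H = (\<lambda>x y. q x * F x y)"
  have F0: "F x y \<ge> 0" for x y by (simp add: F_def)
  have "(\<integral>\<^sup>+w. ennreal (H 0 w) \<partial>exc_pmf z 1) \<le> ennreal (H z 1)"
  proof (rule nn_integral_exc_pmf_super)
    show "0 \<le> H x y" for x y by (simp add: H_def q_def F0)
    fix x y :: nat assume x: "x < z" and y: "1 \<le> y"
    define a where "a = real (Suc x)"
    have a: "1 \<le> a" "a \<le> real z" using x by (auto simp: a_def)
    have z1: "1 \<le> real z" using z by simp
    define d where "d = D (Suc x) y"
    have d: "d = a * (a + 1) + real y * (real y - 1) - real z * (real z + 1)"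
      by (simp add: d_def D_def a_def)
    have d1: "D (Suc x) (Suc y) = d + 2 * real y" "D x y = d - 2 * a"
      unfolding d_def D_def a_def by (simp_all add: algebra_simps)
    define u where "u = a / (real z)\<^sup>2"
    have u: "0 \<le> u" "u \<le> 1"
      using a z1 order_trans[OF a(2) self_le_power[of "real z" 2]]
      unfolding u_def by (auto simp: divide_le_eq_1)
    have qx: "q x = q (Suc x) * exp (- u)"
      unfolding q_def mult_exp_exp u_def a_def using z1 by (simp add: field_simps)
    have "exp u \<ge> 1 + u" by simp
    then have "exp (- u) \<le> 1 / (1 + u)" using u by (simp add: exp_minus field_simps)
    also have "\<dots> \<le> 1 - u / 2"
    proof -
      have "u * u \<le> u * 1" using u by (intro mult_left_mono) auto
      then show ?thesis using u by (simp add: field_simps)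
    qed
    finally have eu: "exp (- u) \<le> 1 - u / 2" .
    have main: "a * F (Suc x) (Suc y) + real y * ((1 - u / 2) * F x y) \<le> (a + real y) * F (Suc x) y"
    proof -
      have "(real z)\<^sup>2 * (24 * d\<^sup>2 * (real y + a) + 32 * d * ((real y)\<^sup>2 - a\<^sup>2) + 16 * (real y ^ 3 + a ^ 3))
        \<le> 1/2 * F x y"
        using exc_fourth_moment_aux[OF a _ d] y by (simp add: F_def d1)
      then have "24 * d\<^sup>2 * (real y + a) + 32 * d * ((real y)\<^sup>2 - a\<^sup>2) + 16 * (real y ^ 3 + a ^ 3)
        \<le> 1/2 * F x y / (real z)\<^sup>2"
        using z1 by (simp add: pos_le_divide_eq mult.commute)
      then have "a * real y * (24 * d\<^sup>2 * (real y + a) + 32 * d * ((real y)\<^sup>2 - a\<^sup>2) + 16 * (real y ^ 3 + a ^ 3))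
        \<le> a * real y * (1/2 * F x y / (real z)\<^sup>2)"
        using a by (intro mult_left_mono) auto
      also have "\<dots> = real y * (u / 2 * F x y)" by (simp add: u_def mult_ac)
      finally have "a * real y * (24 * d\<^sup>2 * (real y + a) + 32 * d * ((real y)\<^sup>2 - a\<^sup>2) + 16 * (real y ^ 3 + a ^ 3))
        \<le> real y * (u / 2 * F x y)" .
      moreover have "a * F (Suc x) (Suc y) + real y * F x y - (a + real y) * F (Suc x) y =
        a * real y * (24 * d\<^sup>2 * (real y + a) + 32 * d * ((real y)\<^sup>2 - a\<^sup>2) + 16 * (real y ^ 3 + a ^ 3))"
        unfolding F_def d1 d_def[symmetric] by algebra
      ultimately show ?thesis by (simp add: algebra_simps)
    qed
    have "real y * H x y = q (Suc x) * (real y * (exp (- u) * F x y))"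
      by (simp add: H_def qx)
    also have "\<dots> \<le> q (Suc x) * (real y * ((1 - u / 2) * F x y))"
      using eu F0 by (intro mult_left_mono mult_right_mono) (auto simp: q_def)
    finally have "real (Suc x) * H (Suc x) (Suc y) + real y * H x y
      \<le> q (Suc x) * (a * F (Suc x) (Suc y) + real y * ((1 - u / 2) * F x y))"
      by (simp add: H_def a_def algebra_simps)
    also have "\<dots> \<le> q (Suc x) * ((a + real y) * F (Suc x) y)"
      using main by (intro mult_left_mono) (auto simp: q_def)
    finally show "real (Suc x) * H (Suc x) (Suc y) + real y * H x y \<le> real (Suc x + y) * H (Suc x) y"
      by (simp add: H_def a_def algebra_simps)
  qed simp
  also have "H z 1 \<le> exp 1 * (4000000000 * real z ^ 6)"
  proof -
    have z1: "1 \<le> real z" using z by simp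
    then have "real z * 1 \<le> real z * real z" by (intro mult_left_mono) auto
    then have "real z * (real z + 1) / (2 * (real z)\<^sup>2) \<le> 1"
      using z1 by (simp add: divide_le_eq_1 power2_eq_square algebra_simps)
    then have "q z \<le> exp 1" by (simp add: q_def)
    then show ?thesis by (simp add: H_def F_def D_def mult_right_mono)
  qed
  finally have "(\<integral>\<^sup>+w. ennreal (H 0 w) \<partial>exc_pmf z 1) \<le> ennreal (exp 1 * 4000000000 * real z ^ 6)"
    by (simp add: ennreal_leI mult.assoc)
  moreover have "(\<integral>\<^sup>+w. ennreal ((real w * (real w - 1) - real z * (real z + 1)) ^ 4) \<partial>exc_pmf z 1)
      \<le> (\<integral>\<^sup>+w. ennreal (H 0 w) \<partial>exc_pmf z 1)"
    by (intro nn_integral_mono ennreal_leI) (simp add: H_def F_def D_def q_def)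
  ultimately show ?thesis by (rule order_trans[rotated])
qed

lemma integrable_pmf_dominated:
  fixes f g :: "'a \<Rightarrow> real"
  assumes "integrable (measure_pmf p) g" "\<And>x. x \<in> set_pmf p \<Longrightarrow> \<bar>f x\<bar> \<le> g x"
  shows "integrable (measure_pmf p) f"
proof (rule Bochner_Integration.integrable_bound[OF assms(1)])
  show "AE x in measure_pmf p. norm (f x) \<le> norm (g x)"
    unfolding AE_measure_pmf_iff using assms(2) by fastforce
qed simp

lemma nn_integral_eq_imp_expectation:
  fixes f :: "'a \<Rightarrow> real"
  assumes "(\<integral>\<^sup>+x. ennreal (f x) \<partial>measure_pmf p) = ennreal c" "c \<ge> 0" "\<And>x. x \<in> set_pmf p \<Longrightarrow> f x \<ge> 0"
  shows "integrable (measure_pmf p) f" "measure_pmf.expectation p f = c"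
proof -
  have ae: "AE x in measure_pmf p. 0 \<le> f x" unfolding AE_measure_pmf_iff using assms(3) by simp
  show "integrable (measure_pmf p) f"
    by (rule integrableI_nonneg) (use ae assms(1) in auto)
  show "measure_pmf.expectation p f = c"
    using assms ae by (subst integral_eq_nn_integral) auto
qed

text \<open>The excess is centred at \<open>z + 1\<close> because \<open>s w = t\<close> there. Then
  \<open>s w - t = e w * (w + z)\<close>, so the fourth-power bound for the left side yields
  \<open>e ^ 4\<close> of order \<open>z\<^sup>2\<close> in mean. The first identity expresses the
  mean of \<open>e\<close> by its second moment, and the second identity determines the second
  moment up to lower-order terms.\<close>

lemma exc_excess_moments:
  obtains C where "C \<ge> 1"
    "\<And>z n. z \<ge> 1 \<Longrightarrow> n \<le> 4 \<Longrightarrow> integrable (measure_pmf (exc_pmf z 1)) (\<lambda>w. (real w - real z - 1) ^ n)"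
    "\<And>z. z \<ge> 1 \<Longrightarrow> measure_pmf.expectation (exc_pmf z 1) (\<lambda>w. (real w - real z - 1) ^ 4) \<le> C * (real z)\<^sup>2"
    "\<And>z. z \<ge> 1 \<Longrightarrow> \<bar>measure_pmf.expectation (exc_pmf z 1) (\<lambda>w. (real w - real z - 1)\<^sup>2) - 2/3 * real z\<bar> \<le> C * sqrt (real z)"
    "\<And>z. z \<ge> 1 \<Longrightarrow> \<bar>measure_pmf.expectation (exc_pmf z 1) (\<lambda>w. real w - real z - 1) + 1/3\<bar> \<le> C / sqrt (real z)"
proof -
  define C0 :: real where "C0 = exp 1 * 4000000000"
  have C0: "C0 \<ge> 1" unfolding C0_def using exp_ge_add_one_self[of 1] by simp
  define C where "C = 1000 * C0"
  have key: "(\<forall>n\<le>4. integrable (measure_pmf (exc_pmf z 1)) (\<lambda>w. (real w - real z - 1) ^ n)) \<and>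
    measure_pmf.expectation (exc_pmf z 1) (\<lambda>w. (real w - real z - 1) ^ 4) \<le> C * (real z)\<^sup>2 \<and>
    \<bar>measure_pmf.expectation (exc_pmf z 1) (\<lambda>w. (real w - real z - 1)\<^sup>2) - 2/3 * real z\<bar> \<le> C * sqrt (real z) \<and>
    \<bar>measure_pmf.expectation (exc_pmf z 1) (\<lambda>w. real w - real z - 1) + 1/3\<bar> \<le> C / sqrt (real z)"
    if z: "z \<ge> 1" for z
  proof -
    let ?p = "exc_pmf z 1"
    define e where "e = (\<lambda>w. real w - real z - 1)"
    define s where "s = (\<lambda>w. real w * (real w - 1))"
    define Z where "Z = real z"
    define t where "t = Z * (Z + 1)"
    define n where "n = 2 * Z + 1"
    define r where "r = sqrt Z"
    have Z1: "Z \<ge> 1" using z by (simp add: Z_def)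
    have r: "r \<ge> 1" "r * r = Z" using Z1 by (auto simp: r_def)
    have rr: "r * (r * x) = Z * x" for x by (simp flip: r(2))
    have supp: "w \<ge> 1" if "w \<in> set_pmf ?p" for w using that set_exc_pmf[of z 1] by auto
    have s0: "s w \<ge> 0" if "w \<ge> 1" for w using that by (simp add: s_def)
    have se: "s w = (e w)\<^sup>2 + n * e w + t" for w
      unfolding s_def e_def n_def t_def Z_def by algebra
    have de: "s w - t = e w * (real w + Z)" for w
      unfolding s_def e_def t_def Z_def by algebra
    have D4: "integrable ?p (\<lambda>w. (s w - t) ^ 4)" "measure_pmf.expectation ?p (\<lambda>w. (s w - t) ^ 4) \<le> C0 * Z ^ 6"
    proof -
      have nn: "(\<integral>\<^sup>+w. ennreal ((s w - t) ^ 4) \<partial>?p) \<le> ennreal (C0 * Z ^ 6)"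
        using exc_fourth_moment[OF z] by (simp add: s_def t_def Z_def C0_def)
      show int: "integrable ?p (\<lambda>w. (s w - t) ^ 4)"
        by (rule integrableI_nonneg) (use nn in \<open>auto simp: top_unique intro: le_less_trans\<close>)
      have "ennreal (measure_pmf.expectation ?p (\<lambda>w. (s w - t) ^ 4)) \<le> ennreal (C0 * Z ^ 6)"
        using nn int by (subst nn_integral_eq_integral[symmetric]) auto
      then show "measure_pmf.expectation ?p (\<lambda>w. (s w - t) ^ 4) \<le> C0 * Z ^ 6"
        using C0 Z1 by (subst (asm) ennreal_le_iff) auto
    qed
    have ez: "(e w) ^ 4 \<le> (s w - t) ^ 4 / Z ^ 4" if "w \<ge> 1" for w
    proof -
      have "\<bar>e w\<bar> * Z \<le> \<bar>e w\<bar> * (real w + Z)" by (intro mult_left_mono) auto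
      also have "\<dots> = \<bar>s w - t\<bar>" unfolding de using Z1 by (simp add: abs_mult)
      finally have "(\<bar>e w\<bar> * Z) ^ 4 \<le> \<bar>s w - t\<bar> ^ 4" using Z1 by (intro power_mono) auto
      then show ?thesis using Z1 by (simp add: power_mult_distrib pos_le_divide_eq)
    qed
    have i4: "integrable ?p (\<lambda>w. (e w) ^ 4)"
      by (rule integrable_pmf_dominated[of _ "\<lambda>w. (s w - t) ^ 4 / Z ^ 4"])
         (use D4(1) ez supp in auto)
    have ik: "integrable ?p (\<lambda>w. (e w) ^ k)" if "k \<le> 4" for k
    proof (rule integrable_pmf_dominated[of _ "\<lambda>w. 1 + (e w) ^ 4"])
      fix w
      have "\<bar>e w\<bar> ^ k \<le> 1 + \<bar>e w\<bar> ^ 4"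
      proof (cases "\<bar>e w\<bar> \<le> 1")
        case True
        then have "\<bar>e w\<bar> ^ k \<le> 1" by (intro power_le_one) auto
        then show ?thesis by (simp add: add_increasing2)
      next
        case False
        then have "\<bar>e w\<bar> ^ k \<le> \<bar>e w\<bar> ^ 4" using that by (intro power_increasing) auto
        then show ?thesis by simp
      qed
      then show "\<bar>(e w) ^ k\<bar> \<le> 1 + (e w) ^ 4" by (simp add: power_abs)
    qed (use i4 in auto)
    define M1 where "M1 = measure_pmf.expectation ?p e"
    define M2 where "M2 = measure_pmf.expectation ?p (\<lambda>w. (e w)\<^sup>2)"
    define M3 where "M3 = measure_pmf.expectation ?p (\<lambda>w. (e w) ^ 3)"
    define M4 where "M4 = measure_pmf.expectation ?p (\<lambda>w. (e w) ^ 4)"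
    have i1: "integrable ?p e" using ik[of 1] by simp
    note i2 = ik[of 2, simplified] and i3 = ik[of 3, simplified]
    have M4: "0 \<le> M4" "M4 \<le> C0 * Z\<^sup>2"
    proof -
      show "0 \<le> M4" unfolding M4_def by simp
      have "M4 \<le> measure_pmf.expectation ?p (\<lambda>w. (s w - t) ^ 4 / Z ^ 4)"
        unfolding M4_def by (rule integral_mono_AE) (use i4 D4 ez supp in \<open>auto simp: AE_measure_pmf_iff\<close>)
      also have "\<dots> \<le> C0 * Z ^ 6 / Z ^ 4" using D4 Z1 by (simp add: divide_right_mono)
      also have "\<dots> = C0 * Z\<^sup>2" using Z1 by (simp add: field_simps eval_nat_numeral)
      finally show "M4 \<le> C0 * Z\<^sup>2" .
    qed
    \<comment> \<open>Interpolation by \<open>2 * e\<^sup>2 \<le> Z + e ^ 4 / Z\<close>. The third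
      moment is treated likewise with \<open>r = sqrt Z\<close> as the weight.\<close>
    have M2: "0 \<le> M2" "M2 \<le> C0 * Z"
    proof -
      show "0 \<le> M2" unfolding M2_def by simp
      have "M2 \<le> measure_pmf.expectation ?p (\<lambda>w. 1/2 * (Z + (e w) ^ 4 / Z))"
        unfolding M2_def
      proof (rule integral_mono)
        fix w
        have "Z * (2 * (e w)\<^sup>2) \<le> Z * (Z + (e w) ^ 4 / Z)"
          using zero_le_power2[of "(e w)\<^sup>2 - Z"] Z1 by (simp add: power2_eq_square algebra_simps eval_nat_numeral)
        then show "(e w)\<^sup>2 \<le> 1/2 * (Z + (e w) ^ 4 / Z)" using Z1 by simp
      qed (use i2 i4 in auto)
      also have "\<dots> = 1/2 * (Z + M4 / Z)" unfolding M4_def using i4 by simp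
      also have "\<dots> \<le> 1/2 * (Z + C0 * Z)"
      proof -
        have "M4 / Z \<le> C0 * Z" using divide_right_mono[OF M4(2), of Z] Z1 by (simp add: power2_eq_square)
        then show ?thesis by (intro mult_left_mono add_left_mono) auto
      qed
      also have "\<dots> \<le> C0 * Z" using mult_right_mono[OF C0, of Z] Z1 by simp
      finally show "M2 \<le> C0 * Z" .
    qed
    have M3: "\<bar>M3\<bar> \<le> C0 * Z * r"
    proof -
      have "\<bar>M3\<bar> \<le> measure_pmf.expectation ?p (\<lambda>w. \<bar>(e w) ^ 3\<bar>)"
        unfolding M3_def by (rule integral_abs_bound)
      also have "\<dots> \<le> measure_pmf.expectation ?p (\<lambda>w. 1/2 * (r * (e w)\<^sup>2 + (e w) ^ 4 / r))"
      proof (rule integral_mono)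
        fix w
        have "2 * r * \<bar>e w\<bar> \<le> r\<^sup>2 + (e w)\<^sup>2"
          using zero_le_power2[of "r - \<bar>e w\<bar>"] by (simp add: power2_eq_square algebra_simps)
        then have "(e w)\<^sup>2 * (2 * r * \<bar>e w\<bar>) \<le> (e w)\<^sup>2 * (r\<^sup>2 + (e w)\<^sup>2)" by (intro mult_left_mono) auto
        then have "r * (2 * \<bar>e w\<bar> ^ 3) \<le> r * (r * (e w)\<^sup>2 + (e w) ^ 4 / r)"
          using r by (simp add: power2_eq_square power3_eq_cube algebra_simps eval_nat_numeral rr)
        then show "\<bar>(e w) ^ 3\<bar> \<le> 1/2 * (r * (e w)\<^sup>2 + (e w) ^ 4 / r)" using r by (simp add: power_abs)
      qed (use i2 i3 i4 in auto)
      also have "\<dots> = 1/2 * (r * M2 + M4 / r)" unfolding M2_def M4_def using i2 i4 by simp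
      also have "M4 / r \<le> C0 * Z\<^sup>2 / r" using M4 r by (intro divide_right_mono) auto
      also have "C0 * Z\<^sup>2 / r = C0 * Z * r" using r by (simp add: power2_eq_square field_simps flip: r(2))
      also have "r * M2 \<le> r * (C0 * Z)" using M2 r by (intro mult_left_mono) auto
      finally show ?thesis by (simp add: algebra_simps)
    qed
    have E1: "M2 + n * M1 = 0"
    proof -
      have "measure_pmf.expectation ?p s = t"
        by (rule nn_integral_eq_imp_expectation)
           (use exc_first_moment[OF z] s0 supp in \<open>auto simp: s_def t_def Z_def\<close>)
      moreover have "measure_pmf.expectation ?p s = M2 + n * M1 + t"
        unfolding M2_def M1_def using i1 i2 by (simp add: se[abs_def])
      ultimately show ?thesis by simp
    qed
    \<comment> \<open>The second identity after elimination of the mean through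
      \<open>M1 = - M2 / n\<close>. Only the summand \<open>t * M1\<close>, which carries no factor
      \<open>n\<close>, leaves a quotient behind.\<close>
    have E2: "3 * M4 + 6 * n * M3 + 3 * n\<^sup>2 * M2 - 4 * M3 - 4 * (3 * Z + 2) * M2 + 4 * (Z + 1) * M2 + 4 * t * M2 / n
        = 4 * (2 * Z + 1) * t"
    proof -
      have a: "measure_pmf.expectation ?p (\<lambda>w. 3 * (s w)\<^sup>2 - 4 * real w * s w + 2 * s w) = 3 * t\<^sup>2 + 4 * Z * t + 2 * t"
      proof (rule nn_integral_eq_imp_expectation)
        show "(\<integral>\<^sup>+w. ennreal (3 * (s w)\<^sup>2 - 4 * real w * s w + 2 * s w) \<partial>?p) = ennreal (3 * t\<^sup>2 + 4 * Z * t + 2 * t)"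
          using exc_second_moment[OF z] unfolding s_def t_def Z_def Let_def by simp
        show "0 \<le> 3 * t\<^sup>2 + 4 * Z * t + 2 * t" using Z1 by (simp add: t_def)
        fix w assume "w \<in> set_pmf ?p"
        then have w: "w \<ge> 1" by (rule supp)
        have "s w * ((3 * real w - 1) * (real w - 2)) \<ge> 0"
        proof (cases "w = 1")
          case False
          then show ?thesis using w s0[OF w] by (intro mult_nonneg_nonneg) auto
        qed (simp add: s_def)
        moreover have "s w * ((3 * real w - 1) * (real w - 2)) = 3 * (s w)\<^sup>2 - 4 * real w * s w + 2 * s w"
          unfolding s_def by algebra
        ultimately show "0 \<le> 3 * (s w)\<^sup>2 - 4 * real w * s w + 2 * s w" by simp
      qed
      have rw: "real w = e w + Z + 1" for w by (simp add: e_def Z_def)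
      have b: "3 * (s w)\<^sup>2 - 4 * real w * s w + 2 * s w =
        3 * (e w) ^ 4 + (6 * n - 4) * (e w) ^ 3 + (3 * n\<^sup>2 + 6 * t - 4 * (n + Z + 1) + 2) * (e w)\<^sup>2
        + (6 * n * t - 4 * (t + n * (Z + 1)) + 2 * n) * e w + (3 * t\<^sup>2 - 4 * (Z + 1) * t + 2 * t)" for w
        unfolding se rw by algebra
      have c: "3 * M4 + (6 * n - 4) * M3 + (3 * n\<^sup>2 + 6 * t - 4 * (n + Z + 1) + 2) * M2
        + (6 * n * t - 4 * (t + n * (Z + 1)) + 2 * n) * M1 + (3 * t\<^sup>2 - 4 * (Z + 1) * t + 2 * t)
        = 3 * t\<^sup>2 + 4 * Z * t + 2 * t"
        using a unfolding b M1_def M2_def M3_def M4_def using i1 i2 i3 i4 by simp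
      have n0: "n > 0" using Z1 by (simp add: n_def)
      have M1: "M1 = - M2 / n" using E1 n0 by (simp add: field_simps)
      have "t * M1 = - (t * M2 / n)" by (simp add: M1)
      moreover have "n * M1 = - M2" using E1 by simp
      moreover have "n * t * M1 = - t * M2" using \<open>n * M1 = - M2\<close> by algebra
      moreover have "n * (Z + 1) * M1 = - (Z + 1) * M2" using \<open>n * M1 = - M2\<close> by algebra
      ultimately have "(6 * n * t - 4 * (t + n * (Z + 1)) + 2 * n) * M1 = - 6 * t * M2 + 4 * (t * M2 / n) + 4 * (Z + 1) * M2 - 2 * M2"
        by (simp add: algebra_simps)
      with c have "3 * M4 + (6 * n - 4) * M3 + (3 * n\<^sup>2 + 6 * t - 4 * (n + Z + 1) + 2) * M2
        - 6 * t * M2 + 4 * (t * M2 / n) + 4 * (Z + 1) * M2 - 2 * M2 = 4 * (2 * Z + 1) * t" by (simp add: algebra_simps)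
      moreover have "4 * (n + Z + 1) = 4 * (3 * Z + 2)" by (simp add: n_def)
      ultimately show ?thesis by (simp add: algebra_simps)
    qed
    have n: "n \<ge> 2 * Z" "n \<le> 3 * Z" "n \<ge> 3" using Z1 by (auto simp: n_def)
    \<comment> \<open>The leading balance in \<open>E2\<close> is
      \<open>3 * n\<^sup>2 * M2 = 2 * n\<^sup>2 * Z\<close>; this is where 2/3 comes from. All other
      terms are bounded by multiples of \<open>Z\<^sup>2 * r\<close>, smaller by a factor of order
      \<open>r\<close>.\<close>
    have A: "\<bar>M2 - 2/3 * Z\<bar> \<le> 100 * C0 * r"
    proof -
      have tn: "0 \<le> t / n" "t / n \<le> Z"
        using Z1 by (auto simp: t_def n_def field_simps)
      have rZ: "1 \<le> r" "Z \<le> Z * r" "Z\<^sup>2 \<le> Z\<^sup>2 * r"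
        using r Z1 by (auto intro: mult_left_mono simp: mult_le_cancel_left1)
      have b4: "\<bar>3 * M4\<bar> \<le> 3 * C0 * (Z\<^sup>2 * r)"
      proof -
        have "C0 * Z\<^sup>2 \<le> C0 * (Z\<^sup>2 * r)" using rZ(3) C0 by (intro mult_left_mono) auto
        then have "M4 \<le> C0 * (Z\<^sup>2 * r)" using M4 by linarith
        then show ?thesis using M4(1) by (simp add: mult.assoc)
      qed
      have b3: "\<bar>(6 * n - 4) * M3\<bar> \<le> 18 * C0 * (Z\<^sup>2 * r)"
      proof -
        have "\<bar>6 * n - 4\<bar> * \<bar>M3\<bar> \<le> (18 * Z) * (C0 * Z * r)"
          using M3 n Z1 by (intro mult_mono) auto
        then show ?thesis by (simp add: abs_mult power2_eq_square mult_ac)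
      qed
      have b2: "\<bar>(- 8 * Z - 4 + 4 * (t / n)) * M2\<bar> \<le> 16 * C0 * (Z\<^sup>2 * r)"
      proof -
        have "\<bar>- 8 * Z - 4 + 4 * (t / n)\<bar> * \<bar>M2\<bar> \<le> (16 * Z) * (C0 * Z)"
          using M2 tn Z1 by (intro mult_mono) auto
        also have "\<dots> \<le> 16 * C0 * (Z\<^sup>2 * r)" using mult_left_mono[OF rZ(3), of "16 * C0"] C0
          by (simp add: power2_eq_square mult_ac)
        finally show ?thesis by (simp add: abs_mult)
      qed
      have eq: "3 * n\<^sup>2 * (M2 - 2/3 * Z) = 2 * n * Z - 3 * M4 - (6 * n - 4) * M3 - (- 8 * Z - 4 + 4 * (t / n)) * M2"
      proof -
        have "4 * (2 * Z + 1) * t = 2 * n\<^sup>2 * Z + 2 * n * Z"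
          unfolding n_def t_def by (simp add: power2_eq_square algebra_simps)
        with E2 show ?thesis by (simp add: algebra_simps)
      qed
      have bn: "\<bar>2 * n * Z\<bar> \<le> 6 * C0 * (Z\<^sup>2 * r)"
      proof -
        have "\<bar>2 * n * Z\<bar> \<le> 6 * Z\<^sup>2"
          using n Z1 mult_right_mono[OF n(2), of Z] by (simp add: power2_eq_square abs_mult)
        also have "\<dots> \<le> 6 * (Z\<^sup>2 * r)" using rZ by simp
        also have "\<dots> \<le> C0 * (6 * (Z\<^sup>2 * r))" using C0 r Z1 by (intro mult_le_cancel_right1[THEN iffD2]) (auto simp: mult_less_0_iff)
        finally show ?thesis by (simp add: mult_ac)
      qed
      have "\<bar>3 * n\<^sup>2 * (M2 - 2/3 * Z)\<bar> \<le> 43 * C0 * (Z\<^sup>2 * r)"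
        unfolding eq using b4 b3 b2 bn by linarith
      moreover have "12 * Z\<^sup>2 \<le> 3 * n\<^sup>2" using power_mono[OF n(1), of 2] Z1 by (simp add: power_mult_distrib)
      then have "12 * Z\<^sup>2 * \<bar>M2 - 2/3 * Z\<bar> \<le> 3 * n\<^sup>2 * \<bar>M2 - 2/3 * Z\<bar>" by (intro mult_right_mono) auto
      ultimately have "Z\<^sup>2 * (12 * \<bar>M2 - 2/3 * Z\<bar>) \<le> Z\<^sup>2 * (43 * C0 * r)"
        by (simp add: abs_mult mult_ac)
      then have "12 * \<bar>M2 - 2/3 * Z\<bar> \<le> 43 * C0 * r" using Z1 by simp
      moreover have "C0 * r \<ge> 0" using C0 r by simp
      ultimately show ?thesis by (simp add: mult.assoc)
    qed
    \<comment> \<open>By \<open>E1\<close> the mean is \<open>- M2 / n\<close> with \<open>n\<close>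
      close to \<open>2 * Z\<close>, hence close to \<open>- 1/3\<close>; the error of
      \<open>M2\<close> is divided by \<open>n\<close>.\<close>
    have B: "\<bar>M1 + 1/3\<bar> \<le> 200 * C0 / r"
    proof -
      have "n * (M1 + 1/3) = - (M2 - 2/3 * Z) + 1/3"
        using E1 by (simp add: n_def algebra_simps)
      moreover have "1 \<le> C0 * r" using C0 r mult_mono[of 1 C0 1 r] by simp
      ultimately have "\<bar>n * (M1 + 1/3)\<bar> \<le> 101 * (C0 * r)" using A by linarith
      moreover have "(2 * Z) * \<bar>M1 + 1/3\<bar> \<le> n * \<bar>M1 + 1/3\<bar>" using n by (intro mult_right_mono) auto
      ultimately have "(2 * Z) * \<bar>M1 + 1/3\<bar> \<le> 101 * (C0 * r)" using n by (simp add: abs_mult)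
      then have "r * (2 * (r * \<bar>M1 + 1/3\<bar>)) \<le> r * (101 * C0)" by (simp add: mult_ac flip: r(2))
      then have "2 * (r * \<bar>M1 + 1/3\<bar>) \<le> 101 * C0" using r by simp
      then have "\<bar>M1 + 1/3\<bar> * r \<le> 200 * C0" using C0 by (simp add: mult_ac)
      then show ?thesis using r by (simp add: pos_le_divide_eq)
    qed
    have "M4 \<le> C * Z\<^sup>2"
    proof -
      have "C0 * Z\<^sup>2 \<le> C * Z\<^sup>2" using C0 by (intro mult_right_mono) (auto simp: C_def)
      then show ?thesis using M4(2) by linarith
    qed
    moreover have "\<bar>M2 - 2/3 * Z\<bar> \<le> C * sqrt Z"
      using A C0 r mult_nonneg_nonneg[of C0 r] by (simp add: C_def r_def)
    moreover have "\<bar>M1 + 1/3\<bar> \<le> C / sqrt Z"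
      using B divide_right_mono[of "200 * C0" C r] C0 r by (simp add: C_def r_def)
    ultimately show ?thesis
      using ik unfolding M1_def M2_def M4_def e_def Z_def by simp
  qed
  show thesis
  proof (rule that[of C])
    show "C \<ge> 1" using C0 by (simp add: C_def)
  qed (use key in auto)
qed

section \<open>The kernel of the embedded process\<close>

text \<open>The noise used on the axis is independent of the crossing, hence the product
  law.\<close>

definition urn_kernel :: "int pmf \<Rightarrow> nat \<Rightarrow> nat pmf" where
  "urn_kernel K z = map_pmf (\<lambda>(w, j). nat (max 1 (int w - j))) (pair_pmf (exc_pmf z 1) K)"

lemma abs_diff_power4_le: "(a + b) ^ 4 \<le> 8 * a ^ 4 + 8 * b ^ 4" for a b :: real
proof -
  have "(a + b)\<^sup>2 \<le> 2 * a\<^sup>2 + 2 * b\<^sup>2"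
    using zero_le_power2[of "a - b"] by (simp add: power2_eq_square algebra_simps)
  then have "((a + b)\<^sup>2)\<^sup>2 \<le> (2 * a\<^sup>2 + 2 * b\<^sup>2)\<^sup>2" by (intro power_mono) auto
  also have "\<dots> \<le> 8 * a ^ 4 + 8 * b ^ 4"
    using zero_le_power2[of "a\<^sup>2 - b\<^sup>2"] by (simp add: power2_eq_square algebra_simps eval_nat_numeral)
  finally show ?thesis by simp
qed

lemma expectation_pair_fst:
  "measure_pmf.expectation (pair_pmf p q) (\<lambda>x. f (fst x)) = measure_pmf.expectation p f" for f :: "'a \<Rightarrow> real"
  using integral_map_pmf[of fst "pair_pmf p q" f] by (simp add: map_fst_pair_pmf)

lemma expectation_pair_snd:
  "measure_pmf.expectation (pair_pmf p q) (\<lambda>x. f (snd x)) = measure_pmf.expectation q f" for f :: "'a \<Rightarrow> real"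
  using integral_map_pmf[of snd "pair_pmf p q" f] by (simp add: map_snd_pair_pmf)

lemma integrable_pair_fst:
  "integrable (measure_pmf p) f \<Longrightarrow> integrable (measure_pmf (pair_pmf p q)) (\<lambda>x. f (fst x))" for f :: "'a \<Rightarrow> real"
  by (subst integrable_map_pmf_eq[symmetric]) (simp add: map_fst_pair_pmf)

lemma integrable_pair_snd:
  "integrable (measure_pmf q) f \<Longrightarrow> integrable (measure_pmf (pair_pmf p q)) (\<lambda>x. f (snd x))" for f :: "'a \<Rightarrow> real"
  by (subst integrable_map_pmf_eq[symmetric]) (simp add: map_snd_pair_pmf)

lemma exp_moment_imp_integrable_power:
  assumes l: "l > 0" and i: "integrable (measure_pmf K) (\<lambda>j. exp (l * \<bar>real_of_int j\<bar>))"
  shows "integrable (measure_pmf K) (\<lambda>j. \<bar>real_of_int j\<bar> ^ n)"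
proof (rule integrable_pmf_dominated[of _ "\<lambda>j. fact n / l ^ n * exp (l * \<bar>real_of_int j\<bar>)"])
  fix j
  have "(l * \<bar>real_of_int j\<bar>) ^ n / fact n \<le> exp (l * \<bar>real_of_int j\<bar>)"
  proof -
    define x where "x = l * \<bar>real_of_int j\<bar>"
    have x: "x \<ge> 0" using l by (simp add: x_def)
    have "(\<lambda>i. x ^ i / fact i) sums exp x" using exp_converges[of x] by (simp add: field_simps)
    then have "(\<Sum>i\<in>{n}. x ^ i / fact i) \<le> exp x"
      using x by (metis (no_types, lifting) sum_le_suminf sums_iff finite.emptyI finite.insertI divide_nonneg_nonneg fact_ge_zero zero_le_power)
    then show ?thesis by (simp add: x_def)
  qed
  then show "\<bar>\<bar>real_of_int j\<bar> ^ n\<bar> \<le> fact n / l ^ n * exp (l * \<bar>real_of_int j\<bar>)"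
    using l by (simp add: power_mult_distrib field_simps)
qed (use i in auto)

text \<open>The increment is the excess plus \<open>1 - \<kappa>\<close>, up to the correction
  \<open>\<rho>\<close> for the truncation at 1. This correction is nonzero only if the noise
  reaches the exit distance, and then \<open>Z \<le> \<bar>\<kappa>\<bar> + \<bar>e\<bar>\<close>.
  Multiplying by \<open>(\<bar>\<kappa>\<bar> + \<bar>e\<bar>)\<^sup>2 / Z\<^sup>2 \<ge> 1\<close>
  shows that its mean is of order \<open>1 / Z\<close>.\<close>

lemma urn_kernel_moments:
  assumes ik: "\<And>n. n \<le> 4 \<Longrightarrow> integrable (measure_pmf K) (\<lambda>j. \<bar>real_of_int j\<bar> ^ n)"
  defines "m \<equiv> 2/3 - measure_pmf.expectation K real_of_int"
  obtains C where "C \<ge> 1"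
    "\<And>z. z \<ge> 1 \<Longrightarrow> integrable (measure_pmf (urn_kernel K z)) (\<lambda>w. (real w - real z) ^ 4)"
    "\<And>z. z \<ge> 1 \<Longrightarrow> measure_pmf.expectation (urn_kernel K z) (\<lambda>w. (real w - real z) ^ 4) \<le> C * (real z)\<^sup>2"
    "\<And>z. z \<ge> 1 \<Longrightarrow> \<bar>measure_pmf.expectation (urn_kernel K z) (\<lambda>w. (real w - real z)\<^sup>2) - 2/3 * real z\<bar> \<le> C * sqrt (real z)"
    "\<And>z. z \<ge> 1 \<Longrightarrow> \<bar>measure_pmf.expectation (urn_kernel K z) (\<lambda>w. real w - real z) - m\<bar> \<le> C / sqrt (real z)"
proof -
  obtain C0 where C0: "C0 \<ge> 1"
    and E: "\<And>z n. z \<ge> 1 \<Longrightarrow> n \<le> 4 \<Longrightarrow> integrable (measure_pmf (exc_pmf z 1)) (\<lambda>w. (real w - real z - 1) ^ n)"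
    and E4: "\<And>z. z \<ge> 1 \<Longrightarrow> measure_pmf.expectation (exc_pmf z 1) (\<lambda>w. (real w - real z - 1) ^ 4) \<le> C0 * (real z)\<^sup>2"
    and E2: "\<And>z. z \<ge> 1 \<Longrightarrow> \<bar>measure_pmf.expectation (exc_pmf z 1) (\<lambda>w. (real w - real z - 1)\<^sup>2) - 2/3 * real z\<bar> \<le> C0 * sqrt (real z)"
    and E1: "\<And>z. z \<ge> 1 \<Longrightarrow> \<bar>measure_pmf.expectation (exc_pmf z 1) (\<lambda>w. real w - real z - 1) + 1/3\<bar> \<le> C0 / sqrt (real z)"
    using exc_excess_moments by blast
  define k2 where "k2 = measure_pmf.expectation K (\<lambda>j. \<bar>real_of_int j\<bar> ^ 2)"
  define k4 where "k4 = measure_pmf.expectation K (\<lambda>j. \<bar>real_of_int j\<bar> ^ 4)"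
  have k: "k2 \<ge> 0" "k4 \<ge> 0" by (auto simp: k2_def k4_def)
  define C where "C = 1000 * (C0 + k2 + k4 + 1)"
  have key: "integrable (measure_pmf (urn_kernel K z)) (\<lambda>w. (real w - real z) ^ 4) \<and>
    measure_pmf.expectation (urn_kernel K z) (\<lambda>w. (real w - real z) ^ 4) \<le> C * (real z)\<^sup>2 \<and>
    \<bar>measure_pmf.expectation (urn_kernel K z) (\<lambda>w. (real w - real z)\<^sup>2) - 2/3 * real z\<bar> \<le> C * sqrt (real z) \<and>
    \<bar>measure_pmf.expectation (urn_kernel K z) (\<lambda>w. real w - real z) - m\<bar> \<le> C / sqrt (real z)"
    if z: "z \<ge> 1" for z
  proof -
    define P where "P = pair_pmf (exc_pmf z 1) K"
    define Z where "Z = real z"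
    define r where "r = sqrt Z"
    have Z1: "Z \<ge> 1" using z by (simp add: Z_def)
    have r: "r \<ge> 1" "r * r = Z" using Z1 by (auto simp: r_def)
    define e where "e = (\<lambda>x::nat \<times> int. real (fst x) - Z - 1)"
    define \<kappa> where "\<kappa> = (\<lambda>x::nat \<times> int. real_of_int (snd x))"
    define \<delta> where "\<delta> = (\<lambda>x::nat \<times> int. real (nat (max 1 (int (fst x) - snd x))) - Z)"
    define \<rho> where "\<rho> = (\<lambda>x. \<delta> x - (e x + 1 - \<kappa> x))"
    have supp: "fst x \<ge> 1" if "x \<in> set_pmf P" for x
      using that set_exc_pmf[of z 1] by (auto simp: P_def set_pair_pmf)
    have ie: "integrable P (\<lambda>x. (e x) ^ n)" if "n \<le> 4" for n
      using integrable_pair_fst[OF E[OF z that], of K] by (simp add: P_def e_def Z_def)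
    have ikap: "integrable P (\<lambda>x. \<bar>\<kappa> x\<bar> ^ n)" if "n \<le> 4" for n
      using integrable_pair_snd[OF ik[OF that]] by (simp add: P_def \<kappa>_def)
    have e1: "\<bar>measure_pmf.expectation P e + 1/3\<bar> \<le> C0 / r"
      using E1[OF z] expectation_pair_fst[of "exc_pmf z 1" K "\<lambda>w. real w - real z - 1"]
      by (simp add: P_def e_def[abs_def] Z_def r_def)
    have e2: "\<bar>measure_pmf.expectation P (\<lambda>x. (e x)\<^sup>2) - 2/3 * Z\<bar> \<le> C0 * r"
      using E2[OF z] expectation_pair_fst[of "exc_pmf z 1" K "\<lambda>w. (real w - real z - 1)\<^sup>2"]
      by (simp add: P_def e_def[abs_def] Z_def r_def)
    have e4: "measure_pmf.expectation P (\<lambda>x. (e x) ^ 4) \<le> C0 * Z\<^sup>2"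
      using E4[OF z] expectation_pair_fst[of "exc_pmf z 1" K "\<lambda>w. (real w - real z - 1) ^ 4"]
      by (simp add: P_def e_def[abs_def] Z_def)
    have kap1: "measure_pmf.expectation P \<kappa> = 2/3 - m"
      using expectation_pair_snd[of "exc_pmf z 1" K real_of_int] by (simp add: P_def \<kappa>_def[abs_def] m_def)
    have kap2: "measure_pmf.expectation P (\<lambda>x. \<bar>\<kappa> x\<bar> ^ 2) = k2"
      using expectation_pair_snd[of "exc_pmf z 1" K "\<lambda>j. \<bar>real_of_int j\<bar> ^ 2"] by (simp add: P_def \<kappa>_def[abs_def] k2_def)
    have kap4: "measure_pmf.expectation P (\<lambda>x. \<bar>\<kappa> x\<bar> ^ 4) = k4"
      using expectation_pair_snd[of "exc_pmf z 1" K "\<lambda>j. \<bar>real_of_int j\<bar> ^ 4"] by (simp add: P_def \<kappa>_def[abs_def] k4_def)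
    note ie1 = ie[of 1, simplified] and ie2 = ie[of 2, simplified] and ie4 = ie[of 4, simplified]
    have ik1: "integrable P \<kappa>" using ikap[of 1] by (simp add: integrable_abs_iff)
    have ik2: "integrable P (\<lambda>x. \<bar>\<kappa> x\<bar> ^ 2)" and ik4: "integrable P (\<lambda>x. \<bar>\<kappa> x\<bar> ^ 4)"
      by (rule ikap; simp)+
    have \<delta>: "\<delta> x = e x + 1 - \<kappa> x + \<rho> x" for x by (simp add: \<rho>_def)
    have rho: "0 \<le> \<rho> x" "\<rho> x \<le> \<bar>\<kappa> x\<bar>" "\<bar>\<rho> x - \<kappa> x\<bar> \<le> \<bar>\<kappa> x\<bar>"
        "\<rho> x \<le> ((\<bar>\<kappa> x\<bar> ^ 2 + \<bar>\<kappa> x\<bar> ^ 4) + (Z * \<bar>\<kappa> x\<bar> ^ 2 + (e x) ^ 4 / Z)) / Z\<^sup>2"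
      if "fst x \<ge> 1" for x
    proof -
      have rx: "\<rho> x = max 0 (1 + \<kappa> x - real (fst x))"
        unfolding \<rho>_def \<delta>_def e_def \<kappa>_def by (auto simp: max_def)
      show rh: "0 \<le> \<rho> x" "\<rho> x \<le> \<bar>\<kappa> x\<bar>" "\<bar>\<rho> x - \<kappa> x\<bar> \<le> \<bar>\<kappa> x\<bar>"
        unfolding rx using that by (auto simp: max_def)
      define a where "a = \<bar>\<kappa> x\<bar>"
      define b where "b = \<bar>e x\<bar>"
      have ab: "a \<ge> 0" "b \<ge> 0" by (auto simp: a_def b_def)
      have "\<rho> x * Z\<^sup>2 \<le> (a ^ 2 + a ^ 4) + (Z * a ^ 2 + b ^ 4 / Z)"
      proof (cases "\<rho> x = 0")
        case False
        then have k: "real (fst x) < 1 + \<kappa> x" "0 < \<rho> x"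
          unfolding rx using that by (auto simp: max_def split: if_splits)
        then have "Z \<le> a + b" by (auto simp: e_def a_def b_def)
        then have "Z\<^sup>2 \<le> (a + b)\<^sup>2" using Z1 by (intro power_mono) auto
        also have "\<dots> \<le> 2 * a\<^sup>2 + 2 * b\<^sup>2"
          using zero_le_power2[of "a - b"] by (simp add: power2_eq_square algebra_simps)
        finally have "\<rho> x * Z\<^sup>2 \<le> a * (2 * a\<^sup>2 + 2 * b\<^sup>2)"
          using rh ab by (intro mult_mono) (auto simp: a_def)
        moreover have "2 * a ^ 3 \<le> a ^ 2 + a ^ 4"
          using zero_le_power2[of "a - a\<^sup>2"] by (simp add: power2_eq_square algebra_simps eval_nat_numeral)
        moreover have "2 * (a * b\<^sup>2) \<le> Z * a ^ 2 + b ^ 4 / Z"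
        proof -
          have "Z * (2 * (a * b\<^sup>2)) \<le> Z * (Z * a ^ 2 + b ^ 4 / Z)"
            using zero_le_power2[of "Z * a - b\<^sup>2"] Z1 by (simp add: power2_eq_square algebra_simps eval_nat_numeral)
          then show ?thesis using Z1 by simp
        qed
        moreover have "a * (2 * a\<^sup>2 + 2 * b\<^sup>2) = 2 * a ^ 3 + 2 * (a * b\<^sup>2)" by (simp add: algebra_simps eval_nat_numeral)
        ultimately show ?thesis by linarith
      qed (use ab Z1 in auto)
      then show "\<rho> x \<le> ((\<bar>\<kappa> x\<bar> ^ 2 + \<bar>\<kappa> x\<bar> ^ 4) + (Z * \<bar>\<kappa> x\<bar> ^ 2 + (e x) ^ 4 / Z)) / Z\<^sup>2"
        using Z1 by (simp add: pos_le_divide_eq a_def b_def)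
    qed
    have irho: "integrable P \<rho>"
      by (rule integrable_pmf_dominated[of _ "\<lambda>x. \<bar>\<kappa> x\<bar>"]) (use rho supp ik1 in auto)
    have Erho: "0 \<le> measure_pmf.expectation P \<rho>" "measure_pmf.expectation P \<rho> \<le> (2 * k2 + k4 + C0) / r"
    proof -
      show "0 \<le> measure_pmf.expectation P \<rho>"
        by (rule integral_nonneg_AE) (use rho supp in \<open>auto simp: AE_measure_pmf_iff\<close>)
      have "measure_pmf.expectation P \<rho> \<le> measure_pmf.expectation P
          (\<lambda>x. ((\<bar>\<kappa> x\<bar> ^ 2 + \<bar>\<kappa> x\<bar> ^ 4) + (Z * \<bar>\<kappa> x\<bar> ^ 2 + (e x) ^ 4 / Z)) / Z\<^sup>2)"
        by (rule integral_mono_AE) (use irho ik2 ik4 ie4 rho supp in \<open>auto simp: AE_measure_pmf_iff\<close>)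
      also have "\<dots> = ((k2 + k4) + (Z * k2 + measure_pmf.expectation P (\<lambda>x. (e x) ^ 4) / Z)) / Z\<^sup>2"
        using ik2 ik4 ie4 kap2 kap4 by simp
      also have "\<dots> \<le> ((k2 + k4) * Z + (Z * k2 + C0 * Z\<^sup>2 / Z)) / Z\<^sup>2"
        using e4 Z1 k mult_left_mono[of 1 Z "k2 + k4"] by (intro divide_right_mono add_mono) auto
      also have "\<dots> = (2 * k2 + k4 + C0) / Z"
        using Z1 by (simp add: power2_eq_square field_simps)
      also have "\<dots> \<le> (2 * k2 + k4 + C0) / r"
      proof -
        have "r \<le> Z" using r mult_left_mono[of 1 r r] by simp
        then show ?thesis using k C0 r by (intro divide_left_mono) auto
      qed
      finally show "measure_pmf.expectation P \<rho> \<le> (2 * k2 + k4 + C0) / r" .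
    qed
    \<comment> \<open>All of the increment except the excess. Its second and fourth moments are
      bounded in \<open>z\<close>, so the variance is disturbed chiefly by the cross term with the
      excess, which is of order \<open>r\<close>.\<close>
    define g where "g = (\<lambda>x. 1 - \<kappa> x + \<rho> x)"
    have dg: "\<delta> x = e x + g x" for x by (simp add: \<delta> g_def)
    have gb: "\<bar>g x\<bar> \<le> 1 + \<bar>\<kappa> x\<bar>" if "fst x \<ge> 1" for x using rho[OF that] by (auto simp: g_def)
    have g2: "(g x)\<^sup>2 \<le> 2 + 2 * \<bar>\<kappa> x\<bar> ^ 2" and g4: "(g x) ^ 4 \<le> 8 + 8 * \<bar>\<kappa> x\<bar> ^ 4" if "fst x \<ge> 1" for x
    proof -
      have "\<bar>g x\<bar> ^ 2 \<le> (1 + \<bar>\<kappa> x\<bar>) ^ 2" "\<bar>g x\<bar> ^ 4 \<le> (1 + \<bar>\<kappa> x\<bar>) ^ 4"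
        by (rule power_mono[OF gb[OF that]], simp)+
      moreover have "(1 + \<bar>\<kappa> x\<bar>) ^ 2 \<le> 2 + 2 * \<bar>\<kappa> x\<bar> ^ 2"
        using zero_le_power2[of "1 - \<bar>\<kappa> x\<bar>"] by (simp add: power2_eq_square algebra_simps)
      moreover have "(1 + \<bar>\<kappa> x\<bar>) ^ 4 \<le> 8 + 8 * \<bar>\<kappa> x\<bar> ^ 4" using abs_diff_power4_le[of 1 "\<bar>\<kappa> x\<bar>"] by simp
      ultimately show "(g x)\<^sup>2 \<le> 2 + 2 * \<bar>\<kappa> x\<bar> ^ 2" "(g x) ^ 4 \<le> 8 + 8 * \<bar>\<kappa> x\<bar> ^ 4" by simp_all
    qed
    have id4: "integrable P (\<lambda>x. (\<delta> x) ^ 4)"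
      and Ed4: "measure_pmf.expectation P (\<lambda>x. (\<delta> x) ^ 4) \<le> C * Z\<^sup>2"
    proof -
      have b: "(\<delta> x) ^ 4 \<le> 8 * (e x) ^ 4 + 8 * (8 + 8 * \<bar>\<kappa> x\<bar> ^ 4)" if "fst x \<ge> 1" for x
        using abs_diff_power4_le[of "e x" "g x"] g4[OF that] unfolding dg by simp
      show i: "integrable P (\<lambda>x. (\<delta> x) ^ 4)"
        by (rule integrable_pmf_dominated[of _ "\<lambda>x. 8 * (e x) ^ 4 + 8 * (8 + 8 * \<bar>\<kappa> x\<bar> ^ 4)"])
           (use b supp ie4 ik4 in auto)
      have "measure_pmf.expectation P (\<lambda>x. (\<delta> x) ^ 4)
        \<le> measure_pmf.expectation P (\<lambda>x. 8 * (e x) ^ 4 + 8 * (8 + 8 * \<bar>\<kappa> x\<bar> ^ 4))"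
        by (rule integral_mono_AE) (use i ie4 ik4 b supp in \<open>auto simp: AE_measure_pmf_iff\<close>)
      also have "\<dots> = 8 * measure_pmf.expectation P (\<lambda>x. (e x) ^ 4) + 8 * (8 + 8 * k4)"
        using ie4 ik4 kap4 by simp
      also have "\<dots> \<le> 8 * (C0 * Z\<^sup>2) + 8 * ((8 + 8 * k4) * Z\<^sup>2)"
      proof -
        have "(8 + 8 * k4) * 1 \<le> (8 + 8 * k4) * Z\<^sup>2" using Z1 k by (intro mult_left_mono) auto
        then show ?thesis using e4 by linarith
      qed
      also have "\<dots> \<le> C * Z\<^sup>2"
        using mult_right_mono[of "8 * C0 + 8 * (8 + 8 * k4)" C "Z\<^sup>2"] k C0 by (simp add: C_def algebra_simps)
      finally show "measure_pmf.expectation P (\<lambda>x. (\<delta> x) ^ 4) \<le> C * Z\<^sup>2" .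
    qed
    have id1: "integrable P \<delta>" unfolding \<delta>[abs_def] using ie1 ik1 irho by simp
    have Ed1: "\<bar>measure_pmf.expectation P \<delta> - m\<bar> \<le> C / r"
    proof -
      have "measure_pmf.expectation P \<delta> = measure_pmf.expectation P e + 1 - (2/3 - m) + measure_pmf.expectation P \<rho>"
        unfolding \<delta>[abs_def] using ie1 ik1 irho kap1 by simp
      then have "\<bar>measure_pmf.expectation P \<delta> - m\<bar> \<le> C0 / r + (2 * k2 + k4 + C0) / r"
        using e1 Erho by linarith
      also have "\<dots> = (C0 + (2 * k2 + k4 + C0)) / r" by (simp add: add_divide_distrib)
      also have "\<dots> \<le> C / r" using k C0 r by (intro divide_right_mono) (auto simp: C_def)
      finally show ?thesis .
    qed
    have Ed2: "\<bar>measure_pmf.expectation P (\<lambda>x. (\<delta> x)\<^sup>2) - 2/3 * Z\<bar> \<le> C * r"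
    proof -
      have ig: "integrable P g" unfolding g_def using ik1 irho by simp
      have ig2: "integrable P (\<lambda>x. (g x)\<^sup>2)"
        by (rule integrable_pmf_dominated[of _ "\<lambda>x. 2 + 2 * \<bar>\<kappa> x\<bar> ^ 2"]) (use g2 supp ik2 in auto)
      have eg: "\<bar>2 * (e x * g x)\<bar> \<le> (e x)\<^sup>2 / r + r * (g x)\<^sup>2" for x
      proof -
        have "r * (2 * (\<bar>e x\<bar> * \<bar>g x\<bar>)) \<le> r * ((e x)\<^sup>2 / r + r * (g x)\<^sup>2)"
          using zero_le_power2[of "\<bar>e x\<bar> - r * \<bar>g x\<bar>"] r(1) by (simp add: power2_eq_square algebra_simps)
        then show ?thesis using r by (simp add: abs_mult)
      qed
      have ieg: "integrable P (\<lambda>x. 2 * (e x * g x))"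
        by (rule integrable_pmf_dominated[of _ "\<lambda>x. (e x)\<^sup>2 / r + r * (g x)\<^sup>2"]) (use ie2 ig2 eg in auto)
      have Eg2: "0 \<le> measure_pmf.expectation P (\<lambda>x. (g x)\<^sup>2)" "measure_pmf.expectation P (\<lambda>x. (g x)\<^sup>2) \<le> 2 + 2 * k2"
      proof -
        have "measure_pmf.expectation P (\<lambda>x. (g x)\<^sup>2) \<le> measure_pmf.expectation P (\<lambda>x. 2 + 2 * \<bar>\<kappa> x\<bar> ^ 2)"
          by (rule integral_mono_AE) (use ig2 g2 supp ik2 in \<open>auto simp: AE_measure_pmf_iff\<close>)
        then show "measure_pmf.expectation P (\<lambda>x. (g x)\<^sup>2) \<le> 2 + 2 * k2" using ik2 kap2 by simp
      qed simp
      have "\<bar>measure_pmf.expectation P (\<lambda>x. 2 * (e x * g x))\<bar> \<le> measure_pmf.expectation P (\<lambda>x. \<bar>2 * (e x * g x)\<bar>)"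
        by (rule integral_abs_bound)
      also have "\<dots> \<le> measure_pmf.expectation P (\<lambda>x. (e x)\<^sup>2 / r + r * (g x)\<^sup>2)"
        using ieg ie2 ig2 eg by (intro integral_mono) auto
      also have "\<dots> = measure_pmf.expectation P (\<lambda>x. (e x)\<^sup>2) / r + r * measure_pmf.expectation P (\<lambda>x. (g x)\<^sup>2)"
        using ie2 ig2 by simp
      also have "\<dots> \<le> ((1 + C0) * Z) / r + r * (2 + 2 * k2)"
      proof -
        have "C0 * r \<le> C0 * Z" using r C0 mult_left_mono[of 1 r r] by (intro mult_left_mono) auto
        then have "measure_pmf.expectation P (\<lambda>x. (e x)\<^sup>2) \<le> (1 + C0) * Z" using e2 Z1 by (simp add: algebra_simps)
        then show ?thesis using Eg2 r by (intro add_mono divide_right_mono mult_left_mono) auto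
      qed
      also have "\<dots> = (3 + C0 + 2 * k2) * r" using r(1) by (simp add: field_simps flip: r(2))
      finally have cross: "\<bar>measure_pmf.expectation P (\<lambda>x. 2 * (e x * g x))\<bar> \<le> (3 + C0 + 2 * k2) * r" .
      have "(\<delta> x)\<^sup>2 = (e x)\<^sup>2 + 2 * (e x * g x) + (g x)\<^sup>2" for x unfolding dg by algebra
      then have "measure_pmf.expectation P (\<lambda>x. (\<delta> x)\<^sup>2) = measure_pmf.expectation P (\<lambda>x. (e x)\<^sup>2) +
         measure_pmf.expectation P (\<lambda>x. 2 * (e x * g x)) + measure_pmf.expectation P (\<lambda>x. (g x)\<^sup>2)"
        using ie2 ieg ig2 by simp
      then have "\<bar>measure_pmf.expectation P (\<lambda>x. (\<delta> x)\<^sup>2) - 2/3 * Z\<bar> \<le> C0 * r + (3 + C0 + 2 * k2) * r + (2 + 2 * k2)"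
        using cross e2 Eg2 by linarith
      also have "\<dots> \<le> C0 * r + (3 + C0 + 2 * k2) * r + (2 + 2 * k2) * r"
        using r k mult_left_mono[of 1 r "2 + 2 * k2"] by simp
      also have "\<dots> = (C0 + (3 + C0 + 2 * k2) + (2 + 2 * k2)) * r" by (simp add: algebra_simps)
      also have "\<dots> \<le> C * r" using k C0 r by (intro mult_right_mono) (auto simp: C_def)
      finally show ?thesis .
    qed
    have ku: "urn_kernel K z = map_pmf (\<lambda>x. nat (max 1 (int (fst x) - snd x))) P"
      by (simp add: urn_kernel_def P_def case_prod_unfold)
    show ?thesis
      using id4 Ed4 Ed2 Ed1 unfolding ku integral_map_pmf integrable_map_pmf_eq
      by (simp add: \<delta>_def[abs_def] Z_def r_def)
  qed
  show thesis
  proof (rule that[of C])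
    show "C \<ge> 1" using C0 k by (simp add: C_def)
  qed (use key in auto)
qed

section \<open>The embedded process is a Markov chain\<close>

lemma nn_integral_countable_rv:
  fixes X :: "'a \<Rightarrow> 'c::countable" and f :: "'c \<Rightarrow> ennreal"
  assumes X: "X \<in> M \<rightarrow>\<^sub>M count_space UNIV"
  shows "(\<integral>\<^sup>+\<omega>. f (X \<omega>) \<partial>M) = (\<integral>\<^sup>+c. emeasure M {\<omega> \<in> space M. X \<omega> = c} * f c \<partial>count_space UNIV)"
proof -
  have "distr M (count_space UNIV) X = density (count_space UNIV) (\<lambda>c. emeasure M {\<omega> \<in> space M. X \<omega> = c})"
  proof (rule measure_eqI_countable[where A = UNIV])
    fix a
    have "emeasure (distr M (count_space UNIV) X) {a} = emeasure M (X -` {a} \<inter> space M)"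
      using X by (intro emeasure_distr) auto
    also have "X -` {a} \<inter> space M = {\<omega> \<in> space M. X \<omega> = a}" by auto
    finally show "emeasure (distr M (count_space UNIV) X) {a} =
        emeasure (density (count_space UNIV) (\<lambda>c. emeasure M {\<omega> \<in> space M. X \<omega> = c})) {a}"
      by (simp add: emeasure_density nn_integral_count_space_indicator[symmetric])
  qed auto
  then have "(\<integral>\<^sup>+\<omega>. f (X \<omega>) \<partial>M) = (\<integral>\<^sup>+c. f c \<partial>density (count_space UNIV) (\<lambda>c. emeasure M {\<omega> \<in> space M. X \<omega> = c}))"
    using nn_integral_distr[OF X, of f] by simp
  then show ?thesis by (simp add: nn_integral_density)
qed

text \<open>A list rather than a function: lists over a countable type are countable, so every
  functional of the past is measurable.\<close>

definition history :: "(nat \<Rightarrow> 'a \<Rightarrow> 's) \<Rightarrow> nat \<Rightarrow> 'a \<Rightarrow> 's list" where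
  "history S n \<omega> = map (\<lambda>i. S i \<omega>) [0..<Suc n]"

lemma history_nth: "i \<le> n \<Longrightarrow> history S n \<omega> ! i = S i \<omega>"
  unfolding history_def by (subst nth_map) (auto simp del: upt_Suc)

lemma length_history [simp]: "length (history S n \<omega>) = Suc n"
  by (simp add: history_def)

lemma history_eq_iff: "history S n \<omega> = l \<longleftrightarrow> length l = Suc n \<and> (\<forall>i\<le>n. S i \<omega> = l ! i)"
  by (auto simp: list_eq_iff_nth_eq history_nth less_Suc_eq_le)

lemma measurable_history:
  fixes S :: "nat \<Rightarrow> 'a \<Rightarrow> 's::countable"
  assumes [measurable]: "\<And>n. S n \<in> M \<rightarrow>\<^sub>M count_space UNIV"
  shows "history S n \<in> M \<rightarrow>\<^sub>M count_space UNIV"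
proof (rule measurable_count_space_eq2_countable[THEN iffD2], intro conjI ballI)
  fix l :: "'s list"
  have "history S n -` {l} \<inter> space M = (if length l = Suc n then {\<omega> \<in> space M. \<forall>i\<le>n. S i \<omega> = l ! i} else {})"
    unfolding set_eq_iff vimage_singleton_eq Int_iff history_eq_iff by auto
  also have "\<dots> \<in> sets M" by auto
  finally show "history S n -` {l} \<inter> space M \<in> sets M" .
qed auto

text \<open>The cylinder identity in \<open>markov_chain\<close>, summed over all pasts and all next
  states.\<close>

lemma markov_chain_nn_integral:
  fixes S :: "nat \<Rightarrow> 'a \<Rightarrow> 's::countable" and G :: "'s list \<Rightarrow> ennreal"
  assumes mc: "markov_chain M Q s0 S"
  shows "(\<integral>\<^sup>+\<omega>. G (history S n \<omega>) * f (S (Suc n) \<omega>) \<partial>M) =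
         (\<integral>\<^sup>+\<omega>. G (history S n \<omega>) * (\<integral>\<^sup>+s. f s \<partial>Q (S n \<omega>)) \<partial>M)"
proof -
  interpret prob_space M using mc by (simp add: markov_chain_def)
  have S [measurable]: "S n \<in> M \<rightarrow>\<^sub>M count_space UNIV" for n using mc by (simp add: markov_chain_def)
  have H [measurable]: "history S n \<in> M \<rightarrow>\<^sub>M count_space UNIV" by (rule measurable_history) simp
  have pair: "(\<lambda>\<omega>. (history S n \<omega>, S (Suc n) \<omega>)) \<in> M \<rightarrow>\<^sub>M count_space UNIV"
  proof (rule measurable_count_space_eq2_countable[THEN iffD2], intro conjI ballI)
    fix x :: "'s list \<times> 's"
    have "(\<lambda>\<omega>. (history S n \<omega>, S (Suc n) \<omega>)) -` {x} \<inter> space M =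
      {\<omega> \<in> space M. history S n \<omega> = fst x \<and> S (Suc n) \<omega> = snd x}" by auto
    also have "\<dots> \<in> sets M" by measurable
    finally show "(\<lambda>\<omega>. (history S n \<omega>, S (Suc n) \<omega>)) -` {x} \<inter> space M \<in> sets M" .
  qed auto
  have step: "emeasure M {\<omega> \<in> space M. (history S n \<omega>, S (Suc n) \<omega>) = (l, s)} =
      emeasure M {\<omega> \<in> space M. history S n \<omega> = l} * ennreal (pmf (Q (l ! n)) s)" for l s
  proof (cases "length l = Suc n")
    case True
    then have 1: "{\<omega> \<in> space M. (history S n \<omega>, S (Suc n) \<omega>) = (l, s)} =
        {\<omega> \<in> space M. (\<forall>i\<le>n. S i \<omega> = l ! i) \<and> S (Suc n) \<omega> = s}"
      "{\<omega> \<in> space M. history S n \<omega> = l} = {\<omega> \<in> space M. \<forall>i\<le>n. S i \<omega> = l ! i}"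
      unfolding prod.inject history_eq_iff by simp_all
    show ?thesis unfolding 1 using mc
      by (simp add: markov_chain_def emeasure_eq_measure ennreal_mult)
  next
    case False
    then have "{\<omega> \<in> space M. (history S n \<omega>, S (Suc n) \<omega>) = (l, s)} = {}"
      "{\<omega> \<in> space M. history S n \<omega> = l} = {}" unfolding prod.inject history_eq_iff by simp_all
    then show ?thesis by (simp only: emeasure_empty mult_zero_left)
  qed
  have "(\<integral>\<^sup>+\<omega>. G (history S n \<omega>) * f (S (Suc n) \<omega>) \<partial>M) =
      (\<integral>\<^sup>+x. emeasure M {\<omega> \<in> space M. (history S n \<omega>, S (Suc n) \<omega>) = x} * (G (fst x) * f (snd x)) \<partial>count_space UNIV)"
    using nn_integral_countable_rv[OF pair, of "\<lambda>x. G (fst x) * f (snd x)"] by simp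
  also have "\<dots> = (\<integral>\<^sup>+l. \<integral>\<^sup>+s. emeasure M {\<omega> \<in> space M. (history S n \<omega>, S (Suc n) \<omega>) = (l, s)} * (G l * f s)
       \<partial>count_space UNIV \<partial>count_space UNIV)"
    by (subst nn_integral_fst_count_space[symmetric]) simp
  also have "\<dots> = (\<integral>\<^sup>+l. emeasure M {\<omega> \<in> space M. history S n \<omega> = l} * (G l * (\<integral>\<^sup>+s. f s \<partial>Q (l ! n))) \<partial>count_space UNIV)"
    unfolding step nn_integral_measure_pmf
    by (intro nn_integral_cong) (simp add: nn_integral_cmult[symmetric] mult_ac)
  also have "\<dots> = (\<integral>\<^sup>+\<omega>. G (history S n \<omega>) * (\<integral>\<^sup>+s. f s \<partial>Q (history S n \<omega> ! n)) \<partial>M)"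
    by (subst nn_integral_countable_rv[OF H]) simp
  finally show ?thesis by (simp add: history_nth)
qed

text \<open>Events of the past are predicates on whole trajectories, so that they can refer to
  absolute times; this records which prefix they may inspect.\<close>

definition determined_by :: "nat \<Rightarrow> ((nat \<Rightarrow> 's) \<Rightarrow> bool) \<Rightarrow> bool" where
  "determined_by n \<phi> \<longleftrightarrow> (\<forall>h h'. (\<forall>i\<le>n. h i = h' i) \<longrightarrow> \<phi> h = \<phi> h')"

lemma determined_by_history:
  assumes "determined_by n \<phi>"
  shows "\<phi> (\<lambda>i. history S n \<omega> ! i) \<longleftrightarrow> \<phi> (\<lambda>i. S i \<omega>)"
  using assms by (auto simp: determined_by_def history_nth)

text \<open>Every trajectory satisfying \<open>\<phi>\<close> is at \<open>s\<close> at time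
  \<open>n\<close>, so the transition probability is constant on the event and factors out.\<close>

lemma markov_chain_step:
  fixes S :: "nat \<Rightarrow> 'a \<Rightarrow> 's::countable"
  assumes mc: "markov_chain M Q s0 S" and \<phi>: "determined_by n \<phi>" and s: "\<And>h. \<phi> h \<Longrightarrow> h n = s"
  shows "{\<omega> \<in> space M. \<phi> (\<lambda>i. S i \<omega>)} \<in> sets M"
    and "{\<omega> \<in> space M. \<phi> (\<lambda>i. S i \<omega>) \<and> S (Suc n) \<omega> = s'} \<in> sets M"
    and "emeasure M {\<omega> \<in> space M. \<phi> (\<lambda>i. S i \<omega>) \<and> S (Suc n) \<omega> = s'} =
         emeasure M {\<omega> \<in> space M. \<phi> (\<lambda>i. S i \<omega>)} * ennreal (pmf (Q s) s')"
proof -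
  have S [measurable]: "S n \<in> M \<rightarrow>\<^sub>M count_space UNIV" for n using mc by (simp add: markov_chain_def)
  have H [measurable]: "history S n \<in> M \<rightarrow>\<^sub>M count_space UNIV" by (rule measurable_history) simp
  note [simp] = determined_by_history[OF \<phi>]
  have "{\<omega> \<in> space M. \<phi> (\<lambda>i. history S n \<omega> ! i)} \<in> sets M" by measurable
  then show 1: "{\<omega> \<in> space M. \<phi> (\<lambda>i. S i \<omega>)} \<in> sets M" by simp
  have "{\<omega> \<in> space M. \<phi> (\<lambda>i. history S n \<omega> ! i) \<and> S (Suc n) \<omega> = s'} \<in> sets M" by measurable
  then show 2: "{\<omega> \<in> space M. \<phi> (\<lambda>i. S i \<omega>) \<and> S (Suc n) \<omega> = s'} \<in> sets M" by simp
  define G :: "'s list \<Rightarrow> ennreal" where "G = (\<lambda>l. indicator {l. \<phi> (\<lambda>i. l ! i)} l)"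
  have G: "G (history S n \<omega>) = indicator {\<omega> \<in> space M. \<phi> (\<lambda>i. S i \<omega>)} \<omega>" if "\<omega> \<in> space M" for \<omega>
    using that by (simp add: G_def indicator_def)
  have "emeasure M {\<omega> \<in> space M. \<phi> (\<lambda>i. S i \<omega>) \<and> S (Suc n) \<omega> = s'} =
      (\<integral>\<^sup>+\<omega>. G (history S n \<omega>) * indicator {s'} (S (Suc n) \<omega>) \<partial>M)"
    using 2 by (subst nn_integral_indicator[symmetric]) (auto intro!: nn_integral_cong simp: G indicator_def simp del: nn_integral_indicator)
  also have "\<dots> = (\<integral>\<^sup>+\<omega>. G (history S n \<omega>) * (\<integral>\<^sup>+s. indicator {s'} s \<partial>Q (S n \<omega>)) \<partial>M)"
    by (rule markov_chain_nn_integral[OF mc])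
  also have "\<dots> = (\<integral>\<^sup>+\<omega>. indicator {\<omega> \<in> space M. \<phi> (\<lambda>i. S i \<omega>)} \<omega> * ennreal (pmf (Q s) s') \<partial>M)"
  proof (intro nn_integral_cong)
    fix \<omega> assume \<omega>: "\<omega> \<in> space M"
    show "G (history S n \<omega>) * (\<integral>\<^sup>+s. indicator {s'} s \<partial>Q (S n \<omega>)) =
        indicator {\<omega> \<in> space M. \<phi> (\<lambda>i. S i \<omega>)} \<omega> * ennreal (pmf (Q s) s')"
    proof (cases "\<phi> (\<lambda>i. S i \<omega>)")
      case True
      then have "S n \<omega> = s" using s by blast
      then show ?thesis by (simp add: G[OF \<omega>] emeasure_pmf_single)
    qed (simp add: G[OF \<omega>])
  qed
  also have "\<dots> = emeasure M {\<omega> \<in> space M. \<phi> (\<lambda>i. S i \<omega>)} * ennreal (pmf (Q s) s')"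
    using 1 by (simp add: nn_integral_multc)
  finally show "emeasure M {\<omega> \<in> space M. \<phi> (\<lambda>i. S i \<omega>) \<and> S (Suc n) \<omega> = s'} =
         emeasure M {\<omega> \<in> space M. \<phi> (\<lambda>i. S i \<omega>)} * ennreal (pmf (Q s) s')" .
qed

section \<open>Rotational symmetry of the urn\<close>

definition turn :: "int \<times> int \<Rightarrow> int \<times> int" where
  "turn = (\<lambda>(x, y). (- y, x))"

text \<open>
  The urn rotates counterclockwise, so in the \<open>j\<close>-th quadrant visited it is the \<open>j\<close>-fold quarter turn of an
  urn in the first quadrant.
\<close>

definition urn_state :: "nat \<Rightarrow> nat \<Rightarrow> nat \<Rightarrow> int \<times> int" where
  "urn_state j a b = (turn ^^ j) (int a, int b)"

definition on_axis :: "int \<times> int \<Rightarrow> bool" where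
  "on_axis s \<longleftrightarrow> fst s * snd s = 0"

definition radius :: "int \<times> int \<Rightarrow> int" where
  "radius s = max \<bar>fst s\<bar> \<bar>snd s\<bar>"

lemma inj_turn_pow: "inj (turn ^^ j)"
proof (induction j)
  case (Suc j)
  have "inj turn" by (auto simp: turn_def inj_def)
  with Suc show ?case unfolding funpow.simps by (intro inj_compose)
qed simp

lemma radius_turn [simp]: "radius (turn s) = radius s"
  by (cases s) (simp add: turn_def radius_def max.commute)

lemma on_axis_turn [simp]: "on_axis (turn s) = on_axis s"
  by (cases s) (auto simp: turn_def on_axis_def)

lemma radius_urn_state [simp]: "radius (urn_state j a b) = max (int a) (int b)"
  by (induction j) (simp_all add: urn_state_def, simp add: radius_def)

lemma on_axis_urn_state [simp]: "on_axis (urn_state j a b) \<longleftrightarrow> a = 0 \<or> b = 0"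
  by (induction j) (simp_all add: urn_state_def, simp add: on_axis_def)

lemma urn_state_eq_iff [simp]: "urn_state j a b = urn_state j a' b' \<longleftrightarrow> a = a' \<and> b = b'"
  by (simp add: urn_state_def inj_eq[OF inj_turn_pow])

text \<open>A quarter turn exchanges the coordinates, so the two outcomes of an interior step change
  places: the coin tossed at the turned state is the negation of the original coin.\<close>

lemma nshu_step_turn:
  assumes "s \<noteq> (0, 0)"
  shows "nshu_step K (turn s) = map_pmf turn (nshu_step K s)"
proof -
  obtain x y where s: "s = (x, y)" by (cases s)
  show ?thesis
  proof (cases "x = 0 \<or> y = 0")
    case True
    then show ?thesis using assms
      by (auto simp: s turn_def nshu_step_def map_pmf_comp sgn_minus intro!: map_pmf_cong)
  next
    case False
    have "bernoulli_pmf (real_of_int \<bar>y\<bar> / real_of_int (\<bar>y\<bar> + \<bar>x\<bar>)) =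
      map_pmf Not (bernoulli_pmf (real_of_int \<bar>x\<bar> / real_of_int (\<bar>x\<bar> + \<bar>y\<bar>)))"
      (is "?p = map_pmf Not ?q")
    proof (rule pmf_eqI)
      fix b
      have pos: "real_of_int \<bar>x\<bar> + real_of_int \<bar>y\<bar> > 0" using False by (intro add_pos_pos) auto
      have "pmf (map_pmf Not ?q) b = pmf ?q (\<not> b)"
        using pmf_map_inj'[of Not ?q "\<not> b"] by (simp add: inj_def)
      also have "\<dots> = pmf ?p b"
        using pos by (cases b) (auto simp: field_simps)
      finally show "pmf ?p b = pmf (map_pmf Not ?q) b" by simp
    qed
    then show ?thesis using False
      by (auto simp: s turn_def nshu_step_def map_pmf_comp sgn_minus intro!: map_pmf_cong)
  qed
qed

lemma urn_state_nonzero: "a \<noteq> 0 \<or> b \<noteq> 0 \<Longrightarrow> urn_state j a b \<noteq> (0, 0)"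
  using radius_urn_state[of j a b] by (auto simp: radius_def)

lemma nshu_step_urn_state:
  assumes "a \<noteq> 0 \<or> b \<noteq> 0"
  shows "nshu_step K (urn_state j a b) = map_pmf (turn ^^ j) (nshu_step K (int a, int b))"
proof (induction j)
  case 0
  show ?case by (simp add: urn_state_def pmf.map_id0)
next
  case (Suc j)
  have "urn_state (Suc j) a b = turn (urn_state j a b)" by (simp add: urn_state_def)
  then have "nshu_step K (urn_state (Suc j) a b) = map_pmf turn (nshu_step K (urn_state j a b))"
    using urn_state_nonzero[OF assms] by (simp add: nshu_step_turn)
  also have "\<dots> = map_pmf (turn ^^ Suc j) (nshu_step K (int a, int b))"
    by (simp add: Suc map_pmf_comp comp_def)
  finally show ?case .
qed

lemma pmf_nshu_step_urn_state:
  assumes "a \<noteq> 0 \<or> b \<noteq> 0"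
  shows "pmf (nshu_step K (urn_state j a b)) ((turn ^^ j) s) = pmf (nshu_step K (int a, int b)) s"
  unfolding nshu_step_urn_state[OF assms] by (rule pmf_map_inj'[OF inj_turn_pow])

lemma pmf_nshu_step_quadrant:
  fixes x y :: int
  assumes "x > 0" "y > 0"
  shows "pmf (nshu_step K (x, y)) (x, y + 1) = real_of_int x / real_of_int (x + y)"
    and "pmf (nshu_step K (x, y)) (x - 1, y) = real_of_int y / real_of_int (x + y)"
proof -
  define f where "f = (\<lambda>c. if c then (x, y + 1) else (x - 1, y))"
  define p where "p = bernoulli_pmf (real_of_int x / real_of_int (x + y))"
  have step: "nshu_step K (x, y) = map_pmf f p"
    using assms sgn_pos[of x] sgn_pos[of y] by (simp add: nshu_step_def f_def p_def cong: if_cong)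
  have "inj f" by (auto simp: inj_def f_def split: if_splits)
  then have "pmf (map_pmf f p) (f c) = pmf p c" for c by (rule pmf_map_inj')
  from this[of True] this[of False] assms
  show "pmf (nshu_step K (x, y)) (x, y + 1) = real_of_int x / real_of_int (x + y)"
    and "pmf (nshu_step K (x, y)) (x - 1, y) = real_of_int y / real_of_int (x + y)"
    unfolding step by (simp_all add: f_def p_def field_simps)
qed

lemma pmf_nshu_step_up:
  assumes "b \<ge> 1"
  shows "pmf (nshu_step K (urn_state j (Suc a) b)) (urn_state j (Suc a) (Suc b)) = real (Suc a) / real (Suc a + b)"
  using pmf_nshu_step_urn_state[of "Suc a" b K j "(int (Suc a), int (Suc b))"]
    pmf_nshu_step_quadrant(1)[of "int (Suc a)" "int b" K] assms
  by (simp add: urn_state_def[of j "Suc a" "Suc b"] add_ac)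

lemma pmf_nshu_step_down:
  assumes "b \<ge> 1"
  shows "pmf (nshu_step K (urn_state j (Suc a) b)) (urn_state j a b) = real b / real (Suc a + b)"
  using pmf_nshu_step_urn_state[of "Suc a" b K j "(int a, int b)"]
    pmf_nshu_step_quadrant(2)[of "int (Suc a)" "int b" K] assms
  by (simp add: urn_state_def[of j a b] add_ac)

definition noise_pmf :: "int pmf \<Rightarrow> nat \<Rightarrow> nat pmf" where
  "noise_pmf K w = map_pmf (\<lambda>j. nat (max 1 (int w - j))) K"

text \<open>From \<open>(0, w)\<close> the urn moves to \<open>(- 1, z)\<close>, which is the
  quarter turn of \<open>(z, 1)\<close>. The axis step thus starts the next quadrant in the standard
  position.\<close>

lemma pmf_nshu_step_axis:
  assumes "w \<ge> 1"
  shows "pmf (nshu_step K (urn_state j 0 w)) (urn_state (Suc j) z 1) = pmf (noise_pmf K w) z"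
proof -
  have "nshu_step K (int 0, int w) = map_pmf (\<lambda>z. (- 1, int z)) (noise_pmf K w)"
    using assms by (auto simp: nshu_step_def noise_pmf_def map_pmf_comp intro!: map_pmf_cong)
  then have "pmf (nshu_step K (int 0, int w)) (- 1, int z) = pmf (noise_pmf K w) z"
    using pmf_map_inj'[of "\<lambda>z. (- 1 :: int, int z)" "noise_pmf K w" z] by (simp add: inj_def)
  moreover have "urn_state (Suc j) z 1 = (turn ^^ j) (- 1, int z)"
    by (simp only: urn_state_def funpow_Suc_right comp_def) (simp add: turn_def)
  ultimately show ?thesis using pmf_nshu_step_urn_state[of 0 w K j "(- 1, int z)"] assms by simp
qed

lemma urn_kernel_eq_bind: "urn_kernel K z = bind_pmf (exc_pmf z 1) (noise_pmf K)"
  unfolding urn_kernel_def pair_pmf_def noise_pmf_def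
  by (simp add: map_bind_pmf bind_map_pmf map_pmf_def bind_assoc_pmf bind_return_pmf)

section \<open>Excursions between axes and restarts after them\<close>

text \<open>The duration is left open. The axis step is included because it carries the
  noise.\<close>

definition excursion :: "nat \<Rightarrow> nat \<Rightarrow> nat \<Rightarrow> nat \<Rightarrow> (nat \<Rightarrow> int \<times> int) \<Rightarrow> bool" where
  "excursion j w z r h \<longleftrightarrow> (\<exists>l\<ge>r. (\<forall>i\<in>{r..<l}. \<not> on_axis (h i)) \<and> h l = urn_state j 0 w \<and> h (Suc l) = urn_state (Suc j) z 1)"

lemma excursion_Suc: "\<not> on_axis (h r) \<Longrightarrow> excursion j w z (Suc r) h \<Longrightarrow> excursion j w z r h"
  unfolding excursion_def
  by (metis Suc_leD Suc_leI atLeastLessThan_iff le_neq_implies_less)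

lemma excursion_sets:
  assumes [measurable]: "\<And>n. S n \<in> M \<rightarrow>\<^sub>M count_space UNIV"
  shows "{\<omega> \<in> space M. excursion j w z r (\<lambda>i. S i \<omega>)} \<in> sets M"
  unfolding excursion_def by measurable

text \<open>
  A lower bound suffices: the right-hand sides, summed over \<open>w\<close> and \<open>z\<close>, cannot exceed the mass of
  the past event, while the left-hand sides already add up to it. No separate proof is needed that
  the next axis is reached almost surely.
\<close>

lemma excursion_lower_bound:
  assumes mc: "markov_chain M (nshu_step K) s0 S"
    and "determined_by r \<phi>" "\<And>h. \<phi> h \<Longrightarrow> h r = urn_state j a b" "b \<ge> 1"
  shows "emeasure M {\<omega> \<in> space M. \<phi> (\<lambda>i. S i \<omega>)} * ennreal (pmf (exc_pmf a b) w * pmf (noise_pmf K w) z)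
     \<le> emeasure M {\<omega> \<in> space M. \<phi> (\<lambda>i. S i \<omega>) \<and> excursion j w z r (\<lambda>i. S i \<omega>)}"
  using assms(2-)
\<comment> \<open>A drop lowers \<open>a\<close>, an increase lowers \<open>Suc w - b\<close> as
  long as \<open>b \<le> w\<close>; once \<open>b\<close> has passed \<open>w\<close>, the target
  has probability 0.\<close>
proof (induction "a + (Suc w - b)" arbitrary: a b r \<phi> rule: less_induct)
  case less
  have S: "S n \<in> M \<rightarrow>\<^sub>M count_space UNIV" for n using mc by (simp add: markov_chain_def)
  note [measurable] = S
  have exs: "{\<omega> \<in> space M. excursion j w z r (\<lambda>i. S i \<omega>)} \<in> sets M" for r
    by (rule excursion_sets[OF S])
  have dets: "{\<omega> \<in> space M. \<psi> (\<lambda>i. S i \<omega>)} \<in> sets M" if "determined_by n \<psi>" "\<And>h. \<psi> h \<Longrightarrow> h n = s" for n \<psi> s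
    using markov_chain_step(1)[OF mc, where n = n and \<phi> = \<psi> and s = s] that by blast
  have phis: "{\<omega> \<in> space M. \<phi> (\<lambda>i. S i \<omega>)} \<in> sets M" using dets[where \<psi> = \<phi>] less.prems(1,2) by blast
  have mstep: "emeasure M {\<omega> \<in> space M. \<phi> (\<lambda>i. S i \<omega>) \<and> S (Suc r) \<omega> = s'} =
      emeasure M {\<omega> \<in> space M. \<phi> (\<lambda>i. S i \<omega>)} * ennreal (pmf (nshu_step K (urn_state j a b)) s')" for s'
    using markov_chain_step(3)[OF mc, where n = r and \<phi> = \<phi> and s = "urn_state j a b"] less.prems(1,2) by blast
  consider "w < b" | "a = 0" "b \<le> w" | a' where "a = Suc a'" "b \<le> w" by (cases a) force+
  then show ?case
  proof cases
    case 1
    then show ?thesis by (simp add: pmf_exc_pmf_less)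
  next
    case 2
    show ?thesis
    proof (cases "b = w")
      case True
      have "emeasure M {\<omega> \<in> space M. \<phi> (\<lambda>i. S i \<omega>)} * ennreal (pmf (exc_pmf a b) w * pmf (noise_pmf K w) z)
        = emeasure M {\<omega> \<in> space M. \<phi> (\<lambda>i. S i \<omega>) \<and> S (Suc r) \<omega> = urn_state (Suc j) z 1}"
        using 2 True less.prems(3) pmf_nshu_step_axis[of w K j z] by (subst mstep) simp_all
      also have "\<dots> \<le> emeasure M {\<omega> \<in> space M. \<phi> (\<lambda>i. S i \<omega>) \<and> excursion j w z r (\<lambda>i. S i \<omega>)}"
      proof (rule emeasure_mono)
        show "{\<omega> \<in> space M. \<phi> (\<lambda>i. S i \<omega>) \<and> S (Suc r) \<omega> = urn_state (Suc j) z 1}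
          \<subseteq> {\<omega> \<in> space M. \<phi> (\<lambda>i. S i \<omega>) \<and> excursion j w z r (\<lambda>i. S i \<omega>)}"
          using less.prems(2) 2 True unfolding excursion_def by fastforce
        have "{\<omega> \<in> space M. \<phi> (\<lambda>i. S i \<omega>) \<and> excursion j w z r (\<lambda>i. S i \<omega>)} =
          {\<omega> \<in> space M. \<phi> (\<lambda>i. S i \<omega>)} \<inter> {\<omega> \<in> space M. excursion j w z r (\<lambda>i. S i \<omega>)}" by auto
        then show "{\<omega> \<in> space M. \<phi> (\<lambda>i. S i \<omega>) \<and> excursion j w z r (\<lambda>i. S i \<omega>)} \<in> sets M"
          using phis exs by auto
      qed
      finally show ?thesis .
    qed (use 2 in simp)
  next
    case 3
    define p where "p = emeasure M {\<omega> \<in> space M. \<phi> (\<lambda>i. S i \<omega>)}"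
    define c where "c = pmf (noise_pmf K w) z"
    define \<phi>1 where "\<phi>1 = (\<lambda>h. \<phi> h \<and> h (Suc r) = urn_state j a (Suc b))"
    define \<phi>2 where "\<phi>2 = (\<lambda>h. \<phi> h \<and> h (Suc r) = urn_state j a' b)"
    have det: "determined_by (Suc r) \<phi>1" "determined_by (Suc r) \<phi>2"
      using less.prems(1) unfolding determined_by_def \<phi>1_def \<phi>2_def by (metis le_SucI le_refl)+
    define A1 where "A1 = {\<omega> \<in> space M. \<phi>1 (\<lambda>i. S i \<omega>) \<and> excursion j w z (Suc r) (\<lambda>i. S i \<omega>)}"
    define A2 where "A2 = {\<omega> \<in> space M. \<phi>2 (\<lambda>i. S i \<omega>) \<and> excursion j w z (Suc r) (\<lambda>i. S i \<omega>)}"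
    have "A1 = {\<omega> \<in> space M. \<phi>1 (\<lambda>i. S i \<omega>)} \<inter> {\<omega> \<in> space M. excursion j w z (Suc r) (\<lambda>i. S i \<omega>)}"
      "A2 = {\<omega> \<in> space M. \<phi>2 (\<lambda>i. S i \<omega>)} \<inter> {\<omega> \<in> space M. excursion j w z (Suc r) (\<lambda>i. S i \<omega>)}"
      by (auto simp: A1_def A2_def)
    then have As: "A1 \<in> sets M" "A2 \<in> sets M"
      using exs dets[where \<psi> = \<phi>1 and n = "Suc r" and s = "urn_state j a (Suc b)", OF det(1)]
        dets[where \<psi> = \<phi>2 and n = "Suc r" and s = "urn_state j a' b", OF det(2)]
      by (auto simp: \<phi>1_def \<phi>2_def)
    have e1: "emeasure M {\<omega> \<in> space M. \<phi>1 (\<lambda>i. S i \<omega>)} = p * ennreal (real a / real (a + b))"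
      unfolding \<phi>1_def p_def using less.prems(3) 3
      by (subst mstep) (simp_all add: pmf_nshu_step_up)
    have e2: "emeasure M {\<omega> \<in> space M. \<phi>2 (\<lambda>i. S i \<omega>)} = p * ennreal (real b / real (a + b))"
      unfolding \<phi>2_def p_def using less.prems(3) 3
      by (subst mstep) (simp_all add: pmf_nshu_step_down)
    have i1: "p * ennreal (real a / real (a + b)) * ennreal (pmf (exc_pmf a (Suc b)) w * c) \<le> emeasure M A1"
      unfolding A1_def e1[symmetric] c_def
      by (rule less.hyps) (use 3 det in \<open>auto simp: \<phi>1_def\<close>)
    have i2: "p * ennreal (real b / real (a + b)) * ennreal (pmf (exc_pmf a' b) w * c) \<le> emeasure M A2"
      unfolding A2_def e2[symmetric] c_def
      by (rule less.hyps) (use 3 det less.prems(3) in \<open>auto simp: \<phi>2_def\<close>)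
    have "p * ennreal (pmf (exc_pmf a b) w * c) =
      p * ennreal (real a / real (a + b)) * ennreal (pmf (exc_pmf a (Suc b)) w * c) +
      p * ennreal (real b / real (a + b)) * ennreal (pmf (exc_pmf a' b) w * c)"
    proof -
      have eq: "pmf (exc_pmf a b) w * c = real a / real (a + b) * (pmf (exc_pmf a (Suc b)) w * c) +
        real b / real (a + b) * (pmf (exc_pmf a' b) w * c)"
        unfolding 3(1) pmf_exc_pmf_step[OF less.prems(3)] by (simp add: algebra_simps)
      have "c \<ge> 0" by (simp add: c_def)
      have "p * ennreal (X * U + Y * V) = p * ennreal X * ennreal U + p * ennreal Y * ennreal V"
        if "X \<ge> 0" "Y \<ge> 0" "U \<ge> 0" "V \<ge> 0" for X Y U V :: real
        using that by (simp add: ennreal_mult ennreal_plus distrib_left mult.assoc)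
      then show ?thesis unfolding eq using \<open>c \<ge> 0\<close> by (simp del: ennreal_plus times_divide_eq_left)
    qed
    also have "\<dots> \<le> emeasure M A1 + emeasure M A2" using i1 i2 by (rule add_mono)
    also have "\<dots> = emeasure M (A1 \<union> A2)"
      using As 3(1) by (intro plus_emeasure) (auto simp: A1_def A2_def \<phi>1_def \<phi>2_def)
    also have "\<dots> \<le> emeasure M {\<omega> \<in> space M. \<phi> (\<lambda>i. S i \<omega>) \<and> excursion j w z r (\<lambda>i. S i \<omega>)}"
    proof (rule emeasure_mono)
      have na: "\<not> on_axis (h r)" if "\<phi> h" for h using less.prems(2)[OF that] less.prems(3) 3(1) by simp
      show "A1 \<union> A2 \<subseteq> {\<omega> \<in> space M. \<phi> (\<lambda>i. S i \<omega>) \<and> excursion j w z r (\<lambda>i. S i \<omega>)}"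
      proof
        fix \<omega> assume "\<omega> \<in> A1 \<union> A2"
        then have *: "\<omega> \<in> space M" "\<phi> (\<lambda>i. S i \<omega>)" "excursion j w z (Suc r) (\<lambda>i. S i \<omega>)"
          by (auto simp: A1_def A2_def \<phi>1_def \<phi>2_def)
        then show "\<omega> \<in> {\<omega> \<in> space M. \<phi> (\<lambda>i. S i \<omega>) \<and> excursion j w z r (\<lambda>i. S i \<omega>)}"
          using excursion_Suc[OF na[OF *(2)] *(3)] by simp
      qed
      have "{\<omega> \<in> space M. \<phi> (\<lambda>i. S i \<omega>) \<and> excursion j w z r (\<lambda>i. S i \<omega>)} =
        {\<omega> \<in> space M. \<phi> (\<lambda>i. S i \<omega>)} \<inter> {\<omega> \<in> space M. excursion j w z r (\<lambda>i. S i \<omega>)}" by auto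
      then show "{\<omega> \<in> space M. \<phi> (\<lambda>i. S i \<omega>) \<and> excursion j w z r (\<lambda>i. S i \<omega>)} \<in> sets M"
        using phis exs by auto
    qed
    finally show ?thesis by (simp add: p_def c_def)
  qed
qed

text \<open>Here \<open>r\<close> is the time just after the \<open>j\<close>-th visit to the axes
  and \<open>z\<close> lists the embedded values up to then. Time 0 is the restart of index 0, which
  matches the convention \<open>axis_time s 0 = - 1\<close>.\<close>

primrec restart_at :: "(nat \<Rightarrow> nat) \<Rightarrow> nat \<Rightarrow> nat \<Rightarrow> (nat \<Rightarrow> int \<times> int) \<Rightarrow> bool" where
  "restart_at z 0 r h \<longleftrightarrow> r = 0 \<and> h 0 = urn_state 0 (z 0) 1 \<and> z 0 \<ge> 1"
| "restart_at z (Suc j) r h \<longleftrightarrow> (\<exists>r' l w. r = Suc l \<and> restart_at z j r' h \<and> r' \<le> l \<and>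
     (\<forall>i\<in>{r'..<l}. \<not> on_axis (h i)) \<and> h l = urn_state j 0 w \<and>
     h (Suc l) = urn_state (Suc j) (z (Suc j)) 1 \<and> z (Suc j) \<ge> 1)"

lemma restart_at_cong:
  "(\<And>i. i \<le> j \<Longrightarrow> z i = z' i) \<Longrightarrow> restart_at z j r h = restart_at z' j r h"
  by (induction j arbitrary: r) auto

lemma restart_at_state: "restart_at z j r h \<Longrightarrow> h r = urn_state j (z j) 1 \<and> z j \<ge> 1"
  by (cases j) auto

text \<open>No axis point lies between a restart and the next recorded visit, so
  \<open>LEAST\<close> finds that visit. In particular the trajectory determines \<open>r\<close>,
  which later gives disjointness over the restart times.\<close>

lemma restart_at_axis_time: "restart_at z j r h \<Longrightarrow> axis_time h j = int r - 1"
proof (induction j arbitrary: r)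
  case (Suc j)
  from Suc.prems obtain r' l w where *: "r = Suc l" "restart_at z j r' h" "r' \<le> l"
     "\<forall>i\<in>{r'..<l}. \<not> on_axis (h i)" "h l = urn_state j 0 w" by auto
  have "(LEAST n. int n > axis_time h j \<and> fst (h n) * snd (h n) = 0) = l"
  proof (rule Least_equality)
    show "axis_time h j < int l \<and> fst (h l) * snd (h l) = 0"
      using Suc.IH[OF *(2)] * on_axis_urn_state[of j 0 w] by (simp add: on_axis_def)
    fix n assume n: "axis_time h j < int n \<and> fst (h n) * snd (h n) = 0"
    show "l \<le> n"
    proof (rule ccontr)
      assume "\<not> l \<le> n"
      then have "n \<in> {r'..<l}" using Suc.IH[OF *(2)] n by auto
      then show False using *(4) n by (auto simp: on_axis_def)
    qed
  qed
  then show ?case using *(1) by simp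
qed simp

lemma restart_at_unique: "restart_at z j r h \<Longrightarrow> restart_at z j r' h \<Longrightarrow> r = r'"
  using restart_at_axis_time[of z j r h] restart_at_axis_time[of z j r' h] by simp

lemma restart_at_embedded:
  "restart_at z j r h \<Longrightarrow> i \<le> j \<Longrightarrow> embedded_process (int (z 0)) h i = int (z i)"
proof (induction j arbitrary: r)
  case (Suc j)
  show ?case
  proof (cases "i = Suc j")
    case True
    have "embedded_process (int (z 0)) h (Suc j) = radius (h r)"
      using restart_at_axis_time[OF Suc.prems(1)] by (simp add: radius_def del: axis_time.simps(2))
    also have "\<dots> = int (z (Suc j))"
      using restart_at_state[OF Suc.prems(1)] by simp
    finally show ?thesis using True by simp
  next
    case False
    then show ?thesis using Suc by auto
  qed
qed simp

lemma determined_by_restart_at: "determined_by r (restart_at z j r)"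
proof (induction j arbitrary: r)
  case 0
  then show ?case by (auto simp: determined_by_def)
next
  case (Suc j)
  have "restart_at z (Suc j) r h \<Longrightarrow> restart_at z (Suc j) r h'" if eq: "\<forall>i\<le>r. h i = h' i" for h h'
  proof -
    assume "restart_at z (Suc j) r h"
    then obtain r' l w where *: "r = Suc l" "restart_at z j r' h" "r' \<le> l"
      "\<forall>i\<in>{r'..<l}. \<not> on_axis (h i)" "h l = urn_state j 0 w"
      "h (Suc l) = urn_state (Suc j) (z (Suc j)) 1" "z (Suc j) \<ge> 1" by auto
    have "restart_at z j r' h'" using Suc[of r'] *(1,2,3) eq unfolding determined_by_def
      by (meson le_SucI le_trans)
    then show "restart_at z (Suc j) r h'" using * eq by auto
  qed
  then show ?case unfolding determined_by_def by metis
qed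

lemma excursion_unique:
  assumes "excursion j w z r h" "excursion j w' z r h"
  shows "w = w'"
proof -
  from assms obtain l l' where l: "r \<le> l" "\<forall>i\<in>{r..<l}. \<not> on_axis (h i)" "h l = urn_state j 0 w"
    "r \<le> l'" "\<forall>i\<in>{r..<l'}. \<not> on_axis (h i)" "h l' = urn_state j 0 w'"
    unfolding excursion_def by blast
  have "on_axis (h l)" "on_axis (h l')" using l by simp_all
  then have "l = l'" using l by (meson atLeastLessThan_iff linorder_neqE_nat)
  then show ?thesis using l by simp
qed

lemma urn_kernel_0: "pmf (urn_kernel K z) 0 = 0"
  unfolding urn_kernel_def by (simp add: pmf_eq_0_set_pmf) (auto simp: max_def split: if_splits)

lemma ennreal_pmf_urn_kernel:
  "ennreal (pmf (urn_kernel K z) s) = (\<Sum>w. ennreal (pmf (exc_pmf z 1) w * pmf (noise_pmf K w) s))"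
  by (simp add: urn_kernel_eq_bind ennreal_pmf_bind nn_integral_measure_pmf nn_integral_count_space_nat ennreal_mult)

lemma restart_sets:
  assumes mc: "markov_chain M (nshu_step K) s0 S"
  shows "{\<omega> \<in> space M. restart_at z j r (\<lambda>i. S i \<omega>)} \<in> sets M"
    "{\<omega> \<in> space M. \<exists>r. restart_at z j r (\<lambda>i. S i \<omega>)} \<in> sets M"
proof -
  show *: "{\<omega> \<in> space M. restart_at z j r (\<lambda>i. S i \<omega>)} \<in> sets M" for r
    using markov_chain_step(1)[OF mc, where n = r and \<phi> = "restart_at z j r" and s = "urn_state j (z j) 1"]
      determined_by_restart_at[of r z j] restart_at_state[of z j r] by blast
  have "{\<omega> \<in> space M. \<exists>r. restart_at z j r (\<lambda>i. S i \<omega>)} =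
      (\<Union>r. {\<omega> \<in> space M. restart_at z j r (\<lambda>i. S i \<omega>)})" by auto
  then show "{\<omega> \<in> space M. \<exists>r. restart_at z j r (\<lambda>i. S i \<omega>)} \<in> sets M" using * by auto
qed

text \<open>Decompose by the restart time and the exit distance. Both are functions of the
  trajectory, so the events are disjoint and the excursion bounds add up to one transition of
  \<open>urn_kernel\<close>.\<close>

lemma restart_lower_bound:
  assumes mc: "markov_chain M (nshu_step K) s0 S"
  shows "emeasure M {\<omega> \<in> space M. \<exists>r. restart_at z j r (\<lambda>i. S i \<omega>)} * ennreal (pmf (urn_kernel K (z j)) (z (Suc j)))
    \<le> emeasure M {\<omega> \<in> space M. \<exists>r. restart_at z (Suc j) r (\<lambda>i. S i \<omega>)}"
proof (cases "z (Suc j) \<ge> 1")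
  case False
  then have "z (Suc j) = 0" by simp
  then show ?thesis by (simp add: urn_kernel_0)
next
  case True
  have S [measurable]: "S n \<in> M \<rightarrow>\<^sub>M count_space UNIV" for n using mc by (simp add: markov_chain_def)
  define B where "B = (\<lambda>r. {\<omega> \<in> space M. restart_at z j r (\<lambda>i. S i \<omega>)})"
  define C where "C = (\<lambda>r w. {\<omega> \<in> space M. restart_at z j r (\<lambda>i. S i \<omega>) \<and> excursion j w (z (Suc j)) r (\<lambda>i. S i \<omega>)})"
  have Bs: "B r \<in> sets M" for r unfolding B_def by (rule restart_sets[OF mc])
  have "C r w = B r \<inter> {\<omega> \<in> space M. excursion j w (z (Suc j)) r (\<lambda>i. S i \<omega>)}" for r w
    by (auto simp: C_def B_def)
  then have Cs: "C r w \<in> sets M" for r w using Bs excursion_sets[OF S] by auto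
  have Bd: "disjoint_family B"
    unfolding disjoint_family_on_def B_def by (auto dest: restart_at_unique)
  have Cd: "disjoint_family (C r)" for r
    unfolding disjoint_family_on_def C_def by (auto dest: excursion_unique)
  have Ud: "disjoint_family (\<lambda>r. \<Union>w. C r w)"
    unfolding disjoint_family_on_def C_def by (auto dest: restart_at_unique)
  have low: "emeasure M (B r) * ennreal (pmf (exc_pmf (z j) 1) w * pmf (noise_pmf K w) (z (Suc j))) \<le> emeasure M (C r w)" for r w
    unfolding B_def C_def
  proof (rule excursion_lower_bound[OF mc determined_by_restart_at])
    show "h r = urn_state j (z j) 1" if "restart_at z j r h" for h
      using restart_at_state[OF that] by (rule conjunct1)
  qed simp
  have "emeasure M {\<omega> \<in> space M. \<exists>r. restart_at z j r (\<lambda>i. S i \<omega>)} = emeasure M (\<Union>r. B r)"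
    by (rule arg_cong[where f = "emeasure M"]) (auto simp: B_def)
  also have "\<dots> = (\<Sum>r. emeasure M (B r))"
    using Bs Bd by (subst suminf_emeasure) auto
  finally have "emeasure M {\<omega> \<in> space M. \<exists>r. restart_at z j r (\<lambda>i. S i \<omega>)} * ennreal (pmf (urn_kernel K (z j)) (z (Suc j)))
     = (\<Sum>r. \<Sum>w. emeasure M (B r) * ennreal (pmf (exc_pmf (z j) 1) w * pmf (noise_pmf K w) (z (Suc j))))"
    unfolding ennreal_pmf_urn_kernel by (simp only: ennreal_suminf_cmult ennreal_suminf_multc)
  also have "\<dots> \<le> (\<Sum>r. \<Sum>w. emeasure M (C r w))"
    by (intro suminf_le low) auto
  also have "\<dots> = (\<Sum>r. emeasure M (\<Union>w. C r w))"
    using Cs Cd by (subst suminf_emeasure) auto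
  also have "\<dots> = emeasure M (\<Union>r. \<Union>w. C r w)"
    using Cs Ud by (intro suminf_emeasure) auto
  also have "\<dots> \<le> emeasure M {\<omega> \<in> space M. \<exists>r. restart_at z (Suc j) r (\<lambda>i. S i \<omega>)}"
  proof (rule emeasure_mono)
    show "(\<Union>r. \<Union>w. C r w) \<subseteq> {\<omega> \<in> space M. \<exists>r. restart_at z (Suc j) r (\<lambda>i. S i \<omega>)}"
    proof
      fix \<omega> assume "\<omega> \<in> (\<Union>r. \<Union>w. C r w)"
      then obtain r w where *: "\<omega> \<in> space M" "restart_at z j r (\<lambda>i. S i \<omega>)" "excursion j w (z (Suc j)) r (\<lambda>i. S i \<omega>)"
        by (auto simp: C_def)
      then obtain l where "r \<le> l" "\<forall>i\<in>{r..<l}. \<not> on_axis (S i \<omega>)" "S l \<omega> = urn_state j 0 w"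
        "S (Suc l) \<omega> = urn_state (Suc j) (z (Suc j)) 1" unfolding excursion_def by blast
      then have "restart_at z (Suc j) (Suc l) (\<lambda>i. S i \<omega>)"
        using True *(2) unfolding restart_at.simps by blast
      then show "\<omega> \<in> {\<omega> \<in> space M. \<exists>r. restart_at z (Suc j) r (\<lambda>i. S i \<omega>)}" using *(1) by blast
    qed
  qed (rule restart_sets[OF mc])
  finally show ?thesis .
qed

text \<open>The lower bounds become equalities: the differences are nonnegative and have sum at most
  0, so each of them vanishes. The part of the old event on which no further restart exists is then
  a null set.\<close>

lemma restart_step:
  assumes mc: "markov_chain M (nshu_step K) s0 S"
  shows "measure M {\<omega> \<in> space M. \<exists>r. restart_at (z(Suc j := s)) (Suc j) r (\<lambda>i. S i \<omega>)} =
      measure M {\<omega> \<in> space M. \<exists>r. restart_at z j r (\<lambda>i. S i \<omega>)} * pmf (urn_kernel K (z j)) s"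
    and "AE \<omega> in M. (\<exists>r. restart_at z j r (\<lambda>i. S i \<omega>)) \<longrightarrow> (\<exists>s r. restart_at (z(Suc j := s)) (Suc j) r (\<lambda>i. S i \<omega>))"
proof -
  interpret prob_space M using mc by (simp add: markov_chain_def)
  define A where "A = {\<omega> \<in> space M. \<exists>r. restart_at z j r (\<lambda>i. S i \<omega>)}"
  define B where "B = (\<lambda>s. {\<omega> \<in> space M. \<exists>r. restart_at (z(Suc j := s)) (Suc j) r (\<lambda>i. S i \<omega>)})"
  have As: "A \<in> sets M" unfolding A_def by (rule restart_sets[OF mc])
  have Bs: "B s \<in> sets M" for s unfolding B_def by (rule restart_sets[OF mc])
  have cong: "restart_at (z(Suc j := s)) j r h = restart_at z j r h" for s r h
    by (rule restart_at_cong) simp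
  have BA: "B s \<subseteq> A" for s unfolding A_def B_def by (auto simp: cong)
  have Bd: "disjoint_family B"
  proof -
    have False if "restart_at (z(Suc j := s)) (Suc j) r h" "restart_at (z(Suc j := s')) (Suc j) r' h" "s \<noteq> s'" for s s' r r' h
      using restart_at_embedded[OF that(1), of "Suc j"] restart_at_embedded[OF that(2), of "Suc j"] that(3)
      by (simp del: restart_at.simps embedded_process.simps)
    then show ?thesis unfolding disjoint_family_on_def B_def by blast
  qed
  have low: "measure M A * pmf (urn_kernel K (z j)) s \<le> measure M (B s)" for s
  proof -
    have "emeasure M A * ennreal (pmf (urn_kernel K (z j)) s) \<le> emeasure M (B s)"
      using restart_lower_bound[OF mc, of "z(Suc j := s)" j] unfolding A_def B_def cong by simp
    then show ?thesis
      by (simp add: emeasure_eq_measure flip: ennreal_mult)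
  qed
  have sB: "(\<lambda>s. measure M (B s)) sums measure M (\<Union>s. B s)"
    using Bs Bd by (intro finite_measure_UNION) auto
  have sA: "(\<lambda>s. measure M A * pmf (urn_kernel K (z j)) s) sums (measure M A * 1)"
  proof (rule sums_mult)
    have "(\<lambda>s. measure (urn_kernel K (z j)) {s}) sums measure (urn_kernel K (z j)) (\<Union>s. {s})"
      by (intro measure_pmf.finite_measure_UNION) (auto simp: disjoint_family_on_def)
    then show "pmf (urn_kernel K (z j)) sums 1" by (simp add: pmf.rep_eq measure_pmf.prob_space[simplified] UNION_singleton_eq_range)
  qed
  have UB: "measure M (\<Union>s. B s) \<le> measure M A"
    using BA As by (intro finite_measure_mono) auto
  have dsum: "(\<lambda>s. measure M (B s) - measure M A * pmf (urn_kernel K (z j)) s) sums (measure M (\<Union>s. B s) - measure M A * 1)"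
    by (intro sums_diff sB sA)
  then have "0 \<le> measure M (\<Union>s. B s) - measure M A * 1"
    using low by (intro sums_le[OF _ sums_zero dsum]) auto
  then have eq: "measure M (\<Union>s. B s) = measure M A" using UB by simp
  then have "(\<lambda>s. measure M (B s) - measure M A * pmf (urn_kernel K (z j)) s) sums 0" using dsum by simp
  then have "\<forall>s. measure M (B s) - measure M A * pmf (urn_kernel K (z j)) s = 0"
    using low suminf_eq_zero_iff[of "\<lambda>s. measure M (B s) - measure M A * pmf (urn_kernel K (z j)) s"]
    by (auto simp: sums_iff)
  then have "measure M (B s) = measure M A * pmf (urn_kernel K (z j)) s" by simp
  then show "measure M {\<omega> \<in> space M. \<exists>r. restart_at (z(Suc j := s)) (Suc j) r (\<lambda>i. S i \<omega>)} =
      measure M {\<omega> \<in> space M. \<exists>r. restart_at z j r (\<lambda>i. S i \<omega>)} * pmf (urn_kernel K (z j)) s"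
    unfolding A_def B_def .
  have "measure M (A - (\<Union>s. B s)) = 0"
    using eq As Bs BA by (subst finite_measure_Diff) auto
  then have "AE \<omega> in M. \<omega> \<notin> A - (\<Union>s. B s)"
    using As Bs by (intro AE_not_in) (auto simp: emeasure_eq_measure null_sets_def)
  moreover have "AE \<omega> in M. \<omega> \<in> space M" by (rule AE_space)
  ultimately show "AE \<omega> in M. (\<exists>r. restart_at z j r (\<lambda>i. S i \<omega>)) \<longrightarrow> (\<exists>s r. restart_at (z(Suc j := s)) (Suc j) r (\<lambda>i. S i \<omega>))"
    by eventually_elim (auto simp: A_def B_def simp del: restart_at.simps)
qed

lemma AE_restart:
  assumes mc: "markov_chain M (nshu_step K) (int n0, 1) S" and n0: "n0 \<ge> 1"
  shows "AE \<omega> in M. \<exists>z r. z 0 = n0 \<and> restart_at z j r (\<lambda>i. S i \<omega>)"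
proof (induction j)
  case 0
  have "AE \<omega> in M. S 0 \<omega> = (int n0, 1)" using mc by (simp add: markov_chain_def)
  then show ?case
    by eventually_elim (use n0 in \<open>auto simp: urn_state_def intro: exI[where x = "\<lambda>_. n0"]\<close>)
next
  case (Suc j)
  \<comment> \<open>The sequences \<open>z\<close> are uncountably many, but only the entries up to
    \<open>j\<close> matter; quantifying over lists keeps the exceptional set null.\<close>
  have "AE \<omega> in M. \<forall>l :: nat list. (\<exists>r. restart_at ((!) l) j r (\<lambda>i. S i \<omega>)) \<longrightarrow>
      (\<exists>s r. restart_at (((!) l)(Suc j := s)) (Suc j) r (\<lambda>i. S i \<omega>))"
    unfolding AE_all_countable using restart_step(2)[OF mc] by blast
  with Suc show ?case
  proof eventually_elim
    case (elim \<omega>)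
    then obtain z r where z: "z 0 = n0" "restart_at z j r (\<lambda>i. S i \<omega>)" by blast
    define l where "l = map z [0..<Suc j]"
    have l: "l ! i = z i" if "i \<le> j" for i using that unfolding l_def by (subst nth_map) (auto simp del: upt_Suc)
    have "restart_at ((!) l) j r (\<lambda>i. S i \<omega>)"
      using z(2) restart_at_cong[of j "(!) l" z r] l by simp
    with elim(2) obtain s r' where "restart_at (((!) l)(Suc j := s)) (Suc j) r' (\<lambda>i. S i \<omega>)" by blast
    moreover have "(((!) l)(Suc j := s)) 0 = n0" using l[of 0] z by simp
    ultimately show ?case by blast
  qed
qed

lemma measurable_embedded_process [measurable]:
  assumes [measurable]: "\<And>n. S n \<in> M \<rightarrow>\<^sub>M count_space UNIV"
  shows "(\<lambda>\<omega>. embedded_process z0 (\<lambda>n. S n \<omega>) k) \<in> M \<rightarrow>\<^sub>M count_space UNIV"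
proof -
  have ax [measurable]: "(\<lambda>\<omega>. axis_time (\<lambda>n. S n \<omega>) k) \<in> M \<rightarrow>\<^sub>M count_space UNIV" for k
  proof (induction k)
    case (Suc k)
    note [measurable] = Suc
    show ?case unfolding axis_time.simps by measurable
  qed simp
  show ?thesis
  proof (cases k)
    case (Suc k')
    define n where "n = (\<lambda>\<omega>. nat (1 + axis_time (\<lambda>n. S n \<omega>) (Suc k')))"
    have n: "n \<in> M \<rightarrow>\<^sub>M count_space UNIV" unfolding n_def by measurable
    have "(\<lambda>\<omega>. radius (S (n \<omega>) \<omega>)) \<in> M \<rightarrow>\<^sub>M count_space UNIV"
      by (rule measurable_compose_countable[OF _ n]) measurable
    then show ?thesis unfolding Suc by (simp add: Let_def n_def radius_def del: axis_time.simps)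
  qed simp
qed

lemma embedded_process_nonneg: "z0 \<ge> 0 \<Longrightarrow> embedded_process z0 s k \<ge> 0"
  by (cases k) (auto simp: Let_def)

text \<open>Up to null sets, prescribing the first embedded values is the same event as the
  existence of a restart with these values, and for restarts the one-step factorisation is
  known.\<close>

theorem embedded_process_markov:
  assumes urn: "noisy_simple_harmonic_urn M K z0 S" and z0: "z0 \<ge> 1"
  shows "markov_chain M (urn_kernel K) (nat z0) (\<lambda>k \<omega>. nat (embedded_process z0 (\<lambda>n. S n \<omega>) k))"
proof -
  have mc: "markov_chain M (nshu_step K) (int (nat z0), 1) S"
    using urn z0 by (simp add: noisy_simple_harmonic_urn_def)
  interpret prob_space M using mc by (simp add: markov_chain_def)
  have S [measurable]: "S n \<in> M \<rightarrow>\<^sub>M count_space UNIV" for n using mc by (simp add: markov_chain_def)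
  define Z where "Z = (\<lambda>k \<omega>. nat (embedded_process z0 (\<lambda>n. S n \<omega>) k))"
  have Z0: "Z 0 \<omega> = nat z0" for \<omega> by (simp add: Z_def)
  have [measurable]: "Z k \<in> M \<rightarrow>\<^sub>M count_space UNIV" for k unfolding Z_def by measurable
  have ZA: "measure M {\<omega> \<in> space M. \<forall>i\<le>n. Z i \<omega> = h i} = measure M {\<omega> \<in> space M. \<exists>r. restart_at h n r (\<lambda>i. S i \<omega>)}"
    if h: "h 0 = nat z0" for n h
  proof (rule measure_eq_AE)
    have "AE \<omega> in M. \<exists>z r. z 0 = nat z0 \<and> restart_at z n r (\<lambda>i. S i \<omega>)"
      by (rule AE_restart[OF mc]) (use z0 in simp)
    then show "AE \<omega> in M. (\<omega> \<in> {\<omega> \<in> space M. \<forall>i\<le>n. Z i \<omega> = h i}) = (\<omega> \<in> {\<omega> \<in> space M. \<exists>r. restart_at h n r (\<lambda>i. S i \<omega>)})"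
    proof eventually_elim
      case (elim \<omega>)
      then obtain z r where z: "z 0 = nat z0" "restart_at z n r (\<lambda>i. S i \<omega>)" by blast
      have Zz: "Z i \<omega> = z i" if "i \<le> n" for i
        using restart_at_embedded[OF z(2) that] z(1) z0 by (simp add: Z_def)
      have "(\<exists>r. restart_at h n r (\<lambda>i. S i \<omega>)) \<longleftrightarrow> (\<forall>i\<le>n. Z i \<omega> = h i)"
      proof
        assume "\<exists>r. restart_at h n r (\<lambda>i. S i \<omega>)"
        then obtain r' where "restart_at h n r' (\<lambda>i. S i \<omega>)" ..
        from restart_at_embedded[OF this] show "\<forall>i\<le>n. Z i \<omega> = h i" using h z0 by (simp add: Z_def)
      next
        assume "\<forall>i\<le>n. Z i \<omega> = h i"
        then have "restart_at h n r (\<lambda>i. S i \<omega>)" using z(2) Zz restart_at_cong[of n h z r] by simp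
        then show "\<exists>r. restart_at h n r (\<lambda>i. S i \<omega>)" ..
      qed
      then show ?case by auto
    qed
    show "{\<omega> \<in> space M. \<exists>r. restart_at h n r (\<lambda>i. S i \<omega>)} \<in> sets M" by (rule restart_sets[OF mc])
  qed measurable
  have "measure M {\<omega> \<in> space M. (\<forall>i\<le>n. Z i \<omega> = h i) \<and> Z (Suc n) \<omega> = s} =
      measure M {\<omega> \<in> space M. \<forall>i\<le>n. Z i \<omega> = h i} * pmf (urn_kernel K (h n)) s" for n h s
  proof (cases "h 0 = nat z0")
    case False
    then have "{\<omega> \<in> space M. \<forall>i\<le>n. Z i \<omega> = h i} = {}" using Z0 by fastforce
    moreover from this have "{\<omega> \<in> space M. (\<forall>i\<le>n. Z i \<omega> = h i) \<and> Z (Suc n) \<omega> = s} = {}" by blast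
    ultimately show ?thesis by (simp only: measure_empty mult_zero_left)
  next
    case True
    have "{\<omega> \<in> space M. (\<forall>i\<le>n. Z i \<omega> = h i) \<and> Z (Suc n) \<omega> = s} = {\<omega> \<in> space M. \<forall>i\<le>Suc n. Z i \<omega> = (h(Suc n := s)) i}"
      by (auto simp: le_Suc_eq)
    then show ?thesis using ZA[of "h(Suc n := s)" "Suc n"] ZA[of h n] True restart_step(1)[OF mc, of h n s] by simp
  qed
  then show ?thesis unfolding markov_chain_def Z_def[symmetric]
    using Z0 by (auto simp: prob_space_axioms)
qed

section \<open>Chains with square-root fluctuations\<close>

lemma integrable_power_le_pmf:
  fixes f :: "'a \<Rightarrow> real"
  assumes "integrable (measure_pmf p) (\<lambda>x. f x ^ n)" "even n" "k \<le> n"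
  shows "integrable (measure_pmf p) (\<lambda>x. \<bar>f x\<bar> ^ k)"
proof (rule Bochner_Integration.integrable_bound[of _ "\<lambda>x. 1 + f x ^ n"])
  show "AE x in measure_pmf p. norm (\<bar>f x\<bar> ^ k) \<le> norm (1 + f x ^ n)"
  proof (rule AE_I2)
    fix x
    have "\<bar>f x\<bar> ^ k \<le> 1 + \<bar>f x\<bar> ^ n"
    proof (cases "\<bar>f x\<bar> \<le> 1")
      case True
      then have "\<bar>f x\<bar> ^ k \<le> 1" by (intro power_le_one) auto
      then show ?thesis by (simp add: add_increasing2)
    next
      case False
      then have "\<bar>f x\<bar> ^ k \<le> \<bar>f x\<bar> ^ n" using assms by (intro power_increasing) auto
      then show ?thesis by simp
    qed
    then show "norm (\<bar>f x\<bar> ^ k) \<le> norm (1 + f x ^ n)"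
      using assms(2) by (simp add: power_even_abs)
  qed
qed (use assms in auto)

text \<open>What the limit uses of the urn. The errors in mean and variance are smaller than the
  main terms by a factor of order \<open>sqrt z\<close>, so they are informative only away from 0;
  \<open>escape\<close> ensures that bounded sets can be left.\<close>

locale diffusive_kernel =
  fixes Q :: "nat \<Rightarrow> nat pmf" and m C :: real
  assumes m_pos: "m > 0" and C1: "C \<ge> 1"
    and supp: "\<And>z. z \<ge> 1 \<Longrightarrow> set_pmf (Q z) \<subseteq> {1..}"
    and escape: "\<And>z L. z \<ge> 1 \<Longrightarrow> \<exists>w\<in>set_pmf (Q z). w > L"
    and integrable4: "\<And>z. z \<ge> 1 \<Longrightarrow> integrable (measure_pmf (Q z)) (\<lambda>w. (real w - real z) ^ 4)"
    and moment4: "\<And>z. z \<ge> 1 \<Longrightarrow> measure_pmf.expectation (Q z) (\<lambda>w. (real w - real z) ^ 4) \<le> C * (real z)\<^sup>2"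
    and moment2: "\<And>z. z \<ge> 1 \<Longrightarrow> \<bar>measure_pmf.expectation (Q z) (\<lambda>w. (real w - real z)\<^sup>2) - 2/3 * real z\<bar> \<le> C * sqrt (real z)"
    and moment1: "\<And>z. z \<ge> 1 \<Longrightarrow> \<bar>measure_pmf.expectation (Q z) (\<lambda>w. real w - real z) - m\<bar> \<le> C / sqrt (real z)"
begin

lemma integrable_diff:
  assumes "z \<ge> 1"
  shows "integrable (measure_pmf (Q z)) (\<lambda>w. real w - real z)"
    and "integrable (measure_pmf (Q z)) (\<lambda>w. (real w - real z)\<^sup>2)"
    and "integrable (measure_pmf (Q z)) (\<lambda>w. \<bar>real w - real z\<bar> ^ 3)"
  using integrable_power_le_pmf[OF integrable4[OF assms], of 1]
    integrable_power_le_pmf[OF integrable4[OF assms], of 2]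
    integrable_power_le_pmf[OF integrable4[OF assms], of 3]
  by (simp_all add: integrable_abs_iff)

text \<open>Interpolation between the second and the fourth moment by
  \<open>2 * e ^ 3 \<le> r * e\<^sup>2 + e ^ 4 / r\<close>, with \<open>r = sqrt z\<close> balancing
  the two.\<close>

lemma moment3:
  assumes z: "z \<ge> 1"
  shows "measure_pmf.expectation (Q z) (\<lambda>w. \<bar>real w - real z\<bar> ^ 3) \<le> 2 * C * (real z * sqrt (real z))"
proof -
  define r where "r = sqrt (real z)"
  have r: "r \<ge> 1" "r * r = real z" using z by (auto simp: r_def)
  have rr: "r * (r * x) = real z * x" for x by (simp flip: r(2))
  have "measure_pmf.expectation (Q z) (\<lambda>w. \<bar>real w - real z\<bar> ^ 3) \<le>
      measure_pmf.expectation (Q z) (\<lambda>w. (r * (real w - real z)\<^sup>2 + (real w - real z) ^ 4 / r) / 2)"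
  proof (rule integral_mono)
    fix w
    define e where "e = \<bar>real w - real z\<bar>"
    have "2 * r * e \<le> r\<^sup>2 + e\<^sup>2"
      using zero_le_power2[of "r - e"] by (simp add: power2_eq_square algebra_simps)
    then have "e\<^sup>2 * (2 * r * e) \<le> e\<^sup>2 * (r\<^sup>2 + e\<^sup>2)" by (intro mult_left_mono) auto
    then have "r * (2 * e ^ 3) \<le> r * (r * e\<^sup>2 + e ^ 4 / r)"
      using r by (simp add: power2_eq_square power3_eq_cube algebra_simps eval_nat_numeral rr)
    then have "2 * e ^ 3 \<le> r * e\<^sup>2 + e ^ 4 / r" using r by simp
    then show "\<bar>real w - real z\<bar> ^ 3 \<le> (r * (real w - real z)\<^sup>2 + (real w - real z) ^ 4 / r) / 2"
      by (simp add: e_def power_even_abs)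
  qed (use integrable_diff[OF z] integrable4[OF z] in auto)
  also have "\<dots> = (r * measure_pmf.expectation (Q z) (\<lambda>w. (real w - real z)\<^sup>2)
      + measure_pmf.expectation (Q z) (\<lambda>w. (real w - real z) ^ 4) / r) / 2"
    using integrable_diff[OF z] integrable4[OF z] by simp
  also have "\<dots> \<le> (r * (2 * C * real z) + C * (real z)\<^sup>2 / r) / 2"
  proof -
    have "C * r \<le> C * real z" using r C1 mult_left_mono[of 1 r r] by (intro mult_left_mono) auto
    moreover have "real z \<le> C * real z" using C1 mult_right_mono[of 1 C "real z"] by simp
    ultimately have "measure_pmf.expectation (Q z) (\<lambda>w. (real w - real z)\<^sup>2) \<le> 2 * C * real z"
      using moment2[OF z] by (simp add: r_def abs_le_iff)
    then show ?thesis
      using moment4[OF z] r by (intro divide_right_mono add_mono mult_left_mono) auto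
  qed
  also have zr: "(real z)\<^sup>2 / r = real z * r" using r by (simp add: power2_eq_square field_simps flip: r(2))
  have "(r * (2 * C * real z) + C * (real z)\<^sup>2 / r) / 2 = 3/2 * C * (real z * r)"
    unfolding times_divide_eq_right[symmetric] zr by (simp add: algebra_simps)
  also have "\<dots> \<le> 2 * C * (real z * r)" using C1 r by (intro mult_right_mono) auto
  finally show ?thesis by (simp add: r_def)
qed

lemma integrable_Q:
  assumes "z \<ge> 1"
  shows "integrable (measure_pmf (Q z)) real" "integrable (measure_pmf (Q z)) (\<lambda>w. (real w)\<^sup>2)"
proof -
  have 1: "integrable (measure_pmf (Q z)) (\<lambda>w. (real w - real z) + real z)"
    using integrable_diff(1)[OF assms] by (intro Bochner_Integration.integrable_add) auto
  then show "integrable (measure_pmf (Q z)) real" by simp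
  have "integrable (measure_pmf (Q z)) (\<lambda>w. (real w - real z)\<^sup>2 + 2 * real z * real w - (real z)\<^sup>2)"
    using integrable_diff(2)[OF assms] 1 by (intro Bochner_Integration.integrable_add Bochner_Integration.integrable_diff) auto
  moreover have "(\<lambda>w. (real w - real z)\<^sup>2 + 2 * real z * real w - (real z)\<^sup>2) = (\<lambda>w. (real w)\<^sup>2)"
    by (rule ext) (simp add: power2_eq_square algebra_simps)
  ultimately show "integrable (measure_pmf (Q z)) (\<lambda>w. (real w)\<^sup>2)" by simp
qed

text \<open>Large enough to serve both estimates below, which yield first and second moments of
  order \<open>n\<close> and \<open>n\<^sup>2\<close> after \<open>n\<close> steps.\<close>

definition growth :: real where "growth = 2 * m + 5 * C"

lemma kernel_growth:
  assumes z: "z \<ge> 1"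
  shows "measure_pmf.expectation (Q z) real \<le> real z + growth"
    and "measure_pmf.expectation (Q z) (\<lambda>w. (real w)\<^sup>2) \<le> (real z)\<^sup>2 + growth * real z"
proof -
  define e1 where "e1 = measure_pmf.expectation (Q z) (\<lambda>w. real w - real z)"
  define e2 where "e2 = measure_pmf.expectation (Q z) (\<lambda>w. (real w - real z)\<^sup>2)"
  note i = integrable_diff[OF z] integrable_Q[OF z]
  have r1: "sqrt (real z) \<ge> 1" using z by simp
  have "sqrt (real z) * 1 \<le> sqrt (real z) * sqrt (real z)" using r1 by (intro mult_left_mono) auto
  with r1 have r: "sqrt (real z) \<ge> 1" "sqrt (real z) \<le> real z" by simp_all
  have "C / sqrt (real z) \<le> C / 1" using C1 r1 by (intro divide_left_mono) auto
  then have e1: "e1 \<le> m + C" using moment1[OF z] unfolding e1_def by (simp add: abs_le_iff)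
  have "C * sqrt (real z) \<le> C * real z" using C1 r by (intro mult_left_mono) auto
  then have e2: "e2 \<le> 2/3 * real z + C * real z" using moment2[OF z] unfolding e2_def abs_le_iff by linarith
  have "measure_pmf.expectation (Q z) real = real z + e1" unfolding e1_def using i by simp
  then show "measure_pmf.expectation (Q z) real \<le> real z + growth" using e1 m_pos C1 by (simp add: growth_def)
  have eq: "(\<lambda>w. (real w)\<^sup>2) = (\<lambda>w. (real w - real z)\<^sup>2 + 2 * real z * (real w - real z) + (real z)\<^sup>2)"
    by (rule ext) (simp add: power2_eq_square algebra_simps)
  have "measure_pmf.expectation (Q z) (\<lambda>w. (real w)\<^sup>2) = e2 + 2 * real z * e1 + (real z)\<^sup>2"
    unfolding eq e1_def e2_def using i by simp
  also have "\<dots> \<le> (2/3 * real z + C * real z) + 2 * real z * (m + C) + (real z)\<^sup>2"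
    using e1 e2 by (intro add_mono mult_left_mono) auto
  also have "\<dots> \<le> (real z)\<^sup>2 + growth * real z"
    using mult_right_mono[OF C1, of "real z"] unfolding growth_def by (simp add: algebra_simps)
  finally show "measure_pmf.expectation (Q z) (\<lambda>w. (real w)\<^sup>2) \<le> (real z)\<^sup>2 + growth * real z" .
qed

end

section \<open>Laplace functionals of one step\<close>

lemma exp_taylor3_bound:
  fixes x y :: real
  assumes "x \<ge> 0" "y \<ge> 0"
  shows "\<bar>exp (- y) - exp (- x) * (1 - (y - x) + (y - x)\<^sup>2 / 2)\<bar> \<le> \<bar>y - x\<bar> ^ 3 / 6"
proof (cases "y = x")
  case False
  define d where "d = (\<lambda>n::nat. \<lambda>t::real. (- 1) ^ n * exp (- t))"
  have "\<exists>t. (if y < x then y < t \<and> t < x else x < t \<and> t < y) \<and>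
      exp (- y) = (\<Sum>n<3. d n x / fact n * (y - x) ^ n) + d 3 t / fact 3 * (y - x) ^ 3"
  proof (rule Taylor[where a = "min x y" and b = "max x y"])
    show "\<forall>n t. n < 3 \<and> min x y \<le> t \<and> t \<le> max x y \<longrightarrow> (d n has_real_derivative d (Suc n) t) (at t)"
      unfolding d_def by (auto intro!: derivative_eq_intros)
  qed (use False in \<open>auto simp: d_def\<close>)
  then obtain t where "if y < x then y < t \<and> t < x else x < t \<and> t < y" and eq: "exp (- y) = (\<Sum>n<3. d n x / fact n * (y - x) ^ n) + d 3 t / fact 3 * (y - x) ^ 3"
    by blast
  then have t: "t \<ge> 0" using assms by (auto split: if_splits)
  have "exp (- y) - exp (- x) * (1 - (y - x) + (y - x)\<^sup>2 / 2) = - exp (- t) / 6 * (y - x) ^ 3"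
    using eq by (simp add: d_def eval_nat_numeral algebra_simps fact_numeral)
  then have "\<bar>exp (- y) - exp (- x) * (1 - (y - x) + (y - x)\<^sup>2 / 2)\<bar> = exp (- t) / 6 * \<bar>y - x\<bar> ^ 3"
    by (simp add: abs_mult power_abs)
  also have "\<dots> \<le> 1 / 6 * \<bar>y - x\<bar> ^ 3" using t by (intro mult_right_mono divide_right_mono) auto
  finally show ?thesis by simp
qed simp

context diffusive_kernel
begin

text \<open>Second-order Taylor expansion around \<open>z\<close>. The three error terms come from
  the errors of the mean and the variance and from the third moment. The bound is uniform over rates
  \<open>a \<le> l\<close>, because the rate will decrease as time passes.\<close>

lemma kernel_laplace:
  assumes z: "z \<ge> 1" and a: "0 \<le> a" "a \<le> l" and k: "k \<ge> 1"
  shows "\<bar>measure_pmf.expectation (Q z) (\<lambda>w. exp (- a * (real w / real k))) -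
      exp (- a * (real z / real k)) * (1 - a * m / real k + a\<^sup>2 / 3 * (real z / (real k)\<^sup>2))\<bar>
    \<le> l * C / (real k * sqrt (real z)) + l\<^sup>2 * C * sqrt (real z) / (2 * (real k)\<^sup>2) + l ^ 3 * C * (real z * sqrt (real z)) / (3 * real k ^ 3)"
proof -
  define p where "p = Q z"
  define \<delta> where "\<delta> = (\<lambda>w. real w - real z)"
  define K where "K = real k"
  define F where "F = exp (- a * (real z / K))"
  have K: "K \<ge> 1" using k by (simp add: K_def)
  have F: "0 \<le> F" "F \<le> 1" using a K by (auto simp: F_def)
  have l: "l \<ge> 0" using a by simp
  have i: "integrable p \<delta>" "integrable p (\<lambda>w. (\<delta> w)\<^sup>2)" "integrable p (\<lambda>w. \<bar>\<delta> w\<bar> ^ 3)"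
    using integrable_diff[OF z] by (simp_all add: p_def \<delta>_def[abs_def])
  define T where "T = (\<lambda>w. F * (1 - a / K * \<delta> w + a\<^sup>2 / (2 * K\<^sup>2) * (\<delta> w)\<^sup>2))"
  have iT: "integrable p T" unfolding T_def using i by simp
  have ie: "integrable p (\<lambda>w. exp (- a * (real w / K)))"
    by (rule measure_pmf.integrable_const_bound[of _ 1]) (use a K in auto)
  have pt: "\<bar>exp (- a * (real w / K)) - T w\<bar> \<le> l ^ 3 / (6 * K ^ 3) * \<bar>\<delta> w\<bar> ^ 3" for w
  proof -
    have "\<bar>exp (- (a * (real w / K))) - exp (- (a * (real z / K))) * (1 - (a * (real w / K) - a * (real z / K)) + (a * (real w / K) - a * (real z / K))\<^sup>2 / 2)\<bar>
       \<le> \<bar>a * (real w / K) - a * (real z / K)\<bar> ^ 3 / 6"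
      using a K by (intro exp_taylor3_bound) auto
    moreover have "a * (real w / K) - a * (real z / K) = a / K * \<delta> w"
      by (simp add: \<delta>_def diff_divide_distrib algebra_simps)
    moreover have "T w = exp (- (a * (real z / K))) * (1 - a / K * \<delta> w + (a / K * \<delta> w)\<^sup>2 / 2)"
      by (simp add: T_def F_def power_mult_distrib power_divide)
    ultimately have "\<bar>exp (- a * (real w / K)) - T w\<bar> \<le> \<bar>a / K * \<delta> w\<bar> ^ 3 / 6"
      by simp
    also have "\<dots> = a ^ 3 / (6 * K ^ 3) * \<bar>\<delta> w\<bar> ^ 3"
      using a K by (simp add: abs_mult power_mult_distrib power_divide)
    also have "\<dots> \<le> l ^ 3 / (6 * K ^ 3) * \<bar>\<delta> w\<bar> ^ 3"
      using a K by (intro mult_right_mono divide_right_mono power_mono) auto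
    finally show ?thesis .
  qed
  have "\<bar>measure_pmf.expectation p (\<lambda>w. exp (- a * (real w / K))) - measure_pmf.expectation p T\<bar>
      = \<bar>measure_pmf.expectation p (\<lambda>w. exp (- a * (real w / K)) - T w)\<bar>" using ie iT by simp
  also have "\<dots> \<le> measure_pmf.expectation p (\<lambda>w. \<bar>exp (- a * (real w / K)) - T w\<bar>)"
    by (rule integral_abs_bound)
  also have "\<dots> \<le> measure_pmf.expectation p (\<lambda>w. l ^ 3 / (6 * K ^ 3) * \<bar>\<delta> w\<bar> ^ 3)"
    using pt ie iT i by (intro integral_mono) auto
  also have "\<dots> = l ^ 3 / (6 * K ^ 3) * measure_pmf.expectation p (\<lambda>w. \<bar>\<delta> w\<bar> ^ 3)" by simp
  also have "\<dots> \<le> l ^ 3 / (6 * K ^ 3) * (2 * C * (real z * sqrt (real z)))"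
    using moment3[OF z] l K by (intro mult_left_mono) (auto simp: p_def \<delta>_def)
  finally have 1: "\<bar>measure_pmf.expectation p (\<lambda>w. exp (- a * (real w / K))) - measure_pmf.expectation p T\<bar>
      \<le> l ^ 3 * C * (real z * sqrt (real z)) / (3 * K ^ 3)" by (simp add: mult_ac)
  define e1 where "e1 = measure_pmf.expectation p \<delta>"
  define e2 where "e2 = measure_pmf.expectation p (\<lambda>w. (\<delta> w)\<^sup>2)"
  have ET: "measure_pmf.expectation p T = F * (1 - a / K * e1 + a\<^sup>2 / (2 * K\<^sup>2) * e2)"
    unfolding T_def e1_def e2_def using i by simp
  have "F * (1 - a / K * e1 + a\<^sup>2 / (2 * K\<^sup>2) * e2) - F * (1 - a * m / K + a\<^sup>2 / 3 * (real z / K\<^sup>2))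
     = F * (- (a / K * (e1 - m)) + a\<^sup>2 / (2 * K\<^sup>2) * (e2 - 2/3 * real z))"
    using K by (simp add: field_simps)
  then have "\<bar>F * (1 - a / K * e1 + a\<^sup>2 / (2 * K\<^sup>2) * e2) - F * (1 - a * m / K + a\<^sup>2 / 3 * (real z / K\<^sup>2))\<bar>
     = F * \<bar>- (a / K * (e1 - m)) + a\<^sup>2 / (2 * K\<^sup>2) * (e2 - 2/3 * real z)\<bar>" using F by (simp add: abs_mult)
  also have "\<dots> \<le> 1 * (\<bar>a / K * (e1 - m)\<bar> + \<bar>a\<^sup>2 / (2 * K\<^sup>2) * (e2 - 2/3 * real z)\<bar>)"
  proof -
    have tri: "\<bar>- X + Y\<bar> \<le> \<bar>X\<bar> + \<bar>Y\<bar>" for X Y :: real by linarith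
    show ?thesis by (rule mult_mono[OF F(2) tri]) auto
  qed
  also have "\<dots> = a / K * \<bar>e1 - m\<bar> + a\<^sup>2 / (2 * K\<^sup>2) * \<bar>e2 - 2/3 * real z\<bar>"
    using a K by (simp add: abs_mult)
  also have "\<dots> \<le> l / K * (C / sqrt (real z)) + l\<^sup>2 / (2 * K\<^sup>2) * (C * sqrt (real z))"
    using moment1[OF z] moment2[OF z] a K C1
    by (intro add_mono mult_mono divide_right_mono power_mono) (auto simp: e1_def e2_def p_def \<delta>_def)
  finally have 2: "\<bar>measure_pmf.expectation p T - F * (1 - a * m / K + a\<^sup>2 / 3 * (real z / K\<^sup>2))\<bar>
     \<le> l * C / (K * sqrt (real z)) + l\<^sup>2 * C * sqrt (real z) / (2 * K\<^sup>2)" unfolding ET by (simp add: mult_ac)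
  show ?thesis using 1 2 unfolding p_def[symmetric] K_def[symmetric] F_def[symmetric] by linarith
qed

end

section \<open>The explicit exponential solutions\<close>

text \<open>The solution of the Riccati equation \<open>a' = - a\<^sup>2 / 3\<close> with initial
  value \<open>l\<close>.\<close>

definition cir_rate :: "real \<Rightarrow> real \<Rightarrow> real" where
  "cir_rate l t = l / (1 + l * t / 3)"

text \<open>The Laplace transform at \<open>l\<close> of the law at time \<open>t\<close> of the
  limit diffusion started from \<open>x\<close>, a Cox-Ingersoll-Ross process without mean
  reversion.\<close>

definition cir_laplace :: "real \<Rightarrow> real \<Rightarrow> real \<Rightarrow> real \<Rightarrow> real" where
  "cir_laplace m l t x = (1 + l * t / 3) powr (- 3 * m) * exp (- cir_rate l t * x)"

lemma cir_rate_bounds: "l \<ge> 0 \<Longrightarrow> t \<ge> 0 \<Longrightarrow> 0 \<le> cir_rate l t" "l \<ge> 0 \<Longrightarrow> t \<ge> 0 \<Longrightarrow> cir_rate l t \<le> l"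
proof -
  assume "l \<ge> 0" "t \<ge> 0"
  then have "0 \<le> l * t" by simp
  then have "1 + l * t / 3 \<ge> 1" by simp
  with \<open>l \<ge> 0\<close> show "0 \<le> cir_rate l t" "cir_rate l t \<le> l"
    by (auto simp: cir_rate_def divide_le_eq mult_le_cancel_left1)
qed

lemma cir_rate_deriv:
  assumes "l \<ge> 0" "t \<ge> 0"
  shows "(cir_rate l has_real_derivative - ((cir_rate l t)\<^sup>2 / 3)) (at t)"
proof -
  define D where "D = (\<lambda>t. 1 + l * t / 3)"
  have D: "D t \<noteq> 0" using assms by (simp add: D_def add_nonneg_eq_0_iff)
  have "(D has_real_derivative l / 3) (at t)" unfolding D_def by (auto intro!: derivative_eq_intros)
  from DERIV_divide[OF DERIV_const this D, of l]
  show ?thesis unfolding cir_rate_def[abs_def] by (simp add: D_def power2_eq_square mult_ac)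
qed

lemma cir_laplace_nonneg: "0 \<le> cir_laplace m l t x"
  by (simp add: cir_laplace_def)

lemma cir_laplace_le_1:
  assumes "m \<ge> 0" "l \<ge> 0" "t \<ge> 0" "x \<ge> 0"
  shows "cir_laplace m l t x \<le> 1"
proof -
  have "(1 + l * t / 3) powr (- 3 * m) \<le> (1 + l * t / 3) powr 0"
    using assms by (intro powr_mono) auto
  moreover have "1 + l * t / 3 > 0" using assms by (simp add: add_pos_nonneg)
  ultimately have "(1 + l * t / 3) powr (- 3 * m) \<le> 1" by simp
  moreover have "exp (- cir_rate l t * x) \<le> 1" using cir_rate_bounds[OF assms(2,3)] assms by simp
  ultimately show ?thesis unfolding cir_laplace_def by (intro mult_le_one) auto
qed

lemma cir_laplace_0: "cir_laplace m l 0 x = exp (- l * x)"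
  by (simp add: cir_laplace_def cir_rate_def)

lemma cir_laplace_deriv_t:
  assumes "l \<ge> 0" "t \<ge> 0"
  shows "((\<lambda>t. cir_laplace m l t x) has_real_derivative
      (- m * cir_rate l t + (cir_rate l t)\<^sup>2 * x / 3) * cir_laplace m l t x) (at t)"
proof -
  have p: "1 + l * t / 3 > 0" using assms by (simp add: add_pos_nonneg)
  have c1: "((\<lambda>t. (1 + l * t / 3) powr (- 3 * m)) has_real_derivative - m * cir_rate l t * (1 + l * t / 3) powr (- 3 * m)) (at t)"
  proof -
    define D where "D = (\<lambda>t. 1 + l * t / 3)"
    have D: "D t > 0" using p by (simp add: D_def)
    have dD: "(D has_real_derivative l / 3) (at t)" unfolding D_def by (auto intro!: derivative_eq_intros)
    have "((\<lambda>t. D t powr (- 3 * m)) has_real_derivative (- 3 * m) * D t powr (- 3 * m - 1) * (l / 3)) (at t)"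
      using DERIV_chain2[OF has_real_derivative_powr[OF D] dD] .
    moreover have "(- 3 * m) * D t powr (- 3 * m - 1) * (l / 3) = - m * (l / D t) * D t powr (- 3 * m)"
      using D by (simp add: powr_diff)
    ultimately show ?thesis by (simp add: D_def cir_rate_def)
  qed
  have c2: "((\<lambda>t. exp (- cir_rate l t * x)) has_real_derivative ((cir_rate l t)\<^sup>2 * x / 3) * exp (- cir_rate l t * x)) (at t)"
    using p by (auto intro!: derivative_eq_intros cir_rate_deriv assms simp: field_simps)
  show ?thesis unfolding cir_laplace_def
    by (rule DERIV_cong[OF DERIV_mult[OF c1 c2]]) (simp add: algebra_simps)
qed

text \<open>With \<open>f' = g * f\<close> the second time derivative is
  \<open>(g' + g\<^sup>2) * f\<close>. Since \<open>f\<close> lies between 0 and 1, it is bounded by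
  a quadratic polynomial in \<open>x\<close>, whose mean along the chain can be controlled.\<close>

lemma cir_laplace_time_taylor:
  assumes m: "m \<ge> 0" and l: "l \<ge> 0" and t: "t \<ge> 0" and h: "h \<ge> 0" and x: "x \<ge> 0"
  shows "\<bar>cir_laplace m l (t + h) x - cir_laplace m l t x
      - h * ((- m * cir_rate l t + (cir_rate l t)\<^sup>2 * x / 3) * cir_laplace m l t x)\<bar>
    \<le> h\<^sup>2 * (m * l\<^sup>2 + l ^ 3 * x + (m * l + l\<^sup>2 * x)\<^sup>2)"
proof (cases "h = 0")
  case False
  define B where "B = m * l\<^sup>2 + l ^ 3 * x + (m * l + l\<^sup>2 * x)\<^sup>2"
  define g where "g = (\<lambda>t. - m * cir_rate l t + (cir_rate l t)\<^sup>2 * x / 3)"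
  define f where "f = (\<lambda>t. cir_laplace m l t x)"
  define g' where "g' = (\<lambda>t. m * ((cir_rate l t)\<^sup>2 / 3) - 2 * cir_rate l t ^ 3 * x / 9)"
  have d1: "(f has_real_derivative g s * f s) (at s)" if "s \<ge> 0" for s
    using cir_laplace_deriv_t[OF l that] by (simp add: f_def g_def)
  have dg: "(g has_real_derivative g' s) (at s)" if "s \<ge> 0" for s
    unfolding g_def g'_def using l that
    by (auto intro!: derivative_eq_intros cir_rate_deriv simp: power2_eq_square power3_eq_cube field_simps)
  have d2: "((\<lambda>s. g s * f s) has_real_derivative (g' s + (g s)\<^sup>2) * f s) (at s)" if "s \<ge> 0" for s
    using DERIV_mult[OF dg[OF that] d1[OF that]] by (simp add: power2_eq_square algebra_simps)
  have f01: "0 \<le> f s" "f s \<le> 1" if "s \<ge> 0" for s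
    using cir_laplace_le_1[OF m l that x] cir_laplace_nonneg by (auto simp: f_def)
  have bound: "\<bar>(g' s + (g s)\<^sup>2) * f s\<bar> \<le> B" if s: "s \<ge> 0" for s
  proof -
    define a where "a = cir_rate l s"
    have a: "0 \<le> a" "a \<le> l" using cir_rate_bounds[OF l s] by (auto simp: a_def)
    have a2: "a\<^sup>2 \<le> l\<^sup>2" "a ^ 3 \<le> l ^ 3" using a by (auto intro: power_mono)
    have n: "m * (a\<^sup>2 / 3) \<ge> 0" "2 * a ^ 3 * x / 9 \<ge> 0" "m * a \<ge> 0" "a\<^sup>2 * x / 3 \<ge> 0" using a m x by auto
    have u: "m * a\<^sup>2 \<le> m * l\<^sup>2" "a ^ 3 * x \<le> l ^ 3 * x" "m * a \<le> m * l" "a\<^sup>2 * x \<le> l\<^sup>2 * x"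
      using a a2 m x by (auto intro: mult_left_mono mult_right_mono)
    have "\<bar>g' s\<bar> \<le> m * l\<^sup>2 + l ^ 3 * x" unfolding g'_def a_def[symmetric] using n u by linarith
    moreover have "\<bar>g s\<bar> \<le> m * l + l\<^sup>2 * x" unfolding g_def a_def[symmetric] using n u by linarith
    then have "\<bar>g s\<bar>\<^sup>2 \<le> (m * l + l\<^sup>2 * x)\<^sup>2" by (intro power_mono) auto
    then have "(g s)\<^sup>2 \<le> (m * l + l\<^sup>2 * x)\<^sup>2" by simp
    moreover have "0 \<le> (g s)\<^sup>2" by simp
    ultimately have "\<bar>g' s + (g s)\<^sup>2\<bar> \<le> B"
      unfolding B_def abs_le_iff by linarith
    then have "\<bar>g' s + (g s)\<^sup>2\<bar> * \<bar>f s\<bar> \<le> B * 1" using f01[OF s] by (intro mult_mono) auto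
    then show ?thesis by (simp add: abs_mult)
  qed
  have hp: "h > 0" using h False by simp
  obtain s where s: "t < s" "s < t + h" "f (t + h) - f t = (t + h - t) * (g s * f s)"
    using MVT2[of t "t + h" f "\<lambda>s. g s * f s"] d1 t hp by (meson less_add_same_cancel1 order_trans)
  obtain v where v: "t < v" "v < s" "g s * f s - g t * f t = (s - t) * ((g' v + (g v)\<^sup>2) * f v)"
    using MVT2[of t s "\<lambda>s. g s * f s" "\<lambda>s. (g' s + (g s)\<^sup>2) * f s"] d2 t s by (meson order_trans)
  have "f (t + h) - f t - h * (g t * f t) = h * (g s * f s - g t * f t)" using s(3) by (simp add: algebra_simps)
  also have "\<dots> = h * ((s - t) * ((g' v + (g v)\<^sup>2) * f v))" by (simp only: v(3))
  finally have "\<bar>f (t + h) - f t - h * (g t * f t)\<bar> = h * ((s - t) * \<bar>(g' v + (g v)\<^sup>2) * f v\<bar>)"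
    using hp s by (simp add: abs_mult)
  also have "\<dots> \<le> h * (h * B)"
    using bound[of v] v s t hp by (intro mult_left_mono mult_mono) auto
  finally show ?thesis unfolding f_def g_def B_def by (simp add: power2_eq_square)
qed simp

text \<open>For \<open>h < - 1/2\<close> the cubic term alone makes the right side negative.
  Otherwise Taylor's formula applies at a point with \<open>1 + t \<ge> 1/2\<close>, where the third
  derivative is at most \<open>2 * 8\<close> in absolute value.\<close>

lemma one_plus_powr_lower:
  fixes h g :: real
  assumes g: "0 < g" "g < 1" and h: "h \<ge> -1"
  shows "(1 + h) powr g \<ge> 1 + g * h - g * (1 - g) / 2 * h\<^sup>2 - 16 * \<bar>h\<bar> ^ 3"
proof -
  consider "h < -1/2" | "h \<ge> -1/2" by linarith
  then show ?thesis
  proof cases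
    case 1
    have "\<bar>h\<bar> ^ 3 \<ge> (1/2) ^ 3" using 1 by (intro power_mono) auto
    then have "16 * \<bar>h\<bar> ^ 3 \<ge> 2" by (simp add: power3_eq_cube)
    moreover have "g * h \<le> 0" using g 1 by (simp add: mult_nonneg_nonpos)
    moreover have "g * (1 - g) / 2 * h\<^sup>2 \<ge> 0" using g by simp
    moreover have "(1 + h) powr g \<ge> 0" by simp
    ultimately show ?thesis by linarith
  next
    case 2
    define c where "c = (\<lambda>n::nat. if n = 0 then 1 else if n = 1 then g else if n = 2 then g * (g - 1) else g * (g - 1) * (g - 2))"
    define d where "d = (\<lambda>n::nat. \<lambda>t::real. c n * (1 + t) powr (g - real n))"
    show ?thesis
    proof (cases "h = 0")
      case False
      have "\<exists>t. (if h < 0 then h < t \<and> t < 0 else 0 < t \<and> t < h) \<and>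
          (1 + h) powr g = (\<Sum>n<3. d n 0 / fact n * (h - 0) ^ n) + d 3 t / fact 3 * (h - 0) ^ 3"
      proof (rule Taylor[where a = "min 0 h" and b = "max 0 h"])
        show "\<forall>n t. n < 3 \<and> min 0 h \<le> t \<and> t \<le> max 0 h \<longrightarrow> (d n has_real_derivative d (Suc n) t) (at t)"
        proof (intro allI impI)
          fix n :: nat and t assume A: "n < 3 \<and> min 0 h \<le> t \<and> t \<le> max 0 h"
          then have t: "1 + t > 0" using 2 by (auto simp: min_def split: if_splits)
          have cn: "c (Suc n) = c n * (g - real n)" using A by (auto simp: c_def eval_nat_numeral less_Suc_eq)
          have dt: "((\<lambda>t. 1 + t) has_real_derivative 1) (at t)" by (auto intro!: derivative_eq_intros)
          have "((\<lambda>t. c n * (1 + t) powr (g - real n)) has_real_derivative c n * ((g - real n) * (1 + t) powr (g - real n - 1) * 1)) (at t)"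
            by (rule DERIV_cmult, rule DERIV_chain2[OF has_real_derivative_powr[OF t] dt])
          then show "(d n has_real_derivative d (Suc n) t) (at t)"
            by (simp add: d_def[abs_def] cn diff_diff_eq add.commute mult.assoc)
        qed
      qed (use False in \<open>auto simp: d_def c_def\<close>)
      then obtain t where t: "if h < 0 then h < t \<and> t < 0 else 0 < t \<and> t < h"
        and eq: "(1 + h) powr g = (\<Sum>n<3. d n 0 / fact n * (h - 0) ^ n) + d 3 t / fact 3 * (h - 0) ^ 3"
        by blast
      have tp: "1 + t \<ge> 1/2" using t 2 by (auto split: if_splits)
      have "(1 + h) powr g = 1 + g * h - g * (1 - g) / 2 * h\<^sup>2 + d 3 t / 6 * h ^ 3"
      proof -
        have "(\<Sum>n<3. d n 0 / fact n * (h - 0) ^ n) = 1 + g * h + g * (g - 1) / 2 * h\<^sup>2"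
          by (simp add: d_def c_def eval_nat_numeral)
        moreover have "g * (g - 1) / 2 * h\<^sup>2 = - (g * (1 - g) / 2 * h\<^sup>2)" by (simp add: field_simps)
        ultimately show ?thesis using eq by (simp add: fact_numeral)
      qed
      moreover have "\<bar>d 3 t / 6 * h ^ 3\<bar> \<le> 16 * \<bar>h\<bar> ^ 3"
      proof -
        have "(1 + t) powr (g - 3) \<le> (1/2) powr (g - 3)"
          using tp g by (intro powr_mono2') auto
        also have "\<dots> \<le> (1/2) powr (- 3)" using g by (intro powr_mono') auto
        also have "\<dots> = 8" by (simp add: powr_minus powr_numeral power_divide)
        finally have p: "(1 + t) powr (g - 3) \<le> 8" .
        have "\<bar>g * (g - 1) * (g - 2)\<bar> \<le> 1 * 1 * 2"
          unfolding abs_mult using g by (intro mult_mono) auto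
        then have "\<bar>d 3 t\<bar> \<le> 2 * 8"
          unfolding d_def abs_mult using p by (intro mult_mono) (auto simp: c_def abs_mult)
        then have "\<bar>d 3 t / 6\<bar> \<le> 16" by simp
        then have "\<bar>d 3 t / 6\<bar> * \<bar>h ^ 3\<bar> \<le> 16 * \<bar>h ^ 3\<bar>" by (intro mult_right_mono) auto
        then show ?thesis by (simp add: abs_mult power_abs)
      qed
      ultimately show ?thesis by linarith
    qed simp
  qed
qed

context diffusive_kernel
begin

text \<open>
  The drift of \<open>z\<^sup>g\<close> is \<open>g z\<^sup>g\<^sup>-\<^sup>1 (m - (1 - g) / 3 + o(1))\<close>, which is positive for \<open>1 - g \<le> m\<close>.
\<close>

lemma powr_drift:
  obtains g :: real and z0 :: nat where "0 < g" "g < 1" "z0 \<ge> L" "z0 \<ge> 1"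
    "\<And>z. z \<ge> z0 \<Longrightarrow> measure_pmf.expectation (Q z) (\<lambda>w. real w powr g) \<ge> real z powr g"
    "\<And>z. z \<ge> 1 \<Longrightarrow> integrable (measure_pmf (Q z)) (\<lambda>w. real w powr g)"
proof -
  \<comment> \<open>Apart from \<open>1 - g \<le> m\<close>, the exponent is kept at least 1/2, so
    that \<open>g\<close> times the surplus \<open>64 * C\<close> found below still covers the
    third-moment error \<open>32 * C\<close>.\<close>
  define g where "g = max (1/2) (1 - m)"
  have g: "0 < g" "g < 1" "1 - g \<le> m" using m_pos by (auto simp: g_def)
  have ig: "integrable (measure_pmf (Q z)) (\<lambda>w. real w powr g)" if z: "z \<ge> 1" for z
  proof (rule Bochner_Integration.integrable_bound[OF integrable_Q(1)[OF z]])
    show "AE w in Q z. norm (real w powr g) \<le> norm (real w)"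
      unfolding AE_measure_pmf_iff
    proof
      fix w assume "w \<in> set_pmf (Q z)"
      then have "real w \<ge> 1" using supp[OF z] by auto
      then have "real w powr g \<le> real w powr 1" using g by (intro powr_mono) auto
      then show "norm (real w powr g) \<le> norm (real w)" using \<open>real w \<ge> 1\<close> by simp
    qed
  qed simp
  \<comment> \<open>From \<open>z \<ge> c\<^sup>2\<close> it follows that
    \<open>100 * C \<le> m * sqrt z\<close>, so the drift dominates all error terms.\<close>
  define c where "c = 100 * C / m"
  define z0 where "z0 = nat \<lceil>c\<^sup>2\<rceil> + L + 1"
  have key: "measure_pmf.expectation (Q z) (\<lambda>w. real w powr g) \<ge> real z powr g" if z: "z \<ge> z0" for z
  proof -
    have z1: "z \<ge> 1" using z by (simp add: z0_def)
    define Z where "Z = real z"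
    define r where "r = sqrt Z"
    have Z1: "Z \<ge> 1" using z1 by (simp add: Z_def)
    have r: "r \<ge> 1" "r * r = Z" using Z1 by (auto simp: r_def)
    have "c\<^sup>2 \<le> real (nat \<lceil>c\<^sup>2\<rceil>)" by (rule real_nat_ceiling_ge)
    also have "\<dots> \<le> Z" using z by (simp add: z0_def Z_def)
    finally have "c \<le> r" unfolding r_def by (rule real_le_rsqrt)
    then have cr: "100 * C \<le> m * r" unfolding c_def using m_pos by (simp add: pos_divide_le_eq mult.commute)
    define p where "p = Q z"
    define \<delta> where "\<delta> = (\<lambda>w. real w - Z)"
    have i: "integrable p \<delta>" "integrable p (\<lambda>w. (\<delta> w)\<^sup>2)" "integrable p (\<lambda>w. \<bar>\<delta> w\<bar> ^ 3)"
      using integrable_diff[OF z1] by (simp_all add: p_def \<delta>_def[abs_def] Z_def)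
    define e1 where "e1 = measure_pmf.expectation p \<delta>"
    define e2 where "e2 = measure_pmf.expectation p (\<lambda>w. (\<delta> w)\<^sup>2)"
    define e3 where "e3 = measure_pmf.expectation p (\<lambda>w. \<bar>\<delta> w\<bar> ^ 3)"
    have e1: "m - C / r \<le> e1" using moment1[OF z1] by (simp add: e1_def p_def \<delta>_def Z_def r_def abs_le_iff)
    have e2: "e2 \<le> 2/3 * Z + C * r" using moment2[OF z1] by (simp add: e2_def p_def \<delta>_def Z_def r_def abs_le_iff)
    have e3: "e3 \<le> 2 * C * (Z * r)" using moment3[OF z1] by (simp add: e3_def p_def \<delta>_def Z_def r_def)
    have pt: "real w powr g \<ge> Z powr g * (1 + g / Z * \<delta> w - g * (1 - g) / (2 * Z\<^sup>2) * (\<delta> w)\<^sup>2 - 16 / Z ^ 3 * \<bar>\<delta> w\<bar> ^ 3)" for w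
    proof -
      have "\<delta> w / Z \<ge> -1" using Z1 by (simp add: \<delta>_def pos_le_divide_eq)
      from one_plus_powr_lower[OF g(1,2) this]
      have "(1 + \<delta> w / Z) powr g \<ge> 1 + g / Z * \<delta> w - g * (1 - g) / (2 * Z\<^sup>2) * (\<delta> w)\<^sup>2 - 16 / Z ^ 3 * \<bar>\<delta> w\<bar> ^ 3"
        using Z1 by (simp add: power_divide abs_divide)
      moreover have "Z * (1 + \<delta> w / Z) = real w" using Z1 by (simp add: \<delta>_def field_simps)
      moreover have "(Z * (1 + \<delta> w / Z)) powr g = Z powr g * (1 + \<delta> w / Z) powr g"
        by (rule powr_mult)
      ultimately have "(1 + \<delta> w / Z) powr g \<ge> 1 + g / Z * \<delta> w - g * (1 - g) / (2 * Z\<^sup>2) * (\<delta> w)\<^sup>2 - 16 / Z ^ 3 * \<bar>\<delta> w\<bar> ^ 3"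
        "real w powr g = Z powr g * (1 + \<delta> w / Z) powr g" by simp_all
      then show ?thesis by (simp only:) (intro mult_left_mono, auto)
    qed
    have "Z powr g * (1 + g / Z * e1 - g * (1 - g) / (2 * Z\<^sup>2) * e2 - 16 / Z ^ 3 * e3)
      = measure_pmf.expectation p (\<lambda>w. Z powr g * (1 + g / Z * \<delta> w - g * (1 - g) / (2 * Z\<^sup>2) * (\<delta> w)\<^sup>2 - 16 / Z ^ 3 * \<bar>\<delta> w\<bar> ^ 3))"
      unfolding e1_def e2_def e3_def using i by simp
    also have "\<dots> \<le> measure_pmf.expectation p (\<lambda>w. real w powr g)"
      using i ig[OF z1] pt by (intro integral_mono) (auto simp: p_def)
    finally have low: "Z powr g * (1 + g / Z * e1 - g * (1 - g) / (2 * Z\<^sup>2) * e2 - 16 / Z ^ 3 * e3)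
      \<le> measure_pmf.expectation p (\<lambda>w. real w powr g)" .
    have "g / Z * e1 \<ge> g / Z * (m - C / r)" using e1 g Z1 by (intro mult_left_mono) auto
    moreover have "g * (1 - g) / (2 * Z\<^sup>2) * e2 \<le> g * (1 - g) / (2 * Z\<^sup>2) * (2/3 * Z + C * r)"
      using e2 g by (intro mult_left_mono) auto
    moreover have "16 / Z ^ 3 * e3 \<le> 16 / Z ^ 3 * (2 * C * (Z * r))"
      using e3 Z1 by (intro mult_left_mono) auto
    moreover have "g / Z * (m - C / r) - g * (1 - g) / (2 * Z\<^sup>2) * (2/3 * Z + C * r) - 16 / Z ^ 3 * (2 * C * (Z * r)) \<ge> 0"
    proof -
      have "g / Z * (m - C / r) - g * (1 - g) / (2 * Z\<^sup>2) * (2/3 * Z + C * r) - 16 / Z ^ 3 * (2 * C * (Z * r))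
        = (g * (m * r - C) - g * (1 - g) * (r / 3 + C / 2) - 32 * C) / (Z * r)"
      proof -
        have "r \<noteq> 0" using r by simp
        then show ?thesis unfolding r(2)[symmetric] by (simp add: field_simps eval_nat_numeral)
      qed
      moreover have "g * (m * r - C) - g * (1 - g) * (r / 3 + C / 2) - 32 * C \<ge> 0"
      proof -
        have "(1 - g) * (r / 3 + C / 2) \<le> m * (r / 3) + 1 * (C / 2)"
          unfolding distrib_left using g r C1 by (intro add_mono mult_right_mono) auto
        then have "m * r - C - (1 - g) * (r / 3 + C / 2) \<ge> 2/3 * (m * r) - 3/2 * C" by simp
        also have "2/3 * (m * r) - 3/2 * C \<ge> 64 * C" using cr C1 by linarith
        finally have "m * r - C - (1 - g) * (r / 3 + C / 2) \<ge> 64 * C" .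
        then have "g * (m * r - C - (1 - g) * (r / 3 + C / 2)) \<ge> 1/2 * (64 * C)"
          using C1 by (intro mult_mono) (auto simp: g_def)
        then show ?thesis by (simp add: algebra_simps)
      qed
      ultimately show ?thesis using Z1 r by simp
    qed
    ultimately have "1 \<le> 1 + g / Z * e1 - g * (1 - g) / (2 * Z\<^sup>2) * e2 - 16 / Z ^ 3 * e3" by linarith
    then have "Z powr g * 1 \<le> Z powr g * (1 + g / Z * e1 - g * (1 - g) / (2 * Z\<^sup>2) * e2 - 16 / Z ^ 3 * e3)"
      by (intro mult_left_mono) auto
    with low show ?thesis by (simp add: p_def Z_def)
  qed
  show thesis by (rule that[of g z0]) (use g key ig in \<open>auto simp: z0_def\<close>)
qed

end

section \<open>Moments and occupation times of the chain\<close>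

locale diffusive_chain = diffusive_kernel Q m C for Q m C +
  fixes M :: "'a measure" and n0 :: nat and Z :: "nat \<Rightarrow> 'a \<Rightarrow> nat"
  assumes chain: "markov_chain M Q n0 Z" and start: "n0 \<ge> 1"
begin

sublocale prob_space M using chain by (simp add: markov_chain_def)

lemma measurable_Z [measurable]: "Z n \<in> M \<rightarrow>\<^sub>M count_space UNIV"
  using chain by (simp add: markov_chain_def)

lemma measurable_hist [measurable]: "history Z n \<in> M \<rightarrow>\<^sub>M count_space UNIV"
  by (rule measurable_history) simp

lemma chain_step:
  "(\<integral>\<^sup>+\<omega>. ennreal (f (Z (Suc n) \<omega>)) \<partial>M) = (\<integral>\<^sup>+\<omega>. (\<integral>\<^sup>+w. ennreal (f w) \<partial>Q (Z n \<omega>)) \<partial>M)"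
  using markov_chain_nn_integral[OF chain, of "\<lambda>_. 1" n "\<lambda>w. ennreal (f w)"] by simp

lemma AE_Z_ge_1: "AE \<omega> in M. Z n \<omega> \<ge> 1"
proof (induction n)
  case 0
  have "AE \<omega> in M. Z 0 \<omega> = n0" using chain by (simp add: markov_chain_def)
  then show ?case by eventually_elim (use start in simp)
next
  case (Suc n)
  have "(\<integral>\<^sup>+\<omega>. ennreal (indicator {0} (Z (Suc n) \<omega>)) \<partial>M) = (\<integral>\<^sup>+\<omega>. (\<integral>\<^sup>+w. ennreal (indicator {0} w) \<partial>Q (Z n \<omega>)) \<partial>M)"
    by (rule chain_step)
  also have "\<dots> = (\<integral>\<^sup>+\<omega>. 0 \<partial>M)"
  proof (rule nn_integral_cong_AE)
    show "AE \<omega> in M. (\<integral>\<^sup>+w. ennreal (indicator {0} w) \<partial>Q (Z n \<omega>)) = 0"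
      using Suc
    proof eventually_elim
      case (elim \<omega>)
      have "(\<integral>\<^sup>+w. ennreal (indicator {0} w) \<partial>Q (Z n \<omega>)) = (\<integral>\<^sup>+w. 0 \<partial>Q (Z n \<omega>))"
        using supp[OF elim] by (intro nn_integral_cong_AE) (auto simp: AE_measure_pmf_iff indicator_def)
      then show ?case by simp
    qed
  qed
  finally have "(\<integral>\<^sup>+\<omega>. ennreal (indicator {0} (Z (Suc n) \<omega>)) \<partial>M) = 0" by simp
  then have "AE \<omega> in M. ennreal (indicator {0} (Z (Suc n) \<omega>)) = 0"
    by (subst (asm) nn_integral_0_iff_AE) (auto intro: measurable_compose[OF measurable_Z])
  then show ?case by eventually_elim (auto simp: indicator_def split: if_splits)
qed

lemma nn_integral_Q_le:
  assumes "z \<ge> 1" "integrable (measure_pmf (Q z)) f" "\<And>w. f w \<ge> 0" "measure_pmf.expectation (Q z) f \<le> c"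
  shows "(\<integral>\<^sup>+w. ennreal (f w) \<partial>Q z) \<le> ennreal c"
  using assms by (subst nn_integral_eq_integral) (auto intro: ennreal_leI)

lemma first_moment_aux: "(\<integral>\<^sup>+\<omega>. ennreal (real (Z n \<omega>)) \<partial>M) \<le> ennreal (real n0 + real n * growth)"
proof (induction n)
  case 0
  have "AE \<omega> in M. Z 0 \<omega> = n0" using chain by (simp add: markov_chain_def)
  then have "(\<integral>\<^sup>+\<omega>. ennreal (real (Z 0 \<omega>)) \<partial>M) = (\<integral>\<^sup>+\<omega>. ennreal (real n0) \<partial>M)"
    by (intro nn_integral_cong_AE) auto
  then show ?case by (simp add: emeasure_space_1)
next
  case (Suc n)
  have g: "growth \<ge> 0" using m_pos C1 by (simp add: growth_def)
  have "(\<integral>\<^sup>+\<omega>. ennreal (real (Z (Suc n) \<omega>)) \<partial>M) = (\<integral>\<^sup>+\<omega>. (\<integral>\<^sup>+w. ennreal (real w) \<partial>Q (Z n \<omega>)) \<partial>M)"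
    by (rule chain_step)
  also have "\<dots> \<le> (\<integral>\<^sup>+\<omega>. ennreal (real (Z n \<omega>)) + ennreal growth \<partial>M)"
  proof (rule nn_integral_mono_AE)
    show "AE \<omega> in M. (\<integral>\<^sup>+w. ennreal (real w) \<partial>Q (Z n \<omega>)) \<le> ennreal (real (Z n \<omega>)) + ennreal growth"
      using AE_Z_ge_1[of n]
      by eventually_elim (use integrable_Q(1) kernel_growth(1) g in \<open>auto intro!: nn_integral_Q_le simp flip: ennreal_plus\<close>)
  qed
  also have "\<dots> = (\<integral>\<^sup>+\<omega>. ennreal (real (Z n \<omega>)) \<partial>M) + ennreal growth"
    by (subst nn_integral_add) (auto simp: emeasure_space_1)
  also have "\<dots> \<le> ennreal (real n0 + real n * growth) + ennreal growth" using Suc by (intro add_right_mono)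
  also have "\<dots> = ennreal (real n0 + real (Suc n) * growth)"
    using g by (simp add: algebra_simps flip: ennreal_plus)
  finally show ?case .
qed

definition size_const :: real where "size_const = real n0 + growth"

lemma size_const: "size_const \<ge> 1" "growth \<ge> 0" "growth \<le> size_const"
  using m_pos C1 start by (auto simp: size_const_def growth_def)

lemma first_moment_nn: "(\<integral>\<^sup>+\<omega>. ennreal (real (Z n \<omega>)) \<partial>M) \<le> ennreal (size_const * (real n + 1))"
proof -
  have "real n0 + real n * growth \<le> size_const * (real n + 1)"
    using size_const(2) by (simp add: size_const_def algebra_simps)
  then show ?thesis using first_moment_aux[of n] by (meson ennreal_leI order_trans)
qed

lemma second_moment_nn: "(\<integral>\<^sup>+\<omega>. ennreal ((real (Z n \<omega>))\<^sup>2) \<partial>M) \<le> ennreal (size_const\<^sup>2 * (real n + 1)\<^sup>2)"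
proof (induction n)
  case 0
  have "AE \<omega> in M. Z 0 \<omega> = n0" using chain by (simp add: markov_chain_def)
  then have "(\<integral>\<^sup>+\<omega>. ennreal ((real (Z 0 \<omega>))\<^sup>2) \<partial>M) = (\<integral>\<^sup>+\<omega>. ennreal ((real n0)\<^sup>2) \<partial>M)"
    by (intro nn_integral_cong_AE) auto
  moreover have "(real n0)\<^sup>2 \<le> size_const\<^sup>2" using size_const by (intro power_mono) (auto simp: size_const_def)
  ultimately show ?case by (simp add: emeasure_space_1 ennreal_leI)
next
  case (Suc n)
  have g: "growth \<ge> 0" by (rule size_const)
  have "(\<integral>\<^sup>+\<omega>. ennreal ((real (Z (Suc n) \<omega>))\<^sup>2) \<partial>M) = (\<integral>\<^sup>+\<omega>. (\<integral>\<^sup>+w. ennreal ((real w)\<^sup>2) \<partial>Q (Z n \<omega>)) \<partial>M)"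
    by (rule chain_step)
  also have "\<dots> \<le> (\<integral>\<^sup>+\<omega>. ennreal ((real (Z n \<omega>))\<^sup>2) + ennreal growth * ennreal (real (Z n \<omega>)) \<partial>M)"
  proof (rule nn_integral_mono_AE)
    show "AE \<omega> in M. (\<integral>\<^sup>+w. ennreal ((real w)\<^sup>2) \<partial>Q (Z n \<omega>)) \<le> ennreal ((real (Z n \<omega>))\<^sup>2) + ennreal growth * ennreal (real (Z n \<omega>))"
      using AE_Z_ge_1[of n]
      by eventually_elim (use integrable_Q(2) kernel_growth(2) g in \<open>auto intro!: nn_integral_Q_le simp flip: ennreal_plus ennreal_mult\<close>)
  qed
  also have "\<dots> = (\<integral>\<^sup>+\<omega>. ennreal ((real (Z n \<omega>))\<^sup>2) \<partial>M) + ennreal growth * (\<integral>\<^sup>+\<omega>. ennreal (real (Z n \<omega>)) \<partial>M)"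
    by (subst nn_integral_add) (auto simp: nn_integral_cmult)
  also have "\<dots> \<le> ennreal (size_const\<^sup>2 * (real n + 1)\<^sup>2) + ennreal growth * ennreal (size_const * (real n + 1))"
    using Suc first_moment_nn[of n] by (intro add_mono mult_left_mono) auto
  also have "\<dots> = ennreal (size_const\<^sup>2 * (real n + 1)\<^sup>2 + growth * (size_const * (real n + 1)))"
    using g size_const by (simp flip: ennreal_plus ennreal_mult)
  also have "\<dots> \<le> ennreal (size_const\<^sup>2 * (real (Suc n) + 1)\<^sup>2)"
  proof (rule ennreal_leI)
    have "growth * (size_const * (real n + 1)) \<le> size_const * (size_const * (real n + 1))"
      using size_const by (intro mult_right_mono) auto
    also have "\<dots> \<le> size_const\<^sup>2 * (2 * real n + 3)"
      using size_const by (simp add: power2_eq_square mult.assoc)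
    finally show "size_const\<^sup>2 * (real n + 1)\<^sup>2 + growth * (size_const * (real n + 1)) \<le> size_const\<^sup>2 * (real (Suc n) + 1)\<^sup>2"
      by (simp add: power2_eq_square algebra_simps)
  qed
  finally show ?case .
qed

lemma integrable_Z: "integrable M (\<lambda>\<omega>. real (Z n \<omega>))" "integrable M (\<lambda>\<omega>. (real (Z n \<omega>))\<^sup>2)"
proof -
  have m1 [measurable]: "(\<lambda>\<omega>. real (Z n \<omega>)) \<in> borel_measurable M"
    by (rule measurable_compose[OF measurable_Z]) simp
  show "integrable M (\<lambda>\<omega>. real (Z n \<omega>))"
    by (rule integrableI_nonneg) (use first_moment_nn[of n] in \<open>auto simp: top_unique intro: le_less_trans\<close>)
  show "integrable M (\<lambda>\<omega>. (real (Z n \<omega>))\<^sup>2)"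
    by (rule integrableI_nonneg) (use second_moment_nn[of n] in \<open>auto simp: top_unique intro: le_less_trans\<close>)
qed

lemma expectation_Z:
  "expectation (\<lambda>\<omega>. real (Z n \<omega>)) \<le> size_const * (real n + 1)"
  "expectation (\<lambda>\<omega>. (real (Z n \<omega>))\<^sup>2) \<le> size_const\<^sup>2 * (real n + 1)\<^sup>2"
proof -
  have "ennreal (expectation (\<lambda>\<omega>. real (Z n \<omega>))) \<le> ennreal (size_const * (real n + 1))"
    using first_moment_nn[of n] integrable_Z(1) by (subst nn_integral_eq_integral[symmetric]) auto
  then show "expectation (\<lambda>\<omega>. real (Z n \<omega>)) \<le> size_const * (real n + 1)"
    using size_const by (subst (asm) ennreal_le_iff) auto
  have "ennreal (expectation (\<lambda>\<omega>. (real (Z n \<omega>))\<^sup>2)) \<le> ennreal (size_const\<^sup>2 * (real n + 1)\<^sup>2)"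
    using second_moment_nn[of n] integrable_Z(2) by (subst nn_integral_eq_integral[symmetric]) auto
  then show "expectation (\<lambda>\<omega>. (real (Z n \<omega>))\<^sup>2) \<le> size_const\<^sup>2 * (real n + 1)\<^sup>2"
    by (subst (asm) ennreal_le_iff) auto
qed

text \<open>The Lyapunov function \<open>V\<close> is the power from \<open>powr_drift\<close>,
  flattened below \<open>z0\<close>. It never decreases in mean and gains at least \<open>d\<close>
  from each state \<open>\<le> z0\<close>, so \<open>d\<close> times the expected number of visits
  there is at most the mean of \<open>V (Z k)\<close>. That mean is of order
  \<open>k powr g\<close>, negligible against \<open>k\<close>.\<close>

lemma occupation_bound:
  obtains c g :: real and B where "c > 0" "0 < g" "g < 1" "B \<ge> 0"
    "\<And>k. k \<ge> 1 \<Longrightarrow> (\<Sum>j<k. prob {\<omega> \<in> space M. Z j \<omega> \<le> L}) \<le> (B + B * real k powr g) / c"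
proof -
  obtain g z0 where g: "0 < g" "g < 1" and z0: "z0 \<ge> L" "z0 \<ge> 1"
    and drift: "\<And>z. z \<ge> z0 \<Longrightarrow> measure_pmf.expectation (Q z) (\<lambda>w. real w powr g) \<ge> real z powr g"
    and ig: "\<And>z. z \<ge> 1 \<Longrightarrow> integrable (measure_pmf (Q z)) (\<lambda>w. real w powr g)"
    using powr_drift[of L] by blast
  define V where "V = (\<lambda>z::nat. real (max z z0) powr g)"
  have V0: "V z \<ge> 0" for z by (simp add: V_def)
  have Vb: "V z \<le> real z0 powr g + real z powr g" for z by (auto simp: V_def max_def)
  have iV: "integrable (measure_pmf (Q z)) V" if "z \<ge> 1" for z
  proof (rule Bochner_Integration.integrable_bound)
    show "integrable (measure_pmf (Q z)) (\<lambda>w. real z0 powr g + real w powr g)" using ig[OF that] by simp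
    show "AE w in Q z. norm (V w) \<le> norm (real z0 powr g + real w powr g)"
      using Vb V0 by (intro AE_I2) simp
  qed simp
  \<comment> \<open>The least gain of \<open>V\<close> in a jump from a state at most
    \<open>z0\<close> to one above it.\<close>
  define e where "e = (\<lambda>z. real (Suc z0) powr g - real z0 powr g) (0::nat)"
  have e: "e > 0" using g by (simp add: e_def powr_less_mono2)
  have up: "measure (Q z) {z0<..} > 0" if z: "z \<ge> 1" for z
  proof -
    obtain w where "w \<in> set_pmf (Q z)" "w > z0" using escape[OF z, of z0] by blast
    then show ?thesis using measure_pmf_posI[of w "Q z" "{z0<..}"] by simp
  qed
  define d where "d = e * Min ((\<lambda>z. measure (Q z) {z0<..}) ` {1..z0})"
  have d: "d > 0" unfolding d_def using e z0 up by (intro mult_pos_pos) auto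
  have VQ: "measure_pmf.expectation (Q z) V \<ge> V z + d * indicator {..z0} z" if z: "z \<ge> 1" for z
  proof (cases "z \<le> z0")
    case True
    have "measure_pmf.expectation (Q z) V \<ge> measure_pmf.expectation (Q z) (\<lambda>w. real z0 powr g + e * indicator {z0<..} w)"
    proof (rule integral_mono)
      fix w
      show "real z0 powr g + e * indicator {z0<..} w \<le> V w"
      proof (cases "w > z0")
        case True
        then have "real (Suc z0) powr g \<le> real w powr g" using g by (intro powr_mono2) auto
        then show ?thesis using True by (simp add: V_def e_def max_def)
      next
        case False
        then show ?thesis by (simp add: V_def max_def)
      qed
    qed (use iV[OF z] in \<open>auto intro!: measure_pmf.integrable_const_bound[of _ "real z0 powr g + e"] simp: indicator_def e less_imp_le\<close>)
    also have "measure_pmf.expectation (Q z) (\<lambda>w. real z0 powr g + e * indicator {z0<..} w) =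
      real z0 powr g + e * measure (Q z) {z0<..}"
    proof -
      have "integrable (measure_pmf (Q z)) (\<lambda>w. e * indicator {z0<..} w)"
        by (intro integrable_mult_right measure_pmf.integrable_const_bound[of _ 1]) (auto split: split_indicator)
      then show ?thesis by (subst Bochner_Integration.integral_add) (auto simp del: indicator_simps)
    qed
    finally have "real z0 powr g + e * measure (Q z) {z0<..} \<le> measure_pmf.expectation (Q z) V" .
    moreover have "d \<le> e * measure (Q z) {z0<..}"
      unfolding d_def using e z True by (intro mult_left_mono Min_le) auto
    ultimately show ?thesis using True by (simp add: V_def max_def)
  next
    case False
    have "V z = real z powr g" using False by (simp add: V_def max_def)
    also have "\<dots> \<le> measure_pmf.expectation (Q z) (\<lambda>w. real w powr g)" using drift[of z] False by simp
    also have "\<dots> \<le> measure_pmf.expectation (Q z) V"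
      using ig[OF z] iV[OF z] g by (intro integral_mono) (auto simp: V_def intro!: powr_mono2)
    finally show ?thesis using False by simp
  qed
  define P where "P = (\<lambda>j. prob {\<omega> \<in> space M. Z j \<omega> \<le> z0})"
  have low: "ennreal (d * (\<Sum>j<k. P j)) \<le> (\<integral>\<^sup>+\<omega>. ennreal (V (Z k \<omega>)) \<partial>M)" for k
  proof (induction k)
    case (Suc k)
    have s: "{\<omega> \<in> space M. Z k \<omega> \<le> z0} \<in> sets M" by measurable
    have "ennreal (d * (\<Sum>j<Suc k. P j)) = ennreal (d * (\<Sum>j<k. P j)) + ennreal (d * P k)"
      using d by (subst ennreal_plus[symmetric]) (auto simp: P_def algebra_simps intro!: mult_nonneg_nonneg sum_nonneg)
    also have "\<dots> \<le> (\<integral>\<^sup>+\<omega>. ennreal (V (Z k \<omega>)) \<partial>M) + ennreal (d * P k)"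
      using Suc by (rule add_right_mono)
    also have "ennreal (d * P k) = (\<integral>\<^sup>+\<omega>. ennreal d * indicator {\<omega> \<in> space M. Z k \<omega> \<le> z0} \<omega> \<partial>M)"
      using s d by (simp add: nn_integral_cmult emeasure_eq_measure P_def ennreal_mult)
    also have "(\<integral>\<^sup>+\<omega>. ennreal (V (Z k \<omega>)) \<partial>M) + \<dots> = (\<integral>\<^sup>+\<omega>. ennreal (V (Z k \<omega>)) + ennreal d * indicator {\<omega> \<in> space M. Z k \<omega> \<le> z0} \<omega> \<partial>M)"
      by (subst nn_integral_add) auto
    also have "\<dots> \<le> (\<integral>\<^sup>+\<omega>. (\<integral>\<^sup>+w. ennreal (V w) \<partial>Q (Z k \<omega>)) \<partial>M)"
    proof (rule nn_integral_mono_AE)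
      show "AE \<omega> in M. ennreal (V (Z k \<omega>)) + ennreal d * indicator {\<omega> \<in> space M. Z k \<omega> \<le> z0} \<omega> \<le> (\<integral>\<^sup>+w. ennreal (V w) \<partial>Q (Z k \<omega>))"
        using AE_Z_ge_1[of k] AE_space
      proof eventually_elim
        case (elim \<omega>)
        have "ennreal (V (Z k \<omega>)) + ennreal d * indicator {\<omega> \<in> space M. Z k \<omega> \<le> z0} \<omega> = ennreal (V (Z k \<omega>) + d * indicator {..z0} (Z k \<omega>))"
          using elim d V0 by (auto simp: indicator_def ennreal_plus)
        also have "\<dots> \<le> ennreal (measure_pmf.expectation (Q (Z k \<omega>)) V)" using VQ[OF elim(1)] by (rule ennreal_leI)
        also have "\<dots> = (\<integral>\<^sup>+w. ennreal (V w) \<partial>Q (Z k \<omega>))"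
          using iV[OF elim(1)] V0 by (subst nn_integral_eq_integral) auto
        finally show ?case .
      qed
    qed
    also have "\<dots> = (\<integral>\<^sup>+\<omega>. ennreal (V (Z (Suc k) \<omega>)) \<partial>M)" by (rule chain_step[symmetric])
    finally show ?case .
  qed simp
  define B where "B = real z0 powr g + 1 + 2 * size_const"
  have B0: "B \<ge> 0" "real z0 powr g \<le> B" "1 + 2 * size_const \<le> B" using size_const by (auto simp: B_def)
  have high: "(\<integral>\<^sup>+\<omega>. ennreal (V (Z k \<omega>)) \<partial>M) \<le> ennreal (B + B * real k powr g)" if k: "k \<ge> 1" for k
  proof -
    define K where "K = real k"
    have K: "K \<ge> 1" using k by (simp add: K_def)
    \<comment> \<open>The bound \<open>x powr g \<le> 1 + x\<close>, applied to
      \<open>z / K\<close>, makes the estimate linear in \<open>z\<close>, so the first moment of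
      the chain suffices.\<close>
    have Vk: "V z \<le> real z0 powr g + K powr g + K powr g / K * real z" for z
    proof -
      have "(real z / K) powr g \<le> 1 + real z / K"
      proof (cases "real z / K \<le> 1")
        case True
        then have "(real z / K) powr g \<le> 1 powr g" using g K by (intro powr_mono2) auto
        also have "\<dots> \<le> 1 + real z / K" using K by simp
        finally show ?thesis .
      next
        case False
        then have "(real z / K) powr g \<le> (real z / K) powr 1" using g by (intro powr_mono) auto
        then show ?thesis using False K by simp
      qed
      then have "K powr g * (real z / K) powr g \<le> K powr g * (1 + real z / K)" by (intro mult_left_mono) auto
      moreover have "K powr g * (real z / K) powr g = real z powr g"
        using K by (subst powr_mult[symmetric]) auto
      ultimately have "real z powr g \<le> K powr g + K powr g / K * real z" by (simp add: algebra_simps)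
      then show ?thesis using Vb[of z] by simp
    qed
    have "(\<integral>\<^sup>+\<omega>. ennreal (V (Z k \<omega>)) \<partial>M) \<le> (\<integral>\<^sup>+\<omega>. ennreal (real z0 powr g + K powr g + K powr g / K * real (Z k \<omega>)) \<partial>M)"
      by (intro nn_integral_mono ennreal_leI Vk)
    also have "\<dots> = ennreal (expectation (\<lambda>\<omega>. real z0 powr g + K powr g + K powr g / K * real (Z k \<omega>)))"
      using integrable_Z(1)[of k] K by (intro nn_integral_eq_integral) auto
    also have "expectation (\<lambda>\<omega>. real z0 powr g + K powr g + K powr g / K * real (Z k \<omega>)) =
      real z0 powr g + K powr g + K powr g / K * expectation (\<lambda>\<omega>. real (Z k \<omega>))"
      using integrable_Z(1)[of k] by (simp add: prob_space)
    also have "\<dots> \<le> real z0 powr g + K powr g + K powr g / K * (size_const * (2 * K))"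
    proof -
      have "expectation (\<lambda>\<omega>. real (Z k \<omega>)) \<le> size_const * (2 * K)"
      proof -
        have "size_const * (real k + 1) \<le> size_const * (2 * K)"
          using K size_const unfolding K_def by (intro mult_left_mono) auto
        then show ?thesis using expectation_Z(1)[of k] by linarith
      qed
      then show ?thesis using K by (intro add_left_mono mult_left_mono) auto
    qed
    also have "\<dots> = real z0 powr g + (1 + 2 * size_const) * K powr g" using K by (simp add: algebra_simps)
    also have "\<dots> \<le> B + B * K powr g" using B0 by (intro add_mono mult_right_mono) auto
    finally show ?thesis by (simp add: K_def ennreal_leI)
  qed
  have "(\<Sum>j<k. prob {\<omega> \<in> space M. Z j \<omega> \<le> L}) \<le> (B + B * real k powr g) / d" if k: "k \<ge> 1" for k
  proof -
    have "ennreal (d * (\<Sum>j<k. P j)) \<le> ennreal (B + B * real k powr g)"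
      using low[of k] high[OF k] by (rule order_trans)
    then have "d * (\<Sum>j<k. P j) \<le> B + B * real k powr g" using B0 by (subst (asm) ennreal_le_iff) auto
    then have "(\<Sum>j<k. P j) \<le> (B + B * real k powr g) / d" using d by (simp add: pos_le_divide_eq mult.commute)
    moreover have "(\<Sum>j<k. prob {\<omega> \<in> space M. Z j \<omega> \<le> L}) \<le> (\<Sum>j<k. P j)"
      unfolding P_def using z0 by (intro sum_mono finite_measure_mono) auto
    ultimately show ?thesis by simp
  qed
  then show thesis using that[OF d g B0(1)] by blast
qed

end

lemma powr_over_tendsto_0:
  assumes "g < 1"
  shows "(\<lambda>k::nat. (B + B * real k powr g) / c / real k) \<longlonglongrightarrow> 0"
proof -
  have t: "(\<lambda>k::nat. B / c * (1 / real k) + B / c * real k powr (g - 1)) \<longlonglongrightarrow> B / c * 0 + B / c * 0"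
    using assms by (intro tendsto_add tendsto_mult_left lim_1_over_n tendsto_neg_powr filterlim_real_sequentially) auto
  have ev: "\<forall>\<^sub>F k in sequentially. B / c * (1 / real k) + B / c * real k powr (g - 1) = (B + B * real k powr g) / c / real k"
    using eventually_gt_at_top[of 0] by eventually_elim (simp add: powr_diff add_divide_distrib)
  show ?thesis using Lim_transform_eventually[OF t ev] by simp
qed

context diffusive_chain
begin

lemma borel_Z [measurable]: "(\<lambda>\<omega>. f (Z n \<omega>)) \<in> borel_measurable M" for f :: "nat \<Rightarrow> real"
  by (rule measurable_compose[OF measurable_Z]) simp

lemma borel_hist [measurable]: "(\<lambda>\<omega>. f (history Z n \<omega>)) \<in> borel_measurable M" for f :: "nat list \<Rightarrow> real"
  by (rule measurable_compose[OF measurable_hist]) simp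

text \<open>The drift error of a step from \<open>z\<close> is a multiple of
  \<open>1 / sqrt z\<close>; this is its average over the first \<open>k\<close> steps.\<close>

definition occupation :: "nat \<Rightarrow> real" where
  "occupation k = (\<Sum>j<k. expectation (\<lambda>\<omega>. 1 / sqrt (real (Z j \<omega>)))) / real k"

lemma inv_sqrt_bounded: "AE \<omega> in M. norm (1 / sqrt (real (Z j \<omega>))) \<le> 1"
  using AE_Z_ge_1[of j] by eventually_elim simp

lemma integrable_inv_sqrt: "integrable M (\<lambda>\<omega>. 1 / sqrt (real (Z j \<omega>)))"
  by (rule integrable_const_bound[OF inv_sqrt_bounded]) (rule borel_Z)

lemma occupation_tendsto_0: "occupation \<longlonglongrightarrow> 0"
proof (rule tendsto_norm_zero_cancel, rule LIMSEQ_I)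
  fix e :: real assume e: "e > 0"
  \<comment> \<open>Above \<open>L\<close> the integrand is at most \<open>e / 2\<close>; the states
    up to \<open>L\<close> are visited rarely.\<close>
  define L where "L = nat \<lceil>(2 / e)\<^sup>2\<rceil> + 1"
  have L: "L \<ge> 1" by (simp add: L_def)
  have "(2 / e)\<^sup>2 \<le> real L" unfolding L_def by (rule order_trans[OF real_nat_ceiling_ge]) simp
  then have "2 / e \<le> sqrt (real L)" by (rule real_le_rsqrt)
  then have sL: "1 / sqrt (real L) \<le> e / 2" using e L by (simp add: field_simps)
  obtain c g B where c: "c > 0" "0 < g" "g < 1" "B \<ge> 0"
    and occ: "\<And>k. k \<ge> 1 \<Longrightarrow> (\<Sum>j<k. prob {\<omega> \<in> space M. Z j \<omega> \<le> L}) \<le> (B + B * real k powr g) / c"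
    using occupation_bound[of L] by blast
  have b: "expectation (\<lambda>\<omega>. 1 / sqrt (real (Z j \<omega>))) \<le> prob {\<omega> \<in> space M. Z j \<omega> \<le> L} + e / 2" for j
  proof -
    have s: "{\<omega> \<in> space M. Z j \<omega> \<le> L} \<in> sets M" by measurable
    have ii: "integrable M (\<lambda>\<omega>. indicator {\<omega> \<in> space M. Z j \<omega> \<le> L} \<omega> :: real)"
      using s by (intro integrable_real_indicator) (auto simp: emeasure_eq_measure)
    have "expectation (\<lambda>\<omega>. 1 / sqrt (real (Z j \<omega>))) \<le> expectation (\<lambda>\<omega>. indicator {\<omega> \<in> space M. Z j \<omega> \<le> L} \<omega> + e / 2)"
    proof (rule integral_mono_AE)
      show "AE \<omega> in M. 1 / sqrt (real (Z j \<omega>)) \<le> indicator {\<omega> \<in> space M. Z j \<omega> \<le> L} \<omega> + e / 2"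
        using AE_Z_ge_1[of j] AE_space
      proof eventually_elim
        case (elim \<omega>)
        show ?case
        proof (cases "Z j \<omega> \<le> L")
          case True
          have "1 / sqrt (real (Z j \<omega>)) \<le> 1" using elim by simp
          moreover have "indicator {\<omega> \<in> space M. Z j \<omega> \<le> L} \<omega> = (1::real)" using True elim by simp
          ultimately show ?thesis using e by linarith
        next
          case False
          then have "1 / sqrt (real (Z j \<omega>)) \<le> 1 / sqrt (real L)" using L by (intro divide_left_mono) auto
          then show ?thesis using False sL by simp
        qed
      qed
      show "integrable M (\<lambda>\<omega>. indicator {\<omega> \<in> space M. Z j \<omega> \<le> L} \<omega> + e / 2)" using ii by simp
    qed (rule integrable_inv_sqrt)
    also have "\<dots> = prob {\<omega> \<in> space M. Z j \<omega> \<le> L} + e / 2"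
      using s ii by (subst Bochner_Integration.integral_add) (auto simp: prob_space)
    finally show ?thesis .
  qed
  have "\<forall>\<^sub>F k in sequentially. \<bar>(B + B * real k powr g) / c / real k\<bar> < e / 2"
    using tendstoD[OF powr_over_tendsto_0[OF c(3), of B c], of "e / 2"] e by (simp add: dist_real_def)
  then obtain k0 where k0: "\<And>k. k \<ge> k0 \<Longrightarrow> \<bar>(B + B * real k powr g) / c / real k\<bar> < e / 2"
    unfolding eventually_sequentially by blast
  have "norm (norm (occupation k) - 0) < e" if k: "k \<ge> max 1 k0" for k
  proof -
    have k1: "real k \<ge> 1" using k by simp
    have "0 \<le> occupation k"
      unfolding occupation_def by (intro divide_nonneg_nonneg sum_nonneg Bochner_Integration.integral_nonneg) auto
    moreover have "(\<Sum>j<k. expectation (\<lambda>\<omega>. 1 / sqrt (real (Z j \<omega>)))) \<le> (\<Sum>j<k. prob {\<omega> \<in> space M. Z j \<omega> \<le> L} + e / 2)"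
      by (intro sum_mono b)
    then have "(\<Sum>j<k. expectation (\<lambda>\<omega>. 1 / sqrt (real (Z j \<omega>)))) \<le> (B + B * real k powr g) / c + real k * (e / 2)"
      using occ[of k] k by (simp add: sum.distrib)
    then have "occupation k \<le> ((B + B * real k powr g) / c + real k * (e / 2)) / real k"
      unfolding occupation_def by (intro divide_right_mono) auto
    then have "occupation k \<le> (B + B * real k powr g) / c / real k + e / 2" using k1 by (simp add: add_divide_distrib)
    moreover have "\<bar>(B + B * real k powr g) / c / real k\<bar> < e / 2"
      by (rule k0) (use k in simp)
    ultimately have "\<bar>\<bar>occupation k\<bar> - 0\<bar> < e" by linarith
    then show ?thesis by simp
  qed
  then show "\<exists>no. \<forall>n\<ge>no. norm (norm (occupation n) - 0) < e" by blast
qed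

section \<open>Laplace transforms along the chain\<close>

lemma chain_expectation:
  fixes F :: "nat \<Rightarrow> real" and G :: "nat list \<Rightarrow> real"
  assumes F: "\<And>z. 0 \<le> F z" "\<And>z. F z \<le> 1" and G: "\<And>h. 0 \<le> G h" "\<And>h. G h \<le> 1"
  shows "expectation (\<lambda>\<omega>. G (history Z n \<omega>) * F (Z (Suc n) \<omega>)) =
    expectation (\<lambda>\<omega>. G (history Z n \<omega>) * measure_pmf.expectation (Q (Z n \<omega>)) F)"
proof -
  have iF: "integrable (measure_pmf p) F" for p
    by (rule measure_pmf.integrable_const_bound[where f = F and B = 1]) (use F in auto)
  have EF: "0 \<le> measure_pmf.expectation p F" "measure_pmf.expectation p F \<le> 1" for p
  proof -
    show "0 \<le> measure_pmf.expectation p F" using F by (intro Bochner_Integration.integral_nonneg) auto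
    have "measure_pmf.expectation p F \<le> measure_pmf.expectation p (\<lambda>_. 1)" using F iF by (intro integral_mono) auto
    then show "measure_pmf.expectation p F \<le> 1" by simp
  qed
  have "(\<integral>\<^sup>+\<omega>. ennreal (G (history Z n \<omega>) * F (Z (Suc n) \<omega>)) \<partial>M) =
    (\<integral>\<^sup>+\<omega>. ennreal (G (history Z n \<omega>)) * ennreal (F (Z (Suc n) \<omega>)) \<partial>M)"
    using F G by (simp add: ennreal_mult)
  also have "\<dots> = (\<integral>\<^sup>+\<omega>. ennreal (G (history Z n \<omega>)) * (\<integral>\<^sup>+w. ennreal (F w) \<partial>Q (Z n \<omega>)) \<partial>M)"
    by (rule markov_chain_nn_integral[OF chain, of "\<lambda>h. ennreal (G h)" n "\<lambda>w. ennreal (F w)"])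
  also have "\<dots> = (\<integral>\<^sup>+\<omega>. ennreal (G (history Z n \<omega>) * measure_pmf.expectation (Q (Z n \<omega>)) F) \<partial>M)"
    using iF F G EF by (subst nn_integral_eq_integral) (auto simp: ennreal_mult)
  finally show ?thesis
    using F G EF by (subst (1 2) integral_eq_nn_integral)
      (auto intro!: borel_measurable_times measurable_compose[OF measurable_Z] borel_hist mult_nonneg_nonneg)
qed

text \<open>The three errors of \<open>kernel_laplace\<close>, followed by the time discretisation
  error of \<open>cir_laplace_time_taylor\<close> for a time step \<open>1 / k\<close>.\<close>

definition step_error :: "real \<Rightarrow> nat \<Rightarrow> nat \<Rightarrow> real" where
  "step_error l k z = l * C / (real k * sqrt (real z)) + l\<^sup>2 * C * sqrt (real z) / (2 * (real k)\<^sup>2)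
     + l ^ 3 * C * (real z * sqrt (real z)) / (3 * real k ^ 3)
     + (1 / real k)\<^sup>2 * (m * l\<^sup>2 + l ^ 3 * (real z / real k) + (m * l + l\<^sup>2 * (real z / real k))\<^sup>2)"

text \<open>Up to this error one step of the chain is a time shift by \<open>1 / k\<close>: the
  bracket in \<open>kernel_laplace\<close> is exactly the first-order change in time of the explicit
  solution.\<close>

lemma kernel_cir_step:
  assumes l: "l \<ge> 0" and t: "t \<ge> 0" and k: "k \<ge> 1" and z: "z \<ge> 1"
  shows "\<bar>measure_pmf.expectation (Q z) (\<lambda>w. cir_laplace m l t (real w / real k)) - cir_laplace m l (t + 1 / real k) (real z / real k)\<bar>
    \<le> step_error l k z"
proof -
  define a where "a = cir_rate l t"
  define A where "A = (1 + l * t / 3) powr (- 3 * m)"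
  have a: "0 \<le> a" "a \<le> l" using cir_rate_bounds[OF l t] by (auto simp: a_def)
  have A: "0 \<le> A" "A \<le> 1" using cir_laplace_le_1[of m l t 0] m_pos l t by (auto simp: A_def cir_laplace_def)
  define x where "x = real z / real k"
  have x: "x \<ge> 0" by (simp add: x_def)
  define e where "e = exp (- a * (real z / real k)) * (1 - a * m / real k + a\<^sup>2 / 3 * (real z / (real k)\<^sup>2))"
  define R where "R = l * C / (real k * sqrt (real z)) + l\<^sup>2 * C * sqrt (real z) / (2 * (real k)\<^sup>2) + l ^ 3 * C * (real z * sqrt (real z)) / (3 * real k ^ 3)"
  have "\<bar>A * measure_pmf.expectation (Q z) (\<lambda>w. exp (- a * (real w / real k))) - A * e\<bar> =
    A * \<bar>measure_pmf.expectation (Q z) (\<lambda>w. exp (- a * (real w / real k))) - e\<bar>"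
    using A by (simp add: abs_mult flip: right_diff_distrib)
  also have "\<dots> \<le> 1 * R" using kernel_laplace[OF z a k] A by (intro mult_mono) (auto simp: e_def R_def)
  finally have 1: "\<bar>A * measure_pmf.expectation (Q z) (\<lambda>w. exp (- a * (real w / real k))) - A * e\<bar> \<le> R" by simp
  have Ae: "A * e = cir_laplace m l t x + 1 / real k * ((- m * a + a\<^sup>2 * x / 3) * cir_laplace m l t x)"
    using k unfolding e_def x_def cir_laplace_def a_def[symmetric] A_def[symmetric]
    by (simp add: field_simps power2_eq_square)
  have 2: "\<bar>cir_laplace m l (t + 1 / real k) x - A * e\<bar> \<le> (1 / real k)\<^sup>2 * (m * l\<^sup>2 + l ^ 3 * x + (m * l + l\<^sup>2 * x)\<^sup>2)"
    using cir_laplace_time_taylor[OF _ l t _ x, of m "1 / real k"] m_pos unfolding Ae a_def by (simp add: diff_diff_eq)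
  have "measure_pmf.expectation (Q z) (\<lambda>w. cir_laplace m l t (real w / real k)) = A * measure_pmf.expectation (Q z) (\<lambda>w. exp (- a * (real w / real k)))"
    by (simp add: cir_laplace_def A_def a_def)
  then show ?thesis using 1 2 unfolding step_error_def R_def x_def by linarith
qed

text \<open>Before time \<open>k\<close> the chain is of order \<open>k\<close> in mean, so every
  term but the first has mean at most of order \<open>1 / (k * sqrt k)\<close>, and \<open>k\<close>
  of them sum to order \<open>1 / sqrt k\<close>. The first term is not small uniformly and is left
  to \<open>occupation\<close>.\<close>

lemma step_error_expectation:
  assumes l: "l \<ge> 0"
  obtains c where "c \<ge> 0" "\<And>j k. k \<ge> 1 \<Longrightarrow> integrable M (\<lambda>\<omega>. step_error l k (Z j \<omega>))"
    "\<And>j k. k \<ge> 1 \<Longrightarrow> j < k \<Longrightarrow> expectation (\<lambda>\<omega>. step_error l k (Z j \<omega>)) \<le>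
       l * C / real k * expectation (\<lambda>\<omega>. 1 / sqrt (real (Z j \<omega>))) + c / (real k * sqrt (real k))"
proof -
  define S where "S = size_const"
  have S: "S \<ge> 1" using size_const by (simp add: S_def)
  define c1 where "c1 = l\<^sup>2 * C * (1 + 2 * S) / 2 + l ^ 3 * C * (S + 2 * S\<^sup>2) / 3"
  define c0 where "c0 = m * l\<^sup>2 + l ^ 3 * (2 * S) + 2 * m\<^sup>2 * l\<^sup>2 + 2 * l ^ 4 * (4 * S\<^sup>2)"
  have c: "c1 \<ge> 0" "c0 \<ge> 0" using l C1 S m_pos by (auto simp: c1_def c0_def)
  have main: "integrable M (\<lambda>\<omega>. step_error l k (Z j \<omega>)) \<and> (j < k \<longrightarrow> expectation (\<lambda>\<omega>. step_error l k (Z j \<omega>)) \<le>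
       l * C / real k * expectation (\<lambda>\<omega>. 1 / sqrt (real (Z j \<omega>))) + (c1 + c0) / (real k * sqrt (real k)))"
    if k: "k \<ge> 1" for j k
  proof -
    define K where "K = real k"
    define r where "r = sqrt K"
    have K: "K \<ge> 1" using k by (simp add: K_def)
    have r: "r \<ge> 1" "r * r = K" using K by (auto simp: r_def)
    \<comment> \<open>Bounding the square root linearly, with the scale \<open>r = sqrt k\<close>,
      leaves only first and second moments of the chain to estimate.\<close>
    have sq: "sqrt x \<le> (r + x / r) / 2" if "x \<ge> 0" for x
    proof -
      have "2 * r * sqrt x \<le> r * r + x"
        using zero_le_power2[of "r - sqrt x"] that by (simp add: power2_eq_square algebra_simps)
      then have "r * (2 * sqrt x) \<le> r * (r + x / r)" using r by (simp add: algebra_simps)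
      then show ?thesis using r by simp
    qed
    define g where "g = (\<lambda>\<omega>. l * C / K * (1 / sqrt (real (Z j \<omega>))) + l\<^sup>2 * C / (2 * K\<^sup>2) * ((r + real (Z j \<omega>) / r) / 2)
       + l ^ 3 * C / (3 * K ^ 3) * ((r * real (Z j \<omega>) + (real (Z j \<omega>))\<^sup>2 / r) / 2)
       + (1 / K)\<^sup>2 * (m * l\<^sup>2 + l ^ 3 * (real (Z j \<omega>) / K) + 2 * m\<^sup>2 * l\<^sup>2 + 2 * l ^ 4 * ((real (Z j \<omega>))\<^sup>2 / K\<^sup>2)))"
    have ig: "integrable M g" unfolding g_def
      using integrable_Z[of j] integrable_inv_sqrt[of j] by (intro Bochner_Integration.integrable_add Bochner_Integration.integrable_mult_right) auto
    have le: "0 \<le> step_error l k (Z j \<omega>) \<and> step_error l k (Z j \<omega>) \<le> g \<omega>" for \<omega>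
    proof -
      define z where "z = real (Z j \<omega>)"
      have z: "z \<ge> 0" by (simp add: z_def)
      have 1: "l\<^sup>2 * C * sqrt z / (2 * K\<^sup>2) \<le> l\<^sup>2 * C / (2 * K\<^sup>2) * ((r + z / r) / 2)"
        using mult_left_mono[OF sq[OF z], of "l\<^sup>2 * C / (2 * K\<^sup>2)"] C1 by simp
      have "z * sqrt z \<le> z * ((r + z / r) / 2)" using sq[OF z] z by (intro mult_left_mono)
      also have "\<dots> = (r * z + z\<^sup>2 / r) / 2" by (simp add: power2_eq_square algebra_simps)
      finally have "l ^ 3 * C / (3 * K ^ 3) * (z * sqrt z) \<le> l ^ 3 * C / (3 * K ^ 3) * ((r * z + z\<^sup>2 / r) / 2)"
        using l C1 K by (intro mult_left_mono) auto
      then have 2: "l ^ 3 * C * (z * sqrt z) / (3 * K ^ 3) \<le> l ^ 3 * C / (3 * K ^ 3) * ((r * z + z\<^sup>2 / r) / 2)" by simp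
      have "(m * l + l\<^sup>2 * (z / K))\<^sup>2 \<le> 2 * (m * l)\<^sup>2 + 2 * (l\<^sup>2 * (z / K))\<^sup>2"
      proof -
        have "(x + y)\<^sup>2 \<le> 2 * x\<^sup>2 + 2 * y\<^sup>2" for x y :: real
          using zero_le_power2[of "x - y"] by (simp add: power2_eq_square algebra_simps)
        then show ?thesis .
      qed
      also have "\<dots> = 2 * m\<^sup>2 * l\<^sup>2 + 2 * l ^ 4 * (z\<^sup>2 / K\<^sup>2)" by (simp add: power_mult_distrib power_divide)
      finally have "m * l\<^sup>2 + l ^ 3 * (z / K) + (m * l + l\<^sup>2 * (z / K))\<^sup>2 \<le> m * l\<^sup>2 + l ^ 3 * (z / K) + 2 * m\<^sup>2 * l\<^sup>2 + 2 * l ^ 4 * (z\<^sup>2 / K\<^sup>2)"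
        by simp
      then have 3: "(1 / K)\<^sup>2 * (m * l\<^sup>2 + l ^ 3 * (z / K) + (m * l + l\<^sup>2 * (z / K))\<^sup>2) \<le> (1 / K)\<^sup>2 * (m * l\<^sup>2 + l ^ 3 * (z / K) + 2 * m\<^sup>2 * l\<^sup>2 + 2 * l ^ 4 * (z\<^sup>2 / K\<^sup>2))"
        by (intro mult_left_mono) auto
      have 4: "l * C / (K * sqrt z) = l * C / K * (1 / sqrt z)" by simp
      have "0 \<le> step_error l k (Z j \<omega>)"
        unfolding step_error_def using l C1 m_pos by (intro add_nonneg_nonneg mult_nonneg_nonneg divide_nonneg_nonneg) auto
      moreover have "step_error l k (Z j \<omega>) \<le> g \<omega>"
        unfolding step_error_def g_def z_def[symmetric] K_def[symmetric] using 1 2 3 4 by linarith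
      ultimately show ?thesis ..
    qed
    have ie: "integrable M (\<lambda>\<omega>. step_error l k (Z j \<omega>))"
    proof (rule Bochner_Integration.integrable_bound[OF ig borel_Z], rule AE_I2)
      fix \<omega> show "norm (step_error l k (Z j \<omega>)) \<le> norm (g \<omega>)" using le[of \<omega>] by simp
    qed
    moreover have "expectation (\<lambda>\<omega>. step_error l k (Z j \<omega>)) \<le>
       l * C / real k * expectation (\<lambda>\<omega>. 1 / sqrt (real (Z j \<omega>))) + (c1 + c0) / (real k * sqrt (real k))" if jk: "j < k"
    proof -
      have jK: "real j + 1 \<le> K" using jk by (simp add: K_def)
      have E1: "expectation (\<lambda>\<omega>. real (Z j \<omega>)) \<le> S * K"
      proof -
        have "size_const * (real j + 1) \<le> S * K" unfolding S_def[symmetric] using jK S by (intro mult_left_mono) auto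
        then show ?thesis using expectation_Z(1)[of j] by linarith
      qed
      have "(real j + 1)\<^sup>2 \<le> K\<^sup>2" using jK by (intro power_mono) auto
      then have E2: "expectation (\<lambda>\<omega>. (real (Z j \<omega>))\<^sup>2) \<le> S\<^sup>2 * K\<^sup>2"
      proof -
        have "size_const\<^sup>2 * (real j + 1)\<^sup>2 \<le> S\<^sup>2 * K\<^sup>2"
          unfolding S_def[symmetric] using \<open>(real j + 1)\<^sup>2 \<le> K\<^sup>2\<close> by (intro mult_left_mono) auto
        then show ?thesis using expectation_Z(2)[of j] by linarith
      qed
      define E where "E = expectation (\<lambda>\<omega>. 1 / sqrt (real (Z j \<omega>)))"
      define e1 where "e1 = expectation (\<lambda>\<omega>. real (Z j \<omega>))"
      define e2 where "e2 = expectation (\<lambda>\<omega>. (real (Z j \<omega>))\<^sup>2)"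
      have "expectation (\<lambda>\<omega>. step_error l k (Z j \<omega>)) \<le> expectation g"
        using ie ig le by (intro integral_mono) auto
      also have "expectation g = l * C / K * E + l\<^sup>2 * C / (2 * K\<^sup>2) * ((r + e1 / r) / 2)
         + l ^ 3 * C / (3 * K ^ 3) * ((r * e1 + e2 / r) / 2)
         + (1 / K)\<^sup>2 * (m * l\<^sup>2 + l ^ 3 * (e1 / K) + 2 * m\<^sup>2 * l\<^sup>2 + 2 * l ^ 4 * (e2 / K\<^sup>2))"
      proof -
        have lin: "expectation (\<lambda>\<omega>. a * X \<omega> + b * ((r + Y \<omega> / r) / 2) + d * ((r * Y \<omega> + W \<omega> / r) / 2)
            + f * (p + q * (Y \<omega> / K) + s + t * (W \<omega> / K\<^sup>2))) =
          a * expectation X + b * ((r + expectation Y / r) / 2) + d * ((r * expectation Y + expectation W / r) / 2)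
            + f * (p + q * (expectation Y / K) + s + t * (expectation W / K\<^sup>2))"
          if "integrable M X" "integrable M Y" "integrable M W" for X Y W :: "'a \<Rightarrow> real" and a b d f p q s t :: real
          using that by (simp add: prob_space)
        show ?thesis unfolding g_def E_def e1_def e2_def
          by (rule lin[OF integrable_inv_sqrt[of j] integrable_Z[of j]])
      qed
      also have "\<dots> \<le> l * C / K * E + l\<^sup>2 * C / (2 * K\<^sup>2) * ((1 + 2 * S) * r)
         + l ^ 3 * C / (3 * K ^ 3) * ((S + 2 * S\<^sup>2) * (K * r))
         + (1 / K)\<^sup>2 * c0"
      proof -
        have "e1 / r \<le> S * K / r" using E1 r by (intro divide_right_mono) (auto simp: e1_def)
        have "S * K / r = S * r" using r(1) by (simp add: field_simps flip: r(2))
        have a: "(r + e1 / r) / 2 \<le> (1 + 2 * S) * r"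
        proof -
          have "0 \<le> S * r" using r S by simp
          moreover have "(1 + 2 * S) * r = r + 2 * (S * r)" by (simp add: algebra_simps)
          ultimately have "r + e1 / r \<le> 2 * ((1 + 2 * S) * r)"
            using \<open>e1 / r \<le> S * K / r\<close> \<open>S * K / r = S * r\<close> r(1) by linarith
          then show ?thesis by simp
        qed
        have "e2 / r \<le> S\<^sup>2 * K\<^sup>2 / r" using E2 r by (intro divide_right_mono) (auto simp: e2_def)
        also have "S\<^sup>2 * K\<^sup>2 / r = S\<^sup>2 * (K * r)" using r(1) by (simp add: field_simps power2_eq_square flip: r(2))
        finally have b1: "e2 / r \<le> S\<^sup>2 * (K * r)" .
        have "r * e1 \<le> r * (S * K)" using E1 r by (intro mult_left_mono) (auto simp: e1_def)
        moreover have "0 \<le> S\<^sup>2 * (K * r)" "0 \<le> S * (K * r)" using r K S by auto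
        ultimately have b: "(r * e1 + e2 / r) / 2 \<le> (S + 2 * S\<^sup>2) * (K * r)"
          using b1 by (simp add: algebra_simps)
        have "e1 / K \<le> S" using E1 K by (simp add: e1_def pos_divide_le_eq)
        then have "e1 / K \<le> 2 * S" using S by linarith
        moreover have "e2 / K\<^sup>2 \<le> S\<^sup>2" using E2 K by (simp add: e2_def pos_divide_le_eq)
        then have "e2 / K\<^sup>2 \<le> 4 * S\<^sup>2" using zero_le_power2[of S] by linarith
        ultimately have d: "m * l\<^sup>2 + l ^ 3 * (e1 / K) + 2 * m\<^sup>2 * l\<^sup>2 + 2 * l ^ 4 * (e2 / K\<^sup>2) \<le> c0"
          unfolding c0_def using l m_pos by (intro add_mono mult_left_mono) auto
        show ?thesis using a b d l C1 K by (intro add_mono mult_left_mono) auto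
      qed
      also have "\<dots> = l * C / K * E + c1 / (K * r) + c0 / K\<^sup>2"
      proof -
        have "l\<^sup>2 * C / (2 * K\<^sup>2) * ((1 + 2 * S) * r) = (l\<^sup>2 * C * (1 + 2 * S) / 2) / (K * r)"
          using r(1) unfolding r(2)[symmetric] by (simp add: field_simps power2_eq_square)
        moreover have "l ^ 3 * C / (3 * K ^ 3) * ((S + 2 * S\<^sup>2) * (K * r)) = (l ^ 3 * C * (S + 2 * S\<^sup>2) / 3) / (K * r)"
          using r(1) unfolding r(2)[symmetric] by (simp add: field_simps power2_eq_square power3_eq_cube)
        ultimately show ?thesis unfolding c1_def by (simp add: add_divide_distrib power_divide)
      qed
      also have "c0 / K\<^sup>2 \<le> c0 / (K * r)"
      proof -
        have "r \<le> K" using r mult_left_mono[of 1 r r] by simp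
        then show ?thesis using c K r by (intro divide_left_mono) (auto simp: power2_eq_square)
      qed
      finally show ?thesis unfolding E_def r_def K_def by (simp add: add_divide_distrib)
    qed
    ultimately show ?thesis by blast
  qed
  show thesis using that[of "c1 + c0"] c main by auto
qed

text \<open>The weight \<open>G\<close> makes the statement conditional on the past, and
  \<open>\<epsilon>\<close> depends on none of \<open>G\<close>, \<open>i\<close>, \<open>n\<close>;
  this is the form used for several times at once, where \<open>G\<close> and the indices vary with
  \<open>k\<close>.\<close>

theorem chain_laplace:
  assumes l: "l \<ge> 0"
  obtains \<epsilon> where "\<epsilon> \<longlonglongrightarrow> 0"
    "\<And>k i n G. k \<ge> 1 \<Longrightarrow> i + n \<le> k \<Longrightarrow> (\<And>h. 0 \<le> G h) \<Longrightarrow> (\<And>h. G h \<le> 1) \<Longrightarrow>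
      \<bar>expectation (\<lambda>\<omega>. G (history Z i \<omega>) * exp (- l * (real (Z (i + n) \<omega>) / real k))) -
       expectation (\<lambda>\<omega>. G (history Z i \<omega>) * cir_laplace m l (real n / real k) (real (Z i \<omega>) / real k))\<bar> \<le> \<epsilon> k"
proof -
  obtain c where c: "c \<ge> 0" and ie: "\<And>j k. k \<ge> 1 \<Longrightarrow> integrable M (\<lambda>\<omega>. step_error l k (Z j \<omega>))"
    and se: "\<And>j k. k \<ge> 1 \<Longrightarrow> j < k \<Longrightarrow> expectation (\<lambda>\<omega>. step_error l k (Z j \<omega>)) \<le>
       l * C / real k * expectation (\<lambda>\<omega>. 1 / sqrt (real (Z j \<omega>))) + c / (real k * sqrt (real k))"
    using step_error_expectation[OF l] by blast
  define \<epsilon> where "\<epsilon> = (\<lambda>k. l * C * occupation k + c / sqrt (real k))"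
  have "(\<lambda>k. l * C * occupation k + c / sqrt (real k)) \<longlonglongrightarrow> l * C * 0 + 0"
    by (intro tendsto_add tendsto_mult_left occupation_tendsto_0 tendsto_divide_0[OF tendsto_const]
        filterlim_at_top_imp_at_infinity filterlim_compose[OF sqrt_at_top filterlim_real_sequentially])
  then have e0: "\<epsilon> \<longlonglongrightarrow> 0" by (simp add: \<epsilon>_def)
  have main: "\<bar>expectation (\<lambda>\<omega>. G (history Z i \<omega>) * exp (- l * (real (Z (i + n) \<omega>) / real k))) -
       expectation (\<lambda>\<omega>. G (history Z i \<omega>) * cir_laplace m l (real n / real k) (real (Z i \<omega>) / real k))\<bar> \<le> \<epsilon> k"
    if k: "k \<ge> 1" and ink: "i + n \<le> k" and G: "\<And>h. 0 \<le> G h" "\<And>h. G h \<le> 1" for k i n G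
  proof -
    define u where "u = (\<lambda>t z. cir_laplace m l t (real z / real k))"
    have u01: "0 \<le> u t z" "u t z \<le> 1" if "t \<ge> 0" for t z
      using cir_laplace_nonneg cir_laplace_le_1[of m l t "real z / real k"] m_pos l that by (auto simp: u_def)
    \<comment> \<open>An interpolation: \<open>a 0\<close> contains the exponential at time
      \<open>i + n\<close>, \<open>a n\<close> the explicit solution at time \<open>i\<close>, and
      each increment trades one step of the chain for the time \<open>1 / k\<close>.\<close>
    define a where "a = (\<lambda>p. expectation (\<lambda>\<omega>. G (history Z i \<omega>) * u (real p / real k) (Z (i + n - p) \<omega>)))"
    have step: "\<bar>a p - a (Suc p)\<bar> \<le> expectation (\<lambda>\<omega>. step_error l k (Z (i + n - Suc p) \<omega>))" if p: "p < n" for p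
    proof -
      define q where "q = i + n - Suc p"
      have q: "i + n - p = Suc q" "i \<le> q" using p by (auto simp: q_def)
      define t where "t = real p / real k"
      have t: "t \<ge> 0" "real (Suc p) / real k = t + 1 / real k" by (auto simp: t_def add_divide_distrib)
      \<comment> \<open>\<open>G\<close> reads the past up to \<open>i\<close>; here it is regarded
        as a functional of the longer past up to \<open>q\<close>.\<close>
      define G' where "G' = (\<lambda>h. G (take (Suc i) h))"
      have G': "G' (history Z q \<omega>) = G (history Z i \<omega>)" for \<omega>
      proof -
        have "take (Suc i) (history Z q \<omega>) = history Z i \<omega>"
          using q(2) unfolding history_def take_map take_upt by (simp add: take_upt del: upt_Suc)
        then show ?thesis by (simp add: G'_def)
      qed
      have "a p = expectation (\<lambda>\<omega>. G' (history Z q \<omega>) * u t (Z (Suc q) \<omega>))"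
        unfolding a_def q(1) t_def G' ..
      also have "\<dots> = expectation (\<lambda>\<omega>. G' (history Z q \<omega>) * measure_pmf.expectation (Q (Z q \<omega>)) (u t))"
        using G u01[OF t(1)] by (intro chain_expectation) (auto simp: G'_def)
      finally have ap: "a p = expectation (\<lambda>\<omega>. G (history Z i \<omega>) * measure_pmf.expectation (Q (Z q \<omega>)) (u t))"
        by (simp add: G')
      have aSp: "a (Suc p) = expectation (\<lambda>\<omega>. G (history Z i \<omega>) * u (t + 1 / real k) (Z q \<omega>))"
        unfolding a_def q_def t(2) ..
      have Eu: "0 \<le> measure_pmf.expectation (Q z) (u t)" "measure_pmf.expectation (Q z) (u t) \<le> 1" for z
      proof -
        have iu: "integrable (measure_pmf (Q z)) (u t)"
          by (rule measure_pmf.integrable_const_bound[of _ 1]) (use u01[OF t(1)] in auto)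
        show "0 \<le> measure_pmf.expectation (Q z) (u t)" using u01[OF t(1)] by (intro Bochner_Integration.integral_nonneg) auto
        have "measure_pmf.expectation (Q z) (u t) \<le> measure_pmf.expectation (Q z) (\<lambda>_. 1)" using u01[OF t(1)] iu by (intro integral_mono) auto
        then show "measure_pmf.expectation (Q z) (u t) \<le> 1" by simp
      qed
      have t1: "t + 1 / real k \<ge> 0" using t by simp
      have i1: "integrable M (\<lambda>\<omega>. G (history Z i \<omega>) * measure_pmf.expectation (Q (Z q \<omega>)) (u t))"
        by (rule integrable_const_bound[of _ 1])
           (use G Eu in \<open>auto intro!: AE_I2 mult_le_one borel_measurable_times borel_hist borel_Z simp: abs_mult\<close>)
      have i2: "integrable M (\<lambda>\<omega>. G (history Z i \<omega>) * u (t + 1 / real k) (Z q \<omega>))"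
        by (rule integrable_const_bound[of _ 1])
           (use G u01[OF t1] in \<open>auto intro!: AE_I2 mult_le_one borel_measurable_times borel_hist borel_Z simp: abs_mult\<close>)
      have "\<bar>a p - a (Suc p)\<bar> = \<bar>expectation (\<lambda>\<omega>. G (history Z i \<omega>) * measure_pmf.expectation (Q (Z q \<omega>)) (u t)
          - G (history Z i \<omega>) * u (t + 1 / real k) (Z q \<omega>))\<bar>"
        unfolding ap aSp using i1 i2 by simp
      also have "\<dots> \<le> expectation (\<lambda>\<omega>. \<bar>G (history Z i \<omega>) * measure_pmf.expectation (Q (Z q \<omega>)) (u t)
          - G (history Z i \<omega>) * u (t + 1 / real k) (Z q \<omega>)\<bar>)"
        by (rule integral_abs_bound)
      also have "\<dots> \<le> expectation (\<lambda>\<omega>. step_error l k (Z q \<omega>))"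
      proof (rule integral_mono_AE)
        show "AE \<omega> in M. \<bar>G (history Z i \<omega>) * measure_pmf.expectation (Q (Z q \<omega>)) (u t)
          - G (history Z i \<omega>) * u (t + 1 / real k) (Z q \<omega>)\<bar> \<le> step_error l k (Z q \<omega>)"
          using AE_Z_ge_1[of q]
        proof eventually_elim
          case (elim \<omega>)
          have "\<bar>G (history Z i \<omega>) * measure_pmf.expectation (Q (Z q \<omega>)) (u t) - G (history Z i \<omega>) * u (t + 1 / real k) (Z q \<omega>)\<bar>
            = G (history Z i \<omega>) * \<bar>measure_pmf.expectation (Q (Z q \<omega>)) (u t) - u (t + 1 / real k) (Z q \<omega>)\<bar>"
            using G by (simp add: abs_mult flip: right_diff_distrib)
          also have "\<dots> \<le> 1 * step_error l k (Z q \<omega>)"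
            using kernel_cir_step[OF l t(1) k elim] G unfolding u_def by (intro mult_mono) auto
          finally show ?case by simp
        qed
      qed (use i1 i2 ie[OF k] in auto)
      finally show ?thesis unfolding q_def .
    qed
    have tele: "\<bar>a 0 - a p\<bar> \<le> (\<Sum>s<p. expectation (\<lambda>\<omega>. step_error l k (Z (i + n - Suc s) \<omega>)))" if "p \<le> n" for p
      using that
    proof (induction p)
      case (Suc p)
      then show ?case using step[of p] by simp
    qed simp
    have nn: "expectation (\<lambda>\<omega>. 1 / sqrt (real (Z j \<omega>))) \<ge> 0" for j by (intro Bochner_Integration.integral_nonneg) auto
    have "\<bar>a 0 - a n\<bar> \<le> (\<Sum>s<n. expectation (\<lambda>\<omega>. step_error l k (Z (i + n - Suc s) \<omega>)))" using tele by simp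
    also have "\<dots> \<le> (\<Sum>s<n. l * C / real k * expectation (\<lambda>\<omega>. 1 / sqrt (real (Z (i + n - Suc s) \<omega>))) + c / (real k * sqrt (real k)))"
      using ink k by (intro sum_mono se) auto
    also have "\<dots> = (\<Sum>j\<in>(\<lambda>s. i + n - Suc s) ` {..<n}. l * C / real k * expectation (\<lambda>\<omega>. 1 / sqrt (real (Z j \<omega>))) + c / (real k * sqrt (real k)))"
      by (subst sum.reindex) (auto intro!: inj_onI)
    also have "\<dots> \<le> (\<Sum>j<k. l * C / real k * expectation (\<lambda>\<omega>. 1 / sqrt (real (Z j \<omega>))) + c / (real k * sqrt (real k)))"
      using ink c l C1 nn by (intro sum_mono2) auto
    also have "\<dots> = \<epsilon> k"
      using k by (simp add: \<epsilon>_def occupation_def sum.distrib sum_distrib_left mult_ac flip: sum_divide_distrib)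
    finally show ?thesis unfolding a_def u_def by (simp add: cir_laplace_0)
  qed
  show thesis by (rule that[OF e0 main])
qed

end

section \<open>The Bessel process\<close>

lemma space_halfline [simp]: "space halfline = {0..}"
  by (simp add: space_restrict_space)

lemma sets_halfline: "A \<in> sets halfline \<longleftrightarrow> A \<in> sets borel \<and> A \<subseteq> {0..}"
  by (subst sets_restrict_space_iff) auto

lemma transition_prob:
  assumes "transition_function p" "t \<ge> 0" "x \<ge> 0"
  shows "prob_space (p t x)" "sets (p t x) = sets halfline" "space (p t x) = {0..}"
proof -
  have "p t \<in> halfline \<rightarrow>\<^sub>M prob_algebra halfline" using assms by (simp add: transition_function_def)
  then have "p t x \<in> space (prob_algebra halfline)" by (rule measurable_space) (use assms in simp)
  then show "prob_space (p t x)" "sets (p t x) = sets halfline" by (auto simp: space_prob_algebra)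
  from sets_eq_imp_space_eq[OF this(2)] show "space (p t x) = {0..}" by simp
qed

lemma measurable_sqrt_halfline: "(\<lambda>y. sqrt (6 * y)) \<in> halfline \<rightarrow>\<^sub>M halfline"
  by (rule measurable_restrict_space3) (auto intro!: borel_measurable_continuous_onI continuous_intros)

lemma measurable_square_halfline: "(\<lambda>r. r\<^sup>2 / 6) \<in> halfline \<rightarrow>\<^sub>M halfline"
  by (rule measurable_restrict_space3) (auto intro!: borel_measurable_continuous_onI continuous_intros)

text \<open>The factor 6 normalises the variance: the derivative of \<open>sqrt (6 * y)\<close> is
  \<open>3 / sqrt (6 * y)\<close>, and \<open>2 / 3 * y\<close> times its square is 1.\<close>

definition sqrt_kernel :: "(real \<Rightarrow> real \<Rightarrow> real measure) \<Rightarrow> real \<Rightarrow> real \<Rightarrow> real measure" where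
  "sqrt_kernel p t r = distr (p t (r\<^sup>2 / 6)) halfline (\<lambda>y. sqrt (6 * y))"

lemma measure_sqrt_kernel:
  assumes p: "transition_function p" and t: "t \<ge> 0" and A: "A \<in> sets halfline"
  shows "measure (sqrt_kernel p t r) A = measure (p t (r\<^sup>2 / 6)) {y \<in> {0..}. sqrt (6 * y) \<in> A}"
proof -
  have s: "sets (p t (r\<^sup>2 / 6)) = sets halfline" "space (p t (r\<^sup>2 / 6)) = {0..}"
    using transition_prob[OF p t] by simp_all
  have "(\<lambda>y. sqrt (6 * y)) \<in> p t (r\<^sup>2 / 6) \<rightarrow>\<^sub>M halfline"
    using measurable_sqrt_halfline measurable_cong_sets[OF s(1) refl] by blast
  then have "measure (sqrt_kernel p t r) A = measure (p t (r\<^sup>2 / 6)) ((\<lambda>y. sqrt (6 * y)) -` A \<inter> {0..})"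
    unfolding sqrt_kernel_def using measure_distr[OF _ A] s(2) by metis
  also have "(\<lambda>y. sqrt (6 * y)) -` A \<inter> {0..} = {y \<in> {0..}. sqrt (6 * y) \<in> A}" by auto
  finally show ?thesis .
qed

lemma sqrt_preimage_sets:
  "A \<in> sets halfline \<Longrightarrow> {y \<in> {0..}. sqrt (6 * y) \<in> A} \<in> sets halfline"
proof -
  assume A: "A \<in> sets halfline"
  have "(\<lambda>y. sqrt (6 * y)) -` A \<inter> space halfline \<in> sets halfline"
    using measurable_sqrt_halfline A by (rule measurable_sets)
  also have "(\<lambda>y. sqrt (6 * y)) -` A \<inter> space halfline = {y \<in> {0..}. sqrt (6 * y) \<in> A}" by auto
  finally show ?thesis .
qed

text \<open>Conjugation by a homeomorphism of the half-line preserves each property. For stochastic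
  continuity, a small ball around \<open>x\<^sup>2 / 6\<close> is mapped into the given ball around
  \<open>x\<close>.\<close>

lemma transition_function_sqrt_kernel:
  assumes p: "transition_function p"
  shows "transition_function (sqrt_kernel p)"
  unfolding transition_function_def
proof (intro conjI allI impI)
  have pm: "p t \<in> halfline \<rightarrow>\<^sub>M prob_algebra halfline" if "t \<ge> 0" for t
    using p that by (simp add: transition_function_def)
  note sub = measurable_prob_algebraD
  show "sqrt_kernel p t \<in> halfline \<rightarrow>\<^sub>M prob_algebra halfline" if "0 \<le> t" for t
    unfolding sqrt_kernel_def[abs_def]
    by (rule measurable_compose[OF measurable_compose[OF measurable_square_halfline pm[OF that]]
          measurable_distr_prob_space[OF measurable_sqrt_halfline]])
  show "sqrt_kernel p 0 x = return halfline x" if x: "0 \<le> x" for x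
  proof -
    have "p 0 (x\<^sup>2 / 6) = return halfline (x\<^sup>2 / 6)" using p by (simp add: transition_function_def)
    then show ?thesis unfolding sqrt_kernel_def
      using distr_return[OF measurable_sqrt_halfline, of "x\<^sup>2 / 6"] x by simp
  qed
  show "sqrt_kernel p (s + t) x = sqrt_kernel p s x \<bind> sqrt_kernel p t" if s: "0 \<le> s" and t: "0 \<le> t" and x: "0 \<le> x" for s t x
  proof -
    define y where "y = x\<^sup>2 / 6"
    have y: "y \<ge> 0" by (simp add: y_def)
    have sp: "sets (p s y) = sets halfline" "space (p s y) = {0..}" using transition_prob[OF p s y] by auto
    have pt: "p t \<in> p s y \<rightarrow>\<^sub>M subprob_algebra halfline"
      using sub[OF pm[OF t]] measurable_cong_sets[OF sp(1) refl] by blast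
    have sq: "(\<lambda>y. sqrt (6 * y)) \<in> p s y \<rightarrow>\<^sub>M halfline"
      using measurable_sqrt_halfline measurable_cong_sets[OF sp(1) refl] by blast
    have kt: "sqrt_kernel p t \<in> halfline \<rightarrow>\<^sub>M subprob_algebra halfline"
      unfolding sqrt_kernel_def[abs_def]
      by (rule sub[OF measurable_compose[OF measurable_compose[OF measurable_square_halfline pm[OF t]]
          measurable_distr_prob_space[OF measurable_sqrt_halfline]]])
    have "sqrt_kernel p (s + t) x = distr (p s y \<bind> p t) halfline (\<lambda>y. sqrt (6 * y))"
      using p s t y by (simp add: sqrt_kernel_def transition_function_def flip: y_def)
    also have "\<dots> = p s y \<bind> (\<lambda>v. distr (p t v) halfline (\<lambda>y. sqrt (6 * y)))"
      by (rule distr_bind[OF pt _ measurable_sqrt_halfline]) (simp add: sp)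
    also have "\<dots> = p s y \<bind> (\<lambda>v. sqrt_kernel p t (sqrt (6 * v)))"
      by (rule bind_cong) (auto simp: sp sqrt_kernel_def)
    also have "\<dots> = distr (p s y) halfline (\<lambda>y. sqrt (6 * y)) \<bind> sqrt_kernel p t"
      by (rule bind_distr[symmetric, OF sq kt]) (simp add: sp)
    finally show ?thesis by (simp add: sqrt_kernel_def y_def)
  qed
  show "((\<lambda>t. measure (sqrt_kernel p t x) {y \<in> {0..}. dist y x < e}) \<longlongrightarrow> 1) (at_right 0)" if x: "0 \<le> x" and e: "e > 0" for x e
  proof -
    define y where "y = x\<^sup>2 / 6"
    have y: "y \<ge> 0" by (simp add: y_def)
    have "isCont (\<lambda>v. sqrt (6 * v)) y" by (intro continuous_intros)
    then obtain d where d: "d > 0" "\<And>v. dist v y < d \<Longrightarrow> dist (sqrt (6 * v)) (sqrt (6 * y)) < e"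
      using e unfolding continuous_at_eps_delta by blast
    have sy: "sqrt (6 * y) = x" using x by (simp add: y_def)
    have lim: "((\<lambda>t. measure (p t y) {v \<in> {0..}. dist v y < d}) \<longlongrightarrow> 1) (at_right 0)"
      using p y d(1) by (simp add: transition_function_def)
    have A: "{y \<in> {0..}. dist y x < e} \<in> sets halfline" for x e :: real
    proof -
      have "{y \<in> {0..}. dist y x < e} = {0..} \<inter> ball x e" by (auto simp: dist_commute)
      then show ?thesis by (simp add: sets_halfline)
    qed
    show ?thesis
    proof (rule tendsto_sandwich[OF _ _ lim tendsto_const])
      show "\<forall>\<^sub>F t in at_right 0. measure (p t y) {v \<in> {0..}. dist v y < d} \<le> measure (sqrt_kernel p t x) {y \<in> {0..}. dist y x < e}"
        unfolding eventually_at_right_field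
      proof (intro exI[of _ 1] conjI allI impI)
        fix t :: real assume t: "0 < t" "t < 1"
        interpret prob_space "p t y" using transition_prob[OF p _ y, of t] t by simp
        have sp: "sets (p t y) = sets halfline" using transition_prob[OF p _ y, of t] t by simp
        have "measure (p t y) {v \<in> {0..}. dist v y < d} \<le> measure (p t y) {v \<in> {0..}. sqrt (6 * v) \<in> {y \<in> {0..}. dist y x < e}}"
          using d(2) sy sqrt_preimage_sets[OF A] by (intro finite_measure_mono) (auto simp: sp)
        also have "\<dots> = measure (sqrt_kernel p t x) {y \<in> {0..}. dist y x < e}"
          using measure_sqrt_kernel[OF p _ A, of t x] t by (simp add: y_def)
        finally show "measure (p t y) {v \<in> {0..}. dist v y < d} \<le> measure (sqrt_kernel p t x) {y \<in> {0..}. dist y x < e}" .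
      qed simp
      show "\<forall>\<^sub>F t in at_right 0. measure (sqrt_kernel p t x) {y \<in> {0..}. dist y x < e} \<le> 1"
        unfolding eventually_at_right_field
      proof (intro exI[of _ 1] conjI allI impI)
        fix t :: real assume t: "0 < t" "t < 1"
        interpret prob_space "p t y" using transition_prob[OF p _ y, of t] t by simp
        show "measure (sqrt_kernel p t x) {y \<in> {0..}. dist y x < e} \<le> 1"
          using measure_sqrt_kernel[OF p _ A, of t x] t by (simp add: flip: y_def)
      qed simp
    qed
  qed
qed

text \<open>On the half-line the root is invertible, with a measurable inverse, so both processes
  generate the same past.\<close>

lemma natural_filtration_sqrt:
  assumes "\<And>t \<omega>. t \<in> T \<Longrightarrow> \<omega> \<in> space N \<Longrightarrow> R t \<omega> = sqrt (6 * D t \<omega>)"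
    and "\<And>t \<omega>. t \<in> T \<Longrightarrow> \<omega> \<in> space N \<Longrightarrow> D t \<omega> \<ge> 0"
  shows "natural_filtration N T R s = natural_filtration N T D s"
proof -
  have "{R r -` A \<inter> space N | r A. r \<in> T \<and> r \<le> s \<and> A \<in> sets borel} = {D r -` A \<inter> space N | r A. r \<in> T \<and> r \<le> s \<and> A \<in> sets borel}"
    (is "?L = ?R")
  proof (rule set_eqI, rule iffI)
    fix B assume "B \<in> ?L"
    then obtain r A where r: "B = R r -` A \<inter> space N" "r \<in> T" "r \<le> s" "A \<in> sets borel" by blast
    have "(\<lambda>y. sqrt (6 * y)) \<in> borel \<rightarrow>\<^sub>M borel"
      by (intro borel_measurable_continuous_onI continuous_intros)
    from measurable_sets[OF this r(4)]
    have "(\<lambda>y. sqrt (6 * y)) -` A \<inter> space borel \<in> sets borel" .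
    moreover have "B = D r -` ((\<lambda>y. sqrt (6 * y)) -` A \<inter> space borel) \<inter> space N" using r assms by auto
    ultimately show "B \<in> ?R" using r by blast
  next
    fix B assume "B \<in> ?R"
    then obtain r A where r: "B = D r -` A \<inter> space N" "r \<in> T" "r \<le> s" "A \<in> sets borel" by blast
    have "(\<lambda>y. y\<^sup>2 / 6 :: real) \<in> borel \<rightarrow>\<^sub>M borel"
      by (intro borel_measurable_continuous_onI continuous_intros) auto
    from measurable_sets[OF this r(4)]
    have "(\<lambda>y. y\<^sup>2 / 6 :: real) -` A \<inter> space borel \<in> sets borel" .
    moreover have "B = R r -` ((\<lambda>y. y\<^sup>2 / 6) -` A \<inter> space borel) \<inter> space N" using r assms by auto
    ultimately show "B \<in> ?L" using r by blast
  qed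
  then show ?thesis unfolding natural_filtration_def by simp
qed

text \<open>The event \<open>A\<close> for the root is the event \<open>B\<close> for
  \<open>D\<close>, and the pasts coincide, so conditional probabilities carry over.\<close>

lemma continuous_markov_process_sqrt:
  assumes D: "continuous_markov_process N T D p" and T: "T \<subseteq> {0..}"
  shows "continuous_markov_process N T (\<lambda>t \<omega>. sqrt (6 * D t \<omega>)) (sqrt_kernel p)"
proof -
  have p: "transition_function p" and N: "prob_space N" and Dm: "\<And>t. t \<in> T \<Longrightarrow> D t \<in> N \<rightarrow>\<^sub>M halfline"
    using D by (auto simp: continuous_markov_process_def)
  have D0: "D t \<omega> \<ge> 0" if "t \<in> T" "\<omega> \<in> space N" for t \<omega>
    using measurable_space[OF Dm[OF that(1)] that(2)] by simp
  have nf: "natural_filtration N T (\<lambda>t \<omega>. sqrt (6 * D t \<omega>)) s = natural_filtration N T D s" for s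
    by (rule natural_filtration_sqrt) (auto simp: D0)
  have mk: "AE \<omega> in N. real_cond_exp N (natural_filtration N T D s) (\<lambda>\<omega>. indicator A (D t \<omega>)) \<omega> =
           measure (p (t - s) (D s \<omega>)) A" if "s \<in> T" "t \<in> T" "A \<in> sets halfline" "s \<le> t" for s t A
    using D that by (auto simp: continuous_markov_process_def)
  show ?thesis unfolding continuous_markov_process_def nf
  proof (intro conjI ballI impI N transition_function_sqrt_kernel[OF p])
    show "(\<lambda>\<omega>. sqrt (6 * D t \<omega>)) \<in> N \<rightarrow>\<^sub>M halfline" if "t \<in> T" for t
      by (rule measurable_compose[OF Dm[OF that] measurable_sqrt_halfline])
    have "AE \<omega> in N. continuous_on T (\<lambda>t. D t \<omega>)" using D by (simp add: continuous_markov_process_def)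
    then show "AE \<omega> in N. continuous_on T (\<lambda>t. sqrt (6 * D t \<omega>))"
      by eventually_elim (intro continuous_intros)
    fix s t A assume st: "s \<in> T" "t \<in> T" "A \<in> sets halfline" "s \<le> t"
    define B where "B = {y \<in> {0..}. sqrt (6 * y) \<in> A}"
    have B: "B \<in> sets halfline" unfolding B_def by (rule sqrt_preimage_sets[OF st(3)])
    interpret prob_space N by (rule N)
    have Dt: "D t \<in> borel_measurable N" if "t \<in> T" for t
      using measurable_compose[OF Dm[OF that], of "\<lambda>x. x" borel] by (simp add: measurable_restrict_space1)
    have sub: "subalgebra N (natural_filtration N T D s)"
      unfolding subalgebra_def
    proof
      show "space (natural_filtration N T D s) = space N"
        unfolding natural_filtration_def by (subst space_measure_of) auto
      show "sets (natural_filtration N T D s) \<subseteq> sets N"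
        unfolding natural_filtration_def
        by (subst sets_measure_of) (auto intro!: sets.sigma_sets_subset measurable_sets[OF Dt])
    qed
    interpret finite_measure_subalgebra N "natural_filtration N T D s" using sub by unfold_locales
    have "AE \<omega> in N. real_cond_exp N (natural_filtration N T D s) (\<lambda>\<omega>. indicator A (sqrt (6 * D t \<omega>))) \<omega> =
        real_cond_exp N (natural_filtration N T D s) (\<lambda>\<omega>. indicator B (D t \<omega>)) \<omega>"
    proof (rule real_cond_exp_cong)
      show "AE \<omega> in N. indicator A (sqrt (6 * D t \<omega>)) = (indicator B (D t \<omega>) :: real)"
        using D0[OF st(2)] by (intro AE_I2) (auto simp: B_def indicator_def)
      show "(\<lambda>\<omega>. indicator A (sqrt (6 * D t \<omega>)) :: real) \<in> borel_measurable N"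
        by (rule measurable_compose[OF measurable_compose[OF Dm[OF st(2)] measurable_sqrt_halfline]]) (use st(3) in simp)
      show "(\<lambda>\<omega>. indicator B (D t \<omega>) :: real) \<in> borel_measurable N"
        by (rule measurable_compose[OF Dm[OF st(2)]]) (use B in simp)
    qed
    moreover note mk[OF st(1,2) B st(4)]
    ultimately show "AE \<omega> in N. real_cond_exp N (natural_filtration N T D s) (\<lambda>\<omega>. indicator A (sqrt (6 * D t \<omega>))) \<omega> =
           measure (sqrt_kernel p (t - s) (sqrt (6 * D s \<omega>))) A"
      using AE_space
    proof eventually_elim
      case (elim \<omega>)
      have "measure (sqrt_kernel p (t - s) (sqrt (6 * D s \<omega>))) A = measure (p (t - s) ((sqrt (6 * D s \<omega>))\<^sup>2 / 6)) B"
        unfolding B_def using st by (intro measure_sqrt_kernel[OF p]) auto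
      also have "(sqrt (6 * D s \<omega>))\<^sup>2 / 6 = D s \<omega>" using D0[OF st(1) elim(3)] by simp
      finally show ?case using elim by simp
    qed
  qed
qed

text \<open>Chain rule for \<open>r \<mapsto> r\<^sup>2 / 6\<close>. In the boundary condition the
  derivative in \<open>r\<close> is \<open>r / 3\<close> times a derivative in \<open>x\<close> that
  has a finite limit at 0, so the product is of order \<open>r powr (6 * m)\<close> and vanishes
  because \<open>m > 0\<close>.\<close>

lemma bessel_backward:
  assumes p: "transition_function p"
    and be: "backward_equation {0..} (\<lambda>x. m) (\<lambda>x. 2 / 3 * x) p" and m: "m > 0"
  shows "backward_equation {0<..} (\<lambda>x. (6 * m - 1) / (2 * x)) (\<lambda>_. 1) (sqrt_kernel p)"
    and "A \<in> sets halfline \<Longrightarrow> t > 0 \<Longrightarrow>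
      ((\<lambda>x. x powr (6 * m - 1) * deriv (\<lambda>y. measure (sqrt_kernel p t y) A) x) \<longlongrightarrow> 0) (at_right 0)"
proof -
  have key: "\<exists>ut ux uxx. (\<forall>t>0. \<forall>x\<in>{0..}.
       ((\<lambda>r. measure (p r x) B) has_real_derivative ut t x) (at t) \<and>
       ((\<lambda>y. measure (p t y) B) has_real_derivative ux t x) (at x within {0..}) \<and>
       ((\<lambda>y. ux t y) has_real_derivative uxx t x) (at x within {0..}) \<and>
       ut t x = m * ux t x + 1 / 2 * (2 / 3 * x) * uxx t x)" if "B \<in> sets halfline" for B
    using bspec[OF be[unfolded backward_equation_def] that] by (rule conjunct2)
  have cont: "continuous_on ({0<..} \<times> {0..}) (\<lambda>(t, x). measure (p t x) B)" if "B \<in> sets halfline" for B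
    using be that unfolding backward_equation_def by blast
  have within: "at (y::real) within {0..} = at y" if "y > 0" for y
    using that by (intro at_within_interior) auto
  have sq: "((\<lambda>r. r\<^sup>2 / 6) has_real_derivative r / 3) (at r)" for r :: real
    by (auto intro!: derivative_eq_intros)
  have B: "{y \<in> {0..}. sqrt (6 * y) \<in> A} \<in> sets halfline" if "A \<in> sets halfline" for A
    by (rule sqrt_preimage_sets[OF that])
  have d1: "((\<lambda>r. measure (sqrt_kernel p t r) A) has_real_derivative ux (r\<^sup>2 / 6) * (r / 3)) (at r)"
    if A: "A \<in> sets halfline" and t: "t > 0" and r: "r > 0"
      and ux: "\<And>x. x \<ge> 0 \<Longrightarrow> ((\<lambda>y. measure (p t y) {y \<in> {0..}. sqrt (6 * y) \<in> A}) has_real_derivative ux x) (at x within {0..})"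
    for A t r ux
  proof -
    have eq: "(\<lambda>r. measure (sqrt_kernel p t r) A) = (\<lambda>r. measure (p t (r\<^sup>2 / 6)) {y \<in> {0..}. sqrt (6 * y) \<in> A})"
      using measure_sqrt_kernel[OF p _ A] t by auto
    have "r\<^sup>2 / 6 > 0" using r by simp
    then have "((\<lambda>y. measure (p t y) {y \<in> {0..}. sqrt (6 * y) \<in> A}) has_real_derivative ux (r\<^sup>2 / 6)) (at (r\<^sup>2 / 6))"
      using ux[of "r\<^sup>2 / 6"] within[of "r\<^sup>2 / 6"] by simp
    from DERIV_chain2[OF this sq] show ?thesis unfolding eq .
  qed
  show "backward_equation {0<..} (\<lambda>x. (6 * m - 1) / (2 * x)) (\<lambda>_. 1) (sqrt_kernel p)"
    unfolding backward_equation_def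
  proof (intro ballI conjI)
    fix A assume A: "A \<in> sets halfline"
    define B where "B = {y \<in> {0..}. sqrt (6 * y) \<in> A}"
    have Bs: "B \<in> sets halfline" unfolding B_def by (rule sqrt_preimage_sets[OF A])
    have mB: "measure (sqrt_kernel p t r) A = measure (p t (r\<^sup>2 / 6)) B" if "t \<ge> 0" for t r
      unfolding B_def by (rule measure_sqrt_kernel[OF p that A])
    have "continuous_on ({0<..} \<times> {0..}) ((\<lambda>(t, x). measure (p t x) B) \<circ> (\<lambda>(t, r). (t, r\<^sup>2 / 6)))"
      by (intro continuous_on_compose continuous_on_subset[OF cont[OF Bs]])
         (auto intro!: continuous_intros simp: case_prod_unfold)
    then show "continuous_on ({0<..} \<times> {0..}) (\<lambda>(t, x). measure (sqrt_kernel p t x) A)"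
      by (rule continuous_on_eq) (auto simp: mB)
    obtain ut ux uxx where u: "\<And>t x. t > 0 \<Longrightarrow> x \<ge> 0 \<Longrightarrow>
       ((\<lambda>r. measure (p r x) B) has_real_derivative ut t x) (at t) \<and>
       ((\<lambda>y. measure (p t y) B) has_real_derivative ux t x) (at x within {0..}) \<and>
       ((\<lambda>y. ux t y) has_real_derivative uxx t x) (at x within {0..}) \<and>
       ut t x = m * ux t x + 1 / 2 * (2 / 3 * x) * uxx t x"
      using key[OF Bs] by (metis atLeast_iff)
    show "\<exists>vt vx vxx. \<forall>t>0. \<forall>r\<in>{0<..}.
           ((\<lambda>s. measure (sqrt_kernel p s r) A) has_real_derivative vt t r) (at t) \<and>
           ((\<lambda>y. measure (sqrt_kernel p t y) A) has_real_derivative vx t r) (at r within {0<..}) \<and>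
           ((\<lambda>y. vx t y) has_real_derivative vxx t r) (at r within {0<..}) \<and>
           vt t r = (6 * m - 1) / (2 * r) * vx t r + 1 / 2 * 1 * vxx t r"
    proof (intro exI allI impI ballI)
      fix t r :: real assume t: "0 < t" and r: "r \<in> {0<..}"
      then have r0: "r > 0" by simp
      have ope: "at r within {0<..} = at r" using r0 by (intro at_within_open) auto
      define x where "x = r\<^sup>2 / 6"
      have x: "x > 0" using r0 by (simp add: x_def)
      \<comment> \<open>The two functions of time agree for nonnegative times only, so the
        derivative is transferred through a neighbourhood of \<open>t\<close>.\<close>
      have vt: "((\<lambda>s. measure (sqrt_kernel p s r) A) has_real_derivative ut t (r\<^sup>2 / 6)) (at t)"
      proof (rule DERIV_cong_ev[THEN iffD1, OF refl _ refl])
        show "((\<lambda>s. measure (p s (r\<^sup>2 / 6)) B) has_real_derivative ut t (r\<^sup>2 / 6)) (at t)" using conjunct1[OF u[OF t, of x]] x by (simp add: x_def)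
        have "\<forall>\<^sub>F s in nhds t. s \<in> {0<..}" using t by (intro eventually_nhds_in_open) auto
        then show "\<forall>\<^sub>F s in nhds t. measure (p s (r\<^sup>2 / 6)) B = measure (sqrt_kernel p s r) A"
          by eventually_elim (simp add: mB)
      qed
      have vx: "((\<lambda>r. measure (sqrt_kernel p t r) A) has_real_derivative ux t (r\<^sup>2 / 6) * (r / 3)) (at r within {0<..})"
        unfolding ope
      proof (rule d1[OF A t r0])
        show "((\<lambda>y. measure (p t y) {y \<in> {0..}. sqrt (6 * y) \<in> A}) has_real_derivative ux t x) (at x within {0..})" if "x \<ge> 0" for x
          using u[OF t that] unfolding B_def by blast
      qed
      have "((\<lambda>y. ux t y) has_real_derivative uxx t x) (at x)"
        using u[OF t, of x] x within[OF x] by simp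
      from DERIV_chain2[OF this[unfolded x_def] sq]
      have c: "((\<lambda>r. ux t (r\<^sup>2 / 6)) has_real_derivative uxx t (r\<^sup>2 / 6) * (r / 3)) (at r)" .
      have "((\<lambda>r. r / 3) has_real_derivative 1 / 3) (at r)" by (auto intro!: derivative_eq_intros)
      from DERIV_mult[OF c this]
      have vxx: "((\<lambda>r. ux t (r\<^sup>2 / 6) * (r / 3)) has_real_derivative
          (uxx t (r\<^sup>2 / 6) * (r / 3) * (r / 3) + 1 / 3 * ux t (r\<^sup>2 / 6))) (at r within {0<..})"
        unfolding ope .
      \<comment> \<open>The product rule contributes \<open>1 / 3 * ux\<close> to the second
        derivative; this accounts for the \<open>- 1\<close> in the drift coefficient
        \<open>6 * m - 1\<close>.\<close>
      have eq: "ut t (r\<^sup>2 / 6) = (6 * m - 1) / (2 * r) * (ux t (r\<^sup>2 / 6) * (r / 3)) + 1 / 2 * 1 *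
          (uxx t (r\<^sup>2 / 6) * (r / 3) * (r / 3) + 1 / 3 * ux t (r\<^sup>2 / 6))"
      proof -
        have "(6 * m - 1) / (2 * r) * (X * (r / 3)) + 1 / 2 * 1 * (Y * (r / 3) * (r / 3) + 1 / 3 * X)
          = m * X + 1 / 2 * (2 / 3 * (r\<^sup>2 / 6)) * Y" for X Y
          using r0 by (simp add: field_simps power2_eq_square)
        then show ?thesis using u[OF t, of x] x unfolding x_def by simp
      qed
      show "((\<lambda>s. measure (sqrt_kernel p s r) A) has_real_derivative ut t (r\<^sup>2 / 6)) (at t) \<and>
           ((\<lambda>y. measure (sqrt_kernel p t y) A) has_real_derivative ux t (r\<^sup>2 / 6) * (r / 3)) (at r within {0<..}) \<and>
           ((\<lambda>y. ux t (y\<^sup>2 / 6) * (y / 3)) has_real_derivative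
             (uxx t (r\<^sup>2 / 6) * (r / 3) * (r / 3) + 1 / 3 * ux t (r\<^sup>2 / 6))) (at r within {0<..}) \<and>
           ut t (r\<^sup>2 / 6) = (6 * m - 1) / (2 * r) * (ux t (r\<^sup>2 / 6) * (r / 3)) + 1 / 2 * 1 *
             (uxx t (r\<^sup>2 / 6) * (r / 3) * (r / 3) + 1 / 3 * ux t (r\<^sup>2 / 6))"
        by (intro conjI vt vx vxx eq)
    qed
  qed
  assume A: "A \<in> sets halfline" and t: "t > 0"
  define B where "B = {y \<in> {0..}. sqrt (6 * y) \<in> A}"
  have Bs: "B \<in> sets halfline" unfolding B_def by (rule sqrt_preimage_sets[OF A])
  obtain ut ux uxx where u: "\<And>t x. t > 0 \<Longrightarrow> x \<ge> 0 \<Longrightarrow>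
       ((\<lambda>r. measure (p r x) B) has_real_derivative ut t x) (at t) \<and>
       ((\<lambda>y. measure (p t y) B) has_real_derivative ux t x) (at x within {0..}) \<and>
       ((\<lambda>y. ux t y) has_real_derivative uxx t x) (at x within {0..}) \<and>
       ut t x = m * ux t x + 1 / 2 * (2 / 3 * x) * uxx t x"
    using key[OF Bs] by (metis atLeast_iff)
  have dr: "deriv (\<lambda>y. measure (sqrt_kernel p t y) A) r = ux t (r\<^sup>2 / 6) * (r / 3)" if "r > 0" for r
  proof (rule DERIV_imp_deriv, rule d1[OF A t that])
    show "((\<lambda>y. measure (p t y) {y \<in> {0..}. sqrt (6 * y) \<in> A}) has_real_derivative ux t x) (at x within {0..})" if "x \<ge> 0" for x
      using u[OF t that] unfolding B_def by blast
  qed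
  have "continuous (at 0 within {0..}) (ux t)"
    using u[OF t, of 0] DERIV_continuous[of "ux t"] by blast
  then have "(ux t \<longlongrightarrow> ux t 0) (at 0 within {0..})" by (simp add: continuous_within)
  moreover have "filterlim (\<lambda>r::real. r\<^sup>2 / 6) (at 0 within {0..}) (at_right 0)"
  proof -
    have t: "((\<lambda>r::real. r\<^sup>2 / 6) \<longlongrightarrow> 0) (at_right 0)" by (auto intro!: tendsto_eq_intros)
    have ev: "\<forall>\<^sub>F r::real in at_right 0. r\<^sup>2 / 6 \<in> {0..} \<and> r\<^sup>2 / 6 \<noteq> 0"
      using eventually_at_right_less[of "0::real"] by (rule eventually_mono) simp
    show ?thesis unfolding filterlim_at by (intro conjI t ev)
  qed
  ultimately have l1: "((\<lambda>r. ux t (r\<^sup>2 / 6)) \<longlongrightarrow> ux t 0) (at_right 0)"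
    by (rule filterlim_compose)
  have "((\<lambda>r::real. r powr (6 * m)) \<longlongrightarrow> 0) (at_right 0)"
  proof (rule tendsto_eq_rhs[OF tendsto_powr'[OF tendsto_ident_at tendsto_const]])
    have "\<forall>\<^sub>F x::real in at_right 0. 0 \<le> x"
      using eventually_at_right_less[of "0::real"] by (rule eventually_mono) simp
    then show "(0::real) \<noteq> 0 \<or> 0 < 6 * m \<and> (\<forall>\<^sub>F x::real in at_right 0. 0 \<le> x)"
      using m by simp
    show "(0::real) powr (6 * m) = 0" by simp
  qed
  then have lim: "((\<lambda>r. r powr (6 * m) * (ux t (r\<^sup>2 / 6) / 3)) \<longlongrightarrow> 0 * (ux t 0 / 3)) (at_right 0)"
    by (intro tendsto_mult tendsto_divide l1 tendsto_const) auto
  have ev: "\<forall>\<^sub>F r in at_right 0. r powr (6 * m) * (ux t (r\<^sup>2 / 6) / 3) =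
      r powr (6 * m - 1) * deriv (\<lambda>y. measure (sqrt_kernel p t y) A) r"
    using eventually_at_right_less[of "0::real"]
    by eventually_elim (simp add: dr powr_diff)
  show "((\<lambda>x. x powr (6 * m - 1) * deriv (\<lambda>y. measure (sqrt_kernel p t y) A) x) \<longlongrightarrow> 0) (at_right 0)"
    using Lim_transform_eventually[OF lim ev] by simp
qed

theorem diffusion_imp_bessel:
  assumes D: "diffusion N T (\<lambda>x. m) (\<lambda>x. 2 / 3 * x) D" and m: "m > 0" and T: "T \<subseteq> {0..}"
  shows "bessel_process N T (6 * m) (\<lambda>t \<omega>. sqrt (6 * D t \<omega>))"
    and "t \<in> T \<Longrightarrow> \<omega> \<in> space N \<Longrightarrow> D t \<omega> = 1 / 6 * (sqrt (6 * D t \<omega>))\<^sup>2"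
proof -
  obtain p where p: "continuous_markov_process N T D p" "backward_equation {0..} (\<lambda>x. m) (\<lambda>x. 2 / 3 * x) p"
    using D by (auto simp: diffusion_def)
  then have tp: "transition_function p" by (simp add: continuous_markov_process_def)
  show "bessel_process N T (6 * m) (\<lambda>t \<omega>. sqrt (6 * D t \<omega>))"
    unfolding bessel_process_def
  proof (rule exI[of _ "sqrt_kernel p"], intro conjI ballI allI impI)
    show "continuous_markov_process N T (\<lambda>t \<omega>. sqrt (6 * D t \<omega>)) (sqrt_kernel p)"
      by (rule continuous_markov_process_sqrt[OF p(1) T])
    show "backward_equation {0<..} (\<lambda>x. (6 * m - 1) / (2 * x)) (\<lambda>_. 1) (sqrt_kernel p)"
      by (rule bessel_backward(1)[OF tp p(2) m])
    show "((\<lambda>x. x powr (6 * m - 1) * deriv (\<lambda>y. measure (sqrt_kernel p t y) A) x) \<longlongrightarrow> 0) (at_right 0)"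
      if "A \<in> sets halfline" "t > 0" for A t
      by (rule bessel_backward(2)[OF tp p(2) m that])
  qed
  assume t: "t \<in> T" and \<omega>: "\<omega> \<in> space N"
  have "D t \<in> N \<rightarrow>\<^sub>M halfline" using p(1) t by (simp add: continuous_markov_process_def)
  from measurable_space[OF this \<omega>] have "D t \<omega> \<ge> 0" by simp
  then show "D t \<omega> = 1 / 6 * (sqrt (6 * D t \<omega>))\<^sup>2" by simp
qed

section \<open>The transition function of the diffusion\<close>

text \<open>The maximum may sit at the final time, so only earlier times are compared.\<close>

lemma deriv_at_max_from_left:
  fixes f :: "real \<Rightarrow> real"
  assumes "(f has_real_derivative d) (at t)" "a < t" "\<And>s. a \<le> s \<Longrightarrow> s \<le> t \<Longrightarrow> f s \<le> f t"
  shows "d \<ge> 0"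
proof (rule ccontr)
  assume "\<not> d \<ge> 0"
  then obtain e where e: "e > 0" "\<And>h. 0 < h \<Longrightarrow> h < e \<Longrightarrow> f t < f (t - h)"
    using DERIV_neg_dec_left[OF assms(1)] by auto
  define h where "h = min (e / 2) (t - a)"
  have "0 < h" "h < e" "a \<le> t - h" using e assms(2) by (auto simp: h_def min_def)
  then show False using e(2)[of h] assms(3)[of "t - h"] by auto
qed

text \<open>
  At an interior maximum the second derivative is nonpositive; at the boundary point \<open>0\<close> only the
  first derivative is used, because the diffusion coefficient vanishes there.
\<close>

lemma generator_at_max:
  fixes f f' :: "real \<Rightarrow> real"
  assumes d1: "\<And>y. y \<ge> 0 \<Longrightarrow> (f has_real_derivative f' y) (at y within {0..})"
    and d2: "(f' has_real_derivative s) (at x within {0..})"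
    and x: "0 \<le> x" "x < R" and max: "\<And>y. 0 \<le> y \<Longrightarrow> y \<le> R \<Longrightarrow> f y \<le> f x" and m: "m > 0"
  shows "m * f' x + x / 3 * s \<le> 0"
proof (cases "x = 0")
  case True
  have "f' 0 \<le> 0"
  proof (rule ccontr)
    assume "\<not> f' 0 \<le> 0"
    then obtain e where e: "e > 0" "\<And>h. 0 < h \<Longrightarrow> 0 + h \<in> {0..} \<Longrightarrow> h < e \<Longrightarrow> f 0 < f (0 + h)"
      using has_real_derivative_pos_inc_right[OF d1[of 0]] by auto
    define h where "h = min (e / 2) R"
    have "0 < h" "h < e" "h \<le> R" using e x by (auto simp: h_def min_def)
    then show False using e(2)[of h] max[of h] True by auto
  qed
  then show ?thesis using True m by (simp add: mult_nonneg_nonpos)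
next
  case False
  then have xp: "x > 0" using x by simp
  have within: "at (y::real) within {0..} = at y" if "y > 0" for y
    using that by (intro at_within_interior) auto
  have d1': "(f has_real_derivative f' y) (at y)" if "y > 0" for y using d1[of y] within[OF that] that by simp
  have d2': "(f' has_real_derivative s) (at x)" using d2 within[OF xp] by simp
  have f0: "f' x = 0"
  proof (rule DERIV_local_max[OF d1'[OF xp], of "min x (R - x)"])
    show "\<forall>y. \<bar>x - y\<bar> < min x (R - x) \<longrightarrow> f y \<le> f x" using max by auto
  qed (use x xp in auto)
  \<comment> \<open>With zero slope at \<open>x\<close>, a positive second derivative would make the
    slope positive just to the right, and the mean value theorem would give a larger value
    there.\<close>
  have "s \<le> 0"
  proof (rule ccontr)
    assume "\<not> s \<le> 0"
    then obtain e where e: "e > 0" "\<And>h. 0 < h \<Longrightarrow> h < e \<Longrightarrow> f' x < f' (x + h)"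
      using DERIV_pos_inc_right[OF d2'] by auto
    define h where "h = min (e / 2) (R - x)"
    have h: "0 < h" "h < e" "x + h \<le> R" using e x by (auto simp: h_def min_def)
    obtain v where v: "x < v" "v < x + h" "f (x + h) - f x = (x + h - x) * f' v"
      using MVT2[of x "x + h" f f'] d1' xp h(1) by auto
    have "f' v > 0" using e(2)[of "v - x"] v h f0 by auto
    then have "f (x + h) - f x > 0" using v(3) h by simp
    then show False using max[of "x + h"] h xp by auto
  qed
  then show ?thesis using f0 xp by (simp add: mult_nonneg_nonpos)
qed

text \<open>The equation is also imposed at \<open>x = 0\<close>, where it reads
  \<open>wt = m * wx\<close>; this plays the part of a boundary condition.\<close>

locale half_line_solution =
  fixes w wt wx wxx :: "real \<Rightarrow> real \<Rightarrow> real" and m B :: real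
  assumes m_pos: "m > 0"
    and cont: "continuous_on ({0..} \<times> {0..}) (\<lambda>(t, x). w t x)"
    and wt: "\<And>t x. t > 0 \<Longrightarrow> x \<ge> 0 \<Longrightarrow> ((\<lambda>s. w s x) has_real_derivative wt t x) (at t)"
    and wx: "\<And>t x. t > 0 \<Longrightarrow> x \<ge> 0 \<Longrightarrow> ((\<lambda>y. w t y) has_real_derivative wx t x) (at x within {0..})"
    and wxx: "\<And>t x. t > 0 \<Longrightarrow> x \<ge> 0 \<Longrightarrow> ((\<lambda>y. wx t y) has_real_derivative wxx t x) (at x within {0..})"
    and pde: "\<And>t x. t > 0 \<Longrightarrow> x \<ge> 0 \<Longrightarrow> wt t x = m * wx t x + x / 3 * wxx t x"
    and bounded: "\<And>t x. t \<ge> 0 \<Longrightarrow> x \<ge> 0 \<Longrightarrow> w t x \<le> B"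
begin

text \<open>The barrier \<open>x + m * t\<close> solves the equation. Multiplied by
  \<open>B / R\<close> it is at least \<open>B\<close> beyond \<open>R\<close>, where only the
  boundedness of \<open>w\<close> is known, and it fades as \<open>R\<close> grows.\<close>

lemma maximum_principle:
  assumes R: "R > 0" and \<eta>: "\<eta> \<ge> 0" and B: "B \<ge> 0"
    and init: "\<And>x. 0 \<le> x \<Longrightarrow> x \<le> R \<Longrightarrow> w 0 x \<le> \<eta>"
    and t: "t \<ge> 0" and x: "x \<ge> 0"
  shows "w t x \<le> \<eta> + B / R * (x + m * t)"
proof (rule field_le_epsilon)
  fix e :: real assume e: "e > 0"
  \<comment> \<open>The summand \<open>d * (1 + t)\<close> makes the barrier a strict supersolution,
    so that a positive maximum contradicts the equation. Its cost at time \<open>t\<close> is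
    exactly \<open>e\<close>.\<close>
  define d where "d = e / (1 + t)"
  have d: "d > 0" using e t by (simp add: d_def)
  define T where "T = t + 1"
  define \<psi> where "\<psi> = (\<lambda>t x. \<eta> + B / R * (x + m * t) + d * (1 + t))"
  define \<phi> where "\<phi> = (\<lambda>t x. w t x - \<psi> t x)"
  have BR: "B / R \<ge> 0" using B R by simp
  have far: "\<phi> s y < 0" if "s \<ge> 0" "y \<ge> R" for s y
  proof -
    have "B / R * R \<le> B / R * (y + m * s)" using BR that m_pos by (intro mult_left_mono add_increasing2) auto
    moreover have "B / R * R = B" using R by simp
    moreover have "d * (1 + s) > 0" using d that by simp
    moreover have "w s y \<le> B" using bounded[of s y] that R by simp
    ultimately show ?thesis using \<eta> by (simp add: \<phi>_def \<psi>_def)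
  qed
  have start: "\<phi> 0 y < 0" if "y \<ge> 0" for y
  proof (cases "y \<le> R")
    case True
    have "B / R * y \<ge> 0" using BR that by (rule mult_nonneg_nonneg)
    then show ?thesis using init[OF that True] d by (simp add: \<phi>_def \<psi>_def)
  qed (use far[of 0 y] in simp)
  have "\<phi> t x \<le> 0"
  proof (rule ccontr)
    assume "\<not> \<phi> t x \<le> 0"
    then have pos: "\<phi> t x > 0" by simp
    then have xR: "x < R" using far[OF t, of x] by force
    have "continuous_on ({0..T} \<times> {0..R}) (\<lambda>(t, x). \<phi> t x)"
      unfolding \<phi>_def \<psi>_def case_prod_unfold
      by (intro continuous_intros continuous_on_subset[OF cont[unfolded case_prod_unfold]]) auto
    then obtain p where p: "p \<in> {0..T} \<times> {0..R}" and pmax: "\<And>q. q \<in> {0..T} \<times> {0..R} \<Longrightarrow> (case q of (t, x) \<Rightarrow> \<phi> t x) \<le> (case p of (t, x) \<Rightarrow> \<phi> t x)"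
      using continuous_attains_sup[of "{0..T} \<times> {0..R}" "\<lambda>(t, x). \<phi> t x"] t R
      by (auto simp: compact_Times T_def)
    obtain s y where sy: "p = (s, y)" by (cases p)
    have s: "0 \<le> s" "s \<le> T" and y: "0 \<le> y" "y \<le> R" using p sy by auto
    have mx: "\<phi> s' y' \<le> \<phi> s y" if "0 \<le> s'" "s' \<le> T" "0 \<le> y'" "y' \<le> R" for s' y'
      using pmax[of "(s', y')"] that sy by auto
    have "\<phi> s y > 0" using mx[of t x] pos t x xR by (simp add: T_def)
    then have s0: "s > 0" and yR: "y < R"
      using start[OF y(1)] far[OF s(1), of y] s y by (metis less_eq_real_def less_asym, force)
    have dt: "((\<lambda>s. \<phi> s y) has_real_derivative wt s y - (B / R * m + d)) (at s)"
      unfolding \<phi>_def \<psi>_def using wt[OF s0 y(1)] R by (auto intro!: derivative_eq_intros)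
    have dx: "((\<lambda>y. \<phi> s y) has_real_derivative wx s y - B / R) (at y within {0..})" if "y \<ge> 0" for y
      unfolding \<phi>_def \<psi>_def using wx[OF s0 that] R by (auto intro!: derivative_eq_intros)
    have dxx: "((\<lambda>y. wx s y - B / R) has_real_derivative wxx s y) (at y within {0..})"
      using wxx[OF s0 y(1)] by (auto intro!: derivative_eq_intros)
    have "wt s y - (B / R * m + d) \<ge> 0"
      by (rule deriv_at_max_from_left[OF dt s0]) (use mx s y in auto)
    moreover have "m * (wx s y - B / R) + y / 3 * wxx s y \<le> 0"
      by (rule generator_at_max[OF dx dxx y(1) yR _ m_pos]) (use mx s in auto)
    ultimately show False using pde[OF s0 y(1)] d by (simp add: algebra_simps)
  qed
  then have "w t x \<le> \<eta> + B / R * (x + m * t) + d * (1 + t)" by (simp add: \<phi>_def \<psi>_def)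
  also have "d * (1 + t) = e" using t by (simp add: d_def)
  finally show "w t x \<le> \<eta> + B / R * (x + m * t) + e" .
qed

end

section \<open>Exponential polynomials and the candidate law\<close>

text \<open>In the variable \<open>exp (- x)\<close> these are polynomials on the unit interval. Its
  endpoint 0 stands for infinity, where \<open>g\<close> need not have a limit; so \<open>g\<close>
  is frozen beyond \<open>R\<close> and tapered linearly to 0. Hence closeness holds on
  \<open>{0..R}\<close> only, with mere boundedness beyond.\<close>

lemma exp_polynomial_approx:
  fixes g :: "real \<Rightarrow> real"
  assumes g: "continuous_on {0..} g" "\<And>x. x \<ge> 0 \<Longrightarrow> 0 \<le> g x" "\<And>x. x \<ge> 0 \<Longrightarrow> g x \<le> 1" and e: "e > 0" and R: "R > 0"
  obtains a :: "nat \<Rightarrow> real" and n where "\<And>x. 0 \<le> x \<Longrightarrow> x \<le> R \<Longrightarrow> \<bar>g x - (\<Sum>i\<le>n. a i * exp (- real i * x))\<bar> \<le> e"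
    "\<And>x. 0 \<le> x \<Longrightarrow> \<bar>\<Sum>i\<le>n. a i * exp (- real i * x)\<bar> \<le> 1 + e"
proof -
  define b where "b = exp (- R)"
  have b: "0 < b" "b < 1" using R by (auto simp: b_def)
  define G where "G = (\<lambda>y. g (- ln (max b y)) * min 1 (y / b))"
  have mb: "- ln (max b y) \<ge> 0" if "y \<le> 1" for y using b that by simp
  have "continuous_on {0..1} G"
    unfolding G_def
  proof (intro continuous_on_mult continuous_on_min continuous_on_divide continuous_on_const continuous_on_id)
    show "continuous_on {0..1} (\<lambda>y. g (- ln (max b y)))"
    proof (rule continuous_on_compose2[OF g(1)])
      show "continuous_on {0..1} (\<lambda>y. - ln (max b y))"
        using b by (intro continuous_intros) (auto simp: max_def)
    qed (use mb in auto)
  qed (use b in auto)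
  then obtain P where P: "real_polynomial_function P" "\<And>y. y \<in> {0..1} \<Longrightarrow> \<bar>G y - P y\<bar> < e"
    using Stone_Weierstrass_real_polynomial_function[of "{0..1}" G e] e by auto
  obtain a n where a: "P = (\<lambda>y. \<Sum>i\<le>n. a i * y ^ i)"
    using P(1) real_polynomial_function_iff_sum by blast
  have PS: "P (exp (- x)) = (\<Sum>i\<le>n. a i * exp (- real i * x))" for x
    unfolding a by (simp add: exp_of_nat_mult[symmetric])
  have GP: "\<bar>G (exp (- x)) - (\<Sum>i\<le>n. a i * exp (- real i * x))\<bar> < e" if "x \<ge> 0" for x
    using P(2)[of "exp (- x)"] that by (simp add: PS)
  have Gx: "G (exp (- x)) = g x" if "0 \<le> x" "x \<le> R" for x
  proof -
    have "exp (- x) \<ge> b" using that by (simp add: b_def)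
    then show ?thesis using b by (simp add: G_def max_def min_def)
  qed
  have G1: "\<bar>G y\<bar> \<le> 1" if "0 \<le> y" "y \<le> 1" for y
  proof -
    have "0 \<le> g (- ln (max b y))" "g (- ln (max b y)) \<le> 1" using g mb[OF that(2)] by auto
    moreover have "0 \<le> min 1 (y / b)" "min 1 (y / b) \<le> 1" using b that by auto
    ultimately have "0 \<le> G y" "G y \<le> 1" unfolding G_def by (auto intro: mult_le_one)
    then show ?thesis by simp
  qed
  show thesis
  proof (rule that[of a n])
    show "\<bar>g x - (\<Sum>i\<le>n. a i * exp (- real i * x))\<bar> \<le> e" if "0 \<le> x" "x \<le> R" for x
      using GP[of x] Gx[OF that] that by simp
    show "\<bar>\<Sum>i\<le>n. a i * exp (- real i * x)\<bar> \<le> 1 + e" if "0 \<le> x" for x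
      using GP[OF that] G1[of "exp (- x)"] that by simp
  qed
qed

lemma cir_laplace_deriv_x:
  "((\<lambda>x. cir_laplace m l t x) has_real_derivative - cir_rate l t * cir_laplace m l t x) (at x within S)"
  unfolding cir_laplace_def by (auto intro!: derivative_eq_intros)

lemma continuous_on_cir_laplace:
  assumes "l \<ge> 0"
  shows "continuous_on ({0..} \<times> {0..}) (\<lambda>(t, x). cir_laplace m l t x)"
proof -
  have p: "1 + l * fst q / 3 \<noteq> 0" if "q \<in> {0..} \<times> {0..}" for q :: "real \<times> real"
  proof -
    have "0 \<le> l * fst q" using assms that by auto
    then show ?thesis by simp
  qed
  show ?thesis unfolding cir_laplace_def cir_rate_def case_prod_unfold
    by (intro continuous_intros) (use p in auto)
qed

text \<open>Euler's integral after the substitution of \<open>c * y\<close>.\<close>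

lemma nn_integral_gamma_scaled:
  assumes a: "a > 0" and c: "c > (0::real)"
  shows "(\<integral>\<^sup>+y. ennreal (indicator {0..} y * y powr (a - 1) * exp (- c * y)) \<partial>lborel) = ennreal (Gamma a / c powr a)"
proof -
  have "ennreal (Gamma a) = (\<integral>\<^sup>+t. ennreal (indicator {0..} t * t powr (a - 1) / exp t) \<partial>lborel)"
    by (rule Gamma_conv_nn_integral_real[OF a])
  also have "\<dots> = \<bar>c\<bar> * (\<integral>\<^sup>+y. ennreal (indicator {0..} (0 + c * y) * (0 + c * y) powr (a - 1) / exp (0 + c * y)) \<partial>lborel)"
    using c by (intro nn_integral_real_affine) auto
  also have "\<dots> = ennreal (c powr a) * (\<integral>\<^sup>+y. ennreal (indicator {0..} y * y powr (a - 1) * exp (- c * y)) \<partial>lborel)"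
  proof -
    have "(\<integral>\<^sup>+y. ennreal (indicator {0..} (0 + c * y) * (0 + c * y) powr (a - 1) / exp (0 + c * y)) \<partial>lborel)
      = (\<integral>\<^sup>+y. ennreal (c powr (a - 1)) * ennreal (indicator {0..} y * y powr (a - 1) * exp (- c * y)) \<partial>lborel)"
      using c by (intro nn_integral_cong)
        (auto simp: indicator_def zero_le_mult_iff powr_mult exp_minus divide_inverse ennreal_mult[symmetric])
    also have "\<dots> = ennreal (c powr (a - 1)) * (\<integral>\<^sup>+y. ennreal (indicator {0..} y * y powr (a - 1) * exp (- c * y)) \<partial>lborel)"
      by (rule nn_integral_cmult) auto
    finally show ?thesis using c by (simp add: mult.assoc[symmetric] ennreal_mult[symmetric] powr_diff)
  qed
  finally have "ennreal (Gamma a) = ennreal (c powr a) * (\<integral>\<^sup>+y. ennreal (indicator {0..} y * y powr (a - 1) * exp (- c * y)) \<partial>lborel)" .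
  then have "ennreal (1 / c powr a) * ennreal (Gamma a) =
      ennreal (1 / c powr a) * (ennreal (c powr a) * (\<integral>\<^sup>+y. ennreal (indicator {0..} y * y powr (a - 1) * exp (- c * y)) \<partial>lborel))"
    by simp
  then show ?thesis using c a Gamma_real_pos[OF a]
    by (simp add: mult.assoc[symmetric] ennreal_mult[symmetric])
qed

text \<open>The density of the Gamma law with shape \<open>a\<close> and scale
  \<open>s\<close>.\<close>

definition gamma_density :: "real \<Rightarrow> real \<Rightarrow> real \<Rightarrow> real" where
  "gamma_density a s y = indicator {0..} y * y powr (a - 1) * exp (- (1 / s) * y) / (Gamma a * s powr a)"

lemma gamma_density_nonneg: "a > 0 \<Longrightarrow> gamma_density a s y \<ge> 0"
  unfolding gamma_density_def
  by (intro divide_nonneg_nonneg mult_nonneg_nonneg) (auto simp: Gamma_real_pos less_imp_le)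

lemma borel_gamma_density [measurable]: "gamma_density a s \<in> borel_measurable borel"
  unfolding gamma_density_def[abs_def] by measurable

text \<open>Tilting by \<open>exp (- l * y)\<close> gives another Gamma integral, with rate
  \<open>l + 1 / s\<close> in place of \<open>1 / s\<close>.\<close>

lemma gamma_density_laplace:
  assumes a: "a > 0" and s: "s > 0" and l: "l \<ge> 0"
  shows "(\<integral>\<^sup>+y. ennreal (exp (- l * y)) \<partial>density lborel (\<lambda>y. ennreal (gamma_density a s y))) = ennreal ((1 + l * s) powr (- a))"
proof -
  define c where "c = l + 1 / s"
  have c: "c > 0" using s l by (simp add: c_def add_nonneg_pos)
  have G: "Gamma a * s powr a > 0" using a s by (intro mult_pos_pos Gamma_real_pos) auto
  have "(\<integral>\<^sup>+y. ennreal (exp (- l * y)) \<partial>density lborel (\<lambda>y. ennreal (gamma_density a s y)))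
    = (\<integral>\<^sup>+y. ennreal (gamma_density a s y) * ennreal (exp (- l * y)) \<partial>lborel)"
    by (intro nn_integral_density) auto
  also have "\<dots> = (\<integral>\<^sup>+y. ennreal (1 / (Gamma a * s powr a)) * ennreal (indicator {0..} y * y powr (a - 1) * exp (- c * y)) \<partial>lborel)"
  proof (intro nn_integral_cong)
    fix y
    have "exp (- (1 / s) * y) * exp (- l * y) = exp (- c * y)"
      unfolding c_def mult_exp_exp by (simp add: algebra_simps)
    then have "gamma_density a s y * exp (- l * y) = 1 / (Gamma a * s powr a) * (indicator {0..} y * y powr (a - 1) * exp (- c * y))"
    proof -
      have "X * E / G * F = 1 / G * (X * (E * F))" for X E F G :: real by simp
      then show ?thesis unfolding gamma_density_def using \<open>exp (- (1 / s) * y) * exp (- l * y) = exp (- c * y)\<close> by simp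
    qed
    then show "ennreal (gamma_density a s y) * ennreal (exp (- l * y)) =
        ennreal (1 / (Gamma a * s powr a)) * ennreal (indicator {0..} y * y powr (a - 1) * exp (- c * y))"
      using gamma_density_nonneg[OF a, of s y] G by (subst (1 2) ennreal_mult[symmetric]) auto
  qed
  also have "\<dots> = ennreal (1 / (Gamma a * s powr a)) * ennreal (Gamma a / c powr a)"
    using nn_integral_gamma_scaled[OF a c] by (subst nn_integral_cmult) simp_all
  also have "\<dots> = ennreal (1 / (Gamma a * s powr a) * (Gamma a / c powr a))"
    using G a by (intro ennreal_mult[symmetric]) (auto simp: Gamma_real_pos less_imp_le)
  also have "1 / (Gamma a * s powr a) * (Gamma a / c powr a) = 1 / (s * c) powr a"
    using Gamma_real_pos[OF a] s c by (simp add: powr_mult)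
  also have "s * c = 1 + l * s" using s by (simp add: c_def field_simps)
  finally show ?thesis by (simp add: powr_minus_divide)
qed

lemma prob_space_gamma_density:
  "a > 0 \<Longrightarrow> s > 0 \<Longrightarrow> prob_space (density lborel (\<lambda>y. ennreal (gamma_density a s y)))"
  using gamma_density_laplace[of a s 0] by (intro prob_spaceI) (simp add: powr_one_eq_one)

text \<open>The measure is a Poisson mixture of Gamma distributions.\<close>

lemma cir_measure_exists:
  assumes m: "m > 0" and t: "t > 0" and x: "x \<ge> 0"
  obtains q where "prob_space q" "sets q = sets borel" "\<And>a. measure q {a} = 0" "measure q {..<0} = 0"
    "\<And>l. l \<ge> 0 \<Longrightarrow> (\<integral>\<^sup>+y. ennreal (exp (- l * y)) \<partial>q) = ennreal (cir_laplace m l t x)"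
proof -
  define s where "s = t / 3"
  have s: "s > 0" using t by (simp add: s_def)
  \<comment> \<open>The mixing variable is Poisson with mean \<open>3 * x / t\<close>, and
    degenerate at 0 when \<open>x = 0\<close>.\<close>
  define P where "P = (if x = 0 then return_pmf 0 else poisson_pmf (x / s))"
  define K where "K = (\<lambda>n::nat. density lborel (\<lambda>y. ennreal (gamma_density (3 * m + real n) s y)))"
  have an: "3 * m + real n > 0" for n using m by (simp add: add_pos_nonneg)
  have Kp: "prob_space (K n)" for n unfolding K_def by (rule prob_space_gamma_density[OF an s])
  have Ks: "sets (K n) = sets borel" for n by (simp add: K_def)
  have KM: "K \<in> measure_pmf P \<rightarrow>\<^sub>M prob_algebra borel"
    using Kp Ks by (auto simp: space_prob_algebra)
  then have KM': "K \<in> measure_pmf P \<rightarrow>\<^sub>M subprob_algebra borel" by (rule measurable_prob_algebraD)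
  define q where "q = measure_pmf P \<bind> K"
  have Pp: "measure_pmf P \<in> space (prob_algebra (count_space UNIV))" by (simp add: space_prob_algebra prob_space_measure_pmf)
  have KM2: "K \<in> count_space UNIV \<rightarrow>\<^sub>M prob_algebra borel" using KM by simp
  have qp: "prob_space q" unfolding q_def by (rule prob_space_bind'[OF Pp KM2])
  have qs: "sets q = sets borel" unfolding q_def by (rule sets_bind'[OF Pp KM2])
  \<comment> \<open>A set that is null for all components is null for the mixture. The absence of
    atoms obtained from this allows distribution functions to be compared at every point.\<close>
  have null: "measure q A = 0" if A: "A \<in> sets borel" "\<And>n. emeasure (K n) A = 0" for A
  proof -
    have "emeasure q A = (\<integral>\<^sup>+n. emeasure (K n) A \<partial>measure_pmf P)"
      unfolding q_def by (rule emeasure_bind[OF _ KM']) (use A in auto)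
    then show ?thesis using A by (simp add: measure_def)
  qed
  have lap: "(\<integral>\<^sup>+y. ennreal (exp (- l * y)) \<partial>q) = ennreal (cir_laplace m l t x)" if l: "l \<ge> 0" for l
  proof -
    define D where "D = 1 + l * s"
    have D: "D > 0" using l s by (simp add: D_def add_pos_nonneg)
    have Dt: "1 + l * t / 3 = D" by (simp add: D_def s_def)
    have "(\<integral>\<^sup>+y. ennreal (exp (- l * y)) \<partial>q) = (\<integral>\<^sup>+n. (\<integral>\<^sup>+y. ennreal (exp (- l * y)) \<partial>K n) \<partial>measure_pmf P)"
      unfolding q_def by (rule nn_integral_bind[OF _ KM']) auto
    also have "\<dots> = (\<integral>\<^sup>+n. ennreal (D powr (- (3 * m + real n))) \<partial>measure_pmf P)"
      unfolding K_def gamma_density_laplace[OF an s l] D_def ..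
    also have "\<dots> = ennreal (cir_laplace m l t x)"
    proof (cases "x = 0")
      case True
      then show ?thesis by (simp add: P_def cir_laplace_def Dt)
    next
      case False
      define r where "r = x / s"
      have r: "r > 0" using False x s by (simp add: r_def)
      \<comment> \<open>Summation over the mixing variable becomes an exponential series and
        produces the factor \<open>exp (- r + r / D)\<close>, whose exponent is
        \<open>- cir_rate l t * x\<close>.\<close>
      have pmfD: "pmf (poisson_pmf r) n * D powr (- (3 * m + real n)) = D powr (- 3 * m) * exp (- r) * ((r / D) ^ n / fact n)" for n
      proof -
        have "D powr (- (3 * m + real n)) = D powr (- 3 * m) / D ^ n"
          using D by (simp add: powr_diff powr_minus_divide powr_add powr_realpow)
        then show ?thesis using r by (simp add: power_divide field_simps)
      qed
      have "(\<lambda>n. (r / D) ^ n / fact n) sums exp (r / D)" using exp_converges[of "r / D"] by (simp add: field_simps)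
      then have "(\<lambda>n. D powr (- 3 * m) * exp (- r) * ((r / D) ^ n / fact n)) sums (D powr (- 3 * m) * exp (- r) * exp (r / D))"
        by (rule sums_mult)
      then have sums: "(\<lambda>n. pmf (poisson_pmf r) n * D powr (- (3 * m + real n))) sums (D powr (- 3 * m) * exp (- r) * exp (r / D))"
        unfolding pmfD .
      have "(\<integral>\<^sup>+n. ennreal (D powr (- (3 * m + real n))) \<partial>measure_pmf P) = (\<Sum>n. ennreal (pmf (poisson_pmf r) n * D powr (- (3 * m + real n))))"
        using False unfolding P_def r_def nn_integral_measure_pmf nn_integral_count_space_nat by (simp add: ennreal_mult)
      also have "\<dots> = ennreal (D powr (- 3 * m) * exp (- r) * exp (r / D))"
        using sums by (subst suminf_ennreal2) (auto simp: sums_iff)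
      also have "D powr (- 3 * m) * exp (- r) * exp (r / D) = cir_laplace m l t x"
      proof -
        have "- r + r / D = - (l / D) * x"
        proof -
          have "r * s = x" using s by (simp add: r_def)
          then have "r * (D - 1) = l * x" by (simp add: D_def mult_ac)
          then show ?thesis using D by (simp add: field_simps)
        qed
        then have "exp (- r) * exp (r / D) = exp (- (l / D) * x)" by (simp only: mult_exp_exp)
        then show ?thesis by (simp add: cir_laplace_def cir_rate_def Dt mult.assoc)
      qed
      finally show ?thesis .
    qed
    finally show ?thesis .
  qed
  show thesis
  proof (rule that[OF qp qs _ _ lap])
    fix a
    show "measure q {a} = 0"
    proof (rule null)
      fix n
      have "AE y in lborel. y \<noteq> a" by (rule AE_lborel_singleton)
      then show "emeasure (K n) {a} = 0"
        unfolding K_def by (subst emeasure_density) (auto intro!: nn_integral_0_iff_AE[THEN iffD2] simp: indicator_def)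
    qed simp
    show "measure q {..<0} = 0"
    proof (rule null)
      show "emeasure (K n) {..<0} = 0" for n
        unfolding K_def by (subst emeasure_density) (auto intro!: nn_integral_0_iff_AE[THEN iffD2] simp: indicator_def gamma_density_def)
    qed simp
  qed
qed

section \<open>Identification of the transition function\<close>

locale cir_transition =
  fixes p :: "real \<Rightarrow> real \<Rightarrow> real measure" and m :: real
  assumes tf: "transition_function p" and m: "m > 0"
    and be: "backward_equation {0..} (\<lambda>x. m) (\<lambda>x. 2 / 3 * x) p"
begin

lemma backward:
  assumes A: "A \<in> sets halfline"
  obtains ut ux uxx where
    "continuous_on ({0<..} \<times> {0..}) (\<lambda>(t, x). measure (p t x) A)"
    "\<And>t x. t > 0 \<Longrightarrow> x \<ge> 0 \<Longrightarrow> ((\<lambda>r. measure (p r x) A) has_real_derivative ut t x) (at t)"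
    "\<And>t x. t > 0 \<Longrightarrow> x \<ge> 0 \<Longrightarrow> ((\<lambda>y. measure (p t y) A) has_real_derivative ux t x) (at x within {0..})"
    "\<And>t x. t > 0 \<Longrightarrow> x \<ge> 0 \<Longrightarrow> ((\<lambda>y. ux t y) has_real_derivative uxx t x) (at x within {0..})"
    "\<And>t x. t > 0 \<Longrightarrow> x \<ge> 0 \<Longrightarrow> ut t x = m * ux t x + x / 3 * uxx t x"
proof -
  note b = bspec[OF be[unfolded backward_equation_def] A]
  from conjunct2[OF b] obtain ut ux uxx where u: "\<forall>t>0. \<forall>x\<in>{0..}.
       ((\<lambda>r. measure (p r x) A) has_real_derivative ut t x) (at t) \<and>
       ((\<lambda>y. measure (p t y) A) has_real_derivative ux t x) (at x within {0..}) \<and>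
       ((\<lambda>y. ux t y) has_real_derivative uxx t x) (at x within {0..}) \<and>
       ut t x = m * ux t x + 1 / 2 * (2 / 3 * x) * uxx t x" by blast
  show thesis
  proof (rule that[of ut ux uxx, OF conjunct1[OF b]])
    fix t x :: real assume "t > 0" "x \<ge> 0"
    then have x0: "x \<in> {0..}" and t0: "t > 0" by simp_all
    from u t0 x0 have v: "((\<lambda>r. measure (p r x) A) has_real_derivative ut t x) (at t) \<and>
       ((\<lambda>y. measure (p t y) A) has_real_derivative ux t x) (at x within {0..}) \<and>
       ((\<lambda>y. ux t y) has_real_derivative uxx t x) (at x within {0..}) \<and>
       ut t x = m * ux t x + 1 / 2 * (2 / 3 * x) * uxx t x" by blast
    from v show "((\<lambda>r. measure (p r x) A) has_real_derivative ut t x) (at t)" by (elim conjE)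
    from v show "((\<lambda>y. measure (p t y) A) has_real_derivative ux t x) (at x within {0..})" by (elim conjE)
    from v show "((\<lambda>y. ux t y) has_real_derivative uxx t x) (at x within {0..})" by (elim conjE)
    from v have "ut t x = m * ux t x + 1 / 2 * (2 / 3 * x) * uxx t x" by (elim conjE)
    then show "ut t x = m * ux t x + x / 3 * uxx t x" by simp
  qed
qed

lemma measure_p_bounds:
  assumes "t \<ge> 0" "x \<ge> 0"
  shows "0 \<le> measure (p t x) A" "measure (p t x) A \<le> 1"
proof -
  interpret prob_space "p t x" by (rule transition_prob[OF tf assms])
  show "0 \<le> measure (p t x) A" "measure (p t x) A \<le> 1" by simp_all
qed

lemma integral_exp_eq_cir:
  assumes q: "prob_space q" "sets q = sets borel" "measure q {..<0} = 0"
    and lap: "\<And>l. l \<ge> 0 \<Longrightarrow> (\<integral>\<^sup>+y. ennreal (exp (- l * y)) \<partial>q) = ennreal (cir_laplace m l t x)"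
    and l: "l \<ge> 0"
  shows "integrable q (\<lambda>y. exp (- l * y))" "(\<integral>y. exp (- l * y) \<partial>q) = cir_laplace m l t x"
proof -
  have meas: "(\<lambda>y. exp (- l * y)) \<in> borel_measurable q"
    unfolding measurable_cong_sets[OF q(2) refl] by measurable
  show "integrable q (\<lambda>y. exp (- l * y))"
    by (rule integrableI_nonneg[OF meas]) (use lap[OF l] in auto)
  then show "(\<integral>y. exp (- l * y) \<partial>q) = cir_laplace m l t x"
    using lap[OF l] cir_laplace_nonneg meas by (subst integral_eq_nn_integral) auto
qed

text \<open>At time 0 the probabilities are indicators and need not be continuous in
  \<open>x\<close>, so their time is shifted by \<open>e\<close>, while the explicit solutions start
  at 0. The sign \<open>s\<close> makes one maximum principle yield both inequalities.\<close>

lemma shifted_solution: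
  assumes A: "A \<in> sets halfline" and e: "e > 0" and s: "\<bar>s\<bar> = (1::real)" and B: "B \<ge> 0"
    and bd: "\<And>t x. t \<ge> 0 \<Longrightarrow> x \<ge> 0 \<Longrightarrow> \<bar>\<Sum>i\<le>n. a i * cir_laplace m (real i) t x\<bar> \<le> B"
  obtains wt wx wxx where "half_line_solution (\<lambda>t x. s * (measure (p (e + t) x) A - (\<Sum>i\<le>n. a i * cir_laplace m (real i) t x))) wt wx wxx m (1 + B)"
proof -
  obtain ut ux uxx where c: "continuous_on ({0<..} \<times> {0..}) (\<lambda>(t, x). measure (p t x) A)"
    and ut: "\<And>t x. t > 0 \<Longrightarrow> x \<ge> 0 \<Longrightarrow> ((\<lambda>r. measure (p r x) A) has_real_derivative ut t x) (at t)"
    and ux: "\<And>t x. t > 0 \<Longrightarrow> x \<ge> 0 \<Longrightarrow> ((\<lambda>y. measure (p t y) A) has_real_derivative ux t x) (at x within {0..})"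
    and uxx: "\<And>t x. t > 0 \<Longrightarrow> x \<ge> 0 \<Longrightarrow> ((\<lambda>y. ux t y) has_real_derivative uxx t x) (at x within {0..})"
    and pde: "\<And>t x. t > 0 \<Longrightarrow> x \<ge> 0 \<Longrightarrow> ut t x = m * ux t x + x / 3 * uxx t x"
    using backward[OF A] by blast
  define L where "L = (\<lambda>i t x. cir_laplace m (real i) t x)"
  define r where "r = (\<lambda>i::nat. cir_rate (real i))"
  define wt where "wt = (\<lambda>t x. s * (ut (e + t) x - (\<Sum>i\<le>n. a i * ((- m * r i t + (r i t)\<^sup>2 * x / 3) * L i t x))))"
  define wx where "wx = (\<lambda>t x. s * (ux (e + t) x - (\<Sum>i\<le>n. a i * (- r i t * L i t x))))"
  define wxx where "wxx = (\<lambda>t x. s * (uxx (e + t) x - (\<Sum>i\<le>n. a i * (- r i t * (- r i t * L i t x)))))"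
  have "half_line_solution (\<lambda>t x. s * (measure (p (e + t) x) A - (\<Sum>i\<le>n. a i * L i t x))) wt wx wxx m (1 + B)"
  proof
    show "m > 0" by (rule m)
    have c1: "continuous_on ({0..} \<times> {0..}) ((\<lambda>(t, x). measure (p t x) A) \<circ> (\<lambda>q. (e + fst q, snd q)))"
      using e by (intro continuous_on_compose continuous_on_subset[OF c]) (auto intro!: continuous_intros)
    have c2: "continuous_on ({0..} \<times> {0..}) (\<lambda>q. L i (fst q) (snd q))" for i
      using continuous_on_cir_laplace[of "real i" m] by (simp add: L_def case_prod_unfold)
    have c1': "continuous_on ({0..} \<times> {0..}) (\<lambda>q. measure (p (e + fst q) (snd q)) A)"
      using c1 by (simp add: comp_def)
    show "continuous_on ({0..} \<times> {0..}) (\<lambda>(t, x). s * (measure (p (e + t) x) A - (\<Sum>i\<le>n. a i * L i t x)))"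
      unfolding case_prod_unfold by (intro continuous_on_mult continuous_on_const continuous_on_diff c1' continuous_on_sum c2)
    fix t x :: real
    show "s * (measure (p (e + t) x) A - (\<Sum>i\<le>n. a i * L i t x)) \<le> 1 + B" if "t \<ge> 0" "x \<ge> 0"
    proof -
      have "\<bar>s * (measure (p (e + t) x) A - (\<Sum>i\<le>n. a i * L i t x))\<bar> = \<bar>measure (p (e + t) x) A - (\<Sum>i\<le>n. a i * L i t x)\<bar>"
        by (simp add: abs_mult s)
      also have "\<dots> \<le> 1 + B" using bd[OF that] measure_p_bounds[of "e + t" x A] that e unfolding L_def by linarith
      finally show ?thesis by linarith
    qed
    assume t: "t > 0" and x: "x \<ge> 0"
    have et: "e + t > 0" using e t by simp
    have "((\<lambda>t. measure (p (e + t) x) A) has_real_derivative ut (e + t) x) (at t)"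
    proof -
      have g: "((\<lambda>t. e + t) has_real_derivative 1) (at t)" by (auto intro!: derivative_eq_intros)
      from DERIV_chain2[where g = "\<lambda>t. e + t", OF ut[OF et x] g] show ?thesis by simp
    qed
    moreover have "((\<lambda>t. \<Sum>i\<le>n. a i * L i t x) has_real_derivative (\<Sum>i\<le>n. a i * ((- m * r i t + (r i t)\<^sup>2 * x / 3) * L i t x))) (at t)"
      unfolding L_def r_def by (intro DERIV_sum DERIV_cmult cir_laplace_deriv_t) (use t in auto)
    ultimately show "((\<lambda>t. s * (measure (p (e + t) x) A - (\<Sum>i\<le>n. a i * L i t x))) has_real_derivative wt t x) (at t)"
      unfolding wt_def by (intro DERIV_cmult DERIV_diff)
    have "((\<lambda>x. \<Sum>i\<le>n. a i * L i t x) has_real_derivative (\<Sum>i\<le>n. a i * (- r i t * L i t x))) (at x within {0..})"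
      unfolding L_def r_def by (intro DERIV_sum DERIV_cmult cir_laplace_deriv_x)
    then show "((\<lambda>x. s * (measure (p (e + t) x) A - (\<Sum>i\<le>n. a i * L i t x))) has_real_derivative wx t x) (at x within {0..})"
      unfolding wx_def by (intro DERIV_cmult DERIV_diff ux[OF et x])
    have "((\<lambda>x. \<Sum>i\<le>n. a i * (- r i t * L i t x)) has_real_derivative (\<Sum>i\<le>n. a i * (- r i t * (- r i t * L i t x)))) (at x within {0..})"
      unfolding L_def r_def by (intro DERIV_sum DERIV_cmult cir_laplace_deriv_x)
    then show "((\<lambda>x. wx t x) has_real_derivative wxx t x) (at x within {0..})"
      unfolding wx_def wxx_def by (intro DERIV_cmult DERIV_diff uxx[OF et x])
    have "(\<Sum>i\<le>n. a i * ((- m * r i t + (r i t)\<^sup>2 * x / 3) * L i t x)) =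
        m * (\<Sum>i\<le>n. a i * (- r i t * L i t x)) + x / 3 * (\<Sum>i\<le>n. a i * (- r i t * (- r i t * L i t x)))"
      unfolding sum_distrib_left sum.distrib[symmetric]
      by (intro sum.cong refl) (simp add: power2_eq_square algebra_simps)
    then show "wt t x = m * wx t x + x / 3 * wxx t x"
      unfolding wt_def wx_def wxx_def pde[OF et x] by (simp add: algebra_simps)
  qed
  then show thesis using that unfolding L_def by blast
qed

text \<open>The initial function \<open>g\<close> is continuous. Approximate it by exponential
  polynomials, evolve these explicitly, and compare with \<open>p\<close> by the maximum principle
  and with \<open>q\<close> by integration; both comparisons meet in \<open>U\<close>.\<close>

lemma representation:
  assumes A: "A \<in> sets halfline" and e: "e > 0" and t: "t > 0" and x: "x \<ge> 0"
    and q: "prob_space q" "sets q = sets borel" "measure q {..<0} = 0"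
    and lap: "\<And>l. l \<ge> 0 \<Longrightarrow> (\<integral>\<^sup>+y. ennreal (exp (- l * y)) \<partial>q) = ennreal (cir_laplace m l t x)"
  shows "measure (p (e + t) x) A = (\<integral>y. indicator {0..} y * measure (p e y) A \<partial>q)"
proof -
  interpret q: prob_space q by (rule q)
  define g where "g = (\<lambda>y. measure (p e y) A)"
  have g01: "0 \<le> g y" "g y \<le> 1" if "y \<ge> 0" for y using measure_p_bounds[of e y A] e that by (auto simp: g_def)
  have gc: "continuous_on {0..} g"
  proof -
    have "continuous_on ({0<..} \<times> {0..}) (\<lambda>(t, x). measure (p t x) A)" using backward[OF A] by blast
    then have "continuous_on {0..} ((\<lambda>(t, x). measure (p t x) A) \<circ> (\<lambda>y. (e, y)))"
      using e by (intro continuous_on_compose) (auto intro!: continuous_intros elim: continuous_on_subset)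
    then show ?thesis by (simp add: g_def comp_def)
  qed
  have gm: "(\<lambda>y. indicator {0..} y * g y) \<in> borel_measurable q"
    unfolding measurable_cong_sets[OF q(2) refl]
    using borel_measurable_continuous_on_indicator[OF _ gc] by simp
  have gi: "integrable q (\<lambda>y. indicator {0..} y * g y)"
    by (rule q.integrable_const_bound[of _ 1]) (use gm g01 in \<open>auto simp: indicator_def\<close>)
  have AE0: "AE y in q. y \<ge> 0"
    by (rule AE_I[where N = "{..<0}"]) (auto simp: q(2) q.emeasure_eq_measure q(3))
  define d where "d = \<bar>measure (p (e + t) x) A - (\<integral>y. indicator {0..} y * g y \<partial>q)\<bar>"
  \<comment> \<open>The range \<open>R = k + 1\<close> and the accuracy \<open>1 / (k + 1)\<close>
    are linked, so that approximation, barrier and tail errors vanish together.\<close>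
  have bound: "d \<le> 2 * (1 / real (Suc k)) + 3 * (x + m * t) * (1 / real (Suc k)) + 3 * measure q {real (Suc k)<..}" for k
  proof -
    define \<eta> where "\<eta> = 1 / real (Suc k)"
    define R where "R = real (Suc k)"
    have \<eta>: "\<eta> > 0" "\<eta> \<le> 1" and R: "R > 0" "1 / R = \<eta>" by (auto simp: \<eta>_def R_def)
    obtain a n where an: "\<And>x. 0 \<le> x \<Longrightarrow> x \<le> R \<Longrightarrow> \<bar>g x - (\<Sum>i\<le>n. a i * exp (- real i * x))\<bar> \<le> \<eta>"
      "\<And>x. 0 \<le> x \<Longrightarrow> \<bar>\<Sum>i\<le>n. a i * exp (- real i * x)\<bar> \<le> 1 + \<eta>"
      using exp_polynomial_approx[OF gc g01 \<eta>(1) R(1)] by blast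
    define S where "S = (\<lambda>x. \<Sum>i\<le>n. a i * exp (- real i * x))"
    define U where "U = (\<lambda>t x. \<Sum>i\<le>n. a i * cir_laplace m (real i) t x)"
    have US: "integrable q' S \<and> (\<integral>y. S y \<partial>q') = U t' x'"
      if "prob_space q'" "sets q' = sets borel" "measure q' {..<0} = 0"
        "\<And>l. l \<ge> 0 \<Longrightarrow> (\<integral>\<^sup>+y. ennreal (exp (- l * y)) \<partial>q') = ennreal (cir_laplace m l t' x')" for q' t' x'
      using integral_exp_eq_cir[OF that] unfolding S_def U_def by simp
    \<comment> \<open>The coefficients \<open>a i\<close> are not controlled individually. The bound
      comes from reading \<open>U\<close> as the mean of the bounded function \<open>S\<close> under
      a probability measure.\<close>
    have Ub: "\<bar>U t' x'\<bar> \<le> 1 + \<eta>" if t': "t' \<ge> 0" and x': "x' \<ge> 0" for t' x'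
    proof (cases "t' = 0")
      case True
      then show ?thesis using an(2)[OF x'] by (simp add: U_def cir_laplace_0)
    next
      case False
      then obtain q' where q': "prob_space q'" "sets q' = sets borel" "measure q' {..<0} = 0"
        "\<And>l. l \<ge> 0 \<Longrightarrow> (\<integral>\<^sup>+y. ennreal (exp (- l * y)) \<partial>q') = ennreal (cir_laplace m l t' x')"
        using cir_measure_exists[OF m _ x', of t'] t' by (metis less_eq_real_def)
      interpret q': prob_space q' by (rule q')
      have AE': "AE y in q'. y \<ge> 0"
        by (rule AE_I[where N = "{..<0}"]) (auto simp: q'(2) q'.emeasure_eq_measure q'(3))
      have iS: "integrable q' S" and eS: "(\<integral>y. S y \<partial>q') = U t' x'" using US[OF q'] by auto
      have "\<bar>U t' x'\<bar> \<le> (\<integral>y. \<bar>S y\<bar> \<partial>q')" unfolding eS[symmetric] by (rule integral_abs_bound)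
      also have "\<dots> \<le> (\<integral>y. 1 + \<eta> \<partial>q')"
      proof (rule integral_mono_AE)
        show "AE y in q'. \<bar>S y\<bar> \<le> 1 + \<eta>"
          using AE' by (rule eventually_mono) (use an(2) in \<open>simp add: S_def\<close>)
      qed (use iS in auto)
      finally show ?thesis by (simp add: q'.prob_space)
    qed
    have B0: "1 + \<eta> \<ge> 0" using \<eta> by simp
    have one_side: "s * (measure (p (e + t) x) A - U t x) \<le> \<eta> + 3 * (x + m * t) * \<eta>" if s: "\<bar>s\<bar> = (1::real)" for s
    proof -
      obtain wt wx wxx where "half_line_solution (\<lambda>t x. s * (measure (p (e + t) x) A - (\<Sum>i\<le>n. a i * cir_laplace m (real i) t x))) wt wx wxx m (1 + (1 + \<eta>))"
        using shifted_solution[OF A e s B0, of a n] Ub unfolding U_def by blast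
      then interpret half_line_solution "\<lambda>t x. s * (measure (p (e + t) x) A - (\<Sum>i\<le>n. a i * cir_laplace m (real i) t x))" wt wx wxx m "1 + (1 + \<eta>)" .
      have "s * (measure (p (e + t) x) A - (\<Sum>i\<le>n. a i * cir_laplace m (real i) t x)) \<le> \<eta> + (1 + (1 + \<eta>)) / R * (x + m * t)"
      proof (rule maximum_principle[OF R(1)])
        fix y assume y: "0 \<le> y" "y \<le> R"
        have "s * (g y - S y) \<le> \<bar>s * (g y - S y)\<bar>" by simp
        also have "\<dots> \<le> \<eta>" using an(1)[OF y] by (simp add: abs_mult s S_def)
        finally show "s * (measure (p (e + 0) y) A - (\<Sum>i\<le>n. a i * cir_laplace m (real i) 0 y)) \<le> \<eta>"
          by (simp add: g_def S_def cir_laplace_0)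
      qed (use \<eta> t x in auto)
      also have "(1 + (1 + \<eta>)) / R * (x + m * t) \<le> 3 / R * (x + m * t)"
        using \<eta> R x t m by (intro mult_right_mono divide_right_mono) auto
      also have "3 / R * (x + m * t) = 3 * (x + m * t) * \<eta>" by (simp add: \<eta>_def R_def)
      finally show ?thesis by (simp add: U_def)
    qed
    have 1: "\<bar>measure (p (e + t) x) A - U t x\<bar> \<le> \<eta> + 3 * (x + m * t) * \<eta>"
      using one_side[of 1] one_side[of "-1"] by (simp add: abs_le_iff)
    have iS: "integrable q S" and eS: "(\<integral>y. S y \<partial>q) = U t x" using US[OF q lap] by auto
    have 2: "\<bar>U t x - (\<integral>y. indicator {0..} y * g y \<partial>q)\<bar> \<le> \<eta> + 3 * measure q {R<..}"
    proof -
      have Rs: "{R<..} \<in> sets q" by (simp add: q(2))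
      have iR: "integrable q (\<lambda>y. \<eta> + 3 * indicator {R<..} y)"
        using Rs by (intro Bochner_Integration.integrable_add integrable_mult_right integrable_real_indicator)
          (auto simp: q.emeasure_eq_measure)
      have "\<bar>U t x - (\<integral>y. indicator {0..} y * g y \<partial>q)\<bar> = \<bar>\<integral>y. S y - indicator {0..} y * g y \<partial>q\<bar>"
        using iS gi by (simp add: eS)
      also have "\<dots> \<le> (\<integral>y. \<bar>S y - indicator {0..} y * g y\<bar> \<partial>q)" by (rule integral_abs_bound)
      also have "\<dots> \<le> (\<integral>y. \<eta> + 3 * indicator {R<..} y \<partial>q)"
      proof (rule integral_mono_AE)
        show "AE y in q. \<bar>S y - indicator {0..} y * g y\<bar> \<le> \<eta> + 3 * indicator {R<..} y"
          using AE0
        proof eventually_elim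
          case (elim y)
          show ?case
          proof (cases "y \<le> R")
            case True
            then show ?thesis using an(1)[OF elim True] elim by (simp add: S_def abs_minus_commute)
          next
            case False
            then show ?thesis using an(2)[OF elim] g01[OF elim] elim \<eta> by (simp add: S_def)
          qed
        qed
      qed (use iS gi iR in auto)
      also have "\<dots> = \<eta> + 3 * measure q {R<..}"
        using Rs by (subst Bochner_Integration.integral_add) (auto simp: q.prob_space q.emeasure_eq_measure)
      finally show ?thesis .
    qed
    have "d \<le> \<bar>measure (p (e + t) x) A - U t x\<bar> + \<bar>U t x - (\<integral>y. indicator {0..} y * g y \<partial>q)\<bar>"
      unfolding d_def by (rule order_trans[OF _ abs_triangle_ineq]) simp
    also have "\<dots> \<le> (\<eta> + 3 * (x + m * t) * \<eta>) + (\<eta> + 3 * measure q {R<..})"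
      using 1 2 by (rule add_mono)
    also have "\<dots> = 2 * (1 / real (Suc k)) + 3 * (x + m * t) * (1 / real (Suc k)) + 3 * measure q {real (Suc k)<..}"
      unfolding \<eta>_def R_def by (simp only: mult_2)
    finally show ?thesis .
  qed
  have lim: "(\<lambda>k. 2 * (1 / real (Suc k)) + 3 * (x + m * t) * (1 / real (Suc k)) + 3 * measure q {real (Suc k)<..})
      \<longlonglongrightarrow> 2 * 0 + 3 * (x + m * t) * 0 + 3 * measure q (\<Inter>k. {real (Suc k)<..})"
  proof (intro tendsto_add tendsto_mult_left)
    show "(\<lambda>k. 1 / real (Suc k)) \<longlonglongrightarrow> 0" using LIMSEQ_inverse_real_of_nat by (simp add: inverse_eq_divide)
    then show "(\<lambda>k. 1 / real (Suc k)) \<longlonglongrightarrow> 0" .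
    show "(\<lambda>k. measure q {real (Suc k)<..}) \<longlonglongrightarrow> measure q (\<Inter>k. {real (Suc k)<..})"
      by (rule q.finite_Lim_measure_decseq) (auto simp: q(2) decseq_def)
  qed
  moreover have "(\<Inter>k. {real (Suc k)<..}) = {}"
  proof -
    have "y \<notin> (\<Inter>k. {real (Suc k)<..})" for y
    proof
      assume y: "y \<in> (\<Inter>k. {real (Suc k)<..})"
      obtain k :: nat where "y \<le> real k" using real_arch_simple by blast
      moreover have "y \<in> {real (Suc k)<..}" using y by (rule INT_D) simp
      ultimately show False by simp
    qed
    then show ?thesis by blast
  qed
  ultimately have "d \<le> 0" using LIMSEQ_le_const[OF lim, of d] bound by auto
  then show ?thesis by (simp add: d_def g_def)
qed

text \<open>As \<open>y \<noteq> a\<close>, a small ball around \<open>y\<close> in the half-line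
  lies inside or outside \<open>{0..a}\<close>, and stochastic continuity decides.\<close>

lemma continuity_at_0:
  assumes a: "y \<ge> 0" "y \<noteq> a" "a \<ge> 0"
  shows "((\<lambda>e. measure (p e y) {0..a}) \<longlongrightarrow> indicator {..a} y) (at_right 0)"
proof -
  define d where "d = \<bar>a - y\<bar>"
  have d: "d > 0" using a by (simp add: d_def)
  have lim: "((\<lambda>e. measure (p e y) {v \<in> {0..}. dist v y < d}) \<longlongrightarrow> 1) (at_right 0)"
    using tf a d by (simp add: transition_function_def)
  have ball: "{v \<in> {0..}. dist v y < d} \<in> sets halfline"
  proof -
    have "{v \<in> {0..}. dist v y < d} = {0..} \<inter> ball y d" by (auto simp: dist_commute)
    then show ?thesis by (simp add: sets_halfline)
  qed
  have ivl: "{0..a} \<in> sets halfline" by (simp add: sets_halfline)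
  show ?thesis
  proof (cases "y < a")
    case True
    have "((\<lambda>e. measure (p e y) {0..a}) \<longlongrightarrow> 1) (at_right 0)"
    proof (rule tendsto_sandwich[OF _ _ lim tendsto_const])
      show "\<forall>\<^sub>F e in at_right 0. measure (p e y) {v \<in> {0..}. dist v y < d} \<le> measure (p e y) {0..a}"
        unfolding eventually_at_right_field
      proof (intro exI[of _ 1] conjI allI impI)
        fix e :: real assume e: "0 < e" "e < 1"
        interpret prob_space "p e y" using transition_prob[OF tf _ a(1), of e] e by simp
        show "measure (p e y) {v \<in> {0..}. dist v y < d} \<le> measure (p e y) {0..a}"
          using transition_prob[OF tf _ a(1), of e] e ivl True
          by (intro finite_measure_mono) (auto simp: d_def dist_real_def)
      qed simp
      show "\<forall>\<^sub>F e in at_right 0. measure (p e y) {0..a} \<le> 1"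
        unfolding eventually_at_right_field
        using measure_p_bounds(2)[OF _ a(1)] by (intro exI[of _ 1]) auto
    qed
    then show ?thesis using True by simp
  next
    case False
    then have ya: "a < y" using a by simp
    have "((\<lambda>e. measure (p e y) {0..a}) \<longlongrightarrow> 0) (at_right 0)"
    proof (rule tendsto_sandwich[OF _ _ tendsto_const])
      show "((\<lambda>e. 1 - measure (p e y) {v \<in> {0..}. dist v y < d}) \<longlongrightarrow> 0) (at_right 0)"
        using tendsto_diff[OF tendsto_const lim, of 1] by simp
      show "\<forall>\<^sub>F e in at_right 0. 0 \<le> measure (p e y) {0..a}" by simp
      show "\<forall>\<^sub>F e in at_right 0. measure (p e y) {0..a} \<le> 1 - measure (p e y) {v \<in> {0..}. dist v y < d}"
        unfolding eventually_at_right_field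
      proof (intro exI[of _ 1] conjI allI impI)
        fix e :: real assume e: "0 < e" "e < 1"
        have tp: "prob_space (p e y)" "sets (p e y) = sets halfline" using transition_prob[OF tf _ a(1), of e] e by auto
        interpret prob_space "p e y" by (rule tp)
        have "measure (p e y) {0..a} + measure (p e y) {v \<in> {0..}. dist v y < d} = measure (p e y) ({0..a} \<union> {v \<in> {0..}. dist v y < d})"
          using ivl ball ya by (intro finite_measure_Union[symmetric]) (auto simp: tp(2) d_def dist_real_def)
        also have "\<dots> \<le> 1" by simp
        finally show "measure (p e y) {0..a} \<le> 1 - measure (p e y) {v \<in> {0..}. dist v y < d}" by simp
      qed simp
    qed
    then show ?thesis using ya by simp
  qed
qed

text \<open>For positive times, let \<open>e\<close> tend to 0 in \<open>representation\<close> with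
  \<open>A = {0..a}\<close>. The left side converges by continuity in time, the right side by
  dominated convergence, since \<open>q\<close> has no mass at \<open>a\<close>. So
  \<open>p t x\<close> and the explicit law have the same distribution function.\<close>

theorem transition_laplace:
  assumes t: "t \<ge> 0" and x: "x \<ge> 0" and l: "l \<ge> 0"
  shows "(\<integral>\<^sup>+y. ennreal (exp (- l * y)) \<partial>p t x) = ennreal (cir_laplace m l t x)"
proof (cases "t = 0")
  case True
  have "p 0 x = return halfline x" using tf x by (simp add: transition_function_def)
  moreover have "(\<lambda>y. ennreal (exp (- l * y))) \<in> borel_measurable halfline"
    by (rule measurable_restrict_space1) measurable
  ultimately show ?thesis using True x by (simp add: nn_integral_return cir_laplace_0)
next
  case False
  then have t0: "t > 0" using t by simp
  obtain q where q: "prob_space q" "sets q = sets borel" "\<And>a. measure q {a} = 0" "measure q {..<0} = 0"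
    and lap: "\<And>l. l \<ge> 0 \<Longrightarrow> (\<integral>\<^sup>+y. ennreal (exp (- l * y)) \<partial>q) = ennreal (cir_laplace m l t x)"
    using cir_measure_exists[OF m t0 x] by blast
  interpret q: prob_space q by (rule q)
  have AE0: "AE y in q. y \<ge> 0"
    by (rule AE_I[where N = "{..<0}"]) (auto simp: q(2) q.emeasure_eq_measure q(4))
  have AEa: "AE y in q. y \<noteq> a" for a
    by (rule AE_I[where N = "{a}"]) (auto simp: q(2) q.emeasure_eq_measure q(3))
  have cdf: "measure (p t x) {0..a} = measure q {..a}" if a: "a \<ge> 0" for a
  proof -
    have A: "{0..a} \<in> sets halfline" by (simp add: sets_halfline)
    define e where "e = (\<lambda>n. 1 / real (Suc n))"
    have e: "e n > 0" for n by (simp add: e_def)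
    have e0: "e \<longlonglongrightarrow> 0" unfolding e_def using LIMSEQ_inverse_real_of_nat by (simp add: inverse_eq_divide)
    have er: "filterlim e (at_right 0) sequentially"
      unfolding filterlim_at using e0 e by (simp add: less_imp_neq[symmetric] less_imp_le)
    have rep: "measure (p (e n + t) x) {0..a} = (\<integral>y. indicator {0..} y * measure (p (e n) y) {0..a} \<partial>q)" for n
      by (rule representation[OF A e t0 x q(1,2,4) lap])
    have cont: "continuous_on ({0<..} \<times> {0..}) (\<lambda>(t, x). measure (p t x) {0..a})" using backward[OF A] by blast
    have l1: "(\<lambda>n. measure (p (e n + t) x) {0..a}) \<longlonglongrightarrow> measure (p t x) {0..a}"
    proof -
      have "continuous_on {0<..} ((\<lambda>(t, x). measure (p t x) {0..a}) \<circ> (\<lambda>t. (t, x)))"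
        using x by (intro continuous_on_compose) (auto intro!: continuous_intros intro: continuous_on_subset[OF cont])
      then have "continuous_on {0<..} (\<lambda>t. measure (p t x) {0..a})" by (simp add: comp_def)
      then have "isCont (\<lambda>t. measure (p t x) {0..a}) t" using t0 by (simp add: continuous_on_eq_continuous_at)
      moreover have "(\<lambda>n. e n + t) \<longlonglongrightarrow> t" using tendsto_add[OF e0 tendsto_const, of t] by simp
      ultimately show ?thesis by (rule isCont_tendsto_compose)
    qed
    have l2: "(\<lambda>n. \<integral>y. indicator {0..} y * measure (p (e n) y) {0..a} \<partial>q) \<longlonglongrightarrow> (\<integral>y. indicator {..a} y \<partial>q)"
    proof (rule integral_dominated_convergence[where w = "\<lambda>_. 1"])
      show "(\<lambda>y. indicator {..a} y) \<in> borel_measurable q" by (intro borel_measurable_indicator) (simp add: q(2))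
      show "(\<lambda>y. indicator {0..} y * measure (p (e n) y) {0..a}) \<in> borel_measurable q" for n
      proof -
        have "continuous_on {0..} ((\<lambda>(t, x). measure (p t x) {0..a}) \<circ> (\<lambda>y. (e n, y)))"
          using e by (intro continuous_on_compose) (auto intro!: continuous_intros intro: continuous_on_subset[OF cont])
        then have c: "continuous_on {0..} (\<lambda>y. measure (p (e n) y) {0..a})" by (simp add: comp_def)
        show ?thesis unfolding measurable_cong_sets[OF q(2) refl]
          using borel_measurable_continuous_on_indicator[OF _ c] by simp
      qed
      show "AE y in q. (\<lambda>n. indicator {0..} y * measure (p (e n) y) {0..a}) \<longlonglongrightarrow> indicator {..a} y"
        using AE0 AEa[of a]
      proof eventually_elim
        case (elim y)
        have "(\<lambda>n. measure (p (e n) y) {0..a}) \<longlonglongrightarrow> indicator {..a} y"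
          by (rule filterlim_compose[OF continuity_at_0[OF elim a] er])
        then show ?case using elim(1) by simp
      qed
      show "AE y in q. norm (indicator {0..} y * measure (p (e n) y) {0..a}) \<le> 1" for n
        using AE0 by eventually_elim (use measure_p_bounds(2)[of "e n"] e in \<open>simp add: less_imp_le\<close>)
    qed simp
    have "(\<integral>y. indicator {..a} y \<partial>q) = measure q {..a}" by (simp add: q(2) sets_eq_imp_space_eq[OF q(2)])
    then show ?thesis using LIMSEQ_unique[OF l1[unfolded rep] l2] by simp
  qed
  \<comment> \<open>\<open>p t x\<close> lives on the half-line; it is pushed to the real line so
    that distribution functions can be compared.\<close>
  define P where "P = distr (p t x) borel (\<lambda>y. y)"
  have tp: "prob_space (p t x)" "sets (p t x) = sets halfline" "space (p t x) = {0..}"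
    using transition_prob[OF tf t x] by auto
  have idm: "(\<lambda>y. y) \<in> p t x \<rightarrow>\<^sub>M borel"
    unfolding measurable_cong_sets[OF tp(2) refl] by (rule measurable_restrict_space1) simp
  have Pr: "real_distribution P"
    unfolding real_distribution_def real_distribution_axioms_def P_def
    using prob_space.prob_space_distr[OF tp(1) idm] by simp
  have qr: "real_distribution q"
    unfolding real_distribution_def real_distribution_axioms_def using q by simp
  have "cdf P = cdf q"
  proof
    fix a
    have "cdf P a = measure (p t x) ({..a} \<inter> {0..})"
      unfolding cdf_def P_def using idm by (subst measure_distr) (auto simp: tp(3))
    also have "\<dots> = measure q {..a}"
    proof (cases "a \<ge> 0")
      case True
      have "{..a} \<inter> {0..} = {0..a}" by auto
      then show ?thesis using cdf[OF True] by simp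
    next
      case False
      then have "{..a} \<inter> {0..} = {}" by auto
      moreover have "measure q {..a} \<le> measure q {..<0}" using False by (intro q.finite_measure_mono) (auto simp: q(2))
      then have "measure q {..a} = 0" using q(4) by (simp add: measure_le_0_iff)
      ultimately show ?thesis by simp
    qed
    finally show "cdf P a = cdf q a" by (simp add: cdf_def)
  qed
  then have "P = q" by (rule cdf_unique[OF Pr qr])
  have "(\<integral>\<^sup>+y. ennreal (exp (- l * y)) \<partial>p t x) = (\<integral>\<^sup>+y. ennreal (exp (- l * y)) \<partial>P)"
    unfolding P_def by (subst nn_integral_distr[OF idm]) auto
  then show ?thesis using lap[OF l] \<open>P = q\<close> by simp
qed

end

section \<open>Joint Laplace transforms\<close>

text \<open>Serves to replace the elapsed time of the chain, a difference of integer parts divided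
  by \<open>k\<close>, by \<open>t - s\<close>.\<close>

lemma cir_laplace_time_lipschitz:
  assumes m: "m \<ge> 0" and l: "l \<ge> 0" and t: "t \<ge> 0" "t' \<ge> 0" and x: "x \<ge> 0"
  shows "\<bar>cir_laplace m l t' x - cir_laplace m l t x\<bar> \<le> \<bar>t' - t\<bar> * (m * l + l\<^sup>2 * x)"
proof -
  have main: "\<bar>cir_laplace m l v x - cir_laplace m l u x\<bar> \<le> (v - u) * (m * l + l\<^sup>2 * x)" if uv: "0 \<le> u" "u < v" for u v
  proof -
    define f' where "f' = (\<lambda>t. (- m * cir_rate l t + (cir_rate l t)\<^sup>2 * x / 3) * cir_laplace m l t x)"
    obtain w where w: "u < w" "w < v" "cir_laplace m l v x - cir_laplace m l u x = (v - u) * f' w"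
      using MVT2[of u v "\<lambda>t. cir_laplace m l t x" f'] cir_laplace_deriv_t[OF l] uv
      unfolding f'_def by (meson order_trans)
    define a where "a = cir_rate l w"
    have a: "0 \<le> a" "a \<le> l" using cir_rate_bounds[OF l, of w] w uv by (auto simp: a_def)
    have "0 \<le> m * a" "m * a \<le> m * l" "0 \<le> a\<^sup>2 * x" "a\<^sup>2 * x \<le> l\<^sup>2 * x"
      using a m x by (auto intro: mult_left_mono mult_right_mono power_mono)
    then have "\<bar>- m * a + a\<^sup>2 * x / 3\<bar> \<le> m * l + l\<^sup>2 * x" by linarith
    moreover have "\<bar>cir_laplace m l w x\<bar> \<le> 1"
      using cir_laplace_nonneg cir_laplace_le_1[OF m l _ x, of w] w uv by simp
    ultimately have "\<bar>f' w\<bar> \<le> (m * l + l\<^sup>2 * x) * 1"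
      unfolding f'_def abs_mult a_def[symmetric] by (intro mult_mono) auto
    then show ?thesis unfolding w(3) abs_mult using uv by (intro mult_mono) auto
  qed
  consider "t < t'" | "t' < t" | "t = t'" by linarith
  then show ?thesis
  proof cases
    case 1 then show ?thesis using main[OF t(1) 1] by simp
  next
    case 2 then show ?thesis using main[OF t(2) 2] by (simp add: abs_minus_commute)
  qed simp
qed

section \<open>The Markov property of the diffusion in Laplace form\<close>

locale cir_process = cir_transition p m for p m +
  fixes N :: "'b measure" and D :: "real \<Rightarrow> 'b \<Rightarrow> real"
  assumes process: "continuous_markov_process N {0..1} D p"
    and D0: "AE \<omega> in N. D 0 \<omega> = 0"
begin

sublocale N: prob_space N using process by (simp add: continuous_markov_process_def)

lemma measurable_D_halfline: "t \<in> {0..1} \<Longrightarrow> D t \<in> N \<rightarrow>\<^sub>M halfline"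
  using process by (simp add: continuous_markov_process_def)

lemma measurable_D: "t \<in> {0..1} \<Longrightarrow> D t \<in> borel_measurable N"
  using measurable_compose[OF measurable_D_halfline, of t "\<lambda>x. x" borel] by (simp add: measurable_restrict_space1)

lemma D_nonneg: "t \<in> {0..1} \<Longrightarrow> \<omega> \<in> space N \<Longrightarrow> D t \<omega> \<ge> 0"
  using measurable_space[OF measurable_D_halfline] by force

definition past :: "real \<Rightarrow> 'b measure" where "past s = natural_filtration N {0..1} D s"

lemma space_past: "space (past s) = space N"
  unfolding past_def natural_filtration_def by (subst space_measure_of) auto

lemma subalgebra_past: "subalgebra N (past s)"
  unfolding subalgebra_def
proof
  show "sets (past s) \<subseteq> sets N"
    unfolding past_def natural_filtration_def
    by (subst sets_measure_of) (auto intro!: sets.sigma_sets_subset measurable_sets[OF measurable_D])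
qed (rule space_past)

lemma measurable_D_past:
  assumes "r \<in> {0..1}" "r \<le> s"
  shows "D r \<in> borel_measurable (past s)"
proof (rule measurableI)
  fix A :: "real set" assume A: "A \<in> sets borel"
  show "D r -` A \<inter> space (past s) \<in> sets (past s)"
    unfolding space_past unfolding past_def natural_filtration_def
    by (rule in_measure_of) (use assms A in auto)
qed simp

text \<open>The Markov property is given for indicators. After weighting \<open>N\<close> by
  \<open>G\<close> it states that the law of \<open>D t\<close> is the weighted measure composed
  with the kernel \<open>K\<close>. This is an equality of measures, and it can be tested with
  exponentials.\<close>

lemma markov_laplace:
  assumes s: "s \<in> {0..1}" and t: "t \<in> {0..1}" "s \<le> t" and l: "l \<ge> 0"
    and G: "G \<in> borel_measurable (past s)" "\<And>\<omega>. 0 \<le> G \<omega>" "\<And>\<omega>. G \<omega> \<le> 1"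
  shows "(\<integral>\<omega>. G \<omega> * exp (- l * D t \<omega>) \<partial>N) = (\<integral>\<omega>. G \<omega> * cir_laplace m l (t - s) (D s \<omega>) \<partial>N)"
proof -
  interpret F: finite_measure_subalgebra N "past s" using subalgebra_past by unfold_locales
  have GN [measurable]: "G \<in> borel_measurable N" by (rule measurable_from_subalg[OF subalgebra_past G(1)])
  have Dt: "D t \<in> N \<rightarrow>\<^sub>M halfline" and Ds: "D s \<in> N \<rightarrow>\<^sub>M halfline" using measurable_D_halfline s t by auto
  have ts: "t - s \<ge> 0" using t by simp
  have pm: "p (t - s) \<in> halfline \<rightarrow>\<^sub>M prob_algebra halfline" using tf ts by (simp add: transition_function_def)
  define K where "K = (\<lambda>\<omega>. p (t - s) (D s \<omega>))"
  have Km: "K \<in> N \<rightarrow>\<^sub>M subprob_algebra halfline"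
    unfolding K_def by (rule measurable_prob_algebraD[OF measurable_compose[OF Ds pm]])
  define GN where "GN = density N (\<lambda>\<omega>. ennreal (G \<omega>))"
  have sGN: "sets GN = sets N" "space GN = space N" by (auto simp: GN_def)
  have KG: "K \<in> GN \<rightarrow>\<^sub>M subprob_algebra halfline" using Km unfolding measurable_cong_sets[OF sGN(1) refl] .
  have DG: "D t \<in> GN \<rightarrow>\<^sub>M halfline" using Dt unfolding measurable_cong_sets[OF sGN(1) refl] .
  have K1: "emeasure (K \<omega>) A = ennreal (measure (K \<omega>) A)" if "\<omega> \<in> space N" for \<omega> A
  proof -
    interpret K: prob_space "K \<omega>" unfolding K_def using transition_prob[OF tf ts D_nonneg[OF s that]] by simp
    show ?thesis by (rule K.emeasure_eq_measure)
  qed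
  have mK: "(\<lambda>\<omega>. measure (K \<omega>) A) \<in> borel_measurable N" if "A \<in> sets halfline" for A
    by (rule measurable_compose[OF Km measurable_measure_subprob_algebra[OF that]])
  have K01: "0 \<le> measure (K \<omega>) A" "measure (K \<omega>) A \<le> 1" if "\<omega> \<in> space N" for \<omega> A
    using measure_p_bounds[OF ts D_nonneg[OF s that]] by (auto simp: K_def)
  have eq: "distr GN halfline (D t) = GN \<bind> K"
  proof (rule measure_eqI)
    show ss: "sets (distr GN halfline (D t)) = sets (GN \<bind> K)"
      using N.not_empty by (subst sets_bind[where N = halfline]) (use measurable_space[OF KG] in \<open>auto simp: sGN space_subprob_algebra\<close>)
    fix A assume "A \<in> sets (distr GN halfline (D t))"
    then have A: "A \<in> sets halfline" by simp
    have cond: "AE \<omega> in N. real_cond_exp N (past s) (\<lambda>\<omega>. indicator A (D t \<omega>)) \<omega> = measure (K \<omega>) A"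
      using process s t A unfolding continuous_markov_process_def past_def K_def by blast
    have iA: "(\<lambda>\<omega>. indicator A (D t \<omega>) :: real) \<in> borel_measurable N"
      by (rule measurable_compose[OF Dt]) (use A in simp)
    have iGA: "integrable N (\<lambda>\<omega>. G \<omega> * indicator A (D t \<omega>))"
      by (rule N.integrable_const_bound[of _ 1]) (use G iA in \<open>auto simp: indicator_def\<close>)
    have iGK: "integrable N (\<lambda>\<omega>. G \<omega> * measure (K \<omega>) A)"
      by (rule N.integrable_const_bound[of _ 1])
         (use G K01 mK[OF A] in \<open>auto intro!: AE_I2 mult_le_one simp: abs_mult\<close>)
    have "emeasure (distr GN halfline (D t)) A = emeasure GN (D t -` A \<inter> space GN)"
      using DG A by (rule emeasure_distr)
    also have "\<dots> = (\<integral>\<^sup>+\<omega>. ennreal (G \<omega>) * indicator (D t -` A \<inter> space N) \<omega> \<partial>N)"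
      unfolding GN_def using measurable_sets[OF Dt A] by (subst emeasure_density) auto
    also have "\<dots> = (\<integral>\<^sup>+\<omega>. ennreal (G \<omega> * indicator A (D t \<omega>)) \<partial>N)"
      by (intro nn_integral_cong) (auto simp: indicator_def)
    also have "\<dots> = ennreal (\<integral>\<omega>. G \<omega> * indicator A (D t \<omega>) \<partial>N)"
      using iGA G by (intro nn_integral_eq_integral) auto
    also have "(\<integral>\<omega>. G \<omega> * indicator A (D t \<omega>) \<partial>N) = (\<integral>\<omega>. G \<omega> * real_cond_exp N (past s) (\<lambda>\<omega>. indicator A (D t \<omega>)) \<omega> \<partial>N)"
      by (rule F.real_cond_exp_intg(2)[symmetric, OF iGA G(1) iA])
    also have "\<dots> = (\<integral>\<omega>. G \<omega> * measure (K \<omega>) A \<partial>N)"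
    proof (rule integral_cong_AE)
      show "(\<lambda>\<omega>. G \<omega> * measure (K \<omega>) A) \<in> borel_measurable N" using iGK by (rule borel_measurable_integrable)
      show "(\<lambda>\<omega>. G \<omega> * real_cond_exp N (past s) (\<lambda>\<omega>. indicator A (D t \<omega>)) \<omega>) \<in> borel_measurable N"
        by (intro borel_measurable_times GN borel_measurable_cond_exp2)
      show "AE \<omega> in N. G \<omega> * real_cond_exp N (past s) (\<lambda>\<omega>. indicator A (D t \<omega>)) \<omega> = G \<omega> * measure (K \<omega>) A"
        using cond by eventually_elim simp
    qed
    also have "ennreal \<dots> = (\<integral>\<^sup>+\<omega>. ennreal (G \<omega> * measure (K \<omega>) A) \<partial>N)"
      using iGK G K01 by (intro nn_integral_eq_integral[symmetric]) auto
    also have "\<dots> = (\<integral>\<^sup>+\<omega>. ennreal (G \<omega>) * emeasure (K \<omega>) A \<partial>N)"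
      by (intro nn_integral_cong) (use G K01 K1 in \<open>auto simp: ennreal_mult\<close>)
    also have "\<dots> = (\<integral>\<^sup>+\<omega>. emeasure (K \<omega>) A \<partial>GN)"
      unfolding GN_def using Km A
      by (subst nn_integral_density) (auto intro: measurable_compose[OF Km measurable_emeasure_subprob_algebra])
    also have "\<dots> = emeasure (GN \<bind> K) A"
      by (rule emeasure_bind[symmetric, OF _ KG A]) (simp add: sGN N.not_empty)
    finally show "emeasure (distr GN halfline (D t)) A = emeasure (GN \<bind> K) A" .
  qed
  have fm: "(\<lambda>y. ennreal (exp (- l * y))) \<in> borel_measurable halfline"
    by (rule measurable_restrict_space1) measurable
  have expm: "(\<lambda>\<omega>. exp (- l * D t \<omega>)) \<in> borel_measurable N"
    using measurable_D[OF t(1)] by measurable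
  have cm: "(\<lambda>x. cir_laplace m l (t - s) x) \<in> borel_measurable borel"
    unfolding cir_laplace_def by measurable
  have cirm: "(\<lambda>\<omega>. cir_laplace m l (t - s) (D s \<omega>)) \<in> borel_measurable N"
    by (rule measurable_compose[OF measurable_D[OF s] cm])
  have "(\<integral>\<^sup>+\<omega>. ennreal (G \<omega> * exp (- l * D t \<omega>)) \<partial>N) = (\<integral>\<^sup>+\<omega>. ennreal (exp (- l * D t \<omega>)) \<partial>GN)"
    unfolding GN_def using expm G by (subst nn_integral_density) (auto simp: ennreal_mult)
  also have "\<dots> = (\<integral>\<^sup>+y. ennreal (exp (- l * y)) \<partial>distr GN halfline (D t))"
    using fm by (subst nn_integral_distr[OF DG]) simp_all
  also have "\<dots> = (\<integral>\<^sup>+\<omega>. (\<integral>\<^sup>+y. ennreal (exp (- l * y)) \<partial>K \<omega>) \<partial>GN)"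
    unfolding eq by (rule nn_integral_bind[OF fm KG])
  also have "\<dots> = (\<integral>\<^sup>+\<omega>. ennreal (cir_laplace m l (t - s) (D s \<omega>)) \<partial>GN)"
    unfolding K_def
  proof (rule nn_integral_cong)
    fix \<omega> assume "\<omega> \<in> space GN"
    then show "(\<integral>\<^sup>+y. ennreal (exp (- l * y)) \<partial>p (t - s) (D s \<omega>)) = ennreal (cir_laplace m l (t - s) (D s \<omega>))"
      using transition_laplace[OF ts D_nonneg[OF s, of \<omega>] l] sGN by simp
  qed
  also have "\<dots> = (\<integral>\<^sup>+\<omega>. ennreal (G \<omega> * cir_laplace m l (t - s) (D s \<omega>)) \<partial>N)"
    unfolding GN_def using cirm G cir_laplace_nonneg by (subst nn_integral_density) (auto simp: ennreal_mult)
  finally show ?thesis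
    using G cir_laplace_nonneg expm cirm by (subst (1 2) integral_eq_nn_integral) auto
qed

end

section \<open>Passage to the limit at several times\<close>

locale cir_limit = diffusive_chain Q m C M n0 Z + cir_process p m N D
  for Q m C and M :: "'a measure" and n0 Z and p and N :: "'b measure" and D
begin

definition X :: "nat \<Rightarrow> real \<Rightarrow> 'a \<Rightarrow> real" where
  "X k t \<omega> = real (Z (nat \<lfloor>real k * t\<rfloor>) \<omega>) / real k"

lemma X_nonneg: "X k t \<omega> \<ge> 0" by (simp add: X_def)

lemma borel_X [measurable]: "X k t \<in> borel_measurable M"
  unfolding X_def[abs_def] by measurable

lemma floor_bounds:
  assumes "0 \<le> s" "s \<le> t" "t \<le> 1"
  shows "nat \<lfloor>real k * s\<rfloor> \<le> nat \<lfloor>real k * t\<rfloor>" "nat \<lfloor>real k * t\<rfloor> \<le> k"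
    "\<bar>real (nat \<lfloor>real k * t\<rfloor> - nat \<lfloor>real k * s\<rfloor>) - real k * (t - s)\<bar> \<le> 1"
proof -
  have ks: "0 \<le> real k * s" "real k * s \<le> real k * t" "real k * t \<le> real k * 1"
    using assms mult_left_mono[OF assms(2), of "real k"] mult_left_mono[OF assms(3), of "real k"] by simp_all
  show 1: "nat \<lfloor>real k * s\<rfloor> \<le> nat \<lfloor>real k * t\<rfloor>" using ks by (intro nat_mono floor_mono)
  show "nat \<lfloor>real k * t\<rfloor> \<le> k" using ks by (simp add: nat_le_iff floor_le_iff)
  have "real (nat \<lfloor>real k * t\<rfloor>) = of_int \<lfloor>real k * t\<rfloor>" "real (nat \<lfloor>real k * s\<rfloor>) = of_int \<lfloor>real k * s\<rfloor>"
    using ks by auto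
  moreover have "real k * t - 1 < of_int \<lfloor>real k * t\<rfloor>" "of_int \<lfloor>real k * t\<rfloor> \<le> real k * t"
    "real k * s - 1 < of_int \<lfloor>real k * s\<rfloor>" "of_int \<lfloor>real k * s\<rfloor> \<le> real k * s" by linarith+
  ultimately show "\<bar>real (nat \<lfloor>real k * t\<rfloor> - nat \<lfloor>real k * s\<rfloor>) - real k * (t - s)\<bar> \<le> 1"
    unfolding abs_le_iff of_nat_diff[OF 1] right_diff_distrib by linarith
qed

text \<open>The exponential over \<open>J\<close> is a functional of the history up to the index
  belonging to \<open>s\<close>, hence \<open>chain_laplace\<close> applies with it as weight.
  Rounding the times to indices costs order \<open>1 / k\<close>.\<close>

lemma laplace_step_limit:
  assumes fin: "finite J" and J: "J \<subseteq> {0..s}" and s: "0 \<le> s" "s \<le> t" "t \<le> 1" and l: "l \<ge> 0" and c: "\<And>r. c r \<ge> 0"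
  shows "(\<lambda>k. (\<integral>\<omega>. exp (- (\<Sum>r\<in>J. c r * X k r \<omega>)) * exp (- l * X k t \<omega>) \<partial>M) -
     (\<integral>\<omega>. exp (- (\<Sum>r\<in>J. c r * X k r \<omega>)) * cir_laplace m l (t - s) (X k s \<omega>) \<partial>M)) \<longlonglongrightarrow> 0"
proof -
  obtain \<epsilon> where e0: "\<epsilon> \<longlonglongrightarrow> 0" and e: "\<And>k i n G. k \<ge> 1 \<Longrightarrow> i + n \<le> k \<Longrightarrow> (\<And>h. 0 \<le> G h) \<Longrightarrow> (\<And>h. G h \<le> 1) \<Longrightarrow>
      \<bar>expectation (\<lambda>\<omega>. G (history Z i \<omega>) * exp (- l * (real (Z (i + n) \<omega>) / real k))) -
       expectation (\<lambda>\<omega>. G (history Z i \<omega>) * cir_laplace m l (real n / real k) (real (Z i \<omega>) / real k))\<bar> \<le> \<epsilon> k"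
    using chain_laplace[OF l] by blast
  define S where "S = size_const"
  \<comment> \<open>The first summand is the error of the chain. The second is the Lipschitz
    constant in time, with \<open>X k s\<close> replaced by the bound \<open>2 * S\<close> for its
    mean, times the rounding error \<open>1 / k\<close>.\<close>
  define B where "B = (\<lambda>k. \<epsilon> k + (m * l + l\<^sup>2 * (2 * S)) * (1 / real k))"
  have "(\<lambda>k. \<epsilon> k + (m * l + l\<^sup>2 * (2 * S)) * (1 / real k)) \<longlonglongrightarrow> 0 + (m * l + l\<^sup>2 * (2 * S)) * 0"
    by (intro tendsto_add e0 tendsto_mult_left lim_1_over_n)
  then have B0: "B \<longlonglongrightarrow> 0" by (simp add: B_def)
  have bound: "\<bar>(\<integral>\<omega>. exp (- (\<Sum>r\<in>J. c r * X k r \<omega>)) * exp (- l * X k t \<omega>) \<partial>M) -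
     (\<integral>\<omega>. exp (- (\<Sum>r\<in>J. c r * X k r \<omega>)) * cir_laplace m l (t - s) (X k s \<omega>) \<partial>M)\<bar> \<le> B k" if k: "k \<ge> 1" for k
  proof -
    define i where "i = nat \<lfloor>real k * s\<rfloor>"
    define n where "n = nat \<lfloor>real k * t\<rfloor> - i"
    note fb = floor_bounds[OF s, of k]
    have in': "i + n = nat \<lfloor>real k * t\<rfloor>" using fb(1) by (simp add: n_def i_def)
    have ik: "i + n \<le> k" using fb(2) in' by simp
    define G where "G = (\<lambda>h::nat list. exp (- (\<Sum>r\<in>J. c r * (real (h ! nat \<lfloor>real k * r\<rfloor>) / real k))))"
    have Gh: "G (history Z i \<omega>) = exp (- (\<Sum>r\<in>J. c r * X k r \<omega>))" for \<omega>
    proof -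
      have "history Z i \<omega> ! nat \<lfloor>real k * r\<rfloor> = Z (nat \<lfloor>real k * r\<rfloor>) \<omega>" if "r \<in> J" for r
      proof (rule history_nth)
        have "r \<le> s" using that J by auto
        then show "nat \<lfloor>real k * r\<rfloor> \<le> i" unfolding i_def by (intro nat_mono floor_mono mult_left_mono) auto
      qed
      then show ?thesis by (simp add: G_def X_def)
    qed
    have G01: "0 \<le> G h" "G h \<le> 1" for h using c by (auto simp: G_def intro!: sum_nonneg)
    have G01': "0 \<le> exp (- (\<Sum>r\<in>J. c r * X k r \<omega>))" "exp (- (\<Sum>r\<in>J. c r * X k r \<omega>)) \<le> 1" for \<omega> using G01[of "history Z i \<omega>"] by (auto simp: Gh)
    define u where "u = real n / real k"
    have u: "u \<ge> 0" by (simp add: u_def)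
    have ts: "t - s \<ge> 0" using s by simp
    have Xs: "X k s \<omega> = real (Z i \<omega>) / real k" for \<omega> by (simp add: X_def i_def)
    have 1: "\<bar>(\<integral>\<omega>. exp (- (\<Sum>r\<in>J. c r * X k r \<omega>)) * exp (- l * X k t \<omega>) \<partial>M) -
      (\<integral>\<omega>. exp (- (\<Sum>r\<in>J. c r * X k r \<omega>)) * cir_laplace m l u (X k s \<omega>) \<partial>M)\<bar> \<le> \<epsilon> k"
      using e[OF k ik, of G] G01 unfolding Gh in' u_def Xs by (simp add: X_def)
    have cb: "cir_laplace m l v (X k s \<omega>) \<le> 1" if "v \<ge> 0" for v \<omega>
      using cir_laplace_le_1[OF _ l that X_nonneg] m_pos by simp
    have meas: "(\<lambda>\<omega>. exp (- (\<Sum>r\<in>J. c r * X k r \<omega>)) * cir_laplace m l v (X k s \<omega>)) \<in> borel_measurable M" for v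
      unfolding cir_laplace_def by measurable
    have int: "integrable M (\<lambda>\<omega>. exp (- (\<Sum>r\<in>J. c r * X k r \<omega>)) * cir_laplace m l v (X k s \<omega>))" if "v \<ge> 0" for v
    proof (rule integrable_const_bound[of _ 1, OF _ meas], rule AE_I2)
      fix \<omega>
      have "exp (- (\<Sum>r\<in>J. c r * X k r \<omega>)) * cir_laplace m l v (X k s \<omega>) \<le> 1"
        using G01' cb[OF that] cir_laplace_nonneg by (intro mult_le_one) auto
      then show "norm (exp (- (\<Sum>r\<in>J. c r * X k r \<omega>)) * cir_laplace m l v (X k s \<omega>)) \<le> 1"
        using cir_laplace_nonneg by (simp add: abs_mult)
    qed
    have iX: "integrable M (\<lambda>\<omega>. (1 / real k) * (m * l + l\<^sup>2 * X k s \<omega>))"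
      unfolding Xs using integrable_Z(1)[of i] by simp
    have du: "\<bar>u - (t - s)\<bar> \<le> 1 / real k"
    proof -
      have "\<bar>real n - real k * (t - s)\<bar> \<le> 1" using fb(3) by (simp add: n_def i_def)
      then have "\<bar>real n - real k * (t - s)\<bar> / real k \<le> 1 / real k" by (intro divide_right_mono) auto
      moreover have "u - (t - s) = (real n - real k * (t - s)) / real k" using k by (simp add: u_def field_simps)
      ultimately show ?thesis by (simp add: abs_divide)
    qed
    have "\<bar>(\<integral>\<omega>. exp (- (\<Sum>r\<in>J. c r * X k r \<omega>)) * cir_laplace m l u (X k s \<omega>) \<partial>M) -
      (\<integral>\<omega>. exp (- (\<Sum>r\<in>J. c r * X k r \<omega>)) * cir_laplace m l (t - s) (X k s \<omega>) \<partial>M)\<bar>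
      = \<bar>\<integral>\<omega>. exp (- (\<Sum>r\<in>J. c r * X k r \<omega>)) * cir_laplace m l u (X k s \<omega>) - exp (- (\<Sum>r\<in>J. c r * X k r \<omega>)) * cir_laplace m l (t - s) (X k s \<omega>) \<partial>M\<bar>"
      using int[OF u] int[OF ts] by simp
    also have "\<dots> \<le> (\<integral>\<omega>. \<bar>exp (- (\<Sum>r\<in>J. c r * X k r \<omega>)) * cir_laplace m l u (X k s \<omega>) - exp (- (\<Sum>r\<in>J. c r * X k r \<omega>)) * cir_laplace m l (t - s) (X k s \<omega>)\<bar> \<partial>M)"
      by (rule integral_abs_bound)
    also have "\<dots> \<le> (\<integral>\<omega>. (1 / real k) * (m * l + l\<^sup>2 * X k s \<omega>) \<partial>M)"
    proof (rule integral_mono)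
      fix \<omega>
      have "\<bar>exp (- (\<Sum>r\<in>J. c r * X k r \<omega>)) * cir_laplace m l u (X k s \<omega>) - exp (- (\<Sum>r\<in>J. c r * X k r \<omega>)) * cir_laplace m l (t - s) (X k s \<omega>)\<bar>
        = exp (- (\<Sum>r\<in>J. c r * X k r \<omega>)) * \<bar>cir_laplace m l u (X k s \<omega>) - cir_laplace m l (t - s) (X k s \<omega>)\<bar>"
        by (simp add: abs_mult flip: right_diff_distrib)
      also have "\<dots> \<le> 1 * (\<bar>u - (t - s)\<bar> * (m * l + l\<^sup>2 * X k s \<omega>))"
        using G01'[of \<omega>] cir_laplace_time_lipschitz[OF _ l ts u X_nonneg, of m k s \<omega>] m_pos by (intro mult_mono) auto
      also have "\<dots> \<le> (1 / real k) * (m * l + l\<^sup>2 * X k s \<omega>)"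
        using du m_pos l X_nonneg by (simp only: mult_1, intro mult_right_mono) auto
      finally show "\<bar>exp (- (\<Sum>r\<in>J. c r * X k r \<omega>)) * cir_laplace m l u (X k s \<omega>) - exp (- (\<Sum>r\<in>J. c r * X k r \<omega>)) * cir_laplace m l (t - s) (X k s \<omega>)\<bar>
        \<le> (1 / real k) * (m * l + l\<^sup>2 * X k s \<omega>)" .
    qed (use int[OF u] int[OF ts] iX in auto)
    also have "\<dots> = (1 / real k) * (m * l + l\<^sup>2 * (expectation (\<lambda>\<omega>. real (Z i \<omega>)) / real k))"
      unfolding Xs using integrable_Z(1)[of i] by (simp add: prob_space)
    also have "\<dots> \<le> (1 / real k) * (m * l + l\<^sup>2 * (2 * S))"
    proof -
      have "real i + 1 \<le> 2 * real k" using ik k by simp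
      then have "size_const * (real i + 1) \<le> S * (2 * real k)" unfolding S_def[symmetric] using size_const by (intro mult_left_mono) (auto simp: S_def)
      then have "expectation (\<lambda>\<omega>. real (Z i \<omega>)) \<le> (2 * S) * real k" using expectation_Z(1)[of i] by simp
      then have "expectation (\<lambda>\<omega>. real (Z i \<omega>)) / real k \<le> 2 * S" using k by (simp add: pos_divide_le_eq)
      then show ?thesis by (intro mult_left_mono add_left_mono) auto
    qed
    finally have 2: "\<bar>(\<integral>\<omega>. exp (- (\<Sum>r\<in>J. c r * X k r \<omega>)) * cir_laplace m l u (X k s \<omega>) \<partial>M) -
      (\<integral>\<omega>. exp (- (\<Sum>r\<in>J. c r * X k r \<omega>)) * cir_laplace m l (t - s) (X k s \<omega>) \<partial>M)\<bar> \<le> (m * l + l\<^sup>2 * (2 * S)) * (1 / real k)"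
      by (simp add: mult.commute)
    show ?thesis using 1 2 unfolding B_def by linarith
  qed
  show ?thesis
  proof (rule Lim_null_comparison[OF _ B0])
    show "\<forall>\<^sub>F k in sequentially. norm ((\<integral>\<omega>. exp (- (\<Sum>r\<in>J. c r * X k r \<omega>)) * exp (- l * X k t \<omega>) \<partial>M) -
     (\<integral>\<omega>. exp (- (\<Sum>r\<in>J. c r * X k r \<omega>)) * cir_laplace m l (t - s) (X k s \<omega>) \<partial>M)) \<le> B k"
      using eventually_ge_at_top[of 1] by eventually_elim (use bound in simp)
  qed
qed

text \<open>Induction on the largest time \<open>b\<close>. Conditioning on the past up to its
  predecessor \<open>s\<close> replaces the last exponential by
  \<open>A * exp (- \<alpha> * x)\<close> at time \<open>s\<close>, for the chain in the limit and
  for the diffusion exactly, and \<open>\<alpha>\<close> is absorbed into the coefficient of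
  \<open>s\<close>. Keeping 0 in the set gives every time a predecessor; at 0 the chain is
  \<open>n0 / k\<close> and the diffusion 0.\<close>

theorem joint_laplace_0:
  assumes "finite J" "J \<subseteq> {0<..1}" "\<And>r. c r \<ge> 0"
  shows "(\<lambda>k. \<integral>\<omega>. exp (- (\<Sum>r\<in>insert 0 J. c r * X k r \<omega>)) \<partial>M) \<longlonglongrightarrow> (\<integral>\<omega>. exp (- (\<Sum>r\<in>insert 0 J. c r * D r \<omega>)) \<partial>N)"
  using assms
proof (induction J arbitrary: c rule: finite_linorder_max_induct)
  case empty
  have Z0: "AE \<omega> in M. Z 0 \<omega> = n0" using chain by (simp add: markov_chain_def)
  have "(\<integral>\<omega>. exp (- (\<Sum>r\<in>insert 0 {}. c r * X k r \<omega>)) \<partial>M) = (\<integral>\<omega>. exp (- (c 0 * (real n0 / real k))) \<partial>M)" for k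
    by (rule integral_cong_AE) (use Z0 in \<open>auto simp: X_def elim!: eventually_mono\<close>)
  then have 1: "(\<integral>\<omega>. exp (- (\<Sum>r\<in>insert 0 {}. c r * X k r \<omega>)) \<partial>M) = exp (- (c 0 * (real n0 * (1 / real k))))" for k
    by (simp add: prob_space)
  have m0: "D 0 \<in> borel_measurable N" by (rule measurable_D) simp
  have "(\<integral>\<omega>. exp (- (\<Sum>r\<in>insert 0 {}. c r * D r \<omega>)) \<partial>N) = (\<integral>\<omega>. exp (- (c 0 * 0)) \<partial>N)"
    by (rule integral_cong_AE) (use D0 m0 in \<open>auto elim!: eventually_mono\<close>)
  then have 2: "(\<integral>\<omega>. exp (- (\<Sum>r\<in>insert 0 {}. c r * D r \<omega>)) \<partial>N) = exp (- (c 0 * (real n0 * 0)))"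
    by (simp add: N.prob_space)
  show ?case unfolding 1 2 by (intro tendsto_intros lim_1_over_n)
next
  case (insert b J)
  define s where "s = Max (insert 0 J)"
  have b: "0 < b" "b \<le> 1" and J: "J \<subseteq> {0<..1}" using insert.prems(1) by auto
  have finJ: "finite (insert 0 J)" using insert.hyps by simp
  have sJ: "s \<in> insert 0 J" unfolding s_def using finJ by (rule Max_in) simp
  have sb: "0 \<le> s" "s < b" using sJ J insert.hyps(2) b by auto
  have J0s: "insert 0 J \<subseteq> {0..s}"
  proof
    fix r assume r: "r \<in> insert 0 J"
    then have "r \<le> s" unfolding s_def using finJ by (intro Max_ge)
    then show "r \<in> {0..s}" using r J by auto
  qed
  have nb: "b \<notin> insert 0 J" using insert.hyps(2) b by force
  define l where "l = c b"
  have l: "l \<ge> 0" using insert.prems(2) by (simp add: l_def)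
  define \<alpha> where "\<alpha> = cir_rate l (b - s)"
  define A where "A = (1 + l * (b - s) / 3) powr (- 3 * m)"
  have \<alpha>: "\<alpha> \<ge> 0" unfolding \<alpha>_def using cir_rate_bounds(1)[OF l] sb by simp
  define c' where "c' = c(s := c s + \<alpha>)"
  have c': "c' r \<ge> 0" for r using insert.prems(2)[of r] insert.prems(2)[of s] \<alpha> by (simp add: c'_def)
  have s01: "s \<in> {0..1}" and b01: "b \<in> {0..1}" using sb b by auto
  have sum_b: "(\<Sum>r\<in>insert 0 (insert b J). f r) = f b + (\<Sum>r\<in>insert 0 J. f r)" for f :: "real \<Rightarrow> real"
    using nb finJ by (subst insert_commute) simp
  have sum_s: "(\<Sum>r\<in>insert 0 J. c' r * f r) = (\<Sum>r\<in>insert 0 J. c r * f r) + \<alpha> * f s" for f :: "real \<Rightarrow> real"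
  proof -
    have "(\<Sum>r\<in>insert 0 J. c' r * f r) = (\<Sum>r\<in>insert 0 J. c r * f r + (if r = s then \<alpha> * f s else 0))"
      by (intro sum.cong refl) (simp add: c'_def algebra_simps)
    then show ?thesis using finJ sJ by (simp add: sum.distrib)
  qed
  have lapf: "exp (- (\<Sum>r\<in>insert 0 J. c r * f r)) * cir_laplace m l (b - s) (f s) = A * exp (- (\<Sum>r\<in>insert 0 J. c' r * f r))" for f :: "real \<Rightarrow> real"
    unfolding sum_s cir_laplace_def A_def \<alpha>_def by (simp add: exp_add[symmetric] algebra_simps)
  have 1: "(\<lambda>k. (\<integral>\<omega>. exp (- (\<Sum>r\<in>insert 0 (insert b J). c r * X k r \<omega>)) \<partial>M) -
     A * (\<integral>\<omega>. exp (- (\<Sum>r\<in>insert 0 J. c' r * X k r \<omega>)) \<partial>M)) \<longlonglongrightarrow> 0"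
  proof -
    have e: "exp (- (\<Sum>r\<in>insert 0 (insert b J). c r * X k r \<omega>)) = exp (- (\<Sum>r\<in>insert 0 J. c r * X k r \<omega>)) * exp (- l * X k b \<omega>)" for k \<omega>
      unfolding sum_b l_def mult_exp_exp by (simp add: algebra_simps)
    have "(\<lambda>k. (\<integral>\<omega>. exp (- (\<Sum>r\<in>insert 0 J. c r * X k r \<omega>)) * exp (- l * X k b \<omega>) \<partial>M) -
      (\<integral>\<omega>. exp (- (\<Sum>r\<in>insert 0 J. c r * X k r \<omega>)) * cir_laplace m l (b - s) (X k s \<omega>) \<partial>M)) \<longlonglongrightarrow> 0"
      by (rule laplace_step_limit[OF finJ J0s sb(1) less_imp_le[OF sb(2)] b(2) l]) (rule insert.prems(2))
    moreover have "exp (- (\<Sum>r\<in>insert 0 J. c r * X k r \<omega>)) * cir_laplace m l (b - s) (X k s \<omega>) =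
        A * exp (- (\<Sum>r\<in>insert 0 J. c' r * X k r \<omega>))" for k \<omega> by (rule lapf)
    ultimately show ?thesis unfolding e by simp
  qed
  have 2: "(\<lambda>k. A * (\<integral>\<omega>. exp (- (\<Sum>r\<in>insert 0 J. c' r * X k r \<omega>)) \<partial>M)) \<longlonglongrightarrow> A * (\<integral>\<omega>. exp (- (\<Sum>r\<in>insert 0 J. c' r * D r \<omega>)) \<partial>N)"
    by (intro tendsto_mult_left insert.IH J c')
  have 3: "(\<integral>\<omega>. exp (- (\<Sum>r\<in>insert 0 (insert b J). c r * D r \<omega>)) \<partial>N) = A * (\<integral>\<omega>. exp (- (\<Sum>r\<in>insert 0 J. c' r * D r \<omega>)) \<partial>N)"
  proof -
    \<comment> \<open>The minimum is inactive on \<open>space N\<close>, where \<open>D\<close> is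
      nonnegative; it provides \<open>G \<le> 1\<close> at every point, as
      \<open>markov_laplace\<close> requires.\<close>
    define G where "G = (\<lambda>\<omega>. min 1 (exp (- (\<Sum>r\<in>insert 0 J. c r * D r \<omega>))))"
    have Gm: "G \<in> borel_measurable (past s)"
      unfolding G_def using J0s s01
      by (intro borel_measurable_min borel_measurable_const borel_measurable_exp[THEN measurable_compose[rotated]] borel_measurable_uminus borel_measurable_sum borel_measurable_times measurable_D_past) auto
    have GD: "G \<omega> = exp (- (\<Sum>r\<in>insert 0 J. c r * D r \<omega>))" if \<omega>: "\<omega> \<in> space N" for \<omega>
    proof -
      have "0 \<le> (\<Sum>r\<in>insert 0 J. c r * D r \<omega>)"
        using D_nonneg[OF _ \<omega>] insert.prems(2) J by (intro sum_nonneg mult_nonneg_nonneg) auto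
      then show ?thesis by (simp add: G_def)
    qed
    have "(\<integral>\<omega>. exp (- (\<Sum>r\<in>insert 0 (insert b J). c r * D r \<omega>)) \<partial>N) = (\<integral>\<omega>. G \<omega> * exp (- l * D b \<omega>) \<partial>N)"
      by (rule Bochner_Integration.integral_cong[OF refl]) (simp only: GD sum_b l_def mult_exp_exp, simp add: algebra_simps)
    also have "\<dots> = (\<integral>\<omega>. G \<omega> * cir_laplace m l (b - s) (D s \<omega>) \<partial>N)"
      by (rule markov_laplace[OF s01 b01 less_imp_le[OF sb(2)] l Gm]) (auto simp: G_def)
    also have "\<dots> = (\<integral>\<omega>. A * exp (- (\<Sum>r\<in>insert 0 J. c' r * D r \<omega>)) \<partial>N)"
      by (rule Bochner_Integration.integral_cong[OF refl]) (simp only: GD, rule lapf)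
    finally show ?thesis by simp
  qed
  show ?case unfolding 3 using tendsto_add[OF 1 2] by simp
qed

theorem joint_laplace:
  assumes fin: "finite J" and J: "J \<subseteq> {0..1}" and c: "\<And>r. c r \<ge> 0"
  shows "(\<lambda>k. \<integral>\<omega>. exp (- (\<Sum>r\<in>J. c r * X k r \<omega>)) \<partial>M) \<longlonglongrightarrow> (\<integral>\<omega>. exp (- (\<Sum>r\<in>J. c r * D r \<omega>)) \<partial>N)"
proof -
  \<comment> \<open>Time 0 is added with coefficient 0 if it does not belong to
    \<open>J\<close>.\<close>
  define c' where "c' = (\<lambda>r. if r \<in> J then c r else 0)"
  have "(\<Sum>r\<in>insert 0 (J - {0}). c' r * f r) = (\<Sum>r\<in>J. c r * f r)" for f :: "real \<Rightarrow> real"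
  proof -
    have "(\<Sum>r\<in>J. c r * f r) = (\<Sum>r\<in>J. c' r * f r)" by (intro sum.cong) (auto simp: c'_def)
    also have "\<dots> = (\<Sum>r\<in>insert 0 (J - {0}). c' r * f r)"
      by (rule sum.mono_neutral_left) (use fin in \<open>auto simp: c'_def\<close>)
    finally show ?thesis ..
  qed
  moreover have "J - {0} \<subseteq> {0<..1}"
  proof
    fix r assume "r \<in> J - {0}"
    then have "0 \<le> r" "r \<le> 1" "r \<noteq> 0" using J by auto
    then show "r \<in> {0<..1}" by simp
  qed
  moreover have "c' r \<ge> 0" for r using c by (simp add: c'_def)
  ultimately show ?thesis using joint_laplace_0[of "J - {0}" c'] fin by simp
qed

end

section \<open>From Laplace transforms to convergence in distribution\<close>

text \<open>A single coordinate separates the two functions. The instances that follow make function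
  types Hausdorff, the setting in which Stone-Weierstrass is applied to the cube.\<close>

lemma fun_hausdorff:
  fixes f g :: "'a \<Rightarrow> 'b :: t2_space"
  assumes "f \<noteq> g"
  obtains U V where "open U" "open V" "f \<in> U" "g \<in> V" "U \<inter> V = {}"
proof -
  obtain i where "f i \<noteq> g i" using assms by auto
  then obtain U V where UV: "open U" "open V" "f i \<in> U" "g i \<in> V" "U \<inter> V = {}" by (metis hausdorff)
  have c: "continuous_on UNIV (\<lambda>h :: 'a \<Rightarrow> 'b. h i)" by (rule continuous_on_product_coordinates)
  have "open ((\<lambda>h. h i) -` U)" "open ((\<lambda>h. h i) -` V)"
    using UV c by (auto intro: open_vimage)
  then show thesis using UV by (intro that[of "(\<lambda>h. h i) -` U" "(\<lambda>h. h i) -` V"]) auto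
qed

instance "fun" :: (type, t2_space) t0_space
proof
  fix f g :: "'a \<Rightarrow> 'b"
  assume "f \<noteq> g"
  then obtain U V where "open U" "open V" "f \<in> U" "g \<in> V" "U \<inter> V = {}" by (rule fun_hausdorff)
  then show "\<exists>U. open U \<and> \<not> (f \<in> U \<longleftrightarrow> g \<in> U)" by blast
qed

instance "fun" :: (type, t2_space) t1_space
proof
  fix f g :: "'a \<Rightarrow> 'b"
  assume "f \<noteq> g"
  then obtain U V where "open U" "open V" "f \<in> U" "g \<in> V" "U \<inter> V = {}" by (rule fun_hausdorff)
  then show "\<exists>U. open U \<and> f \<in> U \<and> g \<notin> U" by blast
qed

instance "fun" :: (type, t2_space) t2_space
proof
  fix f g :: "'a \<Rightarrow> 'b"
  assume "f \<noteq> g"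
  then obtain U V where "open U" "open V" "f \<in> U" "g \<in> V" "U \<inter> V = {}" by (rule fun_hausdorff)
  then show "\<exists>U V. open U \<and> open V \<and> f \<in> U \<and> g \<in> V \<and> U \<inter> V = {}" by blast
qed

text \<open>The range of the variables \<open>exp (- X k t)\<close>; the value outside
  \<open>J\<close> is \<open>undefined\<close>, in agreement with functions restricted to
  \<open>J\<close>.\<close>

definition cube :: "real set \<Rightarrow> (real \<Rightarrow> real) set" where
  "cube J = PiE J (\<lambda>_. {0..1})"

lemma compact_cube: "compact (cube J)"
proof -
  \<comment> \<open>With singleton factors outside \<open>J\<close>, the cube is a full product of
    compact sets, and Tychonoff's theorem applies.\<close>
  have eq: "cube J = PiE UNIV (\<lambda>i. if i \<in> J then {0..1} else {undefined})"
    by (auto simp: cube_def PiE_iff extensional_def split: if_splits)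
  have "compactin (product_topology (\<lambda>i::real. euclidean :: real topology) UNIV) (PiE UNIV (\<lambda>i. if i \<in> J then {0..1} else {undefined}))"
    by (subst compactin_PiE) auto
  then show ?thesis unfolding eq euclidean_product_topology by simp
qed

lemma continuous_on_coordinate: "continuous_on A (\<lambda>y :: real \<Rightarrow> real. y i)"
  by (rule continuous_on_subset[OF continuous_on_product_coordinates]) simp

text \<open>Carries \<open>f\<close> from the product topology over \<open>J\<close> to the topology
  of the function type.\<close>

lemma restrict_cube_continuous:
  assumes f: "continuous_map (powertop_real J) euclideanreal f"
    and h: "\<And>t. continuous_on A (\<lambda>y :: real \<Rightarrow> real. h t y)"
  shows "continuous_on A (\<lambda>y. f (\<lambda>t\<in>J. h t y))"
proof -
  have "continuous_map (top_of_set A) (powertop_real J) (\<lambda>y. \<lambda>t\<in>J. h t y)"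
    unfolding continuous_map_componentwise using h by (auto simp: extensional_def)
  then have "continuous_map (top_of_set A) euclideanreal (f \<circ> (\<lambda>y. \<lambda>t\<in>J. h t y))"
    using f by (rule continuous_map_compose)
  then show ?thesis by (simp add: comp_def)
qed

section \<open>Convergence for continuous functions on the cube\<close>

text \<open>Coefficients in \<open>nat\<close> make the transforms in \<open>lap\<close> the mixed
  moments of the variables \<open>exp (- X k t)\<close>, which are confined to the cube.\<close>

locale laplace_convergence =
  M: prob_space M + N: prob_space N
  for M :: "'a measure" and N :: "'b measure" +
  fixes J :: "real set" and X :: "nat \<Rightarrow> real \<Rightarrow> 'a \<Rightarrow> real" and D :: "real \<Rightarrow> 'b \<Rightarrow> real"
  assumes fin: "finite J"
    and X: "\<And>k t. X k t \<in> borel_measurable M" "\<And>k t \<omega>. X k t \<omega> \<ge> 0"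
    and D: "\<And>t. t \<in> J \<Longrightarrow> D t \<in> borel_measurable N" "\<And>t \<omega>. t \<in> J \<Longrightarrow> \<omega> \<in> space N \<Longrightarrow> D t \<omega> \<ge> 0"
    and lap: "\<And>c :: real \<Rightarrow> nat. (\<lambda>k. \<integral>\<omega>. exp (- (\<Sum>r\<in>J. real (c r) * X k r \<omega>)) \<partial>M) \<longlonglongrightarrow> (\<integral>\<omega>. exp (- (\<Sum>r\<in>J. real (c r) * D r \<omega>)) \<partial>N)"
begin

definition Y :: "nat \<Rightarrow> 'a \<Rightarrow> real \<Rightarrow> real" where "Y k \<omega> = (\<lambda>t\<in>J. exp (- X k t \<omega>))"
definition E :: "'b \<Rightarrow> real \<Rightarrow> real" where "E \<omega> = (\<lambda>t\<in>J. exp (- D t \<omega>))"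

lemma Y_cube: "Y k \<omega> \<in> cube J"
  using X(2) by (auto simp: Y_def cube_def)

lemma E_cube: "\<omega> \<in> space N \<Longrightarrow> E \<omega> \<in> cube J"
  using D(2) by (auto simp: E_def cube_def)

text \<open>
  Quantifying over all monomials makes admissibility stable under multiplication by polynomials.
\<close>

definition admissible :: "((real \<Rightarrow> real) \<Rightarrow> real) \<Rightarrow> bool" where
  "admissible G \<longleftrightarrow> (\<forall>c :: real \<Rightarrow> nat.
     (\<forall>k. integrable M (\<lambda>\<omega>. (\<Prod>t\<in>J. Y k \<omega> t ^ c t) * G (Y k \<omega>))) \<and>
     integrable N (\<lambda>\<omega>. (\<Prod>t\<in>J. E \<omega> t ^ c t) * G (E \<omega>)) \<and>
     (\<lambda>k. \<integral>\<omega>. (\<Prod>t\<in>J. Y k \<omega> t ^ c t) * G (Y k \<omega>) \<partial>M) \<longlonglongrightarrow> (\<integral>\<omega>. (\<Prod>t\<in>J. E \<omega> t ^ c t) * G (E \<omega>) \<partial>N))"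

lemma prod_exp: "(\<Prod>t\<in>J. exp (- f t) ^ c t) = exp (- (\<Sum>t\<in>J. real (c t) * f t))" for f :: "real \<Rightarrow> real"
  by (simp add: exp_of_nat_mult[symmetric] exp_sum[OF fin, symmetric] sum_negf)

lemma admissible_1: "admissible (\<lambda>_. 1)"
  unfolding admissible_def
proof (intro allI conjI)
  fix c :: "real \<Rightarrow> nat"
  have y: "(\<Prod>t\<in>J. Y k \<omega> t ^ c t) * 1 = exp (- (\<Sum>t\<in>J. real (c t) * X k t \<omega>))" for k \<omega>
    unfolding prod_exp[symmetric] by (simp add: Y_def)
  have e: "(\<Prod>t\<in>J. E \<omega> t ^ c t) * 1 = exp (- (\<Sum>t\<in>J. real (c t) * D t \<omega>))" for \<omega>
    unfolding prod_exp[symmetric] by (simp add: E_def)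
  show "integrable M (\<lambda>\<omega>. (\<Prod>t\<in>J. Y k \<omega> t ^ c t) * 1)" for k
    unfolding y using X by (intro M.integrable_const_bound[of _ 1]) (auto intro!: AE_I2 sum_nonneg)
  show "integrable N (\<lambda>\<omega>. (\<Prod>t\<in>J. E \<omega> t ^ c t) * 1)"
    unfolding e using D by (intro N.integrable_const_bound[of _ 1]) (auto intro!: AE_I2 sum_nonneg)
  show "(\<lambda>k. \<integral>\<omega>. (\<Prod>t\<in>J. Y k \<omega> t ^ c t) * 1 \<partial>M) \<longlonglongrightarrow> (\<integral>\<omega>. (\<Prod>t\<in>J. E \<omega> t ^ c t) * 1 \<partial>N)"
    unfolding y e by (rule lap)
qed

lemma admissible_add: "admissible F \<Longrightarrow> admissible G \<Longrightarrow> admissible (\<lambda>y. F y + G y)"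
  unfolding admissible_def distrib_left by (auto intro: tendsto_add)

lemma admissible_cmult: "admissible F \<Longrightarrow> admissible (\<lambda>y. a * F y)"
proof -
  assume F: "admissible F"
  have e: "u * (a * v) = a * (u * v)" for u v :: real by simp
  show ?thesis using F unfolding admissible_def e by (auto intro!: tendsto_mult_left)
qed

lemma admissible_coordinate:
  assumes F: "admissible F" and t: "t \<in> J"
  shows "admissible (\<lambda>y. y t * F y)"
proof -
  have e: "(\<Prod>s\<in>J. y s ^ c s) * (y t * z) = (\<Prod>s\<in>J. y s ^ (c(t := Suc (c t))) s) * z" for y c and z :: real
  proof -
    have "(\<Prod>s\<in>J. y s ^ (c(t := Suc (c t))) s) = (\<Prod>s\<in>J. y s ^ c s * (if s = t then y t else 1))"
      by (intro prod.cong refl) auto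
    also have "\<dots> = (\<Prod>s\<in>J. y s ^ c s) * y t" using fin t by (simp add: prod.distrib)
    finally show ?thesis by (simp add: mult_ac)
  qed
  show ?thesis using F unfolding admissible_def e by blast
qed

text \<open>Membership is defined by the effect of multiplication on admissible functions and not by
  a polynomial expression, so closure under products is immediate. Constants and coordinates belong
  to it, which is all that Stone-Weierstrass asks beyond the ring operations.\<close>

definition poly_ring :: "((real \<Rightarrow> real) \<Rightarrow> real) set" where
  "poly_ring = {F. continuous_on (cube J) F \<and> (\<forall>G. admissible G \<longrightarrow> admissible (\<lambda>y. F y * G y))}"

lemma poly_ringI:
  "continuous_on (cube J) F \<Longrightarrow> (\<And>G. admissible G \<Longrightarrow> admissible (\<lambda>y. F y * G y)) \<Longrightarrow> F \<in> poly_ring"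
  unfolding poly_ring_def by simp

lemma poly_ringD:
  assumes "F \<in> poly_ring"
  shows "continuous_on (cube J) F" "admissible G \<Longrightarrow> admissible (\<lambda>y. F y * G y)"
  using assms unfolding poly_ring_def by simp_all

lemma function_ring: "function_ring_on poly_ring (cube J)"
proof
  show "compact (cube J)" by (rule compact_cube)
  show "continuous_on (cube J) f" if "f \<in> poly_ring" for f using that by (rule poly_ringD(1))
  show "(\<lambda>x. f x + g x) \<in> poly_ring" if "f \<in> poly_ring" "g \<in> poly_ring" for f g
  proof (rule poly_ringI)
    show "continuous_on (cube J) (\<lambda>x. f x + g x)" using that by (intro continuous_on_add poly_ringD(1))
    show "admissible (\<lambda>y. (f y + g y) * G y)" if "admissible G" for G
      unfolding distrib_right using poly_ringD(2) that \<open>f \<in> poly_ring\<close> \<open>g \<in> poly_ring\<close> by (intro admissible_add)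
  qed
  show "(\<lambda>x. f x * g x) \<in> poly_ring" if "f \<in> poly_ring" "g \<in> poly_ring" for f g
  proof (rule poly_ringI)
    show "continuous_on (cube J) (\<lambda>x. f x * g x)" using that by (intro continuous_on_mult poly_ringD(1))
    show "admissible (\<lambda>y. f y * g y * G y)" if "admissible G" for G
      unfolding mult.assoc by (intro poly_ringD(2)[OF \<open>f \<in> poly_ring\<close>] poly_ringD(2)[OF \<open>g \<in> poly_ring\<close>] that)
  qed
  show "(\<lambda>_. c) \<in> poly_ring" for c
    by (intro poly_ringI continuous_on_const admissible_cmult)
  show "\<exists>f\<in>poly_ring. f x \<noteq> f y" if xy: "x \<in> cube J" "y \<in> cube J" "x \<noteq> y" for x y
  proof -
    obtain t where t: "t \<in> J" "x t \<noteq> y t"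
      using PiE_ext[of x J "\<lambda>_. {0..1}" y] xy unfolding cube_def by blast
    have "(\<lambda>y. y t) \<in> poly_ring"
      by (intro poly_ringI continuous_on_coordinate admissible_coordinate t(1))
    then show ?thesis by (rule bexI[where P = "\<lambda>f. f x \<noteq> f y", OF t(2)])
  qed
qed

lemma uniform_approx:
  fixes F :: "(real \<Rightarrow> real) \<Rightarrow> real"
  assumes "continuous_on (cube J) F" "e > 0"
  obtains P where "admissible P" "\<And>y. y \<in> cube J \<Longrightarrow> \<bar>F y - P y\<bar> < e"
proof -
  interpret function_ring_on poly_ring "cube J" by (rule function_ring)
  obtain P where P: "P \<in> poly_ring" "\<forall>x\<in>cube J. \<bar>F x - P x\<bar> < e"
    using Stone_Weierstrass_basic[OF assms] by blast
  have "admissible (\<lambda>y. P y * 1)" by (intro poly_ringD(2)[OF P(1)] admissible_1)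
  then show thesis using that P by simp
qed

lemma admissible_conv:
  assumes "admissible P"
  shows "integrable M (\<lambda>\<omega>. P (Y k \<omega>))" "integrable N (\<lambda>\<omega>. P (E \<omega>))"
    "(\<lambda>k. \<integral>\<omega>. P (Y k \<omega>) \<partial>M) \<longlonglongrightarrow> (\<integral>\<omega>. P (E \<omega>) \<partial>N)"
  using assms[unfolded admissible_def, rule_format, of "\<lambda>_. 0"] by simp_all

text \<open>The approximation is used twice: as pointwise limits of admissible functions the
  compositions of \<open>F\<close> with \<open>Y k\<close> and \<open>E\<close> inherit
  measurability, and the uniform error transfers the convergence of integrals.\<close>

lemma continuous_conv:
  fixes F :: "(real \<Rightarrow> real) \<Rightarrow> real"
  assumes F: "continuous_on (cube J) F"
  shows "integrable M (\<lambda>\<omega>. F (Y k \<omega>))" "integrable N (\<lambda>\<omega>. F (E \<omega>))"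
    "(\<lambda>k. \<integral>\<omega>. F (Y k \<omega>) \<partial>M) \<longlonglongrightarrow> (\<integral>\<omega>. F (E \<omega>) \<partial>N)"
proof -
  have "\<exists>P. admissible P \<and> (\<forall>y\<in>cube J. \<bar>F y - P y\<bar> < 1 / real (Suc n))" for n
    using uniform_approx[OF F, of "1 / real (Suc n)"] by (metis of_nat_0_less_iff zero_less_Suc zero_less_divide_1_iff)
  then obtain P where P: "\<And>n. admissible (P n)" "\<And>n y. y \<in> cube J \<Longrightarrow> \<bar>F y - P n y\<bar> < 1 / real (Suc n)"
    by metis
  have lim: "(\<lambda>n. P n y) \<longlonglongrightarrow> F y" if "y \<in> cube J" for y
  proof (rule LIM_zero_cancel, rule Lim_null_comparison)
    show "\<forall>\<^sub>F n in sequentially. norm (P n y - F y) \<le> 1 / real (Suc n)"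
      using P(2)[OF that] by (intro always_eventually allI) (simp add: abs_minus_commute less_imp_le del: of_nat_Suc)
    show "(\<lambda>n. 1 / real (Suc n)) \<longlonglongrightarrow> 0" using LIMSEQ_inverse_real_of_nat by (simp add: inverse_eq_divide)
  qed
  obtain B where B: "\<And>y. y \<in> cube J \<Longrightarrow> \<bar>F y\<bar> \<le> B"
    using compact_imp_bounded[OF compact_continuous_image[OF F compact_cube]] by (auto simp: bounded_iff)
  have mM: "(\<lambda>\<omega>. F (Y k \<omega>)) \<in> borel_measurable M" for k
    by (rule borel_measurable_LIMSEQ_real[OF lim[OF Y_cube]])
       (rule borel_measurable_integrable[OF admissible_conv(1)[OF P(1)]])
  have mN: "(\<lambda>\<omega>. F (E \<omega>)) \<in> borel_measurable N"
    by (rule borel_measurable_LIMSEQ_real[OF lim[OF E_cube]])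
       (auto intro: borel_measurable_integrable[OF admissible_conv(2)[OF P(1)]])
  show iM: "integrable M (\<lambda>\<omega>. F (Y k \<omega>))" for k
    by (rule M.integrable_const_bound[of _ B]) (use mM B Y_cube in auto)
  show iN: "integrable N (\<lambda>\<omega>. F (E \<omega>))"
    by (rule N.integrable_const_bound[of _ B]) (use mN B E_cube in auto)
  show "(\<lambda>k. \<integral>\<omega>. F (Y k \<omega>) \<partial>M) \<longlonglongrightarrow> (\<integral>\<omega>. F (E \<omega>) \<partial>N)"
  proof (rule LIMSEQ_I)
    fix e :: real assume e: "e > 0"
    obtain P where P: "admissible P" "\<And>y. y \<in> cube J \<Longrightarrow> \<bar>F y - P y\<bar> < e / 3"
      using uniform_approx[OF F, of "e / 3"] e by auto
    note Pc = admissible_conv[OF P(1)]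
    have 1: "\<bar>(\<integral>\<omega>. F (Y k \<omega>) \<partial>M) - (\<integral>\<omega>. P (Y k \<omega>) \<partial>M)\<bar> \<le> e / 3" for k
    proof -
      have "\<bar>(\<integral>\<omega>. F (Y k \<omega>) \<partial>M) - (\<integral>\<omega>. P (Y k \<omega>) \<partial>M)\<bar> = \<bar>\<integral>\<omega>. F (Y k \<omega>) - P (Y k \<omega>) \<partial>M\<bar>"
        using iM Pc(1) by simp
      also have "\<dots> \<le> (\<integral>\<omega>. \<bar>F (Y k \<omega>) - P (Y k \<omega>)\<bar> \<partial>M)" by (rule integral_abs_bound)
      also have "\<dots> \<le> (\<integral>\<omega>. e / 3 \<partial>M)"
        using iM Pc(1) P(2)[OF Y_cube] by (intro integral_mono) (auto intro: less_imp_le)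
      finally show ?thesis by (simp add: M.prob_space)
    qed
    have 2: "\<bar>(\<integral>\<omega>. F (E \<omega>) \<partial>N) - (\<integral>\<omega>. P (E \<omega>) \<partial>N)\<bar> \<le> e / 3"
    proof -
      have "\<bar>(\<integral>\<omega>. F (E \<omega>) \<partial>N) - (\<integral>\<omega>. P (E \<omega>) \<partial>N)\<bar> = \<bar>\<integral>\<omega>. F (E \<omega>) - P (E \<omega>) \<partial>N\<bar>"
        using iN Pc(2) by simp
      also have "\<dots> \<le> (\<integral>\<omega>. \<bar>F (E \<omega>) - P (E \<omega>)\<bar> \<partial>N)" by (rule integral_abs_bound)
      also have "\<dots> \<le> (\<integral>\<omega>. e / 3 \<partial>N)"
        using iN Pc(2) P(2)[OF E_cube] by (intro integral_mono) (auto intro: less_imp_le)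
      finally show ?thesis by (simp add: N.prob_space)
    qed
    obtain k0 where k0: "\<And>k. k \<ge> k0 \<Longrightarrow> \<bar>(\<integral>\<omega>. P (Y k \<omega>) \<partial>M) - (\<integral>\<omega>. P (E \<omega>) \<partial>N)\<bar> < e / 3"
      using LIMSEQ_D[OF Pc(3), of "e / 3"] e by auto
    have "norm ((\<integral>\<omega>. F (Y k \<omega>) \<partial>M) - (\<integral>\<omega>. F (E \<omega>) \<partial>N)) < e" if "k \<ge> k0" for k
      using 1[of k] 2 k0[OF that] unfolding real_norm_def by linarith
    then show "\<exists>k0. \<forall>k\<ge>k0. norm ((\<integral>\<omega>. F (Y k \<omega>) \<partial>M) - (\<integral>\<omega>. F (E \<omega>) \<partial>N)) < e" by blast
  qed
qed

section \<open>Cut-off at infinity and general test functions\<close>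

text \<open>The faces \<open>y t = 0\<close> of the cube stand for infinite values. The function
  vanishes near them and equals 1 where all coordinates in \<open>J\<close> are at least
  \<open>2 * e\<close>.\<close>

definition cut :: "real \<Rightarrow> (real \<Rightarrow> real) \<Rightarrow> real" where
  "cut e y = (\<Prod>t\<in>J. min 1 (max 0 (y t / e - 1)))"

lemma cut_bounds: "0 \<le> cut e y" "cut e y \<le> 1"
  unfolding cut_def by (auto intro!: prod_nonneg prod_le_1)

lemma continuous_cut: "continuous_on A (cut e)"
  unfolding cut_def
  by (cases "e = 0") (auto intro!: continuous_on_prod continuous_on_min continuous_on_max continuous_on_diff
      continuous_on_divide continuous_on_const continuous_on_coordinate)

lemma cut_eq_0: "e > 0 \<Longrightarrow> t \<in> J \<Longrightarrow> y t \<le> e \<Longrightarrow> cut e y = 0"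
  unfolding cut_def using fin by (intro prod_zero) (auto intro!: bexI[of _ t] simp: divide_le_eq_1 max_def)

lemma cut_tendsto: "(\<lambda>n. cut (1 / real (Suc n)) (\<lambda>t\<in>J. exp (- g t))) \<longlonglongrightarrow> 1"
proof -
  have "(\<lambda>n. min 1 (max 0 ((\<lambda>t\<in>J. exp (- g t)) t / (1 / real (Suc n)) - 1))) \<longlonglongrightarrow> 1" if t: "t \<in> J" for t
  proof (rule tendsto_eventually)
    define a where "a = exp (- g t)"
    have a: "a > 0" by (simp add: a_def)
    obtain n0 :: nat where n0: "2 / a \<le> real n0" using real_arch_simple by blast
    show "\<forall>\<^sub>F n in sequentially. min 1 (max 0 ((\<lambda>t\<in>J. exp (- g t)) t / (1 / real (Suc n)) - 1)) = 1"
      using eventually_ge_at_top[of n0]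
    proof eventually_elim
      case (elim n)
      have "2 / a \<le> real (Suc n)" using n0 elim by simp
      then have "2 \<le> a * real (Suc n)" using a by (simp add: pos_divide_le_eq mult.commute del: of_nat_Suc)
      then show ?case using t by (simp add: a_def[symmetric] min_def max_def del: of_nat_Suc)
    qed
  qed
  then have "(\<lambda>n. \<Prod>t\<in>J. min 1 (max 0 ((\<lambda>t\<in>J. exp (- g t)) t / (1 / real (Suc n)) - 1))) \<longlonglongrightarrow> (\<Prod>t\<in>J. 1)"
    by (intro tendsto_prod)
  then show ?thesis by (simp add: cut_def)
qed

text \<open>Cut off near the faces, \<open>f\<close> becomes continuous on the cube. Tightness comes
  with it: the cut-off is itself continuous, so its mean under the chain converges to its mean under
  the limit, and the latter is close to 1 because the limit takes finite values.\<close>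

theorem convergence:
  assumes f: "continuous_map (powertop_real J) euclideanreal f" and bd: "bounded (f ` (J \<rightarrow>\<^sub>E UNIV))"
  shows "(\<lambda>k. \<integral>\<omega>. f (\<lambda>t\<in>J. X k t \<omega>) \<partial>M) \<longlonglongrightarrow> (\<integral>\<omega>. f (\<lambda>t\<in>J. D t \<omega>) \<partial>N)"
proof -
  obtain B where B: "\<And>x. x \<in> J \<rightarrow>\<^sub>E UNIV \<Longrightarrow> \<bar>f x\<bar> \<le> B" using bd by (auto simp: bounded_iff)
  have Bf: "\<bar>f (\<lambda>t\<in>J. g t)\<bar> \<le> B" for g by (rule B) auto
  have B0: "B \<ge> 0" using Bf[of undefined] by linarith
  define F where "F = (\<lambda>e y. f (\<lambda>t\<in>J. - ln (max e (y t))) * cut e y)"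
  have Fc: "continuous_on A (F e)" if e: "e > 0" for e A
    unfolding F_def using e
    by (intro continuous_on_mult continuous_cut restrict_cube_continuous[OF f] continuous_on_minus continuous_on_ln
        continuous_on_max continuous_on_const continuous_on_coordinate) (auto simp: max_def)
  \<comment> \<open>Either some coordinate is at most \<open>e\<close> and both sides vanish, or the
    maximum under the logarithm is inactive.\<close>
  have Feq: "F e (\<lambda>t\<in>J. exp (- g t)) = f (\<lambda>t\<in>J. g t) * cut e (\<lambda>t\<in>J. exp (- g t))" if e: "e > 0" for e g
  proof (cases "\<exists>t\<in>J. exp (- g t) \<le> e")
    case True
    then obtain t where "t \<in> J" "(\<lambda>t\<in>J. exp (- g t)) t \<le> e" by auto
    then have "cut e (\<lambda>t\<in>J. exp (- g t)) = 0" by (intro cut_eq_0[OF e])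
    then show ?thesis by (simp add: F_def)
  next
    case False
    then have "(\<lambda>t\<in>J. - ln (max e ((\<lambda>t\<in>J. exp (- g t)) t))) = (\<lambda>t\<in>J. g t)"
      by (intro restrict_ext) (auto simp: max_def not_le)
    then show ?thesis by (simp add: F_def)
  qed
  have FY: "F e (Y k \<omega>) = f (\<lambda>t\<in>J. X k t \<omega>) * cut e (Y k \<omega>)" if "e > 0" for e k \<omega>
    unfolding Y_def by (rule Feq[OF that])
  have FE: "F e (E \<omega>) = f (\<lambda>t\<in>J. D t \<omega>) * cut e (E \<omega>)" if "e > 0" for e \<omega>
    unfolding E_def by (rule Feq[OF that])
  have abs_diff_mult: "\<bar>a - a * c\<bar> = \<bar>a\<bar> * (1 - c)" if "c \<le> 1" for a c :: real
  proof -
    have "a - a * c = a * (1 - c)" by (simp add: algebra_simps)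
    then show ?thesis using that by (simp add: abs_mult)
  qed
  define ee where "ee = (\<lambda>n. 1 / real (Suc n))"
  have ee: "ee n > 0" for n by (simp add: ee_def)
  have Flim: "(\<lambda>n. f (\<lambda>t\<in>J. g t) * cut (ee n) (\<lambda>t\<in>J. exp (- g t))) \<longlonglongrightarrow> f (\<lambda>t\<in>J. g t)" for g
    using tendsto_mult_left[OF cut_tendsto[of g], of "f (\<lambda>t\<in>J. g t)"] by (simp add: ee_def)
  have mfN: "(\<lambda>\<omega>. f (\<lambda>t\<in>J. D t \<omega>)) \<in> borel_measurable N"
  proof (rule borel_measurable_LIMSEQ_real)
    show "(\<lambda>\<omega>. F (ee n) (E \<omega>)) \<in> borel_measurable N" for n
      by (rule borel_measurable_integrable[OF continuous_conv(2)[OF Fc[OF ee]]])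
    show "(\<lambda>n. F (ee n) (E \<omega>)) \<longlonglongrightarrow> f (\<lambda>t\<in>J. D t \<omega>)" for \<omega>
      unfolding FE[OF ee] unfolding E_def by (rule Flim)
  qed
  have mfM: "(\<lambda>\<omega>. f (\<lambda>t\<in>J. X k t \<omega>)) \<in> borel_measurable M" for k
  proof (rule borel_measurable_LIMSEQ_real)
    show "(\<lambda>\<omega>. F (ee n) (Y k \<omega>)) \<in> borel_measurable M" for n
      by (rule borel_measurable_integrable[OF continuous_conv(1)[OF Fc[OF ee]]])
    show "(\<lambda>n. F (ee n) (Y k \<omega>)) \<longlonglongrightarrow> f (\<lambda>t\<in>J. X k t \<omega>)" for \<omega>
      unfolding FY[OF ee] unfolding Y_def by (rule Flim)
  qed
  have ifN: "integrable N (\<lambda>\<omega>. f (\<lambda>t\<in>J. D t \<omega>))"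
    by (rule N.integrable_const_bound[of _ B]) (use mfN Bf in auto)
  have ifM: "integrable M (\<lambda>\<omega>. f (\<lambda>t\<in>J. X k t \<omega>))" for k
    by (rule M.integrable_const_bound[of _ B]) (use mfM Bf in auto)
  note cc = continuous_conv[OF continuous_cut]
  have diffM: "\<bar>(\<integral>\<omega>. f (\<lambda>t\<in>J. X k t \<omega>) \<partial>M) - (\<integral>\<omega>. F e (Y k \<omega>) \<partial>M)\<bar> \<le> B * (1 - (\<integral>\<omega>. cut e (Y k \<omega>) \<partial>M))" if e: "e > 0" for e k
  proof -
    have "\<bar>(\<integral>\<omega>. f (\<lambda>t\<in>J. X k t \<omega>) \<partial>M) - (\<integral>\<omega>. F e (Y k \<omega>) \<partial>M)\<bar> = \<bar>\<integral>\<omega>. f (\<lambda>t\<in>J. X k t \<omega>) - F e (Y k \<omega>) \<partial>M\<bar>"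
      using ifM continuous_conv(1)[OF Fc[OF e]] by simp
    also have "\<dots> \<le> (\<integral>\<omega>. \<bar>f (\<lambda>t\<in>J. X k t \<omega>) - F e (Y k \<omega>)\<bar> \<partial>M)" by (rule integral_abs_bound)
    also have "\<dots> \<le> (\<integral>\<omega>. B * (1 - cut e (Y k \<omega>)) \<partial>M)"
    proof (rule integral_mono)
      fix \<omega>
      have "\<bar>f (\<lambda>t\<in>J. X k t \<omega>) - F e (Y k \<omega>)\<bar> = \<bar>f (\<lambda>t\<in>J. X k t \<omega>)\<bar> * (1 - cut e (Y k \<omega>))"
        unfolding FY[OF e] by (rule abs_diff_mult[OF cut_bounds(2)])
      also have "\<dots> \<le> B * (1 - cut e (Y k \<omega>))" using Bf cut_bounds by (intro mult_right_mono) auto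
      finally show "\<bar>f (\<lambda>t\<in>J. X k t \<omega>) - F e (Y k \<omega>)\<bar> \<le> B * (1 - cut e (Y k \<omega>))" .
    qed (use ifM continuous_conv(1)[OF Fc[OF e]] cc(1) in auto)
    also have "\<dots> = B * (1 - (\<integral>\<omega>. cut e (Y k \<omega>) \<partial>M))" using cc(1) by (simp add: M.prob_space)
    finally show ?thesis .
  qed
  have diffN: "\<bar>(\<integral>\<omega>. f (\<lambda>t\<in>J. D t \<omega>) \<partial>N) - (\<integral>\<omega>. F e (E \<omega>) \<partial>N)\<bar> \<le> B * (1 - (\<integral>\<omega>. cut e (E \<omega>) \<partial>N))" if e: "e > 0" for e
  proof -
    have "\<bar>(\<integral>\<omega>. f (\<lambda>t\<in>J. D t \<omega>) \<partial>N) - (\<integral>\<omega>. F e (E \<omega>) \<partial>N)\<bar> = \<bar>\<integral>\<omega>. f (\<lambda>t\<in>J. D t \<omega>) - F e (E \<omega>) \<partial>N\<bar>"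
      using ifN continuous_conv(2)[OF Fc[OF e]] by simp
    also have "\<dots> \<le> (\<integral>\<omega>. \<bar>f (\<lambda>t\<in>J. D t \<omega>) - F e (E \<omega>)\<bar> \<partial>N)" by (rule integral_abs_bound)
    also have "\<dots> \<le> (\<integral>\<omega>. B * (1 - cut e (E \<omega>)) \<partial>N)"
    proof (rule integral_mono)
      fix \<omega>
      have "\<bar>f (\<lambda>t\<in>J. D t \<omega>) - F e (E \<omega>)\<bar> = \<bar>f (\<lambda>t\<in>J. D t \<omega>)\<bar> * (1 - cut e (E \<omega>))"
        unfolding FE[OF e] by (rule abs_diff_mult[OF cut_bounds(2)])
      also have "\<dots> \<le> B * (1 - cut e (E \<omega>))" using Bf cut_bounds by (intro mult_right_mono) auto
      finally show "\<bar>f (\<lambda>t\<in>J. D t \<omega>) - F e (E \<omega>)\<bar> \<le> B * (1 - cut e (E \<omega>))" .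
    qed (use ifN continuous_conv(2)[OF Fc[OF e]] cc(2) in auto)
    also have "\<dots> = B * (1 - (\<integral>\<omega>. cut e (E \<omega>) \<partial>N))" using cc(2) by (simp add: N.prob_space)
    finally show ?thesis .
  qed
  have "(\<lambda>n. \<integral>\<omega>. cut (ee n) (E \<omega>) \<partial>N) \<longlonglongrightarrow> (\<integral>\<omega>. 1 \<partial>N)"
  proof (rule integral_dominated_convergence[where w = "\<lambda>_. 1"])
    show "(\<lambda>\<omega>. cut (ee n) (E \<omega>)) \<in> borel_measurable N" for n using cc(2) by (rule borel_measurable_integrable)
    show "AE \<omega> in N. (\<lambda>n. cut (ee n) (E \<omega>)) \<longlonglongrightarrow> 1" unfolding E_def ee_def by (intro AE_I2 cut_tendsto)
    show "AE \<omega> in N. norm (cut (ee n) (E \<omega>)) \<le> 1" for n using cut_bounds by (intro AE_I2) simp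
  qed simp_all
  then have cut1: "(\<lambda>n. B * (1 - (\<integral>\<omega>. cut (ee n) (E \<omega>) \<partial>N))) \<longlonglongrightarrow> B * (1 - 1)"
    by (intro tendsto_mult_left tendsto_diff tendsto_const) (simp add: N.prob_space)
  show ?thesis
  proof (rule LIMSEQ_I)
    fix e :: real assume e: "e > 0"
    \<comment> \<open>The cut-off level is chosen from the limit alone; only afterwards is
      \<open>k\<close> taken large.\<close>
    obtain n where n: "\<bar>B * (1 - (\<integral>\<omega>. cut (ee n) (E \<omega>) \<partial>N))\<bar> < e / 4"
      using LIMSEQ_D[OF cut1, of "e / 4"] e by auto
    define d where "d = ee n"
    have d: "d > 0" using ee by (simp add: d_def)
    have l1: "(\<lambda>k. B * (1 - (\<integral>\<omega>. cut d (Y k \<omega>) \<partial>M))) \<longlonglongrightarrow> B * (1 - (\<integral>\<omega>. cut d (E \<omega>) \<partial>N))"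
      by (intro tendsto_mult_left tendsto_diff tendsto_const cc(3))
    obtain k1 where k1: "\<And>k. k \<ge> k1 \<Longrightarrow> \<bar>B * (1 - (\<integral>\<omega>. cut d (Y k \<omega>) \<partial>M)) - B * (1 - (\<integral>\<omega>. cut d (E \<omega>) \<partial>N))\<bar> < e / 4"
      using LIMSEQ_D[OF l1, of "e / 4"] e by auto
    obtain k2 where k2: "\<And>k. k \<ge> k2 \<Longrightarrow> \<bar>(\<integral>\<omega>. F d (Y k \<omega>) \<partial>M) - (\<integral>\<omega>. F d (E \<omega>) \<partial>N)\<bar> < e / 4"
      using LIMSEQ_D[OF continuous_conv(3)[OF Fc[OF d]], of "e / 4"] e by auto
    have "norm ((\<integral>\<omega>. f (\<lambda>t\<in>J. X k t \<omega>) \<partial>M) - (\<integral>\<omega>. f (\<lambda>t\<in>J. D t \<omega>) \<partial>N)) < e" if k: "k \<ge> max k1 k2" for k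
    proof -
      have "\<bar>B * (1 - (\<integral>\<omega>. cut d (Y k \<omega>) \<partial>M)) - B * (1 - (\<integral>\<omega>. cut d (E \<omega>) \<partial>N))\<bar> < e / 4" using k1[of k] k by simp
      moreover have "\<bar>(\<integral>\<omega>. F d (Y k \<omega>) \<partial>M) - (\<integral>\<omega>. F d (E \<omega>) \<partial>N)\<bar> < e / 4" using k2[of k] k by simp
      moreover note diffM[OF d, of k] diffN[OF d] n[folded d_def]
      moreover have "\<bar>a - b\<bar> < e" if "\<bar>a - a'\<bar> \<le> u" "\<bar>b - b'\<bar> \<le> v" "\<bar>a' - b'\<bar> < e / 4" "\<bar>u - v\<bar> < e / 4" "\<bar>v\<bar> < e / 4"
        for a a' b b' u v :: real using that by linarith
      ultimately show ?thesis unfolding real_norm_def by blast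
    qed
    then show "\<exists>k0. \<forall>k\<ge>k0. norm ((\<integral>\<omega>. f (\<lambda>t\<in>J. X k t \<omega>) \<partial>M) - (\<integral>\<omega>. f (\<lambda>t\<in>J. D t \<omega>) \<partial>N)) < e" by blast
  qed
qed

end

section \<open>The limit theorem\<close>

lemma set_urn_kernel: "set_pmf (urn_kernel K z) \<subseteq> {1..}"
  unfolding urn_kernel_def by auto

text \<open>Fix one possible value \<open>j\<close> of the noise. Arbitrarily large exit distances
  have positive probability, and one of them exceeds \<open>L\<close> even after subtraction of
  \<open>j\<close>.\<close>

lemma urn_kernel_unbounded:
  assumes z: "z \<ge> 1"
  obtains w where "w \<in> set_pmf (urn_kernel K z)" "w > L"
proof -
  obtain j where j: "j \<in> set_pmf K" using set_pmf_not_empty[of K] by blast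
  define w where "w = nat (\<bar>j\<bar> + int L + 1)"
  have "w \<in> set_pmf (exc_pmf z 1)"
    using pmf_exc_pmf_pos[of 1 z w] z by (simp add: w_def pmf_positive_iff)
  then have "nat (max 1 (int w - j)) \<in> set_pmf (urn_kernel K z)"
    unfolding urn_kernel_def set_map_pmf set_pair_pmf using j by (intro image_eqI[of _ _ "(w, j)"]) auto
  moreover have "nat (max 1 (int w - j)) > L" by (simp add: w_def)
  ultimately show thesis by (rule that)
qed

lemma urn_kernel_diffusive:
  assumes em: "\<exists>l>0. integrable (measure_pmf K) (\<lambda>j. exp (l * \<bar>real_of_int j\<bar>))"
    and mean: "measure_pmf.expectation K real_of_int < 2 / 3"
  obtains C where "diffusive_kernel (urn_kernel K) (2 / 3 - measure_pmf.expectation K real_of_int) C"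
proof -
  obtain l where l: "l > 0" "integrable (measure_pmf K) (\<lambda>j. exp (l * \<bar>real_of_int j\<bar>))"
    using em by auto
  obtain C where C: "C \<ge> 1"
    "\<And>z. z \<ge> 1 \<Longrightarrow> integrable (measure_pmf (urn_kernel K z)) (\<lambda>w. (real w - real z) ^ 4)"
    "\<And>z. z \<ge> 1 \<Longrightarrow> measure_pmf.expectation (urn_kernel K z) (\<lambda>w. (real w - real z) ^ 4) \<le> C * (real z)\<^sup>2"
    "\<And>z. z \<ge> 1 \<Longrightarrow> \<bar>measure_pmf.expectation (urn_kernel K z) (\<lambda>w. (real w - real z)\<^sup>2) - 2/3 * real z\<bar> \<le> C * sqrt (real z)"
    "\<And>z. z \<ge> 1 \<Longrightarrow> \<bar>measure_pmf.expectation (urn_kernel K z) (\<lambda>w. real w - real z) - (2 / 3 - measure_pmf.expectation K real_of_int)\<bar> \<le> C / sqrt (real z)"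
    by (rule urn_kernel_moments[OF exp_moment_imp_integrable_power[OF l]]) blast
  have "diffusive_kernel (urn_kernel K) (2 / 3 - measure_pmf.expectation K real_of_int) C"
  proof
    show "2 / 3 - measure_pmf.expectation K real_of_int > 0" using mean by simp
    show "\<exists>w\<in>set_pmf (urn_kernel K z). w > L" if "z \<ge> 1" for z L
      using urn_kernel_unbounded[OF that] by metis
  qed (rule set_urn_kernel C | assumption)+
  then show thesis by (rule that)
qed

theorem theorem2p8:
  fixes K :: "int pmf" and z0 :: int
    and M :: "'a measure" and S :: "nat \<Rightarrow> 'a \<Rightarrow> int \<times> int"
    and N :: "'b measure" and D :: "real \<Rightarrow> 'b \<Rightarrow> real"
  assumes exp_moment:
      "\<exists>l>0. integrable (measure_pmf K) (\<lambda>j. exp (l * \<bar>real_of_int j\<bar>))"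
    and mean: "measure_pmf.expectation K real_of_int < 2 / 3"
    and z0: "z0 \<ge> 1"
    and urn: "noisy_simple_harmonic_urn M K z0 S"
    and D: "diffusion N {0..1}
              (\<lambda>x. 2 / 3 - measure_pmf.expectation K real_of_int) (\<lambda>x. 2 / 3 * x) D"
    and D0: "AE \<omega> in N. D 0 \<omega> = 0"
  shows "fdd_converges {0..1}
           M (\<lambda>k t \<omega>. real_of_int (embedded_process z0 (\<lambda>n. S n \<omega>) (nat \<lfloor>real k * t\<rfloor>)) / real k)
           N D
       \<and> 4 - 6 * measure_pmf.expectation K real_of_int > 0
       \<and> (\<exists>c>0. \<exists>R. bessel_process N {0..1} (4 - 6 * measure_pmf.expectation K real_of_int) R \<and>
             (\<forall>t\<in>{0..1}. \<forall>\<omega>\<in>space N. D t \<omega> = c * (R t \<omega>)\<^sup>2))"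
proof (intro conjI)
  define m where "m = 2 / 3 - measure_pmf.expectation K real_of_int"
  have m: "m > 0" using mean by (simp add: m_def)
  have m6: "4 - 6 * measure_pmf.expectation K real_of_int = 6 * m" by (simp add: m_def)
  show "4 - 6 * measure_pmf.expectation K real_of_int > 0" using mean by simp
  have T: "{0..1::real} \<subseteq> {0..}" by auto
  note bessel = diffusion_imp_bessel[OF D[folded m_def] m T]
  show "\<exists>c>0. \<exists>R. bessel_process N {0..1} (4 - 6 * measure_pmf.expectation K real_of_int) R \<and>
      (\<forall>t\<in>{0..1}. \<forall>\<omega>\<in>space N. D t \<omega> = c * (R t \<omega>)\<^sup>2)"
    unfolding m6
  proof (rule exI[of _ "1 / 6"], intro conjI exI[of _ "\<lambda>t \<omega>. sqrt (6 * D t \<omega>)"] ballI)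
    show "bessel_process N {0..1} (6 * m) (\<lambda>t \<omega>. sqrt (6 * D t \<omega>))" by (rule bessel(1))
    show "D t \<omega> = 1 / 6 * (sqrt (6 * D t \<omega>))\<^sup>2" if "t \<in> {0..1}" "\<omega> \<in> space N" for t \<omega>
      by (rule bessel(2)[OF that])
  qed simp
  define Z where "Z = (\<lambda>k \<omega>. nat (embedded_process z0 (\<lambda>n. S n \<omega>) k))"
  obtain C where "diffusive_kernel (urn_kernel K) m C"
    unfolding m_def by (rule urn_kernel_diffusive[OF exp_moment mean])
  then interpret diffusive_kernel "urn_kernel K" m C .
  have chain: "markov_chain M (urn_kernel K) (nat z0) Z"
    unfolding Z_def by (rule embedded_process_markov[OF urn z0])
  obtain p where p: "continuous_markov_process N {0..1} D p" "backward_equation {0..} (\<lambda>x. m) (\<lambda>x. 2 / 3 * x) p"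
    using D unfolding m_def diffusion_def by blast
  have tf: "transition_function p" using p(1) by (simp add: continuous_markov_process_def)
  interpret L: cir_limit "urn_kernel K" m C M "nat z0" Z p N D
    by unfold_locales (use chain z0 p tf m D0 in auto)
  have X: "real_of_int (embedded_process z0 (\<lambda>n. S n \<omega>) (nat \<lfloor>real k * t\<rfloor>)) / real k = L.X k t \<omega>" for k t \<omega>
    unfolding L.X_def unfolding Z_def using embedded_process_nonneg[of z0] z0 by simp
  show "fdd_converges {0..1}
           M (\<lambda>k t \<omega>. real_of_int (embedded_process z0 (\<lambda>n. S n \<omega>) (nat \<lfloor>real k * t\<rfloor>)) / real k)
           N D"
    unfolding fdd_converges_def X
  proof (intro allI impI, elim conjE)
    fix J and f :: "(real \<Rightarrow> real) \<Rightarrow> real"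
    assume J: "finite J" "J \<subseteq> {0..1}"
      and f: "continuous_map (powertop_real J) euclideanreal f" "bounded (f ` (J \<rightarrow>\<^sub>E UNIV))"
    interpret laplace_convergence M N J L.X D
    proof
      show "finite J" by (rule J)
      show "L.X k t \<in> borel_measurable M" "L.X k t \<omega> \<ge> 0" for k t \<omega> by (rule L.borel_X L.X_nonneg)+
      show "D t \<in> borel_measurable N" if "t \<in> J" for t using L.measurable_D J(2) that by blast
      show "D t \<omega> \<ge> 0" if "t \<in> J" "\<omega> \<in> space N" for t \<omega> using L.D_nonneg J(2) that by blast
      show "(\<lambda>k. \<integral>\<omega>. exp (- (\<Sum>r\<in>J. real (c r) * L.X k r \<omega>)) \<partial>M) \<longlonglongrightarrow> (\<integral>\<omega>. exp (- (\<Sum>r\<in>J. real (c r) * D r \<omega>)) \<partial>N)"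
        for c :: "real \<Rightarrow> nat" by (rule L.joint_laplace[OF J]) simp
    qed
    show "(\<lambda>k. \<integral>\<omega>. f (\<lambda>t\<in>J. L.X k t \<omega>) \<partial>M) \<longlonglongrightarrow> (\<integral>\<omega>. f (\<lambda>t\<in>J. D t \<omega>) \<partial>N)"
      by (rule convergence[OF f])
  qed
qed

end
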